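(* Let $p$ be a prime and let $\mathcal A$ be the quotient algebra $\mathbb F_p[(\mathbb Q/\mathbb Z)^{(p)}]/J_p$. Then: (1) The map $$\mathrm{res}:\mathrm{Hom}(\mathbb Q^{{\rm cyc},p},\mathbb C_p)\to\mathrm{Hom}(\mathcal A,\bar{\mathbb F}_p),\qquad\mathrm{res}(\rho)=\epsilon\circ\rho\circ\delta$$ is a bijection of sets. (2) The algebraic spectrum $\mathrm{Spec}(\mathcal A)$ is in canonical bijection with the set $\Sigma_p$. (3) The canonical surjection $X_p\to\Sigma_p$ corresponds to the natural map $\mathrm{Hom}(\mathcal A,\bar{\mathbb F}_p)\to\mathrm{Spec}(\mathcal A)$.
   Context: $(\mathbb Q/\mathbb Z)^{(p)}$ is the group of fractions mod $1$ with denominator prime to $p$. $\mathbb Q^{\rm cyc}=\mathbb Q[\mathbb Q/\mathbb Z]/J$ is the abstract cyclotomic field, where $J$ is the ideal generated by the idempotents $\frac1n\sum_{j=0}^{n-1}e(\frac jn)$, $n\ge2$. $\mathbb Q^{{\rm cyc},p}\subset\mathbb Q^{\rm cyc}$ is the subfield generated by the group $\mu^{(p)}\simeq(\mathbb Q/\mathbb Z)^{(p)}$ of roots of unity of order prime to $p$. $\delta:\mathbb Z[(\mathbb Q/\mathbb Z)^{(p)}]\to\mathbb Q^{{\rm cyc},p}$ is the natural ring homomorphism; its image is the ring of integers and $\mathrm{Ker}(\delta)=J\cap\mathbb Z[(\mathbb Q/\mathbb Z)^{(p)}]$. $J_p\subset\mathbb F_p[(\mathbb Q/\mathbb Z)^{(p)}]$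 is the reduction of $\mathrm{Ker}(\delta)$ modulo $p$. $\mathbb C_p$ is the completion of an algebraic closure of $\mathbb Q_p$; $\mathcal O\subset\mathbb C_p$ is the ring of integers of the completion of the maximal unramified extension of $\mathbb Q_p$, with residue homomorphism $\epsilon:\mathcal O\to\bar{\mathbb F}_p$. For a field homomorphism $\rho$, the image of $\rho\circ\delta$ lies in $\mathcal O$, and $\epsilon\circ\rho\circ\delta$ factors through $\mathcal A$. $X_p$ is the set of injective group homomorphisms $\sigma:\bar{\mathbb F}_p^\times\to(\mathbb Q^{\rm cyc})^\times$; it is identified with $\mathrm{Hom}(\mathbb Q^{{\rm cyc},p},\mathbb C_p)$ by $\sigma\mapsto\tau\circ\sigma^{-1}$ (restricted to $\mu^{(p)}$ and extended to a field homomorphism), $\tau:\bar{\mathbb F}_p^\times\to\mathcal O^\times$ being the Teichmüller lift. $\Sigma_p$ is the set of bijections $s$ of $\{0\}\cup\mu^{(p)}$ which commute with all their conjugates $R\circ s\circ R^{-1}$ under multiplications $R$ by elements of $\mu^{(p)}$ and fulfill $s(0)=1$, $s^p=\mathrm{id}$. The canonical surjection $X_p\to\Sigma_p$ sends $\sigma$ (extended by $\sigma(0)=0$) to $s(x)=\sigma(\sigma^{-1}(x)+1)$. The natural map $\mathrm{Hom}(\mathcal A,\bar{\mathbb F}_p)\to\mathrm{Spec}(\mathcal A)$ sends a homomorphism to its kernel. In (3), "corresponds" is with respect to the identification $X_p\simeq\mathrm{Hom}(\mathbb Q^{{\rm cyc},p},\mathbb C_p)$, the bijection of (1) and the bijection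 of (2). *)

theory Defs
  imports
    "HOL-Analysis.Abstract_Metric_Spaces"
    "HOL-Number_Theory.Residues"
    "HOL-Algebra.Algebra"
    "HOL-Algebra.Algebraic_Closure_Type"
begin

section \<open>Group algebras\<close>

text \<open>
  The group algebra \<open>R[G]\<close>: finitely supported functions \<open>G \<rightarrow> R\<close> with convolution. The functions are
  extended by zero outside \<open>G\<close>, so that for a subgroup \<open>H\<close> of \<open>G\<close> the algebra \<open>R[H]\<close> is literally a
  subset of \<open>R[G]\<close>.
\<close>

definition group_algebra :: "('r, 'm) ring_scheme \<Rightarrow> ('g, 'n) monoid_scheme \<Rightarrow> ('g \<Rightarrow> 'r) ring" where
  "group_algebra R G =
     \<lparr>carrier = {f. (\<forall>x\<in>carrier G. f x \<in> carrier R) \<and> (\<forall>x. x \<notin> carrier G \<longrightarrow> f x = \<zero>\<^bsub>R\<^esub>) \<and>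
                    finite {x. f x \<noteq> \<zero>\<^bsub>R\<^esub>}},
      monoid.mult = (\<lambda>f g x. if x \<in> carrier G
         then (\<Oplus>\<^bsub>R\<^esub> y \<in> {y. f y \<noteq> \<zero>\<^bsub>R\<^esub>}. f y \<otimes>\<^bsub>R\<^esub> g (inv\<^bsub>G\<^esub> y \<otimes>\<^bsub>G\<^esub> x)) else \<zero>\<^bsub>R\<^esub>),
      monoid.one = (\<lambda>x. if x = \<one>\<^bsub>G\<^esub> then \<one>\<^bsub>R\<^esub> else \<zero>\<^bsub>R\<^esub>),
      ring.zero = (\<lambda>x. \<zero>\<^bsub>R\<^esub>),
      ring.add = (\<lambda>f g x. f x \<oplus>\<^bsub>R\<^esub> g x)\<rparr>"

text \<open>The element \<open>c \<cdot> e(g)\<close> of \<open>R[G]\<close>.\<close>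

definition ga_single :: "('r, 'm) ring_scheme \<Rightarrow> 'g \<Rightarrow> 'r \<Rightarrow> 'g \<Rightarrow> 'r" where
  "ga_single R g c = (\<lambda>x. if x = g then c else \<zero>\<^bsub>R\<^esub>)"

text \<open>
  Ring homomorphisms as a set. They are made extensional, so that two homomorphisms are equal iff
  they agree on the carrier and bijections between such sets are meaningful.
\<close>

definition ring_Hom :: "('a, 'm) ring_scheme \<Rightarrow> ('b, 'n) ring_scheme \<Rightarrow> ('a \<Rightarrow> 'b) set" where
  "ring_Hom R S = ring_hom R S \<inter> extensional (carrier R)"

definition Spec :: "('a, 'm) ring_scheme \<Rightarrow> 'a set set" where
  "Spec R = {P. primeideal P R}"


section \<open>The abstract cyclotomic field\<close>

abbreviation rat_ring :: "rat ring" where "rat_ring \<equiv> ring_of_type_algebra"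
abbreviation int_ring :: "int ring" where "int_ring \<equiv> ring_of_type_algebra"

definition QmodZ :: "rat set monoid" where
  "QmodZ = rat_ring A_Mod \<int>"

definition mod1 :: "rat \<Rightarrow> rat set" where
  "mod1 r = \<int> +>\<^bsub>rat_ring\<^esub> r"

text \<open>The group \<open>(\<rat>/\<int>)\<^sup>(\<^sup>p\<^sup>)\<close>, as a subgroup of \<open>\<rat>/\<int>\<close>.\<close>

definition QmodZ_prime_to :: "nat \<Rightarrow> rat set monoid" where
  "QmodZ_prime_to p =
     QmodZ\<lparr>carrier := {mod1 (of_int a / of_nat n) | a n. n > 0 \<and> coprime n p}\<rparr>"

definition cyc_algebra :: "(rat set \<Rightarrow> rat) ring" where
  "cyc_algebra = group_algebra rat_ring QmodZ"

definition cyc_idem :: "nat \<Rightarrow> rat set \<Rightarrow> rat" where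
  "cyc_idem n =
     (\<Oplus>\<^bsub>cyc_algebra\<^esub> j \<in> {..<n}. ga_single rat_ring (mod1 (of_nat j / of_nat n)) (1 / of_nat n))"

definition cyc_ideal :: "(rat set \<Rightarrow> rat) set" where
  "cyc_ideal = Idl\<^bsub>cyc_algebra\<^esub> {cyc_idem n | n. n \<ge> 2}"

definition Qcyc :: "(rat set \<Rightarrow> rat) set ring" where
  "Qcyc = cyc_algebra Quot cyc_ideal"

text \<open>The group \<open>\<mu>\<^sup>(\<^sup>p\<^sup>)\<close> of roots of unity of order prime to \<open>p\<close>, and the subfield it generates.\<close>

definition mu :: "nat \<Rightarrow> (rat set \<Rightarrow> rat) set set" where
  "mu p = {x \<in> carrier Qcyc. \<exists>n::nat. n > 0 \<and> coprime n p \<and> x [^]\<^bsub>Qcyc\<^esub> n = \<one>\<^bsub>Qcyc\<^esub>}"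

definition Qcyc_prime_to :: "nat \<Rightarrow> (rat set \<Rightarrow> rat) set ring" where
  "Qcyc_prime_to p = Qcyc\<lparr>carrier := generate_field Qcyc (mu p)\<rparr>"


section \<open>The algebra \<open>\<A>\<close>\<close>

definition ZGp :: "nat \<Rightarrow> (rat set \<Rightarrow> int) ring" where
  "ZGp p = group_algebra int_ring (QmodZ_prime_to p)"

definition FpGp :: "nat \<Rightarrow> (rat set \<Rightarrow> int) ring" where
  "FpGp p = group_algebra (residue_ring (int p)) (QmodZ_prime_to p)"

text \<open>The homomorphism \<open>\<delta>\<close> does not depend on \<open>p\<close> except through its domain \<open>ZGp p\<close>.\<close>

definition delta :: "(rat set \<Rightarrow> int) \<Rightarrow> (rat set \<Rightarrow> rat) set" where
  "delta f = cyc_ideal +>\<^bsub>cyc_algebra\<^esub> (\<lambda>x. of_int (f x))"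

definition red_mod :: "nat \<Rightarrow> (rat set \<Rightarrow> int) \<Rightarrow> rat set \<Rightarrow> int" where
  "red_mod p f = (\<lambda>x. f x mod int p)"

definition J_mod :: "nat \<Rightarrow> (rat set \<Rightarrow> int) set" where
  "J_mod p = red_mod p ` a_kernel (ZGp p) Qcyc delta"

definition A_alg :: "nat \<Rightarrow> (rat set \<Rightarrow> int) set ring" where
  "A_alg p = FpGp p Quot J_mod p"


section \<open>The field \<open>\<complex>\<^sub>p\<close> and the integers of its maximal unramified part\<close>

locale nonarch_valued_field = field C for C (structure) +
  fixes absv :: "'a \<Rightarrow> real"
  assumes absv_nonneg: "x \<in> carrier C \<Longrightarrow> 0 \<le> absv x"
    and absv_eq_0_iff: "x \<in> carrier C \<Longrightarrow> absv x = 0 \<longleftrightarrow> x = \<zero>"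
    and absv_mult: "\<lbrakk>x \<in> carrier C; y \<in> carrier C\<rbrakk> \<Longrightarrow> absv (x \<otimes> y) = absv x * absv y"
    and absv_ultra: "\<lbrakk>x \<in> carrier C; y \<in> carrier C\<rbrakk> \<Longrightarrow> absv (x \<oplus> y) \<le> max (absv x) (absv y)"
begin

lemma absv_one: "absv \<one> = 1"
proof -
  have "absv \<one> * absv \<one> = absv \<one>"
    using absv_mult[of \<one> \<one>] by simp
  moreover have "absv \<one> \<noteq> 0"
    using absv_eq_0_iff[of \<one>] by simp
  ultimately show ?thesis
    by simp
qed

lemma absv_uminus:
  assumes "x \<in> carrier C"
  shows "absv (\<ominus> x) = absv x"
proof -
  have "absv (\<ominus> \<one>) * absv (\<ominus> \<one>) = absv (\<ominus> \<one> \<otimes> \<ominus> \<one>)"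
    by (rule absv_mult[symmetric]) auto
  also have "\<dots> = 1"
    by (simp add: l_minus r_minus absv_one)
  finally have "absv (\<ominus> \<one>) = 1"
    using absv_nonneg[of "\<ominus> \<one>"] by (simp add: square_eq_1_iff)
  moreover have "\<ominus> x = \<ominus> \<one> \<otimes> x"
    using assms by (simp add: l_minus)
  ultimately show ?thesis
    using assms by (simp add: absv_mult del: l_minus)
qed

text \<open>
  The metric of the absolute value. The locale \<open>Metric_space\<close> asks for a total function that is
  symmetric and non-negative also outside the carrier, hence the case distinction.
\<close>

definition absv_dist :: "'a \<Rightarrow> 'a \<Rightarrow> real" where
  "absv_dist x y = (if x \<in> carrier C \<and> y \<in> carrier C then absv (x \<ominus> y) else 0)"

lemma Metric_space_absv_dist: "Metric_space (carrier C) absv_dist"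
proof
  fix x y z
  show "0 \<le> absv_dist x y"
    by (simp add: absv_dist_def absv_nonneg)
  show "absv_dist x y = absv_dist y x"
  proof (cases "x \<in> carrier C \<and> y \<in> carrier C")
    case True
    then have "y \<ominus> x = \<ominus> (x \<ominus> y)"
      by (simp add: a_minus_def minus_add a_comm)
    with True show ?thesis
      by (simp add: absv_dist_def absv_uminus)
  qed (auto simp: absv_dist_def)
  show "absv_dist x y = 0 \<longleftrightarrow> x = y" if "x \<in> carrier C" "y \<in> carrier C"
    using that by (simp add: absv_dist_def absv_eq_0_iff)
  show "absv_dist x z \<le> absv_dist x y + absv_dist y z"
    if "x \<in> carrier C" "y \<in> carrier C" "z \<in> carrier C"
  proof -
    have "\<ominus> y \<oplus> (y \<oplus> \<ominus> z) = \<ominus> z"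
      using that by (simp add: r_neg1)
    then have "x \<ominus> z = (x \<ominus> y) \<oplus> (y \<ominus> z)"
      using that by (simp add: a_minus_def a_assoc)
    then have "absv (x \<ominus> z) \<le> max (absv (x \<ominus> y)) (absv (y \<ominus> z))"
      using that absv_ultra by simp
    moreover have "0 \<le> absv (x \<ominus> y)" "0 \<le> absv (y \<ominus> z)"
      using that by (auto intro: absv_nonneg)
    ultimately show ?thesis
      using that by (simp add: absv_dist_def)
  qed
qed

sublocale absv: Metric_space "carrier C" absv_dist
  by (rule Metric_space_absv_dist)

abbreviation closure :: "'a set \<Rightarrow> 'a set" where
  "closure S \<equiv> absv.mtopology closure_of S"

text \<open>
  The following definitions are meant for the field of \<open>p\<close>-adic complex numbers, introduced below.
  The prime field \<open>\<rat>\<close> of \<open>C\<close> carries the \<open>p\<close>-adic absolute value and \<open>C\<close> is complete, so that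
  taking the closure in \<open>C\<close> yields a completion.
\<close>

definition Qp :: "'a set" where
  "Qp = closure (generate_field C {})"

definition Qp_alg :: "'a set" where
  "Qp_alg = {x \<in> carrier C. (algebraic over Qp) x}"

text \<open>
  A finite extension of \<open>Qp\<close> inside \<open>C\<close> is unramified if its ramification index is \<open>1\<close>, i.e. if it
  has the same value group as \<open>Qp\<close> (the residue field of \<open>Qp\<close> is finite, so that separability of the
  residue extension is automatic). The maximal unramified extension is the union of all of them.
\<close>

definition unramified :: "'a set \<Rightarrow> bool" where
  "unramified K \<longleftrightarrow>
     subfield K C \<and> Qp \<subseteq> K \<and> finite_dimension Qp K \<and> absv ` (K - {\<zero>}) = absv ` (Qp - {\<zero>})"

definition Qp_unr :: "'a set" where
  "Qp_unr = \<Union>{K. unramified K}"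

definition unr_integers :: "'a ring" where
  "unr_integers =
     \<lparr>carrier = {x \<in> closure Qp_unr. absv x \<le> 1}, monoid.mult = (\<otimes>), monoid.one = \<one>,
      ring.zero = \<zero>, ring.add = (\<oplus>)\<rparr>"

end

text \<open>
  \<open>C\<close> is the completion of an algebraic closure of \<open>\<rat>\<^sub>p\<close>. The chain
  \<open>\<rat> \<subseteq> \<rat>\<^sub>p \<subseteq> \<rat>\<^sub>p\<^sup>a\<^sup>l\<^sup>g \<subseteq> \<complex>\<^sub>p\<close> is described internally: \<open>C\<close> is complete, its absolute value restricts
  to the \<open>p\<close>-adic one on \<open>\<rat>\<close>, the elements of \<open>C\<close> algebraic over \<open>\<rat>\<^sub>p\<close> form an algebraic closure
  of \<open>\<rat>\<^sub>p\<close>, and they are dense in \<open>C\<close>.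
\<close>

locale padic_complex_field = nonarch_valued_field +
  fixes p :: nat
  assumes absv_of_int: "k \<noteq> 0 \<Longrightarrow> absv (add_pow C (k::int) \<one>) = 1 / real p ^ multiplicity (int p) k"
    and complete: "absv.mcomplete"
    and alg_closure_Qp: "algebraic_closure (C\<lparr>carrier := Qp_alg\<rparr>) Qp"
    and dense: "closure Qp_alg = carrier C"

text \<open>An algebraic closure of the field with \<open>p\<close> elements.\<close>

definition alg_closure_of_Fp :: "nat \<Rightarrow> ('f, 'm) ring_scheme \<Rightarrow> bool" where
  "alg_closure_of_Fp p F \<longleftrightarrow>
     algebraic_closure F (generate_field F {}) \<and> add_pow F p \<one>\<^bsub>F\<^esub> = \<zero>\<^bsub>F\<^esub>"


section \<open>The maps between the sets of homomorphisms, the spectrum and \<open>\<Sigma>\<^sub>p\<close>\<close>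

text \<open>
  In the following, \<open>eps\<close> stands for the residue homomorphism \<open>\<epsilon>\<close> from the ring of integers \<open>W\<close>
  (which will be \<open>unr_integers\<close>) to \<open>F\<close>. The value of \<open>res \<rho>\<close> at a class in \<open>A_alg p\<close> is computed by
  lifting the class to an element of \<open>\<int>[(\<rat>/\<int>)\<^sup>(\<^sup>p\<^sup>)]\<close>.
\<close>

definition res :: "nat \<Rightarrow> ('c \<Rightarrow> 'f) \<Rightarrow> ((rat set \<Rightarrow> rat) set \<Rightarrow> 'c) \<Rightarrow> (rat set \<Rightarrow> int) set \<Rightarrow> 'f" where
  "res p eps \<rho> =
     (\<lambda>a \<in> carrier (A_alg p).
        THE y. \<exists>f \<in> carrier (ZGp p). a = J_mod p +>\<^bsub>FpGp p\<^esub> red_mod p f \<and> y = eps (\<rho> (delta f)))"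

definition teichmueller ::
    "('c, 'm) ring_scheme \<Rightarrow> ('f, 'n) ring_scheme \<Rightarrow> ('c \<Rightarrow> 'f) \<Rightarrow> 'f \<Rightarrow> 'c" where
  "teichmueller W F eps =
     (THE \<tau>. \<tau> \<in> hom (units_of F) (units_of W) \<inter> extensional (Units F) \<and>
             (\<forall>x \<in> Units F. eps (\<tau> x) = x))"

definition X_set :: "('f, 'm) ring_scheme \<Rightarrow> ('f \<Rightarrow> (rat set \<Rightarrow> rat) set) set" where
  "X_set F =
     {\<sigma> \<in> hom (units_of F) (units_of Qcyc) \<inter> extensional (Units F). inj_on \<sigma> (Units F)}"

text \<open>
  The identification of \<open>X\<^sub>p\<close> with the set of homomorphisms from \<open>\<rat>\<^sup>c\<^sup>y\<^sup>c\<^sup>,\<^sup>p\<close> to \<open>\<complex>\<^sub>p\<close>: the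
  homomorphism that restricts to \<open>\<tau> \<circ> \<sigma>\<inverse>\<close> on \<open>\<mu>\<^sup>(\<^sup>p\<^sup>)\<close>.
\<close>

definition X_to_Hom ::
    "nat \<Rightarrow> ('c, 'k) ring_scheme \<Rightarrow> ('c, 'm) ring_scheme \<Rightarrow> ('f, 'n) ring_scheme \<Rightarrow> ('c \<Rightarrow> 'f) \<Rightarrow>
     ('f \<Rightarrow> (rat set \<Rightarrow> rat) set) \<Rightarrow> (rat set \<Rightarrow> rat) set \<Rightarrow> 'c" where
  "X_to_Hom p C W F eps \<sigma> =
     (THE \<rho>. \<rho> \<in> ring_Hom (Qcyc_prime_to p) C \<and>
             (\<forall>x \<in> mu p. \<rho> x = teichmueller W F eps (inv_into (Units F) \<sigma> x)))"

definition mu0 :: "nat \<Rightarrow> (rat set \<Rightarrow> rat) set set" where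
  "mu0 p = insert \<zero>\<^bsub>Qcyc\<^esub> (mu p)"

text \<open>
  In \<open>Sigma_set\<close>, the third condition says that \<open>s\<close> commutes with \<open>R \<circ> s \<circ> R\<inverse>\<close>, where \<open>R\<close> is the
  multiplication by \<open>r\<close>.
\<close>

definition Sigma_set :: "nat \<Rightarrow> ((rat set \<Rightarrow> rat) set \<Rightarrow> (rat set \<Rightarrow> rat) set) set" where
  "Sigma_set p =
     {s \<in> extensional (mu0 p).
        bij_betw s (mu0 p) (mu0 p) \<and>
        (\<forall>r \<in> mu p. \<forall>x \<in> mu0 p.
           s (r \<otimes>\<^bsub>Qcyc\<^esub> s (inv\<^bsub>Qcyc\<^esub> r \<otimes>\<^bsub>Qcyc\<^esub> x)) = r \<otimes>\<^bsub>Qcyc\<^esub> s (inv\<^bsub>Qcyc\<^esub> r \<otimes>\<^bsub>Qcyc\<^esub> s x)) \<and>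
        s \<zero>\<^bsub>Qcyc\<^esub> = \<one>\<^bsub>Qcyc\<^esub> \<and>
        (\<forall>x \<in> mu0 p. (s ^^ p) x = x)}"

definition extend_zero ::
    "('f, 'm) ring_scheme \<Rightarrow> ('f \<Rightarrow> (rat set \<Rightarrow> rat) set) \<Rightarrow> 'f \<Rightarrow> (rat set \<Rightarrow> rat) set" where
  "extend_zero F \<sigma> = (\<lambda>a. if a = \<zero>\<^bsub>F\<^esub> then \<zero>\<^bsub>Qcyc\<^esub> else \<sigma> a)"

definition X_to_Sigma ::
    "nat \<Rightarrow> ('f, 'm) ring_scheme \<Rightarrow> ('f \<Rightarrow> (rat set \<Rightarrow> rat) set) \<Rightarrow>
     (rat set \<Rightarrow> rat) set \<Rightarrow> (rat set \<Rightarrow> rat) set" where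
  "X_to_Sigma p F \<sigma> =
     (\<lambda>x \<in> mu0 p.
        extend_zero F \<sigma> (inv_into (carrier F) (extend_zero F \<sigma>) x \<oplus>\<^bsub>F\<^esub> \<one>\<^bsub>F\<^esub>))"

text \<open>
  The canonical bijection from the spectrum to \<open>\<Sigma>\<^sub>p\<close>. For a prime ideal \<open>P\<close>, every nonzero element of
  \<open>\<A>/P\<close> is the class of \<open>e(r)\<close> for exactly one \<open>r\<close> in \<open>(\<rat>/\<int>)\<^sup>(\<^sup>p\<^sup>)\<close>; \<open>mu0_to_residue p P\<close> is the
  resulting multiplicative bijection from \<open>{0} \<union> \<mu>\<^sup>(\<^sup>p\<^sup>)\<close> to \<open>\<A>/P\<close>, and the element of \<open>\<Sigma>\<^sub>p\<close> attached
  to \<open>P\<close> is the transport of \<open>a \<mapsto> a + 1\<close> along it.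
\<close>

definition mu0_to_residue ::
    "nat \<Rightarrow> (rat set \<Rightarrow> int) set set \<Rightarrow> (rat set \<Rightarrow> rat) set \<Rightarrow> (rat set \<Rightarrow> int) set set" where
  "mu0_to_residue p P x =
     (if x = \<zero>\<^bsub>Qcyc\<^esub> then P
      else P +>\<^bsub>A_alg p\<^esub> (J_mod p +>\<^bsub>FpGp p\<^esub> ga_single (residue_ring (int p))
        (THE r. r \<in> carrier (QmodZ_prime_to p) \<and> delta (ga_single int_ring r 1) = x) 1))"

definition Spec_to_Sigma ::
    "nat \<Rightarrow> (rat set \<Rightarrow> int) set set \<Rightarrow> (rat set \<Rightarrow> rat) set \<Rightarrow> (rat set \<Rightarrow> rat) set" where
  "Spec_to_Sigma p P =
     (\<lambda>x \<in> mu0 p. inv_into (mu0 p) (mu0_to_residue p P)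
        (mu0_to_residue p P x \<oplus>\<^bsub>A_alg p Quot P\<^esub> \<one>\<^bsub>A_alg p Quot P\<^esub>))"

end

theory Submission
  imports Defs
begin

text \<open>
  Write \<open>G\<close> for the group of fractions modulo \<open>1\<close> with denominator prime to \<open>p\<close>. All three assertions are
  about ring homomorphisms \<open>\<theta>\<close> from \<open>\<int>[G]\<close> to a field which kill the kernel of \<open>\<delta>\<close>, and these are
  controlled by their values \<open>\<theta>(e(r))\<close> on the group elements.

  \<^item> An injective homomorphism from \<open>G\<close> to the multiplicative group of a domain in which no integer prime to
    \<open>p\<close> vanishes extends to a homomorphism on \<open>\<int>[G]\<close> that kills the kernel of \<open>\<delta>\<close>
    (\<open>delta_kernel_killed\<close>). An element \<open>f\<close> supported on the fractions with denominator \<open>n\<close> is in this kernel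
    iff it vanishes under \<open>e(r) \<mapsto> exp(2\<pi>ir)\<close>. Let \<open>w\<close> be the product over the divisors \<open>d \<ge> 2\<close> of \<open>n\<close> of the
    elements \<open>d - \<Sum>\<^sub>j e(j/d)\<close>. A character \<open>e(r) \<mapsto> exp(2\<pi>ikr)\<close> kills \<open>f\<close> if \<open>k\<close> is prime to \<open>n\<close>, because
    roots of unity of the same order are conjugate, and it kills the factor of \<open>w\<close> for \<open>d = gcd k n\<close>
    otherwise. Hence \<open>f w = 0\<close> by Fourier inversion. Injectivity on \<open>G\<close> forces \<open>\<theta>(\<Sum>\<^sub>j e(j/d)) = 0\<close>, so that
    \<open>\<theta>(w)\<close> is a product of divisors of \<open>n\<close> and \<open>\<theta>(f) = 0\<close>. The same identity \<open>f w = 0\<close> shows that the ideal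
    generated by the idempotents is the kernel of the evaluation at roots of unity (\<open>cyc_ideal_eq\<close>), and with
    it that the abstract cyclotomic field is a field.

  \<^item> Conversely, let a domain \<open>D\<close> of characteristic \<open>p\<close> be the image of \<open>\<int>[G]\<close> under a homomorphism that kills
    the kernel of \<open>\<delta>\<close> (locale \<open>residue_model\<close>). Every element of \<open>D\<close> is fixed by a power of Frobenius, so the
    nonzero elements are roots of unity of order prime to \<open>p\<close>, and counting shows that \<open>G\<close> maps bijectively to
    them. Thus \<open>D\<close> is the set \<open>{0} \<union> \<mu>\<close> of roots of unity together with zero, with the given multiplication
    and some addition; as \<open>x + y = y (x/y + 1)\<close>, the addition is determined by the permutation
    \<open>x \<mapsto> x + 1\<close>. The axioms of \<open>\<Sigma>\<^sub>p\<close> are what is needed for such a permutation to come from a ring structure: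
    commuting with the conjugates gives commutativity and associativity of the addition, and the order \<open>p\<close>
    gives the characteristic. This is the bijection of the spectrum with \<open>\<Sigma>\<^sub>p\<close>
    (\<open>bij_betw_Spec_to_Sigma\<close>).

  \<^item> In the field of \<open>p\<close>-adic complex numbers, a root of unity \<open>z\<close> of order prime to \<open>p\<close> generates an
    unramified extension: an element of \<open>\<int>\<^sub>p[z]\<close> of absolute value less than \<open>1\<close> is divisible by \<open>p\<close> in
    \<open>\<int>\<^sub>p[z]\<close> (\<open>S_small_divisible\<close>). So such roots lie in \<open>\<O>\<close>, and \<open>\<epsilon>\<close> maps them bijectively to the nonzero
    elements of the residue field (\<open>eps_bij\<close>); the inverse of this bijection is the Teichmueller lift. A
    homomorphism on the cyclotomic field is a choice of roots of unity in \<open>\<complex>\<^sub>p\<close>, a homomorphism on \<open>\<A>\<close> is a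
    choice of nonzero elements of the residue field, and \<open>\<epsilon>\<close> identifies the two
    (\<open>bij_betw_res\<close>).

  \<^item> Finally, for \<open>\<sigma>\<close> in \<open>X\<^sub>p\<close> the homomorphism from \<open>\<A>\<close> to the residue field attached to \<open>\<sigma>\<close> sends \<open>e(r)\<close> to
    the preimage under \<open>\<sigma>\<close> of the root of unity \<open>\<delta>(e(r))\<close>, so the identification of \<open>{0} \<union> \<mu>\<close> with the residue
    field used for its kernel is the inverse of \<open>\<sigma>\<close>, and the permutation attached to the kernel is
    \<open>x \<mapsto> \<sigma>(\<sigma>\<inverse>(x) + 1)\<close> (\<open>Spec_to_Sigma_X\<close>).
\<close>

section \<open>Conjugates of roots of unity\<close>

abbreviation ipoly :: "int poly \<Rightarrow> complex \<Rightarrow> complex" where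
  "ipoly f z \<equiv> poly (map_poly of_int f) z"

lemma ipoly_pCons: "ipoly (pCons a f) z = of_int a + z * ipoly f z"
  by (simp add: map_poly_pCons)

lemma ipoly_add: "ipoly (f + g) z = ipoly f z + ipoly g z"
  by (induction f g rule: poly_induct2) (simp_all add: ipoly_pCons algebra_simps del: map_poly_pCons)

lemma ipoly_smult: "ipoly (smult c f) z = of_int c * ipoly f z"
  by (induction f) (simp_all add: ipoly_pCons algebra_simps)

lemma ipoly_diff: "ipoly (f - g) z = ipoly f z - ipoly g z"
  using ipoly_add[of "f - g" g z] by simp

lemma ipoly_mult: "ipoly (f * g) z = ipoly f z * ipoly g z"
  by (induction f) (simp_all add: ipoly_pCons ipoly_add ipoly_smult algebra_simps)

lemma ipoly_power: "ipoly (f ^ k) z = ipoly f z ^ k"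
  by (induction k) (simp_all add: ipoly_mult)

lemma ipoly_monom: "ipoly (monom c k) z = of_int c * z ^ k"
  by (simp add: map_poly_monom poly_monom)

lemma ipoly_pcompose_monom: "ipoly (pcompose f (monom 1 q)) z = ipoly f (z ^ q)"
  by (induction f) (simp_all add: pcompose_pCons ipoly_pCons ipoly_add ipoly_mult ipoly_monom)

lemmas ipoly_simps = ipoly_pCons ipoly_add ipoly_smult ipoly_diff ipoly_mult ipoly_power ipoly_monom
  ipoly_pcompose_monom

lemma frobenius_int_poly:
  fixes f :: "int poly"
  assumes "Factorial_Ring.prime q"
  shows "[:int q:] dvd pcompose f (monom 1 q) - f ^ q"
proof (induction f)
  case 0
  from assms have "q > 0" by (rule prime_gt_0_nat)
  then show ?case by (simp add: power_0_left)
next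
  case (pCons a f)
  have binom: "[:int q:] dvd (u + v) ^ q - (u ^ q + v ^ q)" for u v :: "int poly"
  proof -
    have "(u + v) ^ q = (\<Sum>k\<le>q. of_nat (q choose k) * u ^ k * v ^ (q - k))"
      by (rule binomial_ring)
    also have "{..q} = {0, q} \<union> {0<..<q}" by auto
    also have "(\<Sum>k\<in>{0, q} \<union> {0<..<q}. of_nat (q choose k) * u ^ k * v ^ (q - k))
       = u ^ q + v ^ q + (\<Sum>k\<in>{0<..<q}. of_nat (q choose k) * u ^ k * v ^ (q - k))"
      using prime_gt_0_nat[OF assms] by (subst sum.union_disjoint) (auto simp: algebra_simps)
    finally have *: "(u + v) ^ q - (u ^ q + v ^ q) =
        (\<Sum>k\<in>{0<..<q}. of_nat (q choose k) * u ^ k * v ^ (q - k))" by simp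
    have "[:int q:] dvd of_nat (q choose k)" if "k \<in> {0<..<q}" for k
    proof -
      have "q dvd q choose k"
        using that assms by (intro dvd_choose_prime) auto
      then obtain c where "q choose k = q * c" by (elim dvdE)
      then have *: "of_nat (q choose k) = [:int q:] * of_nat c"
        by (simp add: of_nat_poly)
      show ?thesis unfolding * by (rule dvd_triv_left)
    qed
    then show ?thesis unfolding * by (intro dvd_sum) (auto intro: dvd_mult2)
  qed
  have "int q dvd a ^ q - a"
  proof -
    have "[a ^ q = a] (mod int q)"
    proof (cases "int q dvd a")
      case True
      then have "int q dvd a ^ q" using prime_gt_0_nat[OF assms] by (metis dvd_power dvd_trans)
      with True show ?thesis by (auto simp: cong_def mod_eq_0_iff_dvd)
    next
      case False
      then have "coprime a (int q)"
        using assms by (metis coprime_commute prime_imp_coprime prime_int_iff prime_nat_int_transfer)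
      then have "[a ^ (q - 1) = 1] (mod int q)"
        using residues.euler_theorem[of "int q" a] assms prime_gt_1_nat[OF assms]
        by (simp add: residues_def totient_prime)
      then have "[a ^ (q - 1) * a = 1 * a] (mod int q)" by (rule cong_scalar_right)
      moreover have "a ^ (q - 1) * a = a ^ q"
        using prime_gt_0_nat[OF assms] by (simp flip: power_Suc2)
      ultimately show ?thesis by simp
    qed
    then show ?thesis by (simp add: cong_iff_dvd_diff)
  qed
  then have 1: "[:int q:] dvd [:a:] - [:a:] ^ q"
    by (auto simp: poly_const_pow const_poly_dvd_iff coeff_pCons dvd_diff_commute split: nat.split)
  have 2: "[:int q:] dvd monom 1 q * pcompose f (monom 1 q) - monom 1 q * f ^ q"
    using pCons.IH by (simp flip: right_diff_distrib)
  have "pCons a f = [:a:] + monom 1 1 * f"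
    by (simp add: monom_altdef)
  then have 3: "[:int q:] dvd pCons a f ^ q - ([:a:] ^ q + monom 1 q * f ^ q)"
    using binom[of "[:a:]" "monom 1 1 * f"] by (simp add: power_mult_distrib monom_power)
  have "pcompose (pCons a f) (monom 1 q) - pCons a f ^ q
     = ([:a:] - [:a:] ^ q) + (monom 1 q * pcompose f (monom 1 q) - monom 1 q * f ^ q)
       - (pCons a f ^ q - ([:a:] ^ q + monom 1 q * f ^ q))"
    by (simp add: pcompose_pCons)
  also have "[:int q:] dvd \<dots>"
    by (rule dvd_diff[OF dvd_add[OF 1 2] 3])
  finally show ?case .
qed

text \<open>
  By Gauss, a primitive integer polynomial of least degree vanishing at \<open>z\<close> divides all others over \<open>\<int>\<close>, not
  only over \<open>\<rat>\<close>. This is the minimal polynomial of \<open>z\<close> up to sign when \<open>z\<close> is an algebraic integer.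
\<close>

lemma minimal_int_poly:
  assumes "f0 \<noteq> 0" "ipoly f0 z = 0"
  obtains h where "ipoly h z = 0" "degree h > 0" "\<And>f. ipoly f z = 0 \<Longrightarrow> h dvd f"
proof -
  define P where "P = (\<lambda>f :: int poly. f \<noteq> 0 \<and> ipoly f z = 0)"
  define g where "g = (ARG_MIN degree f. P f)"
  have g: "P g" and min: "\<And>f. P f \<Longrightarrow> degree g \<le> degree f"
    unfolding g_def using arg_min_nat_lemma[of P f0 degree] assms by (auto simp: P_def)
  define h where "h = primitive_part g"
  have gh: "g = smult (content g) h"
    by (simp add: h_def)
  have h0: "h \<noteq> 0" using g by (auto simp: h_def P_def)
  have ch: "content h = 1" using g by (simp add: h_def P_def)
  have hz: "ipoly h z = 0"
    using g gh ipoly_smult[of "content g" h z] by (auto simp: P_def)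
  have deg: "degree h = degree g" by (simp add: h_def)
  show ?thesis
  proof (rule that[OF hz])
    show "degree h > 0"
    proof (rule ccontr)
      assume "\<not> degree h > 0"
      then obtain c where "h = [:c:]" by (auto elim: degree_eq_zeroE)
      with h0 hz show False by (simp add: ipoly_pCons)
    qed
    fix f assume f: "ipoly f z = 0"
    obtain a q where a: "a \<noteq> 0" and eq: "smult a f = h * q + pseudo_mod f h"
      using pseudo_mod(1)[OF h0] by blast
    have "ipoly (pseudo_mod f h) z = 0"
      using arg_cong[OF eq, of "\<lambda>f. ipoly f z"] f hz by (simp add: ipoly_simps)
    moreover have "pseudo_mod f h = 0 \<or> degree (pseudo_mod f h) < degree h"
      by (rule pseudo_mod(2)[OF h0])
    ultimately have r: "pseudo_mod f h = 0"
      using min[of "pseudo_mod f h"] deg unfolding P_def by linarith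
    have "content q = content (h * q)" by (simp add: content_mult ch)
    also have "\<dots> = normalize a * content f" using eq r by (metis add.right_neutral content_smult)
    finally have "a dvd content q" by simp
    then have "[:a:] dvd q" by (simp add: const_poly_dvd_iff_dvd_content)
    then obtain q' where "q = smult a q'" by (auto elim: dvdE)
    with eq r a have "smult a f = smult a (h * q')" by simp
    then have "smult a (f - h * q') = 0" by (simp add: smult_diff_right)
    with a have "f = h * q'" by simp
    then show "h dvd f" by simp
  qed
qed

text \<open>
  If \<open>z\<^sup>q\<close> were not a root of the minimal polynomial \<open>h\<close> of \<open>z\<close>, it would be a root of the cofactor of \<open>h\<close> in
  \<open>X\<^sup>n - 1\<close>. The derivative of \<open>X\<^sup>n - 1\<close> at \<open>z\<^sup>q\<close> then shows that \<open>h(z\<^sup>q)\<close> divides \<open>n\<close> in \<open>\<int>[z]\<close>, while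
  \<open>h(z\<^sup>q) \<equiv> h(z)\<^sup>q = 0\<close> modulo \<open>q\<close>. So \<open>q\<close> divides \<open>n\<close> in \<open>\<int>[z]\<close>, and hence in \<open>\<int>\<close>.
\<close>

lemma root_of_unity_conjugate_prime:
  assumes "Factorial_Ring.prime q" "\<not> q dvd n" "z ^ n = 1" "ipoly f z = 0"
  shows "ipoly f (z ^ q) = 0"
proof -
  define Xn where "Xn = (monom 1 n - 1 :: int poly)"
  have n: "n > 0" using assms(2) by (auto intro: Nat.gr0I)
  have "coeff Xn n = 1" using n by (simp add: Xn_def)
  then have "Xn \<noteq> 0" by auto
  have Xz: "ipoly Xn w = w ^ n - 1" for w by (simp add: Xn_def ipoly_diff ipoly_monom)
  obtain h where h: "ipoly h z = 0" "degree h > 0" "\<And>f. ipoly f z = 0 \<Longrightarrow> h dvd f"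
    using minimal_int_poly[OF \<open>Xn \<noteq> 0\<close>] Xz assms(3) by (metis diff_self)
  have "h dvd Xn" using h(3) Xz assms(3) by simp
  then obtain g where g: "Xn = h * g" by (elim dvdE)
  define w where "w = z ^ q"
  have wn: "w ^ n = 1"
    using assms(3) unfolding w_def by (metis power_mult mult.commute power_one)
  have "ipoly h w = 0"
  proof (rule ccontr)
    assume hw: "ipoly h w \<noteq> 0"
    have "ipoly h w * ipoly g w = 0"
      using wn Xz[of w] by (simp add: g ipoly_mult)
    with hw have gw: "ipoly g w = 0" by simp
    have "pderiv Xn = monom (int n) (n - 1)"
      by (simp add: Xn_def pderiv_diff pderiv_monom)
    then have "monom (int n) (n - 1) = h * pderiv g + g * pderiv h"
      by (simp add: g pderiv_mult)
    from arg_cong[OF this, of "\<lambda>f. ipoly f w"]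
    have "of_nat n * w ^ (n - 1) = ipoly h w * ipoly (pderiv g) w"
      using gw by (simp add: ipoly_simps)
    then have "of_nat n * (w ^ (n - 1) * w) = ipoly h w * ipoly (pderiv g) w * w" by simp
    also have "w ^ (n - 1) * w = 1" using wn n by (simp flip: power_Suc2)
    finally have 1: "of_nat n = ipoly h w * ipoly (pderiv g) w * w" by simp
    obtain t where t: "pcompose h (monom 1 q) - h ^ q = smult (int q) t"
      using frobenius_int_poly[OF assms(1), of h] by (auto elim: dvdE)
    have "ipoly h w = of_nat q * ipoly t z"
      using arg_cong[OF t, of "\<lambda>f. ipoly f z"] h(1) prime_gt_0_nat[OF assms(1)]
      by (simp add: ipoly_simps w_def power_0_left)
    with 1 have 2: "of_nat n = of_nat q * ipoly (t * pcompose (pderiv g) (monom 1 q) * monom 1 q) z"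
      by (simp add: ipoly_simps w_def)
    define H where "H = t * pcompose (pderiv g) (monom 1 q) * monom 1 q"
    have "ipoly ([:int n:] - smult (int q) H) z = 0"
      using 2 by (simp add: ipoly_simps H_def[symmetric])
    then have "h dvd [:int n:] - smult (int q) H" by (rule h(3))
    then obtain k where k: "[:int n:] - smult (int q) H = h * k" by (elim dvdE)
    \<comment> \<open>After division of \<open>H\<close> by \<open>h\<close> the relation has degree less than the degree of \<open>h\<close>, so it is trivial.\<close>
    obtain u r where ur: "pseudo_divmod H h = (u, r)" by (cases "pseudo_divmod H h")
    define c where "c = lead_coeff h ^ (Suc (degree H) - degree h)"
    have "h \<noteq> 0" using h(2) by auto
    from pseudo_divmod[OF this ur]
    have eq: "smult c H = h * u + r" and r: "r = 0 \<or> degree r < degree h" by (auto simp: c_def)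
    have "[:c * int n:] - smult (int q) r = h * (smult c k + smult (int q) u)"
    proof -
      have "[:c * int n:] - smult (int q) r = smult c ([:int n:] - smult (int q) H) + smult (int q) (smult c H - r)"
        by (simp add: smult_diff_right algebra_simps)
      also have "\<dots> = h * (smult c k + smult (int q) u)"
        using eq by (simp add: k algebra_simps)
      finally show ?thesis .
    qed
    moreover have "degree ([:c * int n:] - smult (int q) r) < degree h"
      using r h(2) by (intro degree_diff_less) (auto intro: le_less_trans[OF degree_smult_le])
    ultimately have "[:c * int n:] - smult (int q) r = 0"
      by (metis dvd_imp_degree_le dvd_triv_left not_le)
    then have "int q dvd c * int n"
      by (metis coeff_pCons_0 coeff_smult dvd_triv_left eq_iff_diff_eq_0)
    moreover have "is_unit c"
    proof -
      have "lead_coeff h * lead_coeff g = lead_coeff Xn" by (simp add: g lead_coeff_mult)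
      also have "\<dots> = 1"
      proof -
        have "degree Xn = n" unfolding Xn_def using n
          by (subst diff_conv_add_uminus, subst degree_add_eq_left) (auto simp: degree_monom_eq)
        then show ?thesis using \<open>coeff Xn n = 1\<close> by simp
      qed
      finally have "is_unit (lead_coeff h)" by (metis dvd_triv_left)
      then show ?thesis unfolding c_def by (rule is_unit_power_iff[THEN iffD2, OF disjI1])
    qed
    ultimately have "int q dvd int n" by (simp add: dvd_mult_unit_iff' )
    with assms(2) show False by simp
  qed
  moreover obtain f' where "f = h * f'" using h(3)[OF assms(4)] by (elim dvdE)
  ultimately show ?thesis by (simp add: ipoly_mult w_def)
qed

theorem root_of_unity_conjugate:
  assumes "coprime a n" "z ^ n = 1" "ipoly f z = 0" "n > 0"
  shows "ipoly f (z ^ a) = 0"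
proof (cases "a = 0")
  case True
  with assms show ?thesis by simp
next
  case False
  have "\<forall>z. z ^ n = 1 \<longrightarrow> ipoly f z = 0 \<longrightarrow> ipoly f (z ^ a) = 0"
    using False assms(1)
  proof (induction a rule: prime_divisors_induct)
    case (factor q a)
    show ?case
    proof (intro allI impI)
      fix z :: complex assume z: "z ^ n = 1" "ipoly f z = 0"
      have "\<not> q dvd n"
        using factor.prems factor.hyps by (metis coprime_mult_left_iff coprime_absorb_left not_prime_unit)
      then have "ipoly f (z ^ q) = 0"
        using root_of_unity_conjugate_prime[of q n z f] factor.hyps z by simp
      moreover have "(z ^ q) ^ n = 1" using z(1) by (metis power_mult mult.commute power_one)
      ultimately show "ipoly f (z ^ (q * a)) = 0"
        using factor.IH factor.prems by (simp add: power_mult)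
    qed
  qed auto
  with assms show ?thesis by simp
qed

section \<open>Group algebras over a commutative ring\<close>

abbreviation type_ring :: "'a::comm_ring_1 ring" where "type_ring \<equiv> ring_of_type_algebra"

lemma type_ring_simps [simp]:
  "carrier type_ring = UNIV" "x \<otimes>\<^bsub>type_ring\<^esub> y = x * y" "x \<oplus>\<^bsub>type_ring\<^esub> y = x + y"
  "\<one>\<^bsub>type_ring\<^esub> = 1" "\<zero>\<^bsub>type_ring\<^esub> = 0"
  by (simp_all add: ring_of_type_algebra_def)

lemma cring_type_ring: "cring (type_ring :: 'a::comm_ring_1 ring)"
  by (rule cring_from_type_algebra)

lemma finsum_type_ring [simp]: "finsum (type_ring :: 'a::comm_ring_1 ring) f A = sum f A"
proof -
  interpret cring "type_ring :: 'a ring" by (rule cring_type_ring)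
  show ?thesis
  proof (cases "finite A")
    case True
    then show ?thesis by (induction A rule: finite_induct) simp_all
  next
    case False
    then show ?thesis by (simp add: finsum_infinite)
  qed
qed

text \<open>
  The linear extension of \<open>h\<close> to the group algebra, with the coefficients transported along \<open>\<phi>\<close>. If \<open>h\<close> is a
  character and \<open>\<phi>\<close> a ring homomorphism, this is a ring homomorphism. The pairings with all \<open>h\<close> determine an
  element, which reduces the ring axioms for the convolution to the ones for iterated sums.
\<close>

definition pairing :: "('a::comm_ring_1 \<Rightarrow> 'b::comm_ring_1) \<Rightarrow> ('g \<Rightarrow> 'a) \<Rightarrow> ('g \<Rightarrow> 'b) \<Rightarrow> 'b" where
  "pairing \<phi> f h = (\<Sum>x\<in>{x. f x \<noteq> 0}. \<phi> (f x) * h x)"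

lemma pairing_superset:
  assumes "\<phi> 0 = 0" "finite A" "{x. f x \<noteq> 0} \<subseteq> A"
  shows "pairing \<phi> f h = (\<Sum>x\<in>A. \<phi> (f x) * h x)"
  unfolding pairing_def using assms by (intro sum.mono_neutral_left) auto

lemma pairing_cong: "(\<And>x. f x \<noteq> 0 \<Longrightarrow> h x = h' x) \<Longrightarrow> pairing \<phi> f h = pairing \<phi> f h'"
  unfolding pairing_def by (intro sum.cong) auto

lemma pairing_delta:
  assumes "\<phi> 0 = 0" "finite {x. f x \<noteq> 0}"
  shows "pairing \<phi> f (\<lambda>x. if x = a then 1 else 0) = \<phi> (f a)"
proof -
  have "pairing \<phi> f (\<lambda>x. if x = a then 1 else 0) = (\<Sum>x\<in>{x. f x \<noteq> 0}. if x = a then \<phi> (f a) else 0)"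
    unfolding pairing_def by (intro sum.cong) auto
  also have "\<dots> = \<phi> (f a)" using assms by auto
  finally show ?thesis .
qed

lemma pairing_add:
  assumes "\<phi> 0 = 0" "\<And>x y. \<phi> (x + y) = \<phi> x + \<phi> y" "finite {x. f x \<noteq> 0}" "finite {x. g x \<noteq> 0}"
  shows "pairing \<phi> (\<lambda>x. f x + g x) h = pairing \<phi> f h + pairing \<phi> g h"
proof -
  define A where "A = {x. f x \<noteq> 0} \<union> {x. g x \<noteq> 0}"
  have A: "finite A" "{x. f x \<noteq> 0} \<subseteq> A" "{x. g x \<noteq> 0} \<subseteq> A" "{x. f x + g x \<noteq> 0} \<subseteq> A"
    using assms by (auto simp: A_def)
  then have "pairing \<phi> (\<lambda>x. f x + g x) h = (\<Sum>x\<in>A. \<phi> (f x + g x) * h x)"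
    "pairing \<phi> f h = (\<Sum>x\<in>A. \<phi> (f x) * h x)" "pairing \<phi> g h = (\<Sum>x\<in>A. \<phi> (g x) * h x)"
    using assms(1) by (simp_all add: pairing_superset)
  then show ?thesis by (simp add: assms(2) algebra_simps sum.distrib)
qed

lemma pairing_single: "\<phi> 0 = 0 \<Longrightarrow> pairing \<phi> (ga_single type_ring g c) h = \<phi> c * h g"
proof -
  assume "\<phi> 0 = 0"
  then have "pairing \<phi> (ga_single type_ring g c) h = (\<Sum>x\<in>{g}. \<phi> (ga_single type_ring g c x) * h x)"
    by (intro pairing_superset) (auto simp: ga_single_def)
  then show ?thesis by (simp add: ga_single_def)
qed

lemma ga_type_simps:
  "f \<oplus>\<^bsub>group_algebra type_ring G\<^esub> g = (\<lambda>x. f x + g x)"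
  "\<zero>\<^bsub>group_algebra type_ring G\<^esub> = (\<lambda>x. 0)"
  "\<one>\<^bsub>group_algebra type_ring G\<^esub> = ga_single type_ring \<one>\<^bsub>G\<^esub> 1"
  by (auto simp: group_algebra_def ga_single_def)

lemma ga_type_carrier:
  "f \<in> carrier (group_algebra type_ring G) \<longleftrightarrow>
     (\<forall>x. x \<notin> carrier G \<longrightarrow> f x = 0) \<and> finite {x. f x \<noteq> 0}"
  by (auto simp: group_algebra_def)

lemma ga_type_finite: "f \<in> carrier (group_algebra type_ring G) \<Longrightarrow> finite {x. f x \<noteq> 0}"
  by (simp add: ga_type_carrier)

lemma ga_type_support: "f \<in> carrier (group_algebra type_ring G) \<Longrightarrow> f x \<noteq> 0 \<Longrightarrow> x \<in> carrier G"
  by (auto simp: ga_type_carrier)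

lemma ga_single_closed:
  "g \<in> carrier G \<Longrightarrow> ga_single type_ring g c \<in> carrier (group_algebra type_ring G)"
  by (auto simp: ga_type_carrier ga_single_def intro: finite_subset[of _ "{g}"])

context comm_group
begin

lemma ga_type_mult:
  "f \<otimes>\<^bsub>group_algebra type_ring G\<^esub> g =
     (\<lambda>x. if x \<in> carrier G then \<Sum>y\<in>{y. f y \<noteq> 0}. f y * g (inv y \<otimes> x) else 0)"
  by (simp add: group_algebra_def cong: if_cong)

lemma ga_type_mult_support:
  assumes "f \<in> carrier (group_algebra type_ring G)"
  shows "{x. (f \<otimes>\<^bsub>group_algebra type_ring G\<^esub> g) x \<noteq> 0} \<subseteq>
    (\<lambda>(y, z). y \<otimes> z) ` ({y. f y \<noteq> 0} \<times> {z. g z \<noteq> 0})"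
proof
  fix x assume x: "x \<in> {x. (f \<otimes>\<^bsub>group_algebra type_ring G\<^esub> g) x \<noteq> 0}"
  then have xG: "x \<in> carrier G" by (auto simp: ga_type_mult split: if_splits)
  with x have "(\<Sum>y\<in>{y. f y \<noteq> 0}. f y * g (inv y \<otimes> x)) \<noteq> 0" by (simp add: ga_type_mult)
  then obtain y where y: "f y \<noteq> 0" "f y * g (inv y \<otimes> x) \<noteq> 0"
    by (metis (mono_tags, lifting) mem_Collect_eq sum.neutral)
  then have "g (inv y \<otimes> x) \<noteq> 0" by auto
  moreover have "x = y \<otimes> (inv y \<otimes> x)"
    using ga_type_support[OF assms y(1)] xG by (simp add: m_assoc[symmetric])
  ultimately show "x \<in> (\<lambda>(y, z). y \<otimes> z) ` ({y. f y \<noteq> 0} \<times> {z. g z \<noteq> 0})"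
    using y by (intro image_eqI[of _ _ "(y, inv y \<otimes> x)"]) auto
qed

lemma ga_type_mult_closed:
  assumes "f \<in> carrier (group_algebra type_ring G)" "g \<in> carrier (group_algebra type_ring G)"
  shows "f \<otimes>\<^bsub>group_algebra type_ring G\<^esub> g \<in> carrier (group_algebra type_ring G)"
proof -
  have "finite {x. (f \<otimes>\<^bsub>group_algebra type_ring G\<^esub> g) x \<noteq> 0}"
    using ga_type_mult_support[OF assms(1)]
    by (rule finite_subset) (simp add: ga_type_finite[OF assms(1)] ga_type_finite[OF assms(2)])
  then show ?thesis unfolding ga_type_carrier by (auto simp: ga_type_mult)
qed

text \<open>
  The change of variable \<open>x = y z\<close> turns the convolution into a double sum. All laws of the convolution product
  follow from this formula.
\<close>

lemma pairing_mult:
  assumes f: "f \<in> carrier (group_algebra type_ring G)" and g: "g \<in> carrier (group_algebra type_ring G)"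
    and \<phi>: "\<phi> 0 = 0" "\<And>x y. \<phi> (x + y) = \<phi> x + \<phi> y" "\<And>x y. \<phi> (x * y) = \<phi> x * \<phi> y"
  shows "pairing \<phi> (f \<otimes>\<^bsub>group_algebra type_ring G\<^esub> g) h =
    pairing \<phi> f (\<lambda>y. pairing \<phi> g (\<lambda>z. h (y \<otimes> z)))"
proof -
  let ?S = "{y. f y \<noteq> 0}" and ?T = "{z. g z \<noteq> 0}"
  define A where "A = (\<lambda>(y, z). y \<otimes> z) ` (?S \<times> ?T)"
  note S = ga_type_support[OF f] and T = ga_type_support[OF g]
  have fin: "finite ?S" "finite ?T" using f g by (simp_all add: ga_type_carrier)
  then have A: "finite A" by (simp add: A_def)
  have AG: "A \<subseteq> carrier G" using S T by (auto simp: A_def)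
  have \<phi>_sum: "\<phi> (sum F V) = (\<Sum>x\<in>V. \<phi> (F x))" for F :: "'x \<Rightarrow> _" and V
    by (induction V rule: infinite_finite_induct) (simp_all add: \<phi>)
  have "pairing \<phi> (f \<otimes>\<^bsub>group_algebra type_ring G\<^esub> g) h
      = (\<Sum>x\<in>A. \<phi> ((f \<otimes>\<^bsub>group_algebra type_ring G\<^esub> g) x) * h x)"
    using A ga_type_mult_support[OF f, of g] unfolding A_def by (intro pairing_superset \<phi>) auto
  also have "\<dots> = (\<Sum>x\<in>A. \<Sum>y\<in>?S. \<phi> (f y) * (\<phi> (g (inv y \<otimes> x)) * h x))"
    using AG by (intro sum.cong) (auto simp: ga_type_mult \<phi> \<phi>_sum sum_distrib_right mult.assoc)
  also have "\<dots> = (\<Sum>y\<in>?S. \<phi> (f y) * (\<Sum>x\<in>A. \<phi> (g (inv y \<otimes> x)) * h x))"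
    by (subst sum.swap) (simp add: sum_distrib_left)
  also have "\<dots> = (\<Sum>y\<in>?S. \<phi> (f y) * (\<Sum>z\<in>?T. \<phi> (g z) * h (y \<otimes> z)))"
  proof (rule sum.cong[OF refl], rule arg_cong2[where f="(*)", OF refl])
    fix y assume y: "y \<in> ?S"
    then have yG: "y \<in> carrier G" using S by auto
    have inj: "inj_on (\<lambda>z. y \<otimes> z) ?T" using T yG by (auto intro!: inj_onI)
    have "(\<Sum>z\<in>?T. \<phi> (g z) * h (y \<otimes> z)) = (\<Sum>z\<in>?T. \<phi> (g (inv y \<otimes> (y \<otimes> z))) * h (y \<otimes> z))"
      using yG T by (intro sum.cong) (auto simp: m_assoc[symmetric])
    also have "\<dots> = (\<Sum>x\<in>(\<lambda>z. y \<otimes> z) ` ?T. \<phi> (g (inv y \<otimes> x)) * h x)"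
      using inj by (simp add: sum.reindex)
    also have "\<dots> = (\<Sum>x\<in>A. \<phi> (g (inv y \<otimes> x)) * h x)"
    proof (rule sum.mono_neutral_left[OF A])
      show "(\<lambda>z. y \<otimes> z) ` ?T \<subseteq> A" using y by (auto simp: A_def)
      show "\<forall>x\<in>A - (\<lambda>z. y \<otimes> z) ` ?T. \<phi> (g (inv y \<otimes> x)) * h x = 0"
      proof
        fix x assume x: "x \<in> A - (\<lambda>z. y \<otimes> z) ` ?T"
        then have "x = y \<otimes> (inv y \<otimes> x)" using AG yG by (auto simp: m_assoc[symmetric])
        with x have "inv y \<otimes> x \<notin> ?T" by (metis DiffD2 image_eqI)
        then show "\<phi> (g (inv y \<otimes> x)) * h x = 0" by (simp add: \<phi>)
      qed
    qed
    finally show "(\<Sum>x\<in>A. \<phi> (g (inv y \<otimes> x)) * h x) = (\<Sum>z\<in>?T. \<phi> (g z) * h (y \<otimes> z))" by simp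
  qed
  finally show ?thesis by (simp add: pairing_def)
qed

lemma ga_type_eqI:
  fixes f g :: "'a \<Rightarrow> 'r::comm_ring_1"
  assumes "f \<in> carrier (group_algebra type_ring G)" "g \<in> carrier (group_algebra type_ring G)"
    "\<And>h. pairing (\<lambda>x. x) f h = pairing (\<lambda>x. x) g h"
  shows "f = g"
proof
  fix a
  show "f a = g a"
    using assms(3)[of "\<lambda>x. if x = a then 1 else 0"]
      pairing_delta[of "\<lambda>x. x" f a, OF _ ga_type_finite[OF assms(1)]]
      pairing_delta[of "\<lambda>x. x" g a, OF _ ga_type_finite[OF assms(2)]]
    by simp
qed

lemma pairing_swap:
  "pairing \<phi> f (\<lambda>y. pairing \<phi> g (\<lambda>z. h y z)) = pairing \<phi> g (\<lambda>z. pairing \<phi> f (\<lambda>y. h y z))"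
proof -
  have "pairing \<phi> f (\<lambda>y. pairing \<phi> g (\<lambda>z. h y z)) =
      (\<Sum>x\<in>{x. f x \<noteq> 0}. \<Sum>y\<in>{x. g x \<noteq> 0}. \<phi> (f x) * \<phi> (g y) * h x y)"
    by (simp add: pairing_def sum_distrib_left mult.assoc)
  also have "\<dots> = (\<Sum>y\<in>{x. g x \<noteq> 0}. \<Sum>x\<in>{x. f x \<noteq> 0}. \<phi> (f x) * \<phi> (g y) * h x y)"
    by (rule sum.swap)
  also have "\<dots> = pairing \<phi> g (\<lambda>z. pairing \<phi> f (\<lambda>y. h y z))"
    by (simp add: pairing_def sum_distrib_left algebra_simps)
  finally show ?thesis .
qed

theorem cring_group_algebra:
  "cring (group_algebra (type_ring :: 'r::comm_ring_1 ring) G)"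
proof -
  let ?A = "group_algebra (type_ring :: 'r ring) G"
  note mult = pairing_mult[of _ _ "\<lambda>x. x"]
  note add = pairing_add[of "\<lambda>x. x"]
  note fin = ga_type_finite
  show ?thesis
  proof (rule cringI)
    show "abelian_group ?A"
    proof (rule abelian_groupI)
      fix f g assume f: "f \<in> carrier ?A" and g: "g \<in> carrier ?A"
      show "f \<oplus>\<^bsub>?A\<^esub> g \<in> carrier ?A"
        using f g by (auto simp: ga_type_carrier ga_type_simps
            intro: finite_subset[of _ "{x. f x \<noteq> 0} \<union> {x. g x \<noteq> 0}"])
      show "f \<oplus>\<^bsub>?A\<^esub> g = g \<oplus>\<^bsub>?A\<^esub> f" by (simp add: ga_type_simps add.commute)
    next
      fix f assume f: "f \<in> carrier ?A"
      show "\<exists>g\<in>carrier ?A. g \<oplus>\<^bsub>?A\<^esub> f = \<zero>\<^bsub>?A\<^esub>"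
        using f by (intro bexI[of _ "\<lambda>x. - f x"]) (auto simp: ga_type_carrier ga_type_simps)
    qed (auto simp: ga_type_carrier ga_type_simps add.assoc)
    show "Group.comm_monoid ?A"
    proof (rule comm_monoidI)
      fix f g assume f: "f \<in> carrier ?A" and g: "g \<in> carrier ?A"
      show "f \<otimes>\<^bsub>?A\<^esub> g \<in> carrier ?A" using f g by (rule ga_type_mult_closed)
      show "f \<otimes>\<^bsub>?A\<^esub> g = g \<otimes>\<^bsub>?A\<^esub> f"
      proof (rule ga_type_eqI)
        fix h :: "'a \<Rightarrow> 'r"
        have "pairing (\<lambda>x. x) f (\<lambda>y. pairing (\<lambda>x. x) g (\<lambda>z. h (y \<otimes> z))) =
           pairing (\<lambda>x. x) f (\<lambda>y. pairing (\<lambda>x. x) g (\<lambda>z. h (z \<otimes> y)))"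
          using ga_type_support[OF f] ga_type_support[OF g]
          by (intro pairing_cong arg_cong[of _ _ h] m_comm)
        also have "\<dots> = pairing (\<lambda>x. x) g (\<lambda>z. pairing (\<lambda>x. x) f (\<lambda>y. h (z \<otimes> y)))"
          by (rule pairing_swap)
        finally show "pairing (\<lambda>x. x) (f \<otimes>\<^bsub>?A\<^esub> g) h = pairing (\<lambda>x. x) (g \<otimes>\<^bsub>?A\<^esub> f) h"
          using f g by (simp add: mult)
      qed (use f g ga_type_mult_closed in auto)
    next
      fix f g k assume f: "f \<in> carrier ?A" and g: "g \<in> carrier ?A" and k: "k \<in> carrier ?A"
      show "f \<otimes>\<^bsub>?A\<^esub> g \<otimes>\<^bsub>?A\<^esub> k = f \<otimes>\<^bsub>?A\<^esub> (g \<otimes>\<^bsub>?A\<^esub> k)"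
      proof (rule ga_type_eqI)
        fix h :: "'a \<Rightarrow> 'r"
        show "pairing (\<lambda>x. x) (f \<otimes>\<^bsub>?A\<^esub> g \<otimes>\<^bsub>?A\<^esub> k) h = pairing (\<lambda>x. x) (f \<otimes>\<^bsub>?A\<^esub> (g \<otimes>\<^bsub>?A\<^esub> k)) h"
          using f g k ga_type_support[OF f] ga_type_support[OF g] ga_type_support[OF k]
          by (simp add: mult ga_type_mult_closed m_assoc cong: pairing_cong)
      qed (use f g k ga_type_mult_closed in auto)
    next
      show "\<one>\<^bsub>?A\<^esub> \<in> carrier ?A" by (simp add: ga_type_simps ga_single_closed)
      fix f assume f: "f \<in> carrier ?A"
      show "\<one>\<^bsub>?A\<^esub> \<otimes>\<^bsub>?A\<^esub> f = f"
      proof (rule ga_type_eqI)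
        fix h :: "'a \<Rightarrow> 'r"
        show "pairing (\<lambda>x. x) (\<one>\<^bsub>?A\<^esub> \<otimes>\<^bsub>?A\<^esub> f) h = pairing (\<lambda>x. x) f h"
          using f ga_type_support[OF f] unfolding ga_type_simps
          by (simp add: mult ga_single_closed pairing_single cong: pairing_cong)
      qed (use f in \<open>auto simp: ga_type_mult_closed ga_type_simps ga_single_closed\<close>)
    qed
    fix f g k assume f: "f \<in> carrier ?A" and g: "g \<in> carrier ?A" and k: "k \<in> carrier ?A"
    have fg: "f \<oplus>\<^bsub>?A\<^esub> g \<in> carrier ?A" if f: "f \<in> carrier ?A" and g: "g \<in> carrier ?A" for f g
        using f g by (auto simp: ga_type_carrier ga_type_simps
            intro: finite_subset[of _ "{x. f x \<noteq> 0} \<union> {x. g x \<noteq> 0}"])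
    show "(f \<oplus>\<^bsub>?A\<^esub> g) \<otimes>\<^bsub>?A\<^esub> k = f \<otimes>\<^bsub>?A\<^esub> k \<oplus>\<^bsub>?A\<^esub> g \<otimes>\<^bsub>?A\<^esub> k"
    proof (rule ga_type_eqI)
      fix h :: "'a \<Rightarrow> 'r"
      show "pairing (\<lambda>x. x) ((f \<oplus>\<^bsub>?A\<^esub> g) \<otimes>\<^bsub>?A\<^esub> k) h = pairing (\<lambda>x. x) (f \<otimes>\<^bsub>?A\<^esub> k \<oplus>\<^bsub>?A\<^esub> g \<otimes>\<^bsub>?A\<^esub> k) h"
        using f g k fg[OF f g] ga_type_mult_closed[OF f k] ga_type_mult_closed[OF g k]
        by (simp add: ga_type_simps add fin mult)
    qed (use f g k fg ga_type_mult_closed in auto)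
  qed
qed

lemma ga_single_mult:
  assumes "g \<in> carrier G" "h \<in> carrier G"
  shows "ga_single type_ring g c \<otimes>\<^bsub>group_algebra type_ring G\<^esub> ga_single type_ring h d =
    ga_single type_ring (g \<otimes> h) (c * d)"
  by (rule ga_type_eqI)
     (use assms in \<open>simp_all add: pairing_mult pairing_single ga_single_closed ga_type_mult_closed mult.assoc\<close>)

end

lemma ga_type_induct [consumes 1, case_names zero single add]:
  assumes f: "f \<in> carrier (group_algebra type_ring G)"
    and "P (\<lambda>x. 0)"
    and single: "\<And>g c. g \<in> carrier G \<Longrightarrow> P (ga_single type_ring g c)"
    and add: "\<And>f g. f \<in> carrier (group_algebra type_ring G) \<Longrightarrow> g \<in> carrier (group_algebra type_ring G) \<Longrightarrow>
      P f \<Longrightarrow> P g \<Longrightarrow> P (\<lambda>x. f x + g x)"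
  shows "P f"
proof -
  have "finite {x. f x \<noteq> 0}" using f by (simp add: ga_type_carrier)
  then show ?thesis using f
  proof (induction "{x. f x \<noteq> 0}" arbitrary: f rule: finite_induct)
    case empty
    then have "f = (\<lambda>x. 0)" by auto
    with assms(2) show ?case by simp
  next
    case (insert a A)
    define f' where "f' = f(a := 0)"
    have supp: "A = {x. f' x \<noteq> 0}" using insert.hyps by (auto simp: f'_def)
    have a: "a \<in> carrier G" using insert.hyps insert.prems by (auto intro: ga_type_support)
    have f': "f' \<in> carrier (group_algebra type_ring G)"
      using insert.prems insert.hyps(1) supp by (auto simp: ga_type_carrier f'_def)
    have "P (\<lambda>x. f' x + ga_single type_ring a (f a) x)"
      using a f' insert.hyps(3)[OF supp f'] by (intro add single ga_single_closed)
    also have "(\<lambda>x. f' x + ga_single type_ring a (f a) x) = f"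
      by (auto simp: f'_def ga_single_def)
    finally show ?case .
  qed
qed

section \<open>Evaluating group algebra elements at roots of unity\<close>

lemma mod1_eq: "mod1 r = {x. x - r \<in> \<int>}"
proof -
  have "mod1 r = {k + r | k. k \<in> \<int>}"
    unfolding mod1_def a_r_coset_def r_coset_def by auto
  also have "\<dots> = {x. x - r \<in> \<int>}"
  proof auto
    fix x assume "x - r \<in> \<int>"
    then show "\<exists>k. x = k + r \<and> k \<in> \<int>" by (intro exI[of _ "x - r"]) simp
  qed
  finally show ?thesis .
qed

lemma mod1_eq_iff: "mod1 r = mod1 s \<longleftrightarrow> r - s \<in> \<int>"
proof
  assume "mod1 r = mod1 s"
  moreover have "r \<in> mod1 r" by (simp add: mod1_eq)
  ultimately have "r \<in> mod1 s" by simp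
  then show "r - s \<in> \<int>" by (simp add: mod1_eq)
next
  assume rs: "r - s \<in> \<int>"
  have "x - r \<in> \<int> \<longleftrightarrow> x - s \<in> \<int>" for x
    using Ints_add[OF _ rs, of "x - r"] Ints_diff[OF _ rs, of "x - s"] by auto
  then show "mod1 r = mod1 s" by (simp add: mod1_eq)
qed

lemma carrier_QmodZ: "carrier QmodZ = range mod1"
  by (auto simp: QmodZ_def A_FactGroup_def FactGroup_def RCOSETS_def mod1_def a_r_coset_def)

lemma mod1_closed [simp]: "mod1 r \<in> carrier QmodZ"
  by (simp add: carrier_QmodZ)

lemma mod1_mult: "mod1 r \<otimes>\<^bsub>QmodZ\<^esub> mod1 s = mod1 (r + s)"
proof -
  have "mod1 r \<otimes>\<^bsub>QmodZ\<^esub> mod1 s = {x + y | x y. x - r \<in> \<int> \<and> y - s \<in> \<int>}"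
    by (auto simp: QmodZ_def A_FactGroup_def FactGroup_def set_mult_def mod1_eq)
  also have "\<dots> = mod1 (r + s)"
  proof (auto simp: mod1_eq)
    fix x y assume "x - r \<in> \<int>" "y - s \<in> \<int>"
    then have "(x - r) + (y - s) \<in> \<int>" by (rule Ints_add)
    then show "x + y - (r + s) \<in> \<int>" by (simp add: algebra_simps)
  next
    fix z assume "z - (r + s) \<in> \<int>"
    then show "\<exists>x y. z = x + y \<and> x - r \<in> \<int> \<and> y - s \<in> \<int>"
      by (intro exI[of _ "z - s"] exI[of _ s]) (simp add: algebra_simps)
  qed
  finally show ?thesis .
qed

lemma one_QmodZ: "\<one>\<^bsub>QmodZ\<^esub> = mod1 0"
  by (auto simp: QmodZ_def A_FactGroup_def FactGroup_def mod1_eq)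

lemma comm_group_QmodZ: "comm_group QmodZ"
proof (rule comm_groupI)
  fix x assume "x \<in> carrier QmodZ"
  then obtain r where "x = mod1 r" by (auto simp: carrier_QmodZ)
  then show "\<exists>y\<in>carrier QmodZ. y \<otimes>\<^bsub>QmodZ\<^esub> x = \<one>\<^bsub>QmodZ\<^esub>"
    by (intro bexI[of _ "mod1 (- r)"]) (auto simp: mod1_mult one_QmodZ)
qed (auto simp: carrier_QmodZ mod1_mult one_QmodZ add_ac)

lemma inv_mod1: "inv\<^bsub>QmodZ\<^esub> (mod1 r) = mod1 (- r)"
proof -
  interpret comm_group QmodZ by (rule comm_group_QmodZ)
  show ?thesis by (rule inv_equality) (simp_all add: mod1_mult one_QmodZ)
qed

lemma mod1_of_nat [simp]: "mod1 (of_nat k) = mod1 0" "mod1 1 = mod1 0"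
  by (auto simp: mod1_eq_iff)

abbreviation frac1 :: "nat \<Rightarrow> nat \<Rightarrow> rat set" where
  "frac1 n j \<equiv> mod1 (of_nat j / of_nat n)"

definition torsion :: "nat \<Rightarrow> rat set set" where
  "torsion n = range (frac1 n)"

lemma frac1_in_torsion [simp]: "frac1 n j \<in> torsion n"
  by (simp add: torsion_def)

lemma frac1_mult: "n > 0 \<Longrightarrow> frac1 n i \<otimes>\<^bsub>QmodZ\<^esub> frac1 n j = frac1 n (i + j)"
  by (simp add: mod1_mult add_divide_distrib)

lemma frac1_mod: "n > 0 \<Longrightarrow> frac1 n (j mod n) = frac1 n j"
proof -
  assume n: "n > 0"
  have "(of_nat (j mod n) :: rat) = of_nat j - of_nat n * of_nat (j div n)"
    by (metis add_diff_cancel_right' mod_mult_div_eq of_nat_add of_nat_mult)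
  then have "(of_nat (j mod n) :: rat) / of_nat n - of_nat j / of_nat n = - of_nat (j div n)"
    using n by (simp add: field_simps)
  then show ?thesis by (simp add: mod1_eq_iff)
qed

lemma torsion_eq: "n > 0 \<Longrightarrow> torsion n = frac1 n ` {..<n}"
  unfolding torsion_def by (auto simp: image_iff) (metis frac1_mod lessThan_iff mod_less_divisor)

lemma mod1_in_torsion:
  assumes "n > 0"
  shows "mod1 (of_int a / of_nat n) \<in> torsion n"
proof -
  have "mod1 (of_int a / of_nat n) = frac1 n (nat (a mod int n))"
  proof -
    have "(of_nat (nat (a mod int n)) :: rat) = of_int (a mod int n)" using assms by simp
    also have "\<dots> = of_int a - of_nat n * of_int (a div int n)"
      by (metis minus_mult_div_eq_mod of_int_diff of_int_mult of_int_of_nat_eq)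
    finally have "of_int a / of_nat n - (of_nat (nat (a mod int n)) :: rat) / of_nat n = of_int (a div int n)"
      using assms by (simp add: field_simps)
    then show ?thesis by (simp add: mod1_eq_iff)
  qed
  then show ?thesis by simp
qed

lemma torsion_mono: "d dvd n \<Longrightarrow> n > 0 \<Longrightarrow> torsion d \<subseteq> torsion n"
proof
  fix x assume "d dvd n" "n > 0" "x \<in> torsion d"
  then obtain j k where "x = frac1 d j" "n = d * k" by (auto simp: torsion_def)
  with \<open>n > 0\<close> have "x = frac1 n (j * k)" by simp
  then show "x \<in> torsion n" by (simp only: frac1_in_torsion)
qed

lemma torsion_subset: "torsion n \<subseteq> carrier QmodZ"
  by (auto simp: torsion_def)

lemma torsion_mult: "n > 0 \<Longrightarrow> x \<in> torsion n \<Longrightarrow> y \<in> torsion n \<Longrightarrow> x \<otimes>\<^bsub>QmodZ\<^esub> y \<in> torsion n"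
proof -
  assume "n > 0" "x \<in> torsion n" "y \<in> torsion n"
  then obtain i j where "x = frac1 n i" "y = frac1 n j" by (auto simp: torsion_def)
  then have "x \<otimes>\<^bsub>QmodZ\<^esub> y = frac1 n (i + j)" using \<open>n > 0\<close> frac1_mult by blast
  then show ?thesis by (simp only: frac1_in_torsion)
qed

lemma finite_torsion: "n > 0 \<Longrightarrow> finite (torsion n)"
  by (simp add: torsion_eq)

lemma rat_in_torsion: "\<exists>n>0. mod1 r \<in> torsion n"
proof -
  obtain a b where "r = of_int a / of_int b" "b > 0"
    by (metis Fract_of_int_quotient Rat_cases)
  then have "r = of_int a / of_nat (nat b)" "nat b > 0" by simp_all
  then show ?thesis using mod1_in_torsion by metis
qed

lemma finite_in_torsion:
  assumes "finite A" "A \<subseteq> (\<Union>n\<in>M. torsion n)" "1 \<in> M" "\<And>m n. m \<in> M \<Longrightarrow> n \<in> M \<Longrightarrow> m * n \<in> M" "0 \<notin> M"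
  shows "\<exists>n\<in>M. A \<subseteq> torsion n"
  using assms(1,2)
proof (induction A rule: finite_induct)
  case empty
  then show ?case using assms(3) by auto
next
  case (insert a A)
  then obtain m n where mn: "m \<in> M" "A \<subseteq> torsion m" "n \<in> M" "a \<in> torsion n" by auto
  then have "m * n > 0" using assms(5) by (metis mult_is_0 neq0_conv)
  then have "torsion m \<subseteq> torsion (m * n)" "torsion n \<subseteq> torsion (m * n)"
    using torsion_mono[of m "m * n"] torsion_mono[of n "m * n"] by simp_all
  with mn assms(4)[of m n] show ?case by auto
qed

text \<open>
  The embedding of \<open>\<rat>/\<int>\<close> in the circle group.
\<close>

definition chi :: "rat set \<Rightarrow> complex" where
  "chi x = cis (2 * pi * of_rat (SOME r. x = mod1 r))"

lemma chi_mod1: "chi (mod1 r) = cis (2 * pi * of_rat r)"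
proof -
  define s where "s = (SOME s. mod1 r = mod1 s)"
  have "mod1 r = mod1 s" unfolding s_def by (rule someI) (rule refl)
  then obtain k where k: "s - r = of_int k"
    by (metis Ints_cases mod1_eq_iff)
  then have "s = r + of_int k" by (simp add: algebra_simps)
  then have "cis (2 * pi * of_rat s) = cis (2 * pi * of_rat r) * cis (2 * pi * of_int k)"
    by (simp add: of_rat_add cis_mult[symmetric] algebra_simps)
  then show ?thesis by (simp add: chi_def s_def)
qed

lemma chi_mult: "x \<in> carrier QmodZ \<Longrightarrow> y \<in> carrier QmodZ \<Longrightarrow> chi (x \<otimes>\<^bsub>QmodZ\<^esub> y) = chi x * chi y"
  by (auto simp: carrier_QmodZ mod1_mult chi_mod1 of_rat_add cis_mult algebra_simps)

lemma chi_frac1: "chi (frac1 n j) = cis (2 * pi * real j / real n)"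
  by (simp add: chi_mod1 of_rat_divide)

lemma chi_frac1_power: "chi (frac1 n j) = chi (frac1 n 1) ^ j"
  unfolding chi_frac1 DeMoivre by (simp add: algebra_simps)

lemma bij_betw_chi: "n > 0 \<Longrightarrow> bij_betw chi (torsion n) {z. z ^ n = 1}"
proof -
  assume n: "n > 0"
  have 1: "bij_betw (\<lambda>j. chi (frac1 n j)) {..<n} {z. z ^ n = 1}"
    unfolding chi_frac1 using bij_betw_roots_unity[OF n] by simp
  then have "inj_on chi (frac1 n ` {..<n})"
    by (intro inj_on_imageI) (auto simp: bij_betw_def o_def)
  with 1 show ?thesis
    by (auto simp: bij_betw_def torsion_eq[OF n] image_image)
qed

lemma chi_torsion: "n > 0 \<Longrightarrow> x \<in> torsion n \<Longrightarrow> chi x ^ n = 1"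
  using bij_betw_chi by (auto simp: bij_betw_def)

lemma inj_chi: "inj_on chi (carrier QmodZ)"
proof (rule inj_onI)
  fix x y assume x: "x \<in> carrier QmodZ" and y: "y \<in> carrier QmodZ" and eq: "chi x = chi y"
  obtain m n where mn: "m > 0" "x \<in> torsion m" "n > 0" "y \<in> torsion n"
    using x y rat_in_torsion unfolding carrier_QmodZ by blast
  then have "x \<in> torsion (m * n)" "y \<in> torsion (m * n)"
    using torsion_mono[of m "m * n"] torsion_mono[of n "m * n"] by auto
  then show "x = y" using bij_betw_chi[of "m * n"] mn eq by (auto simp: bij_betw_def dest: inj_onD)
qed

lemma chi_one: "chi \<one>\<^bsub>QmodZ\<^esub> = 1"
  by (simp add: one_QmodZ chi_mod1)

lemma sum_powers_root_of_unity:
  fixes z :: "'a::field"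
  assumes "z ^ n = 1"
  shows "(\<Sum>k<n. z ^ k) = (if z = 1 then of_nat n else 0)"
  using assms by (simp add: geometric_sum)

text \<open>
  The values at \<open>z\<close> of integer polynomials are closed under inverses up to integer denominators. A nonzero element
  \<open>k\<close> of least degree in the ideal generated by \<open>f\<close> and the minimal polynomial \<open>h\<close> of \<open>z\<close> divides both up to
  constants, so it is constant by the minimality of \<open>h\<close>.
\<close>

lemma root_of_unity_inverse:
  assumes "z ^ n = 1" "n > 0" "ipoly f z \<noteq> 0"
  obtains g m where "m > (0::nat)" "ipoly f z * ipoly g z = of_nat m"
proof -
  define Xn where "Xn = (Polynomial.monom 1 n - 1 :: int poly)"
  have "poly.coeff Xn n = 1" using assms(2) by (simp add: Xn_def)
  then have "Xn \<noteq> 0" by auto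
  moreover have "ipoly Xn z = 0" using assms(1) by (simp add: Xn_def ipoly_diff ipoly_monom)
  ultimately obtain h where h: "ipoly h z = 0" "\<And>f. ipoly f z = 0 \<Longrightarrow> h dvd f"
    using minimal_int_poly by metis
  define I where "I = {a * f + b * h | a b. True}"
  have "f \<noteq> 0" using assms(3) by auto
  have "f \<in> I" "h \<in> I"
    unfolding I_def by (auto intro: exI[of _ 1] exI[of _ 0])
  define k where "k = (ARG_MIN Polynomial.degree k. k \<in> I \<and> k \<noteq> 0)"
  have k: "k \<in> I" "k \<noteq> 0" and min: "\<And>r. r \<in> I \<Longrightarrow> r \<noteq> 0 \<Longrightarrow> Polynomial.degree k \<le> Polynomial.degree r"
    unfolding k_def using arg_min_nat_lemma[of "\<lambda>k. k \<in> I \<and> k \<noteq> 0" f Polynomial.degree] \<open>f \<in> I\<close> \<open>f \<noteq> 0\<close> by auto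
  have div: "\<exists>a q. a \<noteq> 0 \<and> smult a r = k * q" if rI: "r \<in> I" for r
  proof -
    obtain a q where a: "a \<noteq> 0" and eq: "smult a r = k * q + pseudo_mod r k"
      using pseudo_mod(1)[OF k(2)] by blast
    obtain r1 r2 where r: "r = r1 * f + r2 * h" using rI by (auto simp: I_def)
    obtain k1 k2 where "k = k1 * f + k2 * h" using k(1) by (auto simp: I_def)
    moreover note r
    moreover have "pseudo_mod r k = smult a r - k * q" using eq by simp
    ultimately have "pseudo_mod r k = (smult a r1 - q * k1) * f + (smult a r2 - q * k2) * h"
      by (simp add: algebra_simps smult_add_right)
    then have "pseudo_mod r k \<in> I" by (auto simp: I_def)
    then have "pseudo_mod r k = 0" using min pseudo_mod(2)[OF k(2), of r] by fastforce
    with a eq show ?thesis by auto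
  qed
  obtain a q where a: "a \<noteq> 0" "smult a f = k * q" using div[OF \<open>f \<in> I\<close>] by blast
  have kz: "ipoly k z \<noteq> 0"
    using arg_cong[OF a(2), of "\<lambda>f. ipoly f z"] a(1) assms(3) by (auto simp: ipoly_simps)
  obtain b r where b: "b \<noteq> 0" "smult b h = k * r" using div[OF \<open>h \<in> I\<close>] by blast
  have "ipoly r z = 0"
    using arg_cong[OF b(2), of "\<lambda>f. ipoly f z"] kz h(1) by (auto simp: ipoly_simps)
  then obtain s where s: "r = h * s" using h(2) by (auto elim: dvdE)
  have "h \<noteq> 0" using h(2)[of Xn] \<open>Xn \<noteq> 0\<close> \<open>ipoly Xn z = 0\<close> by auto
  have "h * [:b:] = h * (k * s)" using b(2) s by (simp add: mult_ac)
  then have "[:b:] = k * s" using \<open>h \<noteq> 0\<close> by (metis mult_cancel_left)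
  then have "Polynomial.degree k = 0"
    using b(1) k(2) by (metis add_is_0 degree_mult_eq degree_pCons_0 mult_eq_0_iff pCons_eq_0_iff)
  then obtain c where c: "k = [:c:]" by (auto elim: degree_eq_zeroE)
  obtain u v where "k = u * f + v * h" using k(1) by (auto simp: I_def)
  then have uf: "ipoly f z * ipoly u z = of_int c"
    using h(1) c by (metis (no_types, lifting) add.right_neutral ipoly_add ipoly_mult ipoly_pCons map_poly_0 mult.commute mult_zero_right poly_0)
  have "c \<noteq> 0" using c k(2) by simp
  show ?thesis
  proof (rule that)
    show "nat \<bar>c\<bar> > 0" using \<open>c \<noteq> 0\<close> by simp
    have "ipoly f z * ipoly (smult (sgn c) u) z = of_int (sgn c * c)"
      using uf by (simp add: ipoly_smult mult_ac)
    also have "sgn c * c = int (nat \<bar>c\<bar>)" using abs_sgn[of c] by (simp add: mult.commute)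
    finally show "ipoly f z * ipoly (smult (sgn c) u) z = of_nat (nat \<bar>c\<bar>)" by simp
  qed
qed

text \<open>
  The element \<open>\<Sum>\<^sub>j e(j/d)\<close>, which is \<open>d\<close> times the idempotent of index \<open>d\<close>. Unlike the idempotent it has integer
  coefficients.
\<close>

definition norm_elem :: "nat \<Rightarrow> rat set \<Rightarrow> 'a::comm_ring_1" where
  "norm_elem d = (\<lambda>x. if x \<in> torsion d then 1 else 0)"

lemma norm_elem_support: "{x. (norm_elem d x :: 'a::comm_ring_1) \<noteq> 0} = torsion d"
  by (auto simp: norm_elem_def)

lemma inj_frac1: "n > 0 \<Longrightarrow> inj_on (frac1 n) {..<n}"
proof (rule inj_onI)
  fix i j assume n: "n > 0" and ij: "i \<in> {..<n}" "j \<in> {..<n}" "frac1 n i = frac1 n j"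
  then have "cis (2 * pi * real i / real n) = cis (2 * pi * real j / real n)"
    by (metis chi_frac1)
  then show "i = j" using bij_betw_roots_unity[OF n] ij by (auto simp: bij_betw_def dest: inj_onD)
qed

lemma sum_torsion: "n > 0 \<Longrightarrow> (\<Sum>x\<in>torsion n. h x) = (\<Sum>j<n. h (frac1 n j))"
  unfolding torsion_eq by (subst sum.reindex[OF inj_frac1]) simp_all

text \<open>
  Group algebras of subgroups of \<open>\<rat>/\<int>\<close> with coefficients that embed in \<open>\<rat>\<close>. The instances are
  \<open>\<rat>[\<rat>/\<int>]\<close> and \<open>\<int>[G]\<close> with \<open>G\<close> the group of fractions with denominator prime to \<open>p\<close>.
\<close>

locale torsion_group =
  fixes H :: "rat set set" and \<phi> :: "'a::comm_ring_1 \<Rightarrow> complex"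
  assumes H: "subgroup H QmodZ"
    and \<phi>_add: "\<phi> (x + y) = \<phi> x + \<phi> y" and \<phi>_mult: "\<phi> (x * y) = \<phi> x * \<phi> y" and \<phi>_1: "\<phi> 1 = 1"
    and \<phi>_inj: "\<phi> x = 0 \<Longrightarrow> x = 0"
    and \<phi>_frac: "\<exists>m>0. \<exists>k::int. of_nat m * \<phi> x = of_int k"
begin

abbreviation A :: "(rat set \<Rightarrow> 'a) ring" where
  "A \<equiv> group_algebra type_ring (QmodZ\<lparr>carrier := H\<rparr>)"

lemma \<phi>_0: "\<phi> 0 = 0" using \<phi>_add[of 0 0] by simp

sublocale G: comm_group "QmodZ\<lparr>carrier := H\<rparr>"
proof -
  interpret comm_group QmodZ by (rule comm_group_QmodZ)
  have "group (QmodZ\<lparr>carrier := H\<rparr>)"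
    by (rule subgroup.subgroup_is_group[OF H]) (rule is_group)
  then show "comm_group (QmodZ\<lparr>carrier := H\<rparr>)"
    by (rule group.group_comm_groupI) (use subgroup.subset[OF H] in \<open>simp add: m_comm subset_iff\<close>)
qed

lemma H_subset: "H \<subseteq> carrier QmodZ" by (rule subgroup.subset[OF H])

sublocale A: cring A by (rule G.cring_group_algebra)

text \<open>
  The character \<open>e(r) \<mapsto> exp(2\<pi>ikr)\<close> of the group algebra.
\<close>

definition ev :: "nat \<Rightarrow> (rat set \<Rightarrow> 'a) \<Rightarrow> complex" where
  "ev k f = pairing \<phi> f (\<lambda>x. chi x ^ k)"

lemma ev_add: "f \<in> carrier A \<Longrightarrow> g \<in> carrier A \<Longrightarrow> ev k (f \<oplus>\<^bsub>A\<^esub> g) = ev k f + ev k g"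
  unfolding ev_def ga_type_simps by (rule pairing_add) (auto simp: \<phi>_0 \<phi>_add ga_type_finite)

lemma ev_mult:
  assumes "f \<in> carrier A" "g \<in> carrier A"
  shows "ev k (f \<otimes>\<^bsub>A\<^esub> g) = ev k f * ev k g"
proof -
  have "ev k (f \<otimes>\<^bsub>A\<^esub> g) = pairing \<phi> f (\<lambda>y. pairing \<phi> g (\<lambda>z. chi (y \<otimes>\<^bsub>QmodZ\<^esub> z) ^ k))"
    unfolding ev_def using G.pairing_mult[OF assms, of \<phi>] by (simp add: \<phi>_0 \<phi>_add \<phi>_mult)
  also have "\<dots> = pairing \<phi> f (\<lambda>y. pairing \<phi> g (\<lambda>z. chi y ^ k * chi z ^ k))"
    using ga_type_support[OF assms(1)] ga_type_support[OF assms(2)] H_subset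
    by (intro pairing_cong) (auto simp: chi_mult power_mult_distrib subset_iff)
  also have "\<dots> = ev k f * ev k g"
    unfolding ev_def pairing_def sum_product by (simp add: sum_distrib_left mult_ac)
  finally show ?thesis .
qed

lemma ev_single: "ev k (ga_single type_ring g c) = \<phi> c * chi g ^ k"
  unfolding ev_def by (rule pairing_single) (rule \<phi>_0)

lemma ev_one: "ev k \<one>\<^bsub>A\<^esub> = 1"
  by (simp add: ga_type_simps ev_single \<phi>_1 chi_one)

lemma ev_zero: "ev k \<zero>\<^bsub>A\<^esub> = 0"
  by (simp add: ga_type_simps ev_def pairing_def)

lemma ev_uminus: "f \<in> carrier A \<Longrightarrow> ev k (\<ominus>\<^bsub>A\<^esub> f) = - ev k f"
  using ev_add[of f "\<ominus>\<^bsub>A\<^esub> f" k] by (simp add: A.r_neg ev_zero add_eq_0_iff2 minus_equation_iff)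

lemma ev_minus: "f \<in> carrier A \<Longrightarrow> g \<in> carrier A \<Longrightarrow> ev k (f \<ominus>\<^bsub>A\<^esub> g) = ev k f - ev k g"
  by (simp add: a_minus_def ev_add ev_uminus)

definition eval :: "(rat set \<Rightarrow> 'a) \<Rightarrow> complex" where
  "eval = ev 1"

lemma eval_add: "f \<in> carrier A \<Longrightarrow> g \<in> carrier A \<Longrightarrow> eval (f \<oplus>\<^bsub>A\<^esub> g) = eval f + eval g"
  and eval_mult: "f \<in> carrier A \<Longrightarrow> g \<in> carrier A \<Longrightarrow> eval (f \<otimes>\<^bsub>A\<^esub> g) = eval f * eval g"
  and eval_minus: "f \<in> carrier A \<Longrightarrow> g \<in> carrier A \<Longrightarrow> eval (f \<ominus>\<^bsub>A\<^esub> g) = eval f - eval g"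
  and eval_one: "eval \<one>\<^bsub>A\<^esub> = 1" and eval_zero: "eval \<zero>\<^bsub>A\<^esub> = 0"
  and eval_single: "eval (ga_single type_ring r c) = \<phi> c * chi r"
  by (simp_all add: eval_def ev_add ev_mult ev_minus ev_one ev_zero ev_single)

lemma ev_torsion:
  assumes "n > 0" "{x. f x \<noteq> 0} \<subseteq> torsion n"
  shows "ev k f = (\<Sum>x\<in>torsion n. \<phi> (f x) * chi x ^ k)"
  unfolding ev_def using assms by (intro pairing_superset) (auto simp: finite_torsion \<phi>_0)

lemma norm_elem_closed: "d > 0 \<Longrightarrow> torsion d \<subseteq> H \<Longrightarrow> norm_elem d \<in> carrier A"
  by (auto simp: ga_type_carrier norm_elem_support finite_torsion) (auto simp: norm_elem_def)

lemma ev_norm_elem: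
  assumes "d > 0" "d dvd k"
  shows "ev k (norm_elem d) = of_nat d"
proof -
  have "ev k (norm_elem d) = (\<Sum>x\<in>torsion d. chi x ^ k)"
    using assms(1) by (simp add: ev_torsion norm_elem_support) (simp add: norm_elem_def \<phi>_1)
  also have "\<dots> = (\<Sum>x\<in>torsion d. 1)"
    using assms by (intro sum.cong) (auto elim!: dvdE simp: power_mult chi_torsion)
  finally show ?thesis using sum_torsion[OF assms(1), of "\<lambda>_. 1 :: complex"] by simp
qed

text \<open>
  Fourier inversion on the cyclic group of order \<open>n\<close>.
\<close>

lemma fourier_zero:
  assumes f: "f \<in> carrier A" and n: "n > 0" and supp: "{x. f x \<noteq> 0} \<subseteq> torsion n"
    and zero: "\<And>k. k < n \<Longrightarrow> ev k f = 0"
  shows "f = \<zero>\<^bsub>A\<^esub>"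
proof
  fix a
  show "f a = \<zero>\<^bsub>A\<^esub> a"
  proof (cases "a \<in> torsion n")
    case False
    with supp show ?thesis by (auto simp: ga_type_simps)
  next
    case a: True
    have chi_a: "chi a * cnj (chi a) = 1"
      using a by (auto simp: torsion_def chi_mod1 cis_cnj cis_mult)
    have "0 = (\<Sum>k<n. ev k f * cnj (chi a) ^ k)" by (simp add: zero)
    also have "\<dots> = (\<Sum>k<n. \<Sum>x\<in>torsion n. \<phi> (f x) * (chi x * cnj (chi a)) ^ k)"
      by (simp add: ev_torsion[OF n supp] sum_distrib_right power_mult_distrib mult.assoc)
    also have "\<dots> = (\<Sum>x\<in>torsion n. \<phi> (f x) * (\<Sum>k<n. (chi x * cnj (chi a)) ^ k))"
      by (subst sum.swap) (simp add: sum_distrib_left)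
    also have "\<dots> = (\<Sum>x\<in>torsion n. if x = a then of_nat n * \<phi> (f a) else 0)"
    proof (rule sum.cong[OF refl])
      fix x assume x: "x \<in> torsion n"
      have "(chi x * cnj (chi a)) ^ n = 1"
        using chi_torsion[OF n x] chi_torsion[OF n a] by (simp add: power_mult_distrib flip: complex_cnj_power)
      then have "(\<Sum>k<n. (chi x * cnj (chi a)) ^ k) = (if chi x * cnj (chi a) = 1 then of_nat n else 0)"
        by (rule sum_powers_root_of_unity)
      moreover have "chi x * cnj (chi a) = 1 \<longleftrightarrow> x = a"
      proof
        assume "chi x * cnj (chi a) = 1"
        then have "chi x = chi a" using chi_a by (metis mult.commute mult.left_commute mult_1_right)
        then show "x = a" using inj_chi x a torsion_subset by (auto dest: inj_onD)
      qed (use chi_a in auto)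
      ultimately show "\<phi> (f x) * (\<Sum>k<n. (chi x * cnj (chi a)) ^ k) = (if x = a then of_nat n * \<phi> (f a) else 0)"
        by simp
    qed
    also have "\<dots> = of_nat n * \<phi> (f a)" using a finite_torsion[OF n] by simp
    finally have "\<phi> (f a) = 0" using n by simp
    then show ?thesis by (simp add: \<phi>_inj ga_type_simps)
  qed
qed

lemma common_denominator:
  assumes "finite T"
  shows "\<exists>m>0. \<forall>x\<in>T. \<exists>k::int. of_nat m * \<phi> (f x) = of_int k"
  using assms
proof (induction T rule: finite_induct)
  case empty
  then show ?case by auto
next
  case (insert a T)
  then obtain m where m: "m > 0" "\<And>x. x \<in> T \<Longrightarrow> \<exists>k::int. of_nat m * \<phi> (f x) = of_int k" by blast
  obtain l j where l: "l > 0" "of_nat l * \<phi> (f a) = of_int j" using \<phi>_frac by blast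
  show ?case
  proof (intro exI[of _ "l * m"] conjI ballI)
    show "l * m > 0" using l m by simp
    fix x assume x: "x \<in> insert a T"
    show "\<exists>k::int. of_nat (l * m) * \<phi> (f x) = of_int k"
    proof (cases "x = a")
      case True
      with l have "of_nat (l * m) * \<phi> (f x) = of_int (int m * j)" by (simp flip: l(2))
      then show ?thesis by blast
    next
      case False
      then obtain k where "of_nat m * \<phi> (f x) = of_int k" using x m(2) by auto
      then have "of_nat (l * m) * \<phi> (f x) = of_int (int l * k)" by (simp flip: \<open>_ = of_int k\<close>)
      then show ?thesis by blast
    qed
  qed
qed

lemma ev_eq_ipoly:
  assumes n: "n > 0" and supp: "{x. f x \<noteq> 0} \<subseteq> torsion n"
  obtains m P where "m > 0" "\<And>k. ipoly P (chi (frac1 n 1) ^ k) = of_nat m * ev k f"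
proof -
  obtain m where m: "m > 0" "\<forall>x\<in>torsion n. \<exists>k::int. of_nat m * \<phi> (f x) = of_int k"
    using common_denominator finite_torsion[OF n] by blast
  then obtain F :: "rat set \<Rightarrow> int" where F: "\<And>x. x \<in> torsion n \<Longrightarrow> of_nat m * \<phi> (f x) = of_int (F x)"
    by metis
  define P where "P = (\<Sum>j<n. Polynomial.monom (F (frac1 n j)) j)"
  define z where "z = chi (frac1 n 1)"
  have ipoly_sum: "ipoly (\<Sum>j\<in>J. g j) w = (\<Sum>j\<in>J. ipoly (g j) w)" for g :: "nat \<Rightarrow> int poly" and J w
    by (induction J rule: infinite_finite_induct) (simp_all add: ipoly_add)
  have "ipoly P (z ^ k) = of_nat m * ev k f" for k
  proof -
    have "of_nat m * ev k f = (\<Sum>x\<in>torsion n. of_int (F x) * chi x ^ k)"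
      by (simp add: ev_torsion[OF n supp] sum_distrib_left flip: F mult.assoc)
    also have "\<dots> = (\<Sum>j<n. of_int (F (frac1 n j)) * (z ^ k) ^ j)"
      unfolding sum_torsion[OF n] z_def
      by (intro sum.cong refl arg_cong2[where f="(*)"]) (subst chi_frac1_power, simp flip: power_mult add: mult.commute)
    also have "\<dots> = ipoly P (z ^ k)"
      by (simp add: P_def ipoly_sum ipoly_monom)
    finally show ?thesis by simp
  qed
  with m(1) show ?thesis unfolding z_def by (rule that)
qed

text \<open>
  The values \<open>ev k f\<close> with \<open>k\<close> prime to \<open>n\<close> are conjugate, as they are the values of one polynomial at
  the primitive \<open>n\<close>-th roots of unity.
\<close>

lemma ev_conjugate:
  assumes n: "n > 0" and supp: "{x. f x \<noteq> 0} \<subseteq> torsion n" and "coprime k n" "ev 1 f = 0"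
  shows "ev k f = 0"
proof -
  define z where "z = chi (frac1 n 1)"
  obtain m P where m: "m > 0" and P: "\<And>k. ipoly P (z ^ k) = of_nat m * ev k f"
    unfolding z_def using ev_eq_ipoly[OF n supp] by blast
  have "z ^ n = 1" unfolding z_def by (rule chi_torsion[OF n]) (rule frac1_in_torsion)
  moreover have "ipoly P z = 0" using P[of 1] assms(4) by simp
  ultimately have "ipoly P (z ^ k) = 0" using assms(3) n by (intro root_of_unity_conjugate)
  with P m show ?thesis by simp
qed

lemma ev_inverse:
  assumes n: "n > 0" and nH: "torsion n \<subseteq> H" and supp: "{x. f x \<noteq> 0} \<subseteq> torsion n" and "eval f \<noteq> 0"
  obtains g m where "g \<in> carrier A" "m > 0" "eval f * eval g = of_nat m"
proof -
  note evf = assms(4)[unfolded eval_def]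
  define z where "z = chi (frac1 n 1)"
  have one: "mod1 0 \<in> H" "frac1 n 1 \<in> H"
    using subgroup.one_closed[OF H] subsetD[OF nH frac1_in_torsion[where n = n and j = 1]] by (simp_all only: one_QmodZ)
  obtain l P where l: "l > 0" and P: "\<And>k. ipoly P (z ^ k) = of_nat l * ev k f"
    unfolding z_def using ev_eq_ipoly[OF n supp] by blast
  have "z ^ n = 1" unfolding z_def by (rule chi_torsion[OF n]) (rule frac1_in_torsion)
  moreover have "ipoly P z \<noteq> 0" using P[of 1] l evf by simp
  ultimately obtain Q m where m: "m > 0" "ipoly P z * ipoly Q z = of_nat m"
    using n root_of_unity_inverse by metis
  have \<phi>_of_int: "\<phi> (of_int k) = of_int k" for k
  proof -
    have nat: "\<phi> (of_nat m) = of_nat m" for m by (induction m) (simp_all add: \<phi>_0 \<phi>_1 \<phi>_add)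
    have neg: "\<phi> (- x) = - \<phi> x" for x using \<phi>_add[of x "- x"] by (simp add: \<phi>_0 add_eq_0_iff2 minus_equation_iff)
    show ?thesis by (cases k rule: int_cases) (simp_all only: of_int_of_nat_eq of_int_minus nat neg)
  qed
  have "\<exists>g\<in>carrier A. ev 1 g = ipoly Q z"
  proof (induction Q)
    case 0
    then show ?case by (intro bexI[of _ "\<zero>\<^bsub>A\<^esub>"]) (simp_all add: ev_zero del: One_nat_def)
  next
    case (pCons a Q)
    then obtain g where g: "g \<in> carrier A" "ev 1 g = ipoly Q z" by blast
    define g' where "g' = ga_single type_ring (mod1 0) (of_int a) \<oplus>\<^bsub>A\<^esub> ga_single type_ring (frac1 n 1) 1 \<otimes>\<^bsub>A\<^esub> g"
    have s: "ga_single type_ring (mod1 0) (of_int a) \<in> carrier A" "ga_single type_ring (frac1 n 1) 1 \<in> carrier A"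
      using one by (auto intro!: ga_single_closed simp del: of_nat_1 One_nat_def)
    have "ev 1 g' = of_int a + z * ipoly Q z"
      unfolding g'_def using s g
      by (simp add: ev_add ev_mult ev_single chi_mod1[of 0] \<phi>_of_int \<phi>_1 z_def del: One_nat_def of_nat_1)
    moreover have "g' \<in> carrier A" unfolding g'_def using s g by simp
    ultimately show ?case by (intro bexI[of _ g']) (simp_all add: ipoly_pCons del: One_nat_def)
  qed
  then obtain g where g: "g \<in> carrier A" "ev 1 g = ipoly Q z" by blast
  define g' where "g' = ga_single type_ring (mod1 0) (of_int (int l)) \<otimes>\<^bsub>A\<^esub> g"
  have s: "ga_single type_ring (mod1 0) (of_int (int l)) \<in> carrier A" using one by (simp add: ga_single_closed)
  have "ev 1 g' = of_nat l * ipoly Q z"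
    unfolding g'_def using g s by (simp only: ev_mult) (simp only: ev_single \<phi>_of_int chi_mod1, simp)
  then have "ev 1 f * ev 1 g' = of_nat m" using P[of 1] m(2) by (simp add: mult_ac)
  moreover have "g' \<in> carrier A" unfolding g'_def using g s by simp
  ultimately show ?thesis using m(1) that by (metis eval_def)
qed

text \<open>
  With \<open>w\<close> the product of the elements \<open>d - \<Sum>\<^sub>j e(j/d)\<close> over the divisors \<open>d \<ge> 2\<close> of \<open>n\<close>, every character kills
  \<open>f w\<close>: the characters of index prime to \<open>n\<close> kill \<open>f\<close> as conjugates of \<open>eval\<close>, and a character of index \<open>k\<close>
  with \<open>d = gcd k n \<ge> 2\<close> is trivial on the fractions with denominator \<open>d\<close>, so that it kills the factor
  with this index. Hence \<open>f w = 0\<close>. Under \<open>\<theta>\<close>, the element \<open>w\<close> becomes the integer \<open>\<Prod> d\<close>.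
\<close>

theorem vanishing_imp_annihilated:
  assumes f: "f \<in> carrier A" and n: "n > 0" and supp: "{x. f x \<noteq> 0} \<subseteq> torsion n"
    and nH: "torsion n \<subseteq> H" and ev: "eval f = 0"
    and S: "cring S" and \<theta>: "\<theta> \<in> ring_hom A S"
    and \<theta>_norm: "\<And>d. d dvd n \<Longrightarrow> d \<ge> 2 \<Longrightarrow> \<theta> (norm_elem d) = \<zero>\<^bsub>S\<^esub>"
  shows "\<theta> f \<otimes>\<^bsub>S\<^esub> \<theta> (ga_single type_ring (mod1 0) (of_nat (\<Prod>{d. d dvd n \<and> d \<ge> 2}))) = \<zero>\<^bsub>S\<^esub>"
proof -
  interpret S: cring S by (rule S)
  interpret \<theta>: ring_hom_cring A S \<theta>
    by (rule ring_hom_cringI[OF A.cring_axioms S]) (use \<theta> in auto)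
  define D where "D = {d. d dvd n \<and> d \<ge> 2}"
  have D: "finite D" using n by (auto simp: D_def intro: finite_subset[OF _ finite_divisors_nat[of n]])
  have one: "mod1 0 \<in> H" using subgroup.one_closed[OF H] by (simp add: one_QmodZ)
  define c where "c = (\<lambda>m. ga_single type_ring (mod1 0) (of_nat m) :: rat set \<Rightarrow> 'a)"
  have c: "c m \<in> carrier A" for m using one by (simp add: c_def ga_single_closed)
  have c_mult: "c l \<otimes>\<^bsub>A\<^esub> c m = c (l * m)" for l m
    using G.ga_single_mult[of "mod1 0" "mod1 0"] one by (simp add: c_def mod1_mult)
  define t where "t = (\<lambda>d. c d \<ominus>\<^bsub>A\<^esub> norm_elem d)"
  have dH: "torsion d \<subseteq> torsion n" "d > 0" "norm_elem d \<in> carrier A" if "d \<in> D" for d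
  proof -
    show "torsion d \<subseteq> torsion n" "d > 0" using that torsion_mono[of d n] n by (auto simp: D_def)
    then show "norm_elem d \<in> carrier A" using nH by (intro norm_elem_closed) auto
  qed
  have t: "t d \<in> carrier A" if "d \<in> D" for d
    using dH[OF that] c by (simp add: t_def)
  have ev_t: "ev k (t d) = 0" if "d \<in> D" "d dvd k" for d k
  proof -
    have \<phi>_of_nat: "\<phi> (of_nat m) = of_nat m" for m by (induction m) (simp_all add: \<phi>_0 \<phi>_1 \<phi>_add)
    show ?thesis
      using dH[OF that(1)] c that
      by (simp add: t_def ev_minus ev_norm_elem) (simp add: c_def ev_single chi_mod1 \<phi>_of_nat)
  qed
  define w where "w = finprod A t D"
  have w: "w \<in> carrier A" unfolding w_def using t by (intro A.finprod_closed) auto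
  have ev_w: "ev k w = 0" if "d \<in> D" "d dvd k" for d k
  proof -
    have "w = t d \<otimes>\<^bsub>A\<^esub> finprod A t (D - {d})"
      unfolding w_def using t D that(1)
      by (subst A.finprod_insert[of "D - {d}", symmetric]) (auto simp: insert_absorb)
    moreover have "finprod A t (D - {d}) \<in> carrier A" using t by (intro A.finprod_closed) auto
    ultimately show ?thesis using t that by (simp add: ev_mult ev_t)
  qed
  \<comment> \<open>Fourier inversion is applied on the fractions with denominator \<open>n\<close>, which have to contain the support of \<open>f w\<close>.\<close>
  have supp_mult: "{x. (g \<otimes>\<^bsub>A\<^esub> h) x \<noteq> 0} \<subseteq> torsion n"
    if "g \<in> carrier A" "{x. g x \<noteq> 0} \<subseteq> torsion n" "{x. h x \<noteq> 0} \<subseteq> torsion n" for g h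
  proof
    fix x assume "x \<in> {x. (g \<otimes>\<^bsub>A\<^esub> h) x \<noteq> 0}"
    then have "x \<in> (\<lambda>(y, z). y \<otimes>\<^bsub>QmodZ\<^esub> z) ` ({y. g y \<noteq> 0} \<times> {z. h z \<noteq> 0})"
      using G.ga_type_mult_support[OF that(1), of h] by auto
    then obtain y z where "x = y \<otimes>\<^bsub>QmodZ\<^esub> z" "g y \<noteq> 0" "h z \<noteq> 0" by auto
    with that(2,3) show "x \<in> torsion n" using torsion_mult[OF n, of y z] by auto
  qed
  have "mod1 0 = frac1 n 0" by simp
  then have one_n: "mod1 0 \<in> torsion n" by (simp only: frac1_in_torsion)
  have supp_t: "{x. t d x \<noteq> 0} \<subseteq> torsion n" if "d \<in> D" for d
  proof -
    have "t d \<oplus>\<^bsub>A\<^esub> norm_elem d = c d"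
      unfolding t_def a_minus_def using dH[OF that] c by (simp add: A.a_assoc A.l_neg)
    then have "t d x + norm_elem d x = c d x" for x
      by (metis ga_type_simps(1))
    then have "t d x = c d x - norm_elem d x" for x by (metis add_diff_cancel_right')
    then show ?thesis using dH(1)[OF that] one_n
      by (auto simp: c_def ga_single_def norm_elem_def split: if_splits)
  qed
  have supp_w: "{x. finprod A t E x \<noteq> 0} \<subseteq> torsion n" if "E \<subseteq> D" for E
  proof -
    have "finite E" using that D by (rule finite_subset)
    then show ?thesis using that
    proof (induction E rule: finite_induct)
      case empty
      then show ?case using one_n by (auto simp: ga_type_simps ga_single_def one_QmodZ)
    next
      case (insert d E)
      have E: "finprod A t E \<in> carrier A" using insert t by (intro A.finprod_closed) auto
      have td: "t d \<in> carrier A" "{x. t d x \<noteq> 0} \<subseteq> torsion n" using insert.prems t supp_t by auto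
      have eq: "finprod A t (insert d E) = t d \<otimes>\<^bsub>A\<^esub> finprod A t E"
        using insert t by (intro A.finprod_insert) auto
      have "{x. finprod A t E x \<noteq> 0} \<subseteq> torsion n" using insert by auto
      then show ?case unfolding eq by (rule supp_mult[OF td])
    qed
  qed
  have "f \<otimes>\<^bsub>A\<^esub> w = \<zero>\<^bsub>A\<^esub>"
  proof (rule fourier_zero[OF _ n])
    show "f \<otimes>\<^bsub>A\<^esub> w \<in> carrier A" using f w by simp
    show "{x. (f \<otimes>\<^bsub>A\<^esub> w) x \<noteq> 0} \<subseteq> torsion n"
      using f supp supp_w[of D] by (intro supp_mult) (auto simp: w_def)
    fix k
    show "ev k (f \<otimes>\<^bsub>A\<^esub> w) = 0"
    proof (cases "coprime k n")
      case True
      then have "ev k f = 0" using ev_conjugate[OF n supp] ev[unfolded eval_def] by simp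
      then show ?thesis using f w by (simp add: ev_mult)
    next
      case False
      have "gcd k n \<noteq> 0" "gcd k n \<noteq> 1" using n False by (auto simp: coprime_iff_gcd_eq_1)
      then have "gcd k n \<ge> 2" by linarith
      then have "gcd k n \<in> D" by (auto simp: D_def)
      then have "ev k w = 0" by (rule ev_w) simp
      then show ?thesis using f w by (simp add: ev_mult)
    qed
  qed
  then have "\<theta> f \<otimes>\<^bsub>S\<^esub> \<theta> w = \<zero>\<^bsub>S\<^esub>" using f w by (metis \<theta>.hom_mult \<theta>.hom_zero)
  also have "\<theta> w = \<theta> (c (\<Prod>D))"
  proof -
    have "\<theta> (t d) = \<theta> (c d)" if "d \<in> D" for d
      using dH[OF that] c \<theta>_norm[of d] that by (simp add: t_def a_minus_def D_def)
    then have "\<theta> w = finprod S (\<lambda>d. \<theta> (c d)) D"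
      unfolding w_def using t c by (subst \<theta>.hom_finprod) (auto intro!: S.finprod_cong')
    also have "\<dots> = \<theta> (finprod A c D)"
      using c by (subst \<theta>.hom_finprod) (auto simp: o_def)
    also have "finprod A c D = c (\<Prod>D)"
      using D
    proof (induction D rule: finite_induct)
      case empty
      then show ?case by (simp add: ga_type_simps c_def one_QmodZ)
    next
      case (insert d E)
      then show ?case using c by (simp add: c_mult)
    qed
    finally show ?thesis .
  qed
  finally show ?thesis by (simp add: c_def D_def)
qed

end

section \<open>The ideal that defines the abstract cyclotomic field\<close>

lemma (in ideal) a_rcos_eq_iff:
  assumes "x \<in> carrier R" "y \<in> carrier R"
  shows "I +> x = I +> y \<longleftrightarrow> x \<ominus> y \<in> I"
proof -
  have "x \<in> I +> y \<longleftrightarrow> x \<ominus> y \<in> I"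
    using assms by (simp add: a_rcos_module a_minus_def)
  then show ?thesis
    using assms a_repr_independence'[of x y] a_repr_independenceD[of x y] by auto
qed

interpretation Q: torsion_group "carrier QmodZ" "of_rat :: rat \<Rightarrow> complex"
  rewrites "QmodZ\<lparr>carrier := carrier QmodZ\<rparr> = QmodZ"
    and "group_algebra (type_ring :: rat ring) QmodZ = cyc_algebra"
proof -
  show "torsion_group (carrier QmodZ) (of_rat :: rat \<Rightarrow> complex)"
  proof (rule torsion_group.intro)
    interpret comm_group QmodZ by (rule comm_group_QmodZ)
    show "subgroup (carrier QmodZ) QmodZ" by (rule subgroup_self)
  next
    fix x :: rat
    obtain a b where "x = of_int a / of_int b" "b > 0" by (metis Fract_of_int_quotient Rat_cases)
    then have "of_nat (nat b) * (of_rat x :: complex) = of_int a" "nat b > 0" by (simp_all add: of_rat_divide)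
    then show "\<exists>m>0. \<exists>k. of_nat m * (of_rat x :: complex) = of_int k" by blast
  qed (auto simp: of_rat_add of_rat_mult)
qed (simp_all add: cyc_algebra_def)

abbreviation Gp :: "nat \<Rightarrow> rat set set" where "Gp p \<equiv> carrier (QmodZ_prime_to p)"

lemma Gp_eq: "Gp p = (\<Union>n\<in>{n. n > 0 \<and> coprime n p}. torsion n)"
proof
  show "Gp p \<subseteq> (\<Union>n\<in>{n. n > 0 \<and> coprime n p}. torsion n)"
    by (auto simp: QmodZ_prime_to_def mod1_in_torsion)
  show "(\<Union>n\<in>{n. n > 0 \<and> coprime n p}. torsion n) \<subseteq> Gp p"
    by (auto simp: QmodZ_prime_to_def torsion_def intro: exI[of _ "int _"])
       (metis of_int_of_nat_eq)
qed

lemma QmodZ_prime_to_eq: "QmodZ_prime_to p = QmodZ\<lparr>carrier := Gp p\<rparr>"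
  by (simp add: QmodZ_prime_to_def)

lemma torsion_subset_Gp: "n > 0 \<Longrightarrow> coprime n p \<Longrightarrow> torsion n \<subseteq> Gp p"
  by (auto simp: Gp_eq)

lemma torsion_cover: "finite T \<Longrightarrow> T \<subseteq> Gp p \<Longrightarrow> \<exists>n>0. coprime n p \<and> T \<subseteq> torsion n"
  using finite_in_torsion[of T "{n. n > 0 \<and> coprime n p}"] by (auto simp: Gp_eq)

lemma torsion_cover_all: "finite T \<Longrightarrow> T \<subseteq> carrier QmodZ \<Longrightarrow> \<exists>n>0. T \<subseteq> torsion n"
proof -
  assume T: "finite T" "T \<subseteq> carrier QmodZ"
  have "x \<in> (\<Union>n\<in>{n. n > 0}. torsion n)" if x: "x \<in> carrier QmodZ" for x
  proof -
    obtain q where "x = mod1 q" using x unfolding carrier_QmodZ by blast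
    then show ?thesis using rat_in_torsion[of q] by blast
  qed
  then have "T \<subseteq> (\<Union>n\<in>{n. n > 0}. torsion n)" using T(2) by blast
  then have "\<exists>n\<in>{n. n > 0}. T \<subseteq> torsion n" by (rule finite_in_torsion[OF T(1)]) auto
  then show ?thesis by blast
qed

lemma subgroup_Gp: "subgroup (Gp p) QmodZ"
proof -
  show ?thesis
  proof (rule Q.G.subgroupI)
    show "Gp p \<subseteq> carrier QmodZ" using torsion_subset by (auto simp: Gp_eq)
    show "Gp p \<noteq> {}" by (auto simp: Gp_eq torsion_def intro: exI[of _ 1])
    fix x y assume x: "x \<in> Gp p"
    then obtain a n where "x = mod1 (of_int a / of_nat n)" "n > 0" "coprime n p"
      by (auto simp: QmodZ_prime_to_def)
    then have "inv\<^bsub>QmodZ\<^esub> x = mod1 (of_int (- a) / of_nat n)" by (simp add: inv_mod1)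
    then have "inv\<^bsub>QmodZ\<^esub> x \<in> torsion n" using mod1_in_torsion[OF \<open>n > 0\<close>, of "- a"] by simp
    with \<open>n > 0\<close> \<open>coprime n p\<close> show "inv\<^bsub>QmodZ\<^esub> x \<in> Gp p"
      using torsion_subset_Gp by blast
    assume y: "y \<in> Gp p"
    then obtain m where "m > 0" "coprime m p" "{x, y} \<subseteq> torsion m" using x torsion_cover[of "{x, y}" p] by auto
    then show "x \<otimes>\<^bsub>QmodZ\<^esub> y \<in> Gp p" using torsion_mult[of m x y] torsion_subset_Gp[of m p] by auto
  qed
qed

interpretation Z: torsion_group "Gp p" "of_int :: int \<Rightarrow> complex"
  rewrites "QmodZ\<lparr>carrier := Gp p\<rparr> = QmodZ_prime_to p"
    and "group_algebra (type_ring :: int ring) (QmodZ_prime_to p) = ZGp p"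
  for p
proof -
  show "torsion_group (Gp p) (of_int :: int \<Rightarrow> complex)"
  proof (rule torsion_group.intro)
    show "subgroup (Gp p) QmodZ" by (rule subgroup_Gp)
  next
    fix x :: int
    show "\<exists>m>0. \<exists>k. of_nat m * (of_int x :: complex) = of_int k"
      by (intro exI[of _ 1] conjI exI[of _ x]) auto
  qed auto
qed (simp_all add: ZGp_def flip: QmodZ_prime_to_eq)

lemma ZGp_ga: "ZGp p = group_algebra type_ring (QmodZ_prime_to p)"
  by (simp add: ZGp_def)

lemma cyc_ga: "cyc_algebra = group_algebra type_ring QmodZ"
  by (simp add: cyc_algebra_def)

lemma prime_to_mult [simp]: "x \<otimes>\<^bsub>QmodZ_prime_to p\<^esub> y = x \<otimes>\<^bsub>QmodZ\<^esub> y"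
  and prime_to_one [simp]: "\<one>\<^bsub>QmodZ_prime_to p\<^esub> = \<one>\<^bsub>QmodZ\<^esub>"
  by (simp_all add: QmodZ_prime_to_def)

abbreviation eval_C :: "(rat set \<Rightarrow> rat) \<Rightarrow> complex" where "eval_C \<equiv> Q.eval"
abbreviation eval_Z :: "(rat set \<Rightarrow> int) \<Rightarrow> complex" where "eval_Z \<equiv> Z.eval"

lemma ring_hom_eval_C: "eval_C \<in> ring_hom cyc_algebra type_ring"
  by (rule ring_hom_memI) (simp_all add: Q.eval_add Q.eval_mult Q.eval_one)

lemma cyc_zero: "\<zero>\<^bsub>cyc_algebra\<^esub> = (\<lambda>x. 0)"
  by (simp add: cyc_ga ga_type_simps)

lemma finsum_cyc_algebra:
  assumes "\<And>j. j \<in> J \<Longrightarrow> F j \<in> carrier cyc_algebra" "finite J"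
  shows "finsum cyc_algebra F J = (\<lambda>x. \<Sum>j\<in>J. F j x)"
  using assms(2,1)
proof (induction J rule: finite_induct)
  case empty
  then show ?case by (simp add: cyc_zero)
next
  case (insert j J)
  then have "finsum cyc_algebra F (insert j J) = F j \<oplus>\<^bsub>cyc_algebra\<^esub> finsum cyc_algebra F J"
    by (intro Q.A.finsum_insert) auto
  also have "\<dots> = (\<lambda>x. F j x + finsum cyc_algebra F J x)" by (simp add: cyc_ga ga_type_simps)
  finally show ?case using insert by simp
qed

lemma cyc_single_closed: "ga_single type_ring (mod1 r) c \<in> carrier cyc_algebra"
  unfolding cyc_ga by (rule ga_single_closed) simp

lemma cyc_idem_eq:
  assumes "n > 0"
  shows "cyc_idem n = (\<lambda>x. if x \<in> torsion n then 1 / of_nat n else 0)"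
proof
  fix x
  have "cyc_idem n x = (\<Sum>j<n. ga_single type_ring (frac1 n j) (1 / of_nat n) x)"
    unfolding cyc_idem_def by (subst finsum_cyc_algebra) (auto intro: cyc_single_closed)
  also have "\<dots> = (\<Sum>y\<in>torsion n. if x = y then 1 / of_nat n else 0)"
    by (subst sum_torsion[OF assms]) (simp add: ga_single_def cong: if_cong)
  also have "\<dots> = (if x \<in> torsion n then 1 / of_nat n else 0)"
    by (simp add: finite_torsion[OF assms])
  finally show "cyc_idem n x = (if x \<in> torsion n then 1 / of_nat n else 0)" .
qed

lemma cyc_idem_closed: "n > 0 \<Longrightarrow> cyc_idem n \<in> carrier cyc_algebra"
  using torsion_subset[of n] finite_torsion[of n]
  by (auto simp: cyc_idem_eq cyc_ga ga_type_carrier intro: finite_subset[of _ "torsion n"])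

lemma eval_C_idem:
  assumes "n \<ge> 2"
  shows "eval_C (cyc_idem n) = 0"
proof -
  have n: "n > 0" using assms by simp
  define z where "z = chi (frac1 n 1)"
  have "eval_C (cyc_idem n) = (\<Sum>x\<in>torsion n. of_rat (1 / of_nat n) * chi x ^ 1)"
    unfolding Q.eval_def by (subst Q.ev_torsion[OF n]) (auto simp: cyc_idem_eq[OF n] split: if_splits)
  also have "\<dots> = of_rat (1 / of_nat n) * (\<Sum>j<n. z ^ j)"
    unfolding sum_torsion[OF n] z_def by (subst chi_frac1_power) (simp add: sum_distrib_left)
  finally have eq: "eval_C (cyc_idem n) = of_rat (1 / of_nat n) * (\<Sum>j<n. z ^ j)" .
  have "z ^ n = 1" unfolding z_def by (rule chi_torsion[OF n]) (rule frac1_in_torsion)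
  then have sum: "(\<Sum>j<n. z ^ j) = (if z = 1 then of_nat n else 0)" by (rule sum_powers_root_of_unity)
  have "z \<noteq> 1"
  proof
    assume "z = 1"
    then have "chi (frac1 n 1) = chi (frac1 n 0)" by (simp add: z_def chi_mod1)
    then have "frac1 n 1 = frac1 n 0" using inj_chi by (auto dest!: inj_onD)
    then show False using inj_onD[OF inj_frac1[OF n], of 1 0] assms by simp
  qed
  with eq sum show ?thesis by simp
qed

lemma ideal_cyc_ideal: "ideal cyc_ideal cyc_algebra"
  unfolding cyc_ideal_def by (rule Q.A.genideal_ideal) (auto intro: cyc_idem_closed)

lemma J_a_rcos_const: "f \<in> cyc_ideal \<Longrightarrow> cyc_ideal +>\<^bsub>cyc_algebra\<^esub> f = cyc_ideal"
  by (rule abelian_subgroup.a_rcos_const[OF abelian_subgroupI3[OF ideal.axioms(1)[OF ideal_cyc_ideal] Q.A.abelian_group_axioms]])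

lemma cyc_idem_mem: "n \<ge> 2 \<Longrightarrow> cyc_idem n \<in> cyc_ideal"
  unfolding cyc_ideal_def
  by (rule subsetD[OF Q.A.genideal_self]) (auto intro: cyc_idem_closed)

lemma norm_elem_mem:
  assumes "d \<ge> 2"
  shows "norm_elem d \<in> cyc_ideal"
proof -
  have "norm_elem d = ga_single type_ring (mod1 0) (of_nat d) \<otimes>\<^bsub>cyc_algebra\<^esub> cyc_idem d"
  proof
    fix x
    have "(ga_single type_ring (mod1 0) (of_nat d) \<otimes>\<^bsub>cyc_algebra\<^esub> cyc_idem d) x =
       (if x \<in> carrier QmodZ then of_nat d * cyc_idem d (inv\<^bsub>QmodZ\<^esub> mod1 0 \<otimes>\<^bsub>QmodZ\<^esub> x) else 0)"
    proof -
      have "{y. ga_single type_ring (mod1 0) (rat_of_nat d) y \<noteq> 0} = {mod1 0}"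
        using assms by (auto simp: ga_single_def)
      then show ?thesis unfolding cyc_ga by (simp add: Q.G.ga_type_mult) (simp add: ga_single_def)
    qed
    also have "\<dots> = norm_elem d x"
      using assms torsion_subset[of d]
      by (auto simp: carrier_QmodZ inv_mod1 mod1_mult cyc_idem_eq norm_elem_def)
    finally show "norm_elem d x = (ga_single type_ring (mod1 0) (of_nat d) \<otimes>\<^bsub>cyc_algebra\<^esub> cyc_idem d) x" by simp
  qed
  then show ?thesis using ideal.I_l_closed[OF ideal_cyc_ideal, OF cyc_idem_mem[OF assms] cyc_single_closed] by simp
qed

text \<open>
  An element that vanishes under the evaluation is annihilated in the quotient by a positive integer, which is a
  unit over \<open>\<rat>\<close>.
\<close>

theorem cyc_ideal_eq: "cyc_ideal = {f \<in> carrier cyc_algebra. eval_C f = 0}"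
proof
  interpret ev: ring_hom_ring cyc_algebra "type_ring :: complex ring" eval_C
    by (rule ring_hom_ringI2[OF Q.A.ring_axioms _ ring_hom_eval_C]) (rule cring.axioms(1)[OF cring_type_ring])
  have ker: "a_kernel cyc_algebra type_ring eval_C = {f \<in> carrier cyc_algebra. eval_C f = 0}"
    unfolding a_kernel_def' type_ring_simps ..
  have "{cyc_idem n | n. n \<ge> 2} \<subseteq> {f \<in> carrier cyc_algebra. eval_C f = 0}"
    by (auto simp: cyc_idem_closed eval_C_idem)
  then show "cyc_ideal \<subseteq> {f \<in> carrier cyc_algebra. eval_C f = 0}"
    unfolding cyc_ideal_def by (rule Q.A.genideal_minimal[OF ev.kernel_is_ideal, unfolded ker])
  show "{f \<in> carrier cyc_algebra. eval_C f = 0} \<subseteq> cyc_ideal"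
  proof
    fix f assume "f \<in> {f \<in> carrier cyc_algebra. eval_C f = 0}"
    then have f: "f \<in> carrier cyc_algebra" and zero: "eval_C f = 0" by auto
    obtain n where n: "n > 0" "{x. f x \<noteq> 0} \<subseteq> torsion n"
      using torsion_cover_all[of "{x. f x \<noteq> 0}"] f ga_type_support[of f QmodZ]
      by (auto simp: cyc_ga ga_type_finite)
    define c where "c = \<Prod>{d. d dvd n \<and> d \<ge> 2}"
    have c: "c > 0" unfolding c_def by (rule prod_pos) auto
    let ?q = "\<lambda>x. cyc_ideal +>\<^bsub>cyc_algebra\<^esub> x"
    let ?c = "ga_single type_ring (mod1 0) (of_nat c)"
    have zero_Q: "\<zero>\<^bsub>cyc_algebra Quot cyc_ideal\<^esub> = cyc_ideal" by (simp add: FactRing_def)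
    have "?q f \<otimes>\<^bsub>cyc_algebra Quot cyc_ideal\<^esub> ?q ?c = \<zero>\<^bsub>cyc_algebra Quot cyc_ideal\<^esub>"
      unfolding c_def
    proof (rule Q.vanishing_imp_annihilated[OF f n _ zero])
      show "torsion n \<subseteq> carrier QmodZ" by (rule torsion_subset)
      show "cring (cyc_algebra Quot cyc_ideal)" by (rule ideal.quotient_is_cring[OF ideal_cyc_ideal Q.A.cring_axioms])
      show "?q \<in> ring_hom cyc_algebra (cyc_algebra Quot cyc_ideal)" by (rule ideal.rcos_ring_hom[OF ideal_cyc_ideal])
      fix d assume "d \<ge> (2::nat)"
      then show "?q (norm_elem d) = \<zero>\<^bsub>cyc_algebra Quot cyc_ideal\<^esub>"
        unfolding zero_Q by (intro J_a_rcos_const norm_elem_mem)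
    qed
    then have "?q (f \<otimes>\<^bsub>cyc_algebra\<^esub> ?c) = cyc_ideal"
      using ring_hom_mult[OF ideal.rcos_ring_hom[OF ideal_cyc_ideal] f cyc_single_closed] zero_Q by simp
    then have "f \<otimes>\<^bsub>cyc_algebra\<^esub> ?c \<in> cyc_ideal"
      using f cyc_single_closed by (intro ideal.rcos_const_imp_mem[OF ideal_cyc_ideal]) auto
    then have "f \<otimes>\<^bsub>cyc_algebra\<^esub> ?c \<otimes>\<^bsub>cyc_algebra\<^esub> ga_single type_ring (mod1 0) (1 / of_nat c) \<in> cyc_ideal"
      by (rule ideal.I_r_closed[OF ideal_cyc_ideal]) (rule cyc_single_closed)
    also have "f \<otimes>\<^bsub>cyc_algebra\<^esub> ?c \<otimes>\<^bsub>cyc_algebra\<^esub> ga_single type_ring (mod1 0) (1 / of_nat c) =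
      f \<otimes>\<^bsub>cyc_algebra\<^esub> (?c \<otimes>\<^bsub>cyc_algebra\<^esub> ga_single type_ring (mod1 0) (1 / of_nat c))"
      using f cyc_single_closed by (intro Q.A.m_assoc)
    also have "?c \<otimes>\<^bsub>cyc_algebra\<^esub> ga_single type_ring (mod1 0) (1 / of_nat c) = \<one>\<^bsub>cyc_algebra\<^esub>"
      using Q.G.ga_single_mult[of "mod1 0" "mod1 0" "of_nat c" "1 / of_nat c :: rat"] c
      by (simp add: cyc_ga ga_type_simps mod1_mult one_QmodZ)
    also have "f \<otimes>\<^bsub>cyc_algebra\<^esub> \<one>\<^bsub>cyc_algebra\<^esub> = f" using f by simp
    finally show "f \<in> cyc_ideal" .
  qed
qed

section \<open>The abstract cyclotomic field inside the complex numbers\<close>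

text \<open>
  The value does not depend on the representative, because the ideal is the kernel of the evaluation.
\<close>

definition emb :: "(rat set \<Rightarrow> rat) set \<Rightarrow> complex" where
  "emb X' = eval_C (SOME f. f \<in> carrier cyc_algebra \<and> X' = cyc_ideal +>\<^bsub>cyc_algebra\<^esub> f)"

lemma emb_class:
  assumes "f \<in> carrier cyc_algebra"
  shows "emb (cyc_ideal +>\<^bsub>cyc_algebra\<^esub> f) = eval_C f"
proof -
  define g where "g = (SOME g. g \<in> carrier cyc_algebra \<and>
     cyc_ideal +>\<^bsub>cyc_algebra\<^esub> f = cyc_ideal +>\<^bsub>cyc_algebra\<^esub> g)"
  have "g \<in> carrier cyc_algebra \<and> cyc_ideal +>\<^bsub>cyc_algebra\<^esub> f = cyc_ideal +>\<^bsub>cyc_algebra\<^esub> g"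
    unfolding g_def by (rule someI[of _ f]) (use assms in auto)
  then have "g \<in> carrier cyc_algebra" "f \<ominus>\<^bsub>cyc_algebra\<^esub> g \<in> cyc_ideal"
    using ideal.a_rcos_eq_iff[OF ideal_cyc_ideal] assms by auto
  then have "eval_C f = eval_C g"
    using assms by (simp add: cyc_ideal_eq Q.eval_minus)
  then show ?thesis by (simp add: emb_def g_def)
qed

lemma carrier_Qcyc: "carrier Qcyc = (\<lambda>f. cyc_ideal +>\<^bsub>cyc_algebra\<^esub> f) ` carrier cyc_algebra"
  by (auto simp: Qcyc_def FactRing_def A_RCOSETS_def')

lemma class_hom: "(\<lambda>f. cyc_ideal +>\<^bsub>cyc_algebra\<^esub> f) \<in> ring_hom cyc_algebra Qcyc"
  unfolding Qcyc_def by (rule ideal.rcos_ring_hom[OF ideal_cyc_ideal])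

interpretation Qcyc: cring Qcyc
  unfolding Qcyc_def by (rule ideal.quotient_is_cring[OF ideal_cyc_ideal Q.A.cring_axioms])

lemma ring_hom_emb: "emb \<in> ring_hom Qcyc type_ring"
proof (rule ring_hom_memI)
  fix x y assume "x \<in> carrier Qcyc" "y \<in> carrier Qcyc"
  then obtain f g where fg: "f \<in> carrier cyc_algebra" "g \<in> carrier cyc_algebra"
    "x = cyc_ideal +>\<^bsub>cyc_algebra\<^esub> f" "y = cyc_ideal +>\<^bsub>cyc_algebra\<^esub> g" by (auto simp: carrier_Qcyc)
  have "x \<otimes>\<^bsub>Qcyc\<^esub> y = cyc_ideal +>\<^bsub>cyc_algebra\<^esub> (f \<otimes>\<^bsub>cyc_algebra\<^esub> g)"
    "x \<oplus>\<^bsub>Qcyc\<^esub> y = cyc_ideal +>\<^bsub>cyc_algebra\<^esub> (f \<oplus>\<^bsub>cyc_algebra\<^esub> g)"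
    using fg class_hom by (auto simp: ring_hom_mult ring_hom_add)
  then show "emb (x \<otimes>\<^bsub>Qcyc\<^esub> y) = emb x \<otimes>\<^bsub>type_ring\<^esub> emb y" "emb (x \<oplus>\<^bsub>Qcyc\<^esub> y) = emb x \<oplus>\<^bsub>type_ring\<^esub> emb y"
    using fg by (simp_all add: emb_class Q.eval_mult Q.eval_add)
next
  show "emb \<one>\<^bsub>Qcyc\<^esub> = \<one>\<^bsub>type_ring\<^esub>"
    unfolding ring_hom_one[OF class_hom, symmetric]
    by (simp add: emb_class Q.eval_one)
qed auto

lemma emb_mult [simp]: "x \<in> carrier Qcyc \<Longrightarrow> y \<in> carrier Qcyc \<Longrightarrow> emb (x \<otimes>\<^bsub>Qcyc\<^esub> y) = emb x * emb y"
  and emb_add [simp]: "x \<in> carrier Qcyc \<Longrightarrow> y \<in> carrier Qcyc \<Longrightarrow> emb (x \<oplus>\<^bsub>Qcyc\<^esub> y) = emb x + emb y"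
  and emb_one [simp]: "emb \<one>\<^bsub>Qcyc\<^esub> = 1" and emb_zero [simp]: "emb \<zero>\<^bsub>Qcyc\<^esub> = 0"
  using ring_hom_mult[OF ring_hom_emb] ring_hom_add[OF ring_hom_emb] ring_hom_one[OF ring_hom_emb]
    ring_hom_zero[OF ring_hom_emb Qcyc.ring_axioms cring.axioms(1)[OF cring_type_ring]] by simp_all

lemma emb_uminus [simp]: "x \<in> carrier Qcyc \<Longrightarrow> emb (\<ominus>\<^bsub>Qcyc\<^esub> x) = - emb x"
  using emb_add[of x "\<ominus>\<^bsub>Qcyc\<^esub> x"] by (simp add: Qcyc.r_neg add_eq_0_iff2 minus_equation_iff del: emb_add)

lemma emb_pow [simp]: "x \<in> carrier Qcyc \<Longrightarrow> emb (x [^]\<^bsub>Qcyc\<^esub> (n::nat)) = emb x ^ n"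
  by (induction n) (simp_all add: mult.commute)

lemma emb_eq_0:
  assumes "x \<in> carrier Qcyc" "emb x = 0"
  shows "x = \<zero>\<^bsub>Qcyc\<^esub>"
proof -
  obtain f where f: "f \<in> carrier cyc_algebra" "x = cyc_ideal +>\<^bsub>cyc_algebra\<^esub> f"
    using assms(1) by (auto simp: carrier_Qcyc)
  then have "eval_C f = 0" using assms(2) by (simp add: emb_class)
  then have "f \<in> cyc_ideal" using f(1) by (simp add: cyc_ideal_eq)
  then have "x = cyc_ideal" unfolding f(2) by (rule J_a_rcos_const)
  then show ?thesis by (simp add: Qcyc_def FactRing_def)
qed

lemma inj_emb: "inj_on emb (carrier Qcyc)"
proof (rule inj_onI)
  fix x y assume xy: "x \<in> carrier Qcyc" "y \<in> carrier Qcyc" "emb x = emb y"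
  then have "emb (x \<ominus>\<^bsub>Qcyc\<^esub> y) = 0" by (simp add: a_minus_def)
  then have "x \<ominus>\<^bsub>Qcyc\<^esub> y = \<zero>\<^bsub>Qcyc\<^esub>" using xy by (intro emb_eq_0) auto
  then show "x = y" using xy by simp
qed

lemma field_Qcyc: "field Qcyc"
proof (rule Qcyc.cring_fieldI2)
  show "\<zero>\<^bsub>Qcyc\<^esub> \<noteq> \<one>\<^bsub>Qcyc\<^esub>" using emb_one emb_zero by force
  fix x assume x: "x \<in> carrier Qcyc" "x \<noteq> \<zero>\<^bsub>Qcyc\<^esub>"
  then obtain f where f: "f \<in> carrier cyc_algebra" "x = cyc_ideal +>\<^bsub>cyc_algebra\<^esub> f"
    by (auto simp: carrier_Qcyc)
  obtain n where n: "n > 0" "{x. f x \<noteq> 0} \<subseteq> torsion n"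
    using torsion_cover_all[of "{x. f x \<noteq> 0}"] f ga_type_support[of f QmodZ]
    by (auto simp: cyc_ga ga_type_finite)
  have "eval_C f \<noteq> 0" using emb_eq_0 x f emb_class by metis
  then obtain g m where g: "g \<in> carrier cyc_algebra" "m > 0" "eval_C f * eval_C g = of_nat m"
    using Q.ev_inverse[OF n(1) torsion_subset n(2)] by metis
  define c where "c = ga_single type_ring (mod1 0) (1 / of_nat m :: rat)"
  have c: "c \<in> carrier cyc_algebra" "eval_C c = 1 / of_nat m"
    by (simp_all add: c_def cyc_single_closed Q.eval_single chi_mod1 of_rat_divide)
  define y where "y = cyc_ideal +>\<^bsub>cyc_algebra\<^esub> (g \<otimes>\<^bsub>cyc_algebra\<^esub> c)"
  have y: "y \<in> carrier Qcyc" using g c by (auto simp: y_def carrier_Qcyc)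
  have "emb y = eval_C g / of_nat m" unfolding y_def using g c by (simp add: emb_class Q.eval_mult)
  then have "emb (x \<otimes>\<^bsub>Qcyc\<^esub> y) = emb \<one>\<^bsub>Qcyc\<^esub>"
    using x y g f(1) by (simp add: f(2) emb_class)
  then have "x \<otimes>\<^bsub>Qcyc\<^esub> y = \<one>\<^bsub>Qcyc\<^esub>" using inj_onD[OF inj_emb] x y by simp
  with y show "\<exists>y\<in>carrier Qcyc. x \<otimes>\<^bsub>Qcyc\<^esub> y = \<one>\<^bsub>Qcyc\<^esub>" by blast
qed

lemma emb_inv [simp]: "x \<in> carrier Qcyc \<Longrightarrow> x \<noteq> \<zero>\<^bsub>Qcyc\<^esub> \<Longrightarrow> emb (inv\<^bsub>Qcyc\<^esub> x) = inverse (emb x)"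
proof -
  assume x: "x \<in> carrier Qcyc" "x \<noteq> \<zero>\<^bsub>Qcyc\<^esub>"
  then have "x \<in> Units Qcyc" by (simp add: field.field_Units[OF field_Qcyc])
  then have "emb (x \<otimes>\<^bsub>Qcyc\<^esub> inv\<^bsub>Qcyc\<^esub> x) = 1" by simp
  then have "emb x * emb (inv\<^bsub>Qcyc\<^esub> x) = 1" using x \<open>x \<in> Units Qcyc\<close> by (simp del: Qcyc.Units_r_inv)
  then show ?thesis by (simp add: inverse_unique)
qed

section \<open>The homomorphism \<open>\<delta>\<close> and the roots of unity\<close>

abbreviation single_Z :: "rat set \<Rightarrow> rat set \<Rightarrow> int" where
  "single_Z r \<equiv> ga_single int_ring r 1"

lemma of_int_ZGp: "f \<in> carrier (ZGp p) \<Longrightarrow> (\<lambda>x. of_int (f x)) \<in> carrier cyc_algebra"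
  using Z.H_subset by (auto simp: ZGp_ga cyc_ga ga_type_carrier)

lemma eval_C_of_int: "eval_C (\<lambda>x. of_int (f x)) = eval_Z f"
  by (simp add: Q.eval_def Z.eval_def Q.ev_def Z.ev_def pairing_def)

lemma delta_closed [simp]: "f \<in> carrier (ZGp p) \<Longrightarrow> delta f \<in> carrier Qcyc"
  by (auto simp: delta_def carrier_Qcyc of_int_ZGp)

lemma emb_delta [simp]: "f \<in> carrier (ZGp p) \<Longrightarrow> emb (delta f) = eval_Z f"
  using emb_class[OF of_int_ZGp, of f p] by (simp add: delta_def eval_C_of_int)

lemma Qcyc_eqI: "x \<in> carrier Qcyc \<Longrightarrow> y \<in> carrier Qcyc \<Longrightarrow> emb x = emb y \<Longrightarrow> x = y"
  using inj_onD[OF inj_emb] by simp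

lemma ring_hom_delta: "delta \<in> ring_hom (ZGp p) Qcyc"
proof (rule ring_hom_memI)
  fix f g assume f: "f \<in> carrier (ZGp p)" and g: "g \<in> carrier (ZGp p)"
  have fg: "f \<otimes>\<^bsub>ZGp p\<^esub> g \<in> carrier (ZGp p)" "f \<oplus>\<^bsub>ZGp p\<^esub> g \<in> carrier (ZGp p)"
    using f g by simp_all
  show "delta (f \<otimes>\<^bsub>ZGp p\<^esub> g) = delta f \<otimes>\<^bsub>Qcyc\<^esub> delta g"
    using delta_closed[OF f] delta_closed[OF g] delta_closed[OF fg(1)] f g
    by (intro Qcyc_eqI) (simp_all add: emb_delta[OF fg(1)] emb_delta[OF f] emb_delta[OF g] Z.eval_mult)
  show "delta (f \<oplus>\<^bsub>ZGp p\<^esub> g) = delta f \<oplus>\<^bsub>Qcyc\<^esub> delta g"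
    using delta_closed[OF f] delta_closed[OF g] delta_closed[OF fg(2)] f g
    by (intro Qcyc_eqI) (simp_all add: emb_delta[OF fg(2)] emb_delta[OF f] emb_delta[OF g] Z.eval_add)
next
  have one: "\<one>\<^bsub>ZGp p\<^esub> \<in> carrier (ZGp p)" by simp
  show "delta \<one>\<^bsub>ZGp p\<^esub> = \<one>\<^bsub>Qcyc\<^esub>"
    using delta_closed[OF one] by (intro Qcyc_eqI) (simp_all add: emb_delta[OF one] Z.eval_one)
qed auto

lemma eval_Z_single: "eval_Z (single_Z r) = chi r"
  by (simp add: Z.eval_single)

lemma single_Z_closed [simp]: "r \<in> Gp p \<Longrightarrow> single_Z r \<in> carrier (ZGp p)"
  unfolding ZGp_ga by (rule ga_single_closed)

abbreviation root :: "rat set \<Rightarrow> (rat set \<Rightarrow> rat) set" where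
  "root r \<equiv> delta (single_Z r)"

lemma root_closed [simp]: "r \<in> Gp p \<Longrightarrow> root r \<in> carrier Qcyc"
  using single_Z_closed by (rule delta_closed)

lemma emb_root [simp]: "r \<in> Gp p \<Longrightarrow> emb (root r) = chi r"
  by (subst emb_delta[OF single_Z_closed]) (simp_all add: eval_Z_single)

text \<open>
  An \<open>n\<close>-th root of unity in the abstract field is sent by the embedding to a complex \<open>n\<close>-th root of unity, and
  all these are values of \<open>chi\<close>.
\<close>

lemma mu_eq: "mu p = root ` Gp p"
proof
  show "mu p \<subseteq> root ` Gp p"
  proof
    fix x assume "x \<in> mu p"
    then obtain n where x: "x \<in> carrier Qcyc" and n: "n > 0" "coprime n p" "x [^]\<^bsub>Qcyc\<^esub> n = \<one>\<^bsub>Qcyc\<^esub>"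
      by (auto simp: mu_def)
    then have "emb x ^ n = 1" by (metis emb_one emb_pow)
    then have "emb x \<in> chi ` torsion n" using bij_betw_chi[OF n(1)] by (simp add: bij_betw_def)
    then obtain r where r: "r \<in> torsion n" "emb x = chi r" by blast
    then have rG: "r \<in> Gp p" using torsion_subset_Gp n by auto
    then have "x = root r" using x r by (intro Qcyc_eqI) simp_all
    with rG show "x \<in> root ` Gp p" by blast
  qed
  show "root ` Gp p \<subseteq> mu p"
  proof
    fix x assume "x \<in> root ` Gp p"
    then obtain r n where r: "r \<in> Gp p" "x = root r" "n > 0" "coprime n p" "r \<in> torsion n"
      by (auto simp: Gp_eq)
    then have "x [^]\<^bsub>Qcyc\<^esub> n = \<one>\<^bsub>Qcyc\<^esub>"
      by (intro Qcyc_eqI) (simp_all add: chi_torsion)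
    with r show "x \<in> mu p" by (auto simp: mu_def)
  qed
qed

lemma root_inj: "inj_on root (Gp p)"
proof (rule inj_onI)
  fix r s assume rs: "r \<in> Gp p" "s \<in> Gp p" "root r = root s"
  then have "emb (root r) = emb (root s)" by simp
  then have "chi r = chi s" using rs(1,2) by simp
  then show "r = s" using inj_onD[OF inj_chi] rs(1,2) subsetD[OF Z.H_subset] by simp
qed

lemma root_mult: "r \<in> Gp p \<Longrightarrow> s \<in> Gp p \<Longrightarrow> root r \<otimes>\<^bsub>Qcyc\<^esub> root s = root (r \<otimes>\<^bsub>QmodZ\<^esub> s)"
  using ring_hom_mult[OF ring_hom_delta, of "single_Z r" p "single_Z s"] Z.G.ga_single_mult[of r p s "1::int" 1]
  by (simp add: ZGp_ga[symmetric])

lemma root_one: "root (mod1 0) = \<one>\<^bsub>Qcyc\<^esub>"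
  using ring_hom_one[OF ring_hom_delta] by (simp add: ZGp_ga ga_type_simps one_QmodZ)

lemma delta_eq_0_iff: "f \<in> carrier (ZGp p) \<Longrightarrow> delta f = \<zero>\<^bsub>Qcyc\<^esub> \<longleftrightarrow> eval_Z f = 0"
  using emb_eq_0[OF delta_closed, of f p] emb_delta[of f p] emb_zero by metis

section \<open>The universal property of the integral group algebra\<close>

lemma ZGp_add: "f \<oplus>\<^bsub>ZGp p\<^esub> g = (\<lambda>x. f x + g x)"
  and ZGp_zero: "\<zero>\<^bsub>ZGp p\<^esub> = (\<lambda>x. 0)"
  and ZGp_one: "\<one>\<^bsub>ZGp p\<^esub> = single_Z (mod1 0)"
  by (simp_all add: ZGp_ga ga_type_simps one_QmodZ)

lemma Gp_0 [simp]: "mod1 0 \<in> Gp p"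
  using Z.G.one_closed by (simp add: one_QmodZ)

lemma Gp_mult [simp]: "r \<in> Gp p \<Longrightarrow> s \<in> Gp p \<Longrightarrow> r \<otimes>\<^bsub>QmodZ\<^esub> s \<in> Gp p"
  using Z.G.m_closed[of r p s] by simp

lemma single_closed_c [simp]: "r \<in> Gp p \<Longrightarrow> ga_single type_ring r (c :: int) \<in> carrier (ZGp p)"
  unfolding ZGp_ga by (rule ga_single_closed)

lemma single_mult: "r \<in> Gp p \<Longrightarrow> s \<in> Gp p \<Longrightarrow>
   ga_single type_ring r (c::int) \<otimes>\<^bsub>ZGp p\<^esub> ga_single type_ring s d = ga_single type_ring (r \<otimes>\<^bsub>QmodZ\<^esub> s) (c * d)"
  using Z.G.ga_single_mult[of r p s c d] by (simp add: ZGp_ga)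

lemma ZGp_single_induct [consumes 1, case_names zero single add]:
  assumes "f \<in> carrier (ZGp p)"
    and "P \<zero>\<^bsub>ZGp p\<^esub>"
    and "\<And>r c. r \<in> Gp p \<Longrightarrow> P (ga_single type_ring r c)"
    and "\<And>f g. f \<in> carrier (ZGp p) \<Longrightarrow> g \<in> carrier (ZGp p) \<Longrightarrow> P f \<Longrightarrow> P g \<Longrightarrow> P (f \<oplus>\<^bsub>ZGp p\<^esub> g)"
  shows "P f"
  using assms unfolding ZGp_add ZGp_zero unfolding ZGp_ga by (rule ga_type_induct)

lemma ZGp_induct [consumes 1, case_names zero single minus add]:
  assumes "f \<in> carrier (ZGp p)"
    and zero: "P \<zero>\<^bsub>ZGp p\<^esub>"
    and single: "\<And>r. r \<in> Gp p \<Longrightarrow> P (single_Z r)"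
    and minus: "\<And>f. f \<in> carrier (ZGp p) \<Longrightarrow> P f \<Longrightarrow> P (\<ominus>\<^bsub>ZGp p\<^esub> f)"
    and add: "\<And>f g. f \<in> carrier (ZGp p) \<Longrightarrow> g \<in> carrier (ZGp p) \<Longrightarrow> P f \<Longrightarrow> P g \<Longrightarrow> P (f \<oplus>\<^bsub>ZGp p\<^esub> g)"
  shows "P f"
  using assms(1)
proof (induction f rule: ZGp_single_induct)
  case (single r c)
  have add_single: "ga_single type_ring r a \<oplus>\<^bsub>ZGp p\<^esub> ga_single type_ring r b = ga_single type_ring r (a + b)" for a b :: int
    by (auto simp: ZGp_add ga_single_def)
  have zero': "ga_single type_ring r (0::int) = \<zero>\<^bsub>ZGp p\<^esub>"
    by (auto simp: ZGp_zero ga_single_def)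
  have nat: "P (ga_single type_ring r (int n))" for n
  proof (induction n)
    case 0
    then show ?case using zero by (simp add: zero')
  next
    case (Suc n)
    then have "P (ga_single type_ring r (int n) \<oplus>\<^bsub>ZGp p\<^esub> single_Z r)"
      using single.hyps by (intro add assms(3)) auto
    then show ?case by (simp add: add_single add.commute)
  qed
  have minus_single: "\<ominus>\<^bsub>ZGp p\<^esub> (ga_single type_ring r (int n)) = ga_single type_ring r (- int n)" for n
    by (rule Z.A.minus_equality) (use single.hyps in \<open>auto simp: add_single zero'\<close>)
  show ?case
  proof (cases c rule: int_cases2)
    case (nonneg n)
    with nat show ?thesis by simp
  next
    case (nonpos n)
    then show ?thesis using minus[OF single_closed_c[OF single.hyps] nat[of n]] minus_single by simp
  qed
qed (use zero add in auto)

lemma ZGp_hom_eqI: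
  assumes S: "ring S" and \<theta>: "\<theta> \<in> ring_hom (ZGp p) S" and \<theta>': "\<theta>' \<in> ring_hom (ZGp p) S"
    and eq: "\<And>r. r \<in> Gp p \<Longrightarrow> \<theta> (single_Z r) = \<theta>' (single_Z r)" and f: "f \<in> carrier (ZGp p)"
  shows "\<theta> f = \<theta>' f"
proof -
  interpret \<theta>: ring_hom_ring "ZGp p" S \<theta> by (rule ring_hom_ringI2[OF Z.A.ring_axioms S \<theta>])
  interpret \<theta>': ring_hom_ring "ZGp p" S \<theta>' by (rule ring_hom_ringI2[OF Z.A.ring_axioms S \<theta>'])
  from f show ?thesis
    by (induction f rule: ZGp_induct) (simp_all add: eq)
qed

definition ga_lift :: "('c, 'm) ring_scheme \<Rightarrow> (rat set \<Rightarrow> 'c) \<Rightarrow> (rat set \<Rightarrow> int) \<Rightarrow> 'c" where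
  "ga_lift S u f = finsum S (\<lambda>x. add_pow S (f x) (u x)) {x. f x \<noteq> 0}"

lemma ga_lift:
  assumes S: "cring S" and u: "\<And>r. r \<in> Gp p \<Longrightarrow> u r \<in> carrier S"
    and u_mult: "\<And>r s. r \<in> Gp p \<Longrightarrow> s \<in> Gp p \<Longrightarrow> u (r \<otimes>\<^bsub>QmodZ\<^esub> s) = u r \<otimes>\<^bsub>S\<^esub> u s"
    and u_one: "u (mod1 0) = \<one>\<^bsub>S\<^esub>"
  shows "ga_lift S u \<in> ring_hom (ZGp p) S" and "\<And>r. r \<in> Gp p \<Longrightarrow> ga_lift S u (single_Z r) = u r"
proof -
  interpret S: cring S by (rule S)
  let ?L = "ga_lift S u"
  have superset: "?L f = finsum S (\<lambda>x. add_pow S (f x) (u x)) T"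
    if "finite T" "{x. f x \<noteq> 0} \<subseteq> T" "T \<subseteq> Gp p" for f T
    unfolding ga_lift_def
    by (rule S.add.finprod_mono_neutral_cong_left) (use that u in \<open>auto simp: add_pow_int_ge\<close>)
  have supp: "{x. f x \<noteq> 0} \<subseteq> Gp p" "finite {x. f x \<noteq> 0}" if "f \<in> carrier (ZGp p)" for f
    using that by (auto simp: ZGp_ga ga_type_carrier)
  have closed: "?L f \<in> carrier S" if "f \<in> carrier (ZGp p)" for f
    unfolding ga_lift_def using supp[OF that] u by (intro S.finsum_closed) auto
  have L_add: "?L (f \<oplus>\<^bsub>ZGp p\<^esub> g) = ?L f \<oplus>\<^bsub>S\<^esub> ?L g"
    if f: "f \<in> carrier (ZGp p)" and g: "g \<in> carrier (ZGp p)" for f g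
  proof -
    define T where "T = {x. f x \<noteq> 0} \<union> {x. g x \<noteq> 0}"
    have T: "finite T" "T \<subseteq> Gp p" using supp f g by (auto simp: T_def)
    have "?L (f \<oplus>\<^bsub>ZGp p\<^esub> g) = finsum S (\<lambda>x. add_pow S (f x + g x) (u x)) T"
      using T by (subst superset) (auto simp: T_def ZGp_add)
    also have "\<dots> = finsum S (\<lambda>x. add_pow S (f x) (u x) \<oplus>\<^bsub>S\<^esub> add_pow S (g x) (u x)) T"
      using T u by (intro S.finsum_cong') (auto simp: S.add.int_pow_mult)
    also have "\<dots> = finsum S (\<lambda>x. add_pow S (f x) (u x)) T \<oplus>\<^bsub>S\<^esub> finsum S (\<lambda>x. add_pow S (g x) (u x)) T"
      using T u by (intro S.finsum_addf) auto
    also have "\<dots> = ?L f \<oplus>\<^bsub>S\<^esub> ?L g"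
      using T by (simp add: superset[of T] T_def)
    finally show ?thesis .
  qed
  have L_single: "?L (ga_single type_ring r c) = add_pow S c (u r)" if "r \<in> Gp p" for r c
    using that u by (subst superset[of "{r}"]) (auto simp: ga_single_def)
  then show single: "?L (single_Z r) = u r" if "r \<in> Gp p" for r
    using that u by (simp add: add_pow_int_ge)
  have L_zero: "?L \<zero>\<^bsub>ZGp p\<^esub> = \<zero>\<^bsub>S\<^esub>" by (simp add: ga_lift_def ZGp_zero)
  have L_mult: "?L (f \<otimes>\<^bsub>ZGp p\<^esub> g) = ?L f \<otimes>\<^bsub>S\<^esub> ?L g"
    if "f \<in> carrier (ZGp p)" "g \<in> carrier (ZGp p)" for f g
    using that
  proof (induction f rule: ZGp_single_induct)
    case zero
    then show ?case by (simp add: L_zero closed)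
  next
    case (single r c)
    from single(2) show ?case
    proof (induction g rule: ZGp_single_induct)
      case zero
      then show ?case using single(1) by (simp add: L_zero closed)
    next
      case (single s d)
      have "add_pow S (c * d) (u r \<otimes>\<^bsub>S\<^esub> u s) = add_pow S c (u r) \<otimes>\<^bsub>S\<^esub> add_pow S d (u s)"
        using u[OF \<open>r \<in> Gp p\<close>] u[OF single(1)]
        by (simp add: S.add_pow_ldistr_int S.add_pow_rdistr_int S.add.int_pow_pow mult.commute)
      then show ?case using single(1) \<open>r \<in> Gp p\<close> by (simp add: single_mult L_single u_mult)
    next
      case (add g h)
      then show ?case using single(1) by (simp add: Z.A.r_distr L_add S.r_distr closed)
    qed
  next
    case (add f h)
    then show ?case by (simp add: Z.A.l_distr L_add S.l_distr closed)
  qed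
  show "?L \<in> ring_hom (ZGp p) S"
  proof (rule ring_hom_memI)
    show "?L \<one>\<^bsub>ZGp p\<^esub> = \<one>\<^bsub>S\<^esub>" by (simp add: ZGp_one single u_one)
  qed (use closed L_mult L_add in auto)
qed

section \<open>Homomorphisms that kill the kernel of \<open>\<delta>\<close>\<close>

lemma add_pow_one_hom:
  assumes "ring R" "ring S" "h \<in> ring_hom R S"
  shows "h (add_pow R (k::int) \<one>\<^bsub>R\<^esub>) = add_pow S k \<one>\<^bsub>S\<^esub>"
proof -
  interpret h: ring_hom_ring R S h by (rule ring_hom_ringI2[OF assms])
  have nat: "h (add_pow R (n::nat) \<one>\<^bsub>R\<^esub>) = add_pow S n \<one>\<^bsub>S\<^esub>" for n
    by (induction n) simp_all
  show ?thesis
    by (cases k rule: int_cases2) (simp_all add: add_pow_int_ge nat h.R.add.int_pow_neg h.S.add.int_pow_neg)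
qed

lemma single_Z_const: "add_pow (ZGp p) (k::int) \<one>\<^bsub>ZGp p\<^esub> = ga_single type_ring (mod1 0) k"
proof -
  have 1: "ga_single type_ring (mod1 0) a \<oplus>\<^bsub>ZGp p\<^esub> ga_single type_ring (mod1 0) b = ga_single type_ring (mod1 0) (a + b)" for a b :: int
    by (auto simp: ZGp_add ga_single_def)
  have nat: "add_pow (ZGp p) (n::nat) \<one>\<^bsub>ZGp p\<^esub> = ga_single type_ring (mod1 0) (int n)" for n
  proof (induction n)
    case 0
    show ?case by (auto simp: ZGp_zero ga_single_def)
  next
    case (Suc n)
    then show ?case by (simp add: 1 ZGp_one add.commute)
  qed
  show ?thesis
  proof (cases k rule: int_cases2)
    case (nonneg n)
    then show ?thesis using nat by (simp add: add_pow_int_ge)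
  next
    case (nonpos n)
    have "\<ominus>\<^bsub>ZGp p\<^esub> ga_single type_ring (mod1 0) (int n) = ga_single type_ring (mod1 0) (- int n)"
      by (rule Z.A.minus_equality) (auto simp: 1 ZGp_zero, auto simp: ga_single_def)
    then show ?thesis using nat[of n] nonpos by (simp add: Z.A.add.int_pow_neg add_pow_int_ge)
  qed
qed

text \<open>
  As \<open>e(1/d) N = N\<close> for \<open>N = \<Sum>\<^sub>j e(j/d)\<close> and \<open>\<theta>(e(1/d)) \<noteq> 1\<close>, the element \<open>N\<close> is killed by \<open>\<theta>\<close>. So
  \<open>vanishing_imp_annihilated\<close> shows that an integer prime to \<open>p\<close> annihilates \<open>\<theta>(f)\<close>.
\<close>

theorem delta_kernel_killed:
  assumes D: "domain S" and \<theta>: "\<theta> \<in> ring_hom (ZGp p) S"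
    and inj: "inj_on (\<lambda>r. \<theta> (single_Z r)) (Gp p)"
    and char: "\<And>n::nat. n > 0 \<Longrightarrow> coprime n p \<Longrightarrow> add_pow S n \<one>\<^bsub>S\<^esub> \<noteq> \<zero>\<^bsub>S\<^esub>"
    and f: "f \<in> carrier (ZGp p)" "delta f = \<zero>\<^bsub>Qcyc\<^esub>"
  shows "\<theta> f = \<zero>\<^bsub>S\<^esub>"
proof -
  interpret S: domain S by (rule D)
  interpret \<theta>: ring_hom_ring "ZGp p" S \<theta> by (rule ring_hom_ringI2[OF Z.A.ring_axioms S.ring_axioms \<theta>])
  have ev: "eval_Z f = 0" using f delta_eq_0_iff by simp
  obtain n where n: "n > 0" "coprime n p" "{x. f x \<noteq> 0} \<subseteq> torsion n"
    using torsion_cover[of "{x. f x \<noteq> 0}" p] f(1) by (auto simp: ZGp_ga ga_type_carrier)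
  have norm: "\<theta> (norm_elem d) = \<zero>\<^bsub>S\<^esub>" if "d dvd n" "d \<ge> 2" for d
  proof -
    have d: "d > 0" "coprime d p" using that n coprime_divisors[of d n p p] by auto
    then have dG: "torsion d \<subseteq> Gp p" by (rule torsion_subset_Gp)
    have Nd: "norm_elem d \<in> carrier (ZGp p)" by (rule Z.norm_elem_closed[OF d(1) dG])
    let ?t = "frac1 d 1"
    have tt: "?t \<in> torsion d" by (rule frac1_in_torsion)
    then have t: "?t \<in> Gp p" using dG by blast
    have "single_Z ?t \<otimes>\<^bsub>ZGp p\<^esub> norm_elem d = norm_elem d"
    proof
      fix x
      have "{y. single_Z ?t y \<noteq> 0} = {?t}" by (auto simp: ga_single_def)
      then have "(single_Z ?t \<otimes>\<^bsub>ZGp p\<^esub> norm_elem d) x =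
        (if x \<in> Gp p then norm_elem d (inv\<^bsub>QmodZ_prime_to p\<^esub> ?t \<otimes>\<^bsub>QmodZ\<^esub> x) else 0)"
        unfolding ZGp_ga Z.G.ga_type_mult by (simp add: ga_single_def)
      also have "\<dots> = norm_elem d x"
      proof (cases "x \<in> Gp p")
        case False
        with dG show ?thesis by (auto simp: norm_elem_def)
      next
        case True
        have inv_t: "inv\<^bsub>QmodZ_prime_to p\<^esub> ?t \<in> torsion d"
        proof -
          have "inv\<^bsub>QmodZ_prime_to p\<^esub> ?t = mod1 (of_int (- 1) / of_nat d)"
          proof (rule Z.G.inv_equality)
            show "mod1 (of_int (- 1) / of_nat d) \<in> Gp p" using mod1_in_torsion[OF d(1), of "-1"] dG by blast
          qed (use t in \<open>simp_all add: mod1_mult one_QmodZ\<close>)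
          then show ?thesis using mod1_in_torsion[OF d(1), of "-1"] by metis
        qed
        let ?y = "inv\<^bsub>QmodZ_prime_to p\<^esub> ?t \<otimes>\<^bsub>QmodZ\<^esub> x"
        have "x = ?t \<otimes>\<^bsub>QmodZ\<^esub> ?y"
          using Z.G.m_assoc[OF t Z.G.inv_closed[OF t] True] Z.G.r_inv[OF t] Z.G.l_one[OF True] by simp
        then have "?y \<in> torsion d \<longleftrightarrow> x \<in> torsion d"
          using torsion_mult[OF d(1) inv_t, of x] torsion_mult[OF d(1) tt, of ?y] by metis
        then show ?thesis using True by (simp add: norm_elem_def)
      qed
      finally show "(single_Z ?t \<otimes>\<^bsub>ZGp p\<^esub> norm_elem d) x = norm_elem d x" .
    qed
    then have "\<theta> (single_Z ?t) \<otimes>\<^bsub>S\<^esub> \<theta> (norm_elem d) = \<theta> (norm_elem d)"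
      using \<theta>.hom_mult[OF single_Z_closed[OF t] Nd] by simp
    then have "(\<theta> (single_Z ?t) \<ominus>\<^bsub>S\<^esub> \<one>\<^bsub>S\<^esub>) \<otimes>\<^bsub>S\<^esub> \<theta> (norm_elem d) = \<zero>\<^bsub>S\<^esub>"
      using \<theta>.hom_closed[OF single_Z_closed[OF t]] \<theta>.hom_closed[OF Nd]
      by (simp add: a_minus_def S.l_distr S.l_minus S.r_neg)
    moreover have "\<theta> (single_Z ?t) \<noteq> \<one>\<^bsub>S\<^esub>"
    proof
      assume "\<theta> (single_Z ?t) = \<one>\<^bsub>S\<^esub>"
      then have "\<theta> (single_Z ?t) = \<theta> (single_Z (mod1 0))" using \<theta>.hom_one by (simp add: ZGp_one)
      then have "frac1 d 1 = frac1 d 0" using inj_onD[OF inj] t by fastforce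
      then show False using inj_onD[OF inj_frac1[OF d(1)], of 1 0] that by simp
    qed
    then have "\<theta> (single_Z ?t) \<ominus>\<^bsub>S\<^esub> \<one>\<^bsub>S\<^esub> \<noteq> \<zero>\<^bsub>S\<^esub>"
      using \<theta>.hom_closed[OF single_Z_closed[OF t]] by simp
    ultimately show ?thesis
      using \<theta>.hom_closed[OF single_Z_closed[OF t]] \<theta>.hom_closed[OF Nd] S.integral_iff by simp
  qed
  define c where "c = \<Prod>{d. d dvd n \<and> d \<ge> 2}"
  have "\<theta> f \<otimes>\<^bsub>S\<^esub> \<theta> (ga_single type_ring (mod1 0) (of_nat c)) = \<zero>\<^bsub>S\<^esub>"
    unfolding c_def
    by (rule Z.vanishing_imp_annihilated[OF f(1) n(1,3) torsion_subset_Gp[OF n(1,2)] ev S.cring_axioms \<theta> norm])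
  moreover have "\<theta> (ga_single type_ring (mod1 0) (int c)) = add_pow S c \<one>\<^bsub>S\<^esub>"
  proof -
    have "\<theta> (ga_single type_ring (mod1 0) (int c)) = add_pow S (int c) \<one>\<^bsub>S\<^esub>"
      by (rule add_pow_one_hom[OF Z.A.ring_axioms S.ring_axioms \<theta>, of "int c", unfolded single_Z_const])
    also have "\<dots> = add_pow S (nat (int c)) \<one>\<^bsub>S\<^esub>" by (rule add_pow_int_ge) (rule of_nat_0_le_iff)
    finally show ?thesis unfolding nat_int .
  qed
  moreover have "add_pow S c \<one>\<^bsub>S\<^esub> \<noteq> \<zero>\<^bsub>S\<^esub>"
  proof (rule char)
    show "c > 0" unfolding c_def by (rule prod_pos) auto
    show "coprime c p" unfolding c_def
      by (rule prod_coprime_left) (use n(2) coprime_divisors[of _ n p p] in auto)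
  qed
  ultimately show ?thesis using \<theta>.hom_closed[OF f(1)] S.integral_iff by simp
qed

section \<open>The algebra \<open>\<A>\<close>\<close>

lemma residue_ring_simps:
  "carrier (residue_ring m) = {0..m - 1}" "\<zero>\<^bsub>residue_ring m\<^esub> = 0" "\<one>\<^bsub>residue_ring m\<^esub> = 1"
  "x \<oplus>\<^bsub>residue_ring m\<^esub> y = (x + y) mod m" "x \<otimes>\<^bsub>residue_ring m\<^esub> y = (x * y) mod m"
  by (simp_all add: residue_ring_def)

context
  fixes p :: nat
  assumes p: "p > 1"
begin

interpretation residues "int p" "residue_ring (int p)"
  using p by unfold_locales simp

lemma carrier_FpGp: "carrier (FpGp p) = red_mod p ` carrier (ZGp p)"
proof
  show "red_mod p ` carrier (ZGp p) \<subseteq> carrier (FpGp p)"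
  proof
    fix h assume "h \<in> red_mod p ` carrier (ZGp p)"
    then obtain f where f: "f \<in> carrier (ZGp p)" and h: "h = (\<lambda>x. f x mod int p)" by (auto simp: red_mod_def)
    have "finite {x. h x \<noteq> 0}"
      by (rule finite_subset[of _ "{x. f x \<noteq> 0}"]) (use f in \<open>auto simp: h ZGp_ga ga_type_carrier\<close>)
    then show "h \<in> carrier (FpGp p)"
      using p f by (simp add: h FpGp_def group_algebra_def residue_ring_simps ZGp_ga ga_type_carrier)
  qed
  show "carrier (FpGp p) \<subseteq> red_mod p ` carrier (ZGp p)"
  proof
    fix f assume f: "f \<in> carrier (FpGp p)"
    then have "f x \<in> {0..int p - 1}" for x
      using p by (cases "x \<in> Gp p") (auto simp: FpGp_def group_algebra_def residue_ring_simps)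
    then have "red_mod p f = f" by (auto simp: red_mod_def)
    moreover have "f \<in> carrier (ZGp p)"
      using f by (auto simp: FpGp_def group_algebra_def residue_ring_simps ZGp_ga ga_type_carrier)
    ultimately show "f \<in> red_mod p ` carrier (ZGp p)" by (metis image_eqI)
  qed
qed

lemma FpGp_add: "red_mod p (f \<oplus>\<^bsub>ZGp p\<^esub> g) = red_mod p f \<oplus>\<^bsub>FpGp p\<^esub> red_mod p g"
  by (simp add: red_mod_def FpGp_def group_algebra_def residue_ring_simps ZGp_add mod_add_eq)

lemma FpGp_one: "red_mod p \<one>\<^bsub>ZGp p\<^esub> = \<one>\<^bsub>FpGp p\<^esub>"
  using p by (auto simp: red_mod_def FpGp_def group_algebra_def residue_ring_simps ZGp_one ga_single_def one_QmodZ)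

lemma FpGp_mult:
  assumes "f \<in> carrier (ZGp p)" "g \<in> carrier (ZGp p)"
  shows "red_mod p (f \<otimes>\<^bsub>ZGp p\<^esub> g) = red_mod p f \<otimes>\<^bsub>FpGp p\<^esub> red_mod p g"
proof
  fix x
  let ?T = "{y. f y mod int p \<noteq> 0}" and ?i = "\<lambda>y. inv\<^bsub>QmodZ_prime_to p\<^esub> y \<otimes>\<^bsub>QmodZ\<^esub> x"
  have fin: "finite {y. f y \<noteq> 0}" "?T \<subseteq> {y. f y \<noteq> 0}" using assms(1) by (auto simp: ZGp_ga ga_type_carrier)
  show "red_mod p (f \<otimes>\<^bsub>ZGp p\<^esub> g) x = (red_mod p f \<otimes>\<^bsub>FpGp p\<^esub> red_mod p g) x"
  proof (cases "x \<in> Gp p")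
    case False
    then show ?thesis
      by (simp add: red_mod_def FpGp_def group_algebra_def residue_ring_simps ZGp_ga Z.G.ga_type_mult)
  next
    case True
    have "(red_mod p f \<otimes>\<^bsub>FpGp p\<^esub> red_mod p g) x =
      (\<Oplus>\<^bsub>residue_ring (int p)\<^esub>y\<in>?T. ((f y mod int p) * (g (?i y) mod int p)) mod int p)"
      using True by (simp add: red_mod_def FpGp_def group_algebra_def residue_ring_simps)
    also have "\<dots> = (\<Sum>y\<in>?T. (f y mod int p) * (g (?i y) mod int p)) mod int p"
      using finite_subset[OF fin(2,1)] by (rule sum_cong)
    also have "\<dots> = (\<Sum>y\<in>{y. f y \<noteq> 0}. (f y mod int p) * (g (?i y) mod int p)) mod int p"
      using fin by (intro arg_cong[of _ _ "\<lambda>a. a mod int p"] sum.mono_neutral_left) auto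
    also have "\<dots> = (\<Sum>y\<in>{y. f y \<noteq> 0}. f y * g (?i y)) mod int p"
      by (subst mod_sum_eq[symmetric]) (simp add: mod_mult_eq mod_sum_eq)
    also have "\<dots> = red_mod p (f \<otimes>\<^bsub>ZGp p\<^esub> g) x"
      using True by (simp add: red_mod_def ZGp_ga Z.G.ga_type_mult)
    finally show ?thesis by simp
  qed
qed

lemma ring_hom_red_mod: "red_mod p \<in> ring_hom (ZGp p) (FpGp p)"
  by (rule ring_hom_memI) (auto simp: FpGp_add FpGp_mult FpGp_one carrier_FpGp)

lemma cring_FpGp: "cring (FpGp p)"
proof -
  have zero: "red_mod p \<zero>\<^bsub>ZGp p\<^esub> = \<zero>\<^bsub>FpGp p\<^esub>"
    by (simp add: red_mod_def ZGp_zero FpGp_def group_algebra_def residue_ring_simps)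
  have "ring (FpGp p \<lparr>carrier := red_mod p ` carrier (ZGp p), zero := red_mod p \<zero>\<^bsub>ZGp p\<^esub>\<rparr>)"
    by (rule Z.A.ring_hom_imp_img_ring[OF ring_hom_red_mod])
  then have "ring (FpGp p)" by (simp add: zero carrier_FpGp[symmetric])
  then interpret R: ring "FpGp p" .
  show ?thesis
  proof
    fix x y assume "x \<in> carrier (FpGp p)" "y \<in> carrier (FpGp p)"
    then obtain f g where "f \<in> carrier (ZGp p)" "g \<in> carrier (ZGp p)" "x = red_mod p f" "y = red_mod p g"
      by (auto simp: carrier_FpGp)
    then show "x \<otimes>\<^bsub>FpGp p\<^esub> y = y \<otimes>\<^bsub>FpGp p\<^esub> x" by (simp flip: FpGp_mult add: Z.A.m_comm)
  qed
qed

lemma delta_kernel_ideal: "ideal (a_kernel (ZGp p) Qcyc delta) (ZGp p)"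
  by (rule ring_hom_ring.kernel_is_ideal) (rule ring_hom_ringI2[OF Z.A.ring_axioms Qcyc.ring_axioms ring_hom_delta])

lemma mem_delta_kernel: "f \<in> a_kernel (ZGp p) Qcyc delta \<longleftrightarrow> f \<in> carrier (ZGp p) \<and> delta f = \<zero>\<^bsub>Qcyc\<^esub>"
  by (simp add: a_kernel_def')

lemma ideal_J_mod: "ideal (J_mod p) (FpGp p)"
proof -
  interpret R: cring "FpGp p" by (rule cring_FpGp)
  interpret K: ideal "a_kernel (ZGp p) Qcyc delta" "ZGp p" by (rule delta_kernel_ideal)
  interpret h: ring_hom_ring "ZGp p" "FpGp p" "red_mod p"
    by (rule ring_hom_ringI2[OF Z.A.ring_axioms R.ring_axioms ring_hom_red_mod])
  show ?thesis
  proof (rule idealI)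
    show "subgroup (J_mod p) (add_monoid (FpGp p))"
      unfolding J_mod_def by (rule h.img_is_add_subgroup) (rule K.a_subgroup)
    fix a x assume "a \<in> J_mod p" "x \<in> carrier (FpGp p)"
    then obtain k g where kg: "k \<in> a_kernel (ZGp p) Qcyc delta" "a = red_mod p k" "g \<in> carrier (ZGp p)" "x = red_mod p g"
      by (auto simp: J_mod_def carrier_FpGp)
    then have "x \<otimes>\<^bsub>FpGp p\<^esub> a = red_mod p (g \<otimes>\<^bsub>ZGp p\<^esub> k)" "a \<otimes>\<^bsub>FpGp p\<^esub> x = red_mod p (k \<otimes>\<^bsub>ZGp p\<^esub> g)"
      using K.a_Hcarr by (auto simp: FpGp_mult)
    then show "x \<otimes>\<^bsub>FpGp p\<^esub> a \<in> J_mod p" "a \<otimes>\<^bsub>FpGp p\<^esub> x \<in> J_mod p"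
      using K.I_l_closed[OF kg(1,3)] K.I_r_closed[OF kg(1,3)] by (auto simp: J_mod_def)
  qed (rule R.ring_axioms)
qed

text \<open>
  The projection from \<open>\<int>[G]\<close> to \<open>\<A>\<close>. Its kernel is generated by \<open>p\<close> and the kernel of \<open>\<delta>\<close>; with it, elements of
  \<open>\<A>\<close> are handled by integral representatives.
\<close>

definition proj :: "(rat set \<Rightarrow> int) \<Rightarrow> (rat set \<Rightarrow> int) set" where
  "proj f = J_mod p +>\<^bsub>FpGp p\<^esub> red_mod p f"

lemma cring_A_alg: "cring (A_alg p)"
  unfolding A_alg_def by (rule ideal.quotient_is_cring[OF ideal_J_mod cring_FpGp])

lemma ring_hom_proj: "proj \<in> ring_hom (ZGp p) (A_alg p)"
proof -
  have "(\<lambda>x. J_mod p +>\<^bsub>FpGp p\<^esub> x) \<circ> red_mod p \<in> ring_hom (ZGp p) (A_alg p)"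
    unfolding A_alg_def by (rule ring_hom_trans[OF ring_hom_red_mod ideal.rcos_ring_hom[OF ideal_J_mod]])
  moreover have "proj = (\<lambda>x. J_mod p +>\<^bsub>FpGp p\<^esub> x) \<circ> red_mod p" by (auto simp: proj_def)
  ultimately show ?thesis by simp
qed

lemma carrier_A_alg: "carrier (A_alg p) = proj ` carrier (ZGp p)"
  by (auto simp: A_alg_def FactRing_def A_RCOSETS_def' carrier_FpGp proj_def)

lemma proj_kills: "f \<in> carrier (ZGp p) \<Longrightarrow> delta f = \<zero>\<^bsub>Qcyc\<^esub> \<Longrightarrow> proj f = \<zero>\<^bsub>A_alg p\<^esub>"
proof -
  assume "f \<in> carrier (ZGp p)" "delta f = \<zero>\<^bsub>Qcyc\<^esub>"
  then have mem: "red_mod p f \<in> J_mod p" by (auto simp: J_mod_def mem_delta_kernel)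
  interpret J: ideal "J_mod p" "FpGp p" by (rule ideal_J_mod)
  show ?thesis using J.a_rcos_const[OF mem] by (simp add: proj_def A_alg_def FactRing_def)
qed

lemma A_alg_char: "add_pow (A_alg p) p \<one>\<^bsub>A_alg p\<^esub> = \<zero>\<^bsub>A_alg p\<^esub>"
proof -
  interpret A: cring "A_alg p" by (rule cring_A_alg)
  have "add_pow (A_alg p) (int p) \<one>\<^bsub>A_alg p\<^esub> = proj (ga_single type_ring (mod1 0) (int p))"
    using add_pow_one_hom[OF Z.A.ring_axioms A.ring_axioms ring_hom_proj, of "int p"] by (simp add: single_Z_const)
  also have "\<dots> = proj \<zero>\<^bsub>ZGp p\<^esub>"
    by (auto simp: proj_def red_mod_def ga_single_def ZGp_zero intro!: arg_cong[of _ _ "\<lambda>x. J_mod p +>\<^bsub>FpGp p\<^esub> x"])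
  also have "\<dots> = \<zero>\<^bsub>A_alg p\<^esub>"
    by (rule ring_hom_zero[OF ring_hom_proj Z.A.ring_axioms A.ring_axioms])
  finally show ?thesis by (simp add: add_pow_int_ge)
qed

text \<open>
  Two representatives of a class differ by the sum of an element of the kernel of \<open>\<delta>\<close> and a multiple of \<open>p\<close>.
\<close>

lemma proj_eq_imp:
  assumes S: "ring S" and \<theta>: "\<theta> \<in> ring_hom (ZGp p) S"
    and kills: "\<And>f. f \<in> carrier (ZGp p) \<Longrightarrow> delta f = \<zero>\<^bsub>Qcyc\<^esub> \<Longrightarrow> \<theta> f = \<zero>\<^bsub>S\<^esub>"
    and char: "add_pow S p \<one>\<^bsub>S\<^esub> = \<zero>\<^bsub>S\<^esub>"
    and f: "f \<in> carrier (ZGp p)" and g: "g \<in> carrier (ZGp p)" and eq: "proj f = proj g"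
  shows "\<theta> f = \<theta> g"
proof -
  interpret R: cring "FpGp p" by (rule cring_FpGp)
  interpret S: ring S by (rule S)
  interpret J: ideal "J_mod p" "FpGp p" by (rule ideal_J_mod)
  interpret \<theta>: ring_hom_ring "ZGp p" S \<theta> by (rule ring_hom_ringI2[OF Z.A.ring_axioms S \<theta>])
  interpret h: ring_hom_ring "ZGp p" "FpGp p" "red_mod p"
    by (rule ring_hom_ringI2[OF Z.A.ring_axioms R.ring_axioms ring_hom_red_mod])
  have "red_mod p f \<ominus>\<^bsub>FpGp p\<^esub> red_mod p g \<in> J_mod p"
    using eq J.a_rcos_eq_iff f g by (simp add: proj_def)
  then have "red_mod p (f \<ominus>\<^bsub>ZGp p\<^esub> g) \<in> J_mod p" using f g by (simp add: a_minus_def)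
  then obtain k where k: "k \<in> carrier (ZGp p)" "delta k = \<zero>\<^bsub>Qcyc\<^esub>" "red_mod p (f \<ominus>\<^bsub>ZGp p\<^esub> g) = red_mod p k"
    by (auto simp: J_mod_def mem_delta_kernel)
  define d where "d = f \<ominus>\<^bsub>ZGp p\<^esub> g \<ominus>\<^bsub>ZGp p\<^esub> k"
  have d: "d \<in> carrier (ZGp p)" using f g k by (simp add: d_def)
  have "red_mod p d = \<zero>\<^bsub>FpGp p\<^esub>"
    unfolding d_def using f g k by (simp add: a_minus_def R.r_neg)
  then have "int p dvd d x" for x
    by (metis (mono_tags) mod_0_imp_dvd red_mod_def h.hom_zero ZGp_zero mod_0)
  then have dx: "d x = int p * (d x div int p)" for x by simp
  define q where "q = (\<lambda>x. d x div int p)"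
  have q: "q \<in> carrier (ZGp p)"
    using d by (auto simp: q_def ZGp_ga ga_type_carrier intro: finite_subset[of "{x. d x div int p \<noteq> 0}" "{x. d x \<noteq> 0}"])
  have "d = ga_single type_ring (mod1 0) (int p) \<otimes>\<^bsub>ZGp p\<^esub> q"
  proof
    fix x
    have "{y. ga_single type_ring (mod1 0) (int p) y \<noteq> 0} = {mod1 0}"
      using p by (auto simp: ga_single_def)
    moreover have "inv\<^bsub>QmodZ_prime_to p\<^esub> mod1 0 = mod1 0"
      using Z.G.inv_one by (simp add: one_QmodZ)
    ultimately have "(ga_single type_ring (mod1 0) (int p) \<otimes>\<^bsub>ZGp p\<^esub> q) x = (if x \<in> Gp p then int p * q x else 0)"
      unfolding ZGp_ga Z.G.ga_type_mult using Z.G.l_one[of x p] by (simp add: ga_single_def one_QmodZ)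
    also have "\<dots> = d x"
      using dx[of x] d by (auto simp: q_def ZGp_ga ga_type_carrier)
    finally show "d x = (ga_single type_ring (mod1 0) (int p) \<otimes>\<^bsub>ZGp p\<^esub> q) x" by simp
  qed
  moreover have "\<theta> (ga_single type_ring (mod1 0) (int p)) = \<zero>\<^bsub>S\<^esub>"
    using add_pow_one_hom[OF Z.A.ring_axioms S \<theta>, of "int p"] char by (simp add: single_Z_const add_pow_int_ge)
  ultimately have "\<theta> d = \<zero>\<^bsub>S\<^esub>" using q by simp
  moreover have "\<theta> d = \<theta> f \<ominus>\<^bsub>S\<^esub> \<theta> g"
    unfolding d_def using f g k kills[of k] by (simp add: a_minus_def)
  ultimately show ?thesis using f g by simp
qed

end

section \<open>Frobenius and roots of unity\<close>

lemma (in cring) binomial: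
  assumes a: "a \<in> carrier R" and b: "b \<in> carrier R"
  shows "(a \<oplus> b) [^] n = (\<Oplus>k\<in>{..n}. add_pow R (n choose k) (a [^] k \<otimes> b [^] (n - k)))"
proof (induction n)
  case 0
  show ?case by simp
next
  case (Suc n)
  define F where "F = (\<lambda>k. add_pow R (n choose k) (a [^] k \<otimes> b [^] (n - k)))"
  define g where "g = (\<lambda>k. add_pow R (if k = 0 then 0 else n choose (k - 1)) (a [^] k \<otimes> b [^] (Suc n - k)))"
  define h where "h = (\<lambda>k. add_pow R (n choose k) (a [^] k \<otimes> b [^] (Suc n - k)))"
  have cl: "F k \<in> carrier R" "g k \<in> carrier R" "h k \<in> carrier R" for k
    using a b by (simp_all add: F_def g_def h_def)
  have "(\<Oplus>k\<in>{..n}. F k) \<otimes> a = (\<Oplus>k\<in>{..n}. g (Suc k)) \<oplus> g 0"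
  proof -
    have "a [^] k \<otimes> b [^] (n - k) \<otimes> a = a [^] Suc k \<otimes> b [^] (n - k)" for k
      using a b by (simp add: m_ac)
    then have "F k \<otimes> a = g (Suc k)" if "k \<le> n" for k
      using a b that by (simp add: F_def g_def add_pow_ldistr)
    then have "(\<Oplus>k\<in>{..n}. F k) \<otimes> a = (\<Oplus>k\<in>{..n}. g (Suc k))"
      using a cl by (subst finsum_ldistr) (auto intro!: finsum_cong')
    moreover have "g 0 = \<zero>" by (simp add: g_def)
    ultimately show ?thesis using cl by simp
  qed
  also have "\<dots> = (\<Oplus>k\<in>{..Suc n}. g k)" using cl by (subst finsum_Suc2) auto
  finally have 1: "(\<Oplus>k\<in>{..n}. F k) \<otimes> a = (\<Oplus>k\<in>{..Suc n}. g k)" .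
  have "(\<Oplus>k\<in>{..n}. F k) \<otimes> b = (\<Oplus>k\<in>{..n}. h k)"
  proof -
    have "F k \<otimes> b = h k" if "k \<le> n" for k
      using a b that by (simp add: F_def h_def add_pow_ldistr m_assoc Suc_diff_le)
    then show ?thesis
      using b cl by (subst finsum_ldistr) (auto intro!: finsum_cong')
  qed
  also have "\<dots> = (\<Oplus>k\<in>{..Suc n}. h k)"
  proof -
    have "h (Suc n) = \<zero>" by (simp add: h_def binomial_eq_0)
    then show ?thesis using cl by (subst finsum_Suc) auto
  qed
  finally have 2: "(\<Oplus>k\<in>{..n}. F k) \<otimes> b = (\<Oplus>k\<in>{..Suc n}. h k)" .
  have "(a \<oplus> b) [^] Suc n = (\<Oplus>k\<in>{..n}. F k) \<otimes> (a \<oplus> b)"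
    by (simp add: Suc.IH F_def)
  also have "\<dots> = (\<Oplus>k\<in>{..Suc n}. g k) \<oplus> (\<Oplus>k\<in>{..Suc n}. h k)"
    using a b cl by (simp add: r_distr 1 2 del: finsum_Suc)
  also have "\<dots> = (\<Oplus>k\<in>{..Suc n}. g k \<oplus> h k)"
    using cl by (intro finsum_addf[symmetric]) auto
  also have "\<dots> = (\<Oplus>k\<in>{..Suc n}. add_pow R (Suc n choose k) (a [^] k \<otimes> b [^] (Suc n - k)))"
  proof (rule finsum_cong')
    fix k assume "k \<in> {..Suc n}"
    show "g k \<oplus> h k = add_pow R (Suc n choose k) (a [^] k \<otimes> b [^] (Suc n - k))"
      using a b by (cases k) (simp_all add: g_def h_def add.nat_pow_mult)
  qed (use a b in auto)
  finally show ?case .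
qed

text \<open>
  The intermediate binomial coefficients are divisible by \<open>p\<close>. The factor \<open>a b\<close> is kept because congruences modulo
  \<open>p\<^sup>k\<close> are later raised to the power \<open>p\<close>: if \<open>b\<close> is divisible by \<open>p\<^sup>k\<close>, the correction term is divisible by
  \<open>p\<^sup>k\<^sup>+\<^sup>1\<close>.
\<close>

lemma (in cring) frobenius_add:
  assumes p: "Factorial_Ring.prime (p::nat)" and a: "a \<in> carrier R" and b: "b \<in> carrier R"
  shows "\<exists>t\<in>carrier R. (a \<oplus> b) [^] p = a [^] p \<oplus> b [^] p \<oplus> add_pow R p (a \<otimes> b \<otimes> t)"
proof -
  have p1: "p > 1" using p by (rule prime_gt_1_nat)
  define F where "F = (\<lambda>k. add_pow R (p choose k) (a [^] k \<otimes> b [^] (p - k)))"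
  have cl: "F k \<in> carrier R" for k using a b by (simp add: F_def)
  define I where "I = {add_pow R p (a \<otimes> b \<otimes> t) | t. t \<in> carrier R}"
  have F_I: "F k \<in> I" if k: "k \<in> {0<..<p}" for k
  proof -
    have "p dvd p choose k" using k p by (intro dvd_choose_prime) auto
    then obtain c where c: "p choose k = p * c" by (elim dvdE)
    have "a [^] k = a \<otimes> a [^] (k - 1)" "b [^] (p - k) = b \<otimes> b [^] (p - k - 1)"
      using k a b nat_pow_Suc2[of a "k - 1"] nat_pow_Suc2[of b "p - k - 1"] by (simp_all add: Suc_diff_Suc)
    then have "a [^] k \<otimes> b [^] (p - k) = a \<otimes> b \<otimes> (a [^] (k - 1) \<otimes> b [^] (p - k - 1))"
      using a b by (simp add: m_ac)
    then have "F k = add_pow R p (add_pow R c (a \<otimes> b \<otimes> (a [^] (k - 1) \<otimes> b [^] (p - k - 1))))"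
      using a b by (simp add: F_def c add.nat_pow_pow mult.commute)
    also have "\<dots> = add_pow R p (a \<otimes> b \<otimes> add_pow R c (a [^] (k - 1) \<otimes> b [^] (p - k - 1)))"
      using a b by (simp add: add_pow_rdistr)
    finally show ?thesis unfolding I_def using a b by auto
  qed
  have sum_I: "finsum R F T \<in> I" if "finite T" "\<And>k. k \<in> T \<Longrightarrow> F k \<in> I" for T
    using that
  proof (induction T rule: finite_induct)
    case empty
    show ?case unfolding I_def using a b by (auto intro!: exI[of _ \<zero>])
  next
    case (insert k T)
    have "F k \<in> I" "finsum R F T \<in> I" using insert by auto
    then obtain s t where "s \<in> carrier R" "F k = add_pow R p (a \<otimes> b \<otimes> s)"
      and "t \<in> carrier R" "finsum R F T = add_pow R p (a \<otimes> b \<otimes> t)" unfolding I_def by auto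
    then have "finsum R F (insert k T) = add_pow R p (a \<otimes> b \<otimes> (s \<oplus> t))"
      using insert cl a b by (simp add: r_distr add.nat_pow_distrib)
    then show ?case unfolding I_def using \<open>s \<in> _\<close> \<open>t \<in> _\<close> by auto
  qed
  have "finsum R F {0<..<p} \<in> I" by (rule sum_I) (simp_all add: F_I)
  then obtain t where t: "t \<in> carrier R" "finsum R F {0<..<p} = add_pow R p (a \<otimes> b \<otimes> t)"
    unfolding I_def by auto
  have "{..p} = insert p (insert 0 {0<..<p})" using p1 by auto
  then have "finsum R F {..p} = F p \<oplus> (F 0 \<oplus> finsum R F {0<..<p})"
    using p1 cl by simp
  also have "F p = a [^] p" using a by (simp add: F_def)
  also have "F 0 = b [^] p" using b by (simp add: F_def)
  finally have "(a \<oplus> b) [^] p = a [^] p \<oplus> b [^] p \<oplus> add_pow R p (a \<otimes> b \<otimes> t)"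
    using binomial[OF a b, of p] a b t by (simp add: F_def a_assoc)
  with t(1) show ?thesis by blast
qed

lemma (in cring) frobenius_add_subring:
  assumes S: "subring S R" and p: "Factorial_Ring.prime (p::nat)" and a: "a \<in> S" and b: "b \<in> S"
  shows "\<exists>t\<in>S. (a \<oplus> b) [^] p = a [^] p \<oplus> b [^] p \<oplus> add_pow R p (a \<otimes> b \<otimes> t)"
proof -
  interpret S: cring "R\<lparr>carrier := S\<rparr>" using subring_is_ring[OF S] subcring.intro subcringI' S subcring_iff
    by (metis subcring_iff subcringI' subringE(1))
  have pow: "x [^]\<^bsub>R\<lparr>carrier := S\<rparr>\<^esub> n = x [^] n" for x and n :: nat by (simp add: nat_pow_def)
  have add_pow: "add_pow (R\<lparr>carrier := S\<rparr>) n x = add_pow R n x" for x and n :: nat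
    by (simp add: add_pow_def nat_pow_def)
  show ?thesis using S.frobenius_add[OF p, of a b] a b by (simp add: pow add_pow)
qed

lemma (in cring) frobenius_char:
  assumes p: "Factorial_Ring.prime (p::nat)" and char: "add_pow R p \<one> = \<zero>"
    and a: "a \<in> carrier R" and b: "b \<in> carrier R"
  shows "(a \<oplus> b) [^] (p ^ m) = a [^] (p ^ m) \<oplus> b [^] (p ^ m)"
proof (induction m)
  case 0
  show ?case using a b by simp
next
  case (Suc m)
  have zero: "add_pow R p x = \<zero>" if "x \<in> carrier R" for x
    using add_pow_ldistr[of \<one> x p] char that by simp
  have frob: "(x \<oplus> y) [^] p = x [^] p \<oplus> y [^] p" if "x \<in> carrier R" "y \<in> carrier R" for x y
    using frobenius_add[OF p that] that zero by auto
  have "(a \<oplus> b) [^] (p ^ Suc m) = ((a \<oplus> b) [^] (p ^ m)) [^] p"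
    using a b by (simp add: nat_pow_pow mult.commute)
  also have "\<dots> = a [^] (p ^ Suc m) \<oplus> b [^] (p ^ Suc m)"
    using a b by (simp add: Suc.IH frob nat_pow_pow mult.commute)
  finally show ?case .
qed

lemma (in ring) eval_power_minus:
  assumes x: "x \<in> carrier R" and c: "c \<in> carrier R"
  shows "eval (\<one> # replicate n \<zero> @ [\<ominus> c]) x = x [^] Suc n \<ominus> c"
proof -
  have "eval (replicate n \<zero> @ [\<ominus> c]) x = \<ominus> c"
    using x c by (induction n) simp_all
  then show ?thesis using x c by (simp add: a_minus_def)
qed

lemma (in domain) power_minus_carrier:
  "c \<in> carrier R \<Longrightarrow> \<one> # replicate n \<zero> @ [\<ominus> c] \<in> carrier (poly_ring R)"
  by (auto simp: univ_poly_carrier[symmetric] polynomial_def)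

lemma (in field) card_roots_of_unity_le:
  assumes "n > 0"
  shows "finite {x \<in> carrier R. x [^] n = \<one>}" "card {x \<in> carrier R. x [^] n = \<one>} \<le> n"
proof -
  define P where "P = \<one> # replicate (n - 1) \<zero> @ [\<ominus> \<one>]"
  have P: "P \<in> carrier (poly_ring R)" unfolding P_def by (rule power_minus_carrier) simp
  have "x [^] n = \<one> \<longleftrightarrow> is_root P x" if "x \<in> carrier R" for x
    using that assms eval_power_minus[of x \<one> "n - 1"] by (simp add: is_root_def P_def)
  then have "{x \<in> carrier R. x [^] n = \<one>} = set_mset (roots P)"
    using roots_mem_iff_is_root[OF P] by (auto simp: is_root_def)
  moreover have "card (set_mset (roots P)) \<le> size (roots P)"
    by (metis mset_set_set_mset_msubset size_mset_mono size_mset_set)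
  moreover have "size (roots P) \<le> n"
    using size_roots_le_degree[OF P] assms by (simp add: P_def)
  ultimately show "finite {x \<in> carrier R. x [^] n = \<one>}" "card {x \<in> carrier R. x [^] n = \<one>} \<le> n"
    by simp_all
qed

lemma (in ring) add_pow_coprime:
  assumes char: "add_pow R p \<one> = \<zero>" and "coprime n p" "p > 1" and "\<one> \<noteq> \<zero>"
  shows "add_pow R (n::nat) \<one> \<noteq> \<zero>"
proof
  assume n: "add_pow R n \<one> = \<zero>"
  obtain a where "[n * a = Suc 0] (mod p)" using cong_solve_coprime_nat[OF assms(2)] by blast
  then have "n * a mod p = 1" using assms(3) by (simp add: cong_def)
  then have ab: "a * n = (n * a div p) * p + 1" by (metis div_mult_mod_eq mult.commute)
  define b where "b = n * a div p"
  have "add_pow R (a * n) \<one> = \<zero>" "add_pow R (b * p) \<one> = \<zero>"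
    by (metis add.nat_pow_pow add.nat_pow_one n char mult.commute one_closed)+
  then have "\<one> = \<zero>" unfolding ab b_def[symmetric] using add.nat_pow_mult[of \<one> "b * p" 1] by simp
  with assms(4) show False by simp
qed

lemma torsion_pow:
  assumes "n > 0" "r \<in> torsion n" "coprime n p"
  shows "single_Z r [^]\<^bsub>ZGp p\<^esub> n = \<one>\<^bsub>ZGp p\<^esub>"
proof -
  obtain j where j: "r = frac1 n j" using assms(2) by (auto simp: torsion_def)
  have G: "frac1 n k \<in> Gp p" for k using torsion_subset_Gp[OF assms(1,3)] frac1_in_torsion by blast
  have "single_Z r [^]\<^bsub>ZGp p\<^esub> k = single_Z (frac1 n (j * k))" for k
  proof (induction k)
    case 0
    show ?case by (simp add: ZGp_one)
  next
    case (Suc k)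
    then show ?case using single_mult[OF G G] assms(1)
      by (simp add: j frac1_mult del: of_nat_mult) (simp add: add.commute)
  qed
  moreover have "frac1 n (j * n) = mod1 0" using frac1_mod[OF assms(1), of "j * n"] by simp
  ultimately show ?thesis by (simp add: ZGp_one)
qed

section \<open>Quotient domains of the group algebra\<close>

text \<open>
  A quotient domain of \<open>\<A>\<close>, given by a surjection \<open>\<theta>\<close> from \<open>\<int>[G]\<close>. The instances are the quotients of \<open>\<A>\<close> by prime
  ideals, the residue field, and the fields constructed from elements of \<open>\<Sigma>\<^sub>p\<close>.
\<close>

locale residue_model = domain D for p :: nat and D (structure) and \<theta> +
  assumes p: "Factorial_Ring.prime p"
    and \<theta>: "\<theta> \<in> ring_hom (ZGp p) D"
    and surj: "\<theta> ` carrier (ZGp p) = carrier D"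
    and kills: "\<And>f. f \<in> carrier (ZGp p) \<Longrightarrow> delta f = \<zero>\<^bsub>Qcyc\<^esub> \<Longrightarrow> \<theta> f = \<zero>"
    and char: "add_pow D p \<one> = \<zero>"
begin

sublocale hom: ring_hom_cring "ZGp p" D \<theta>
  by (rule ring_hom_cringI[OF Z.A.cring_axioms cring_axioms]) (use \<theta> in auto)

lemma hom_pow: "f \<in> carrier (ZGp p) \<Longrightarrow> \<theta> (f [^]\<^bsub>ZGp p\<^esub> (n::nat)) = \<theta> f [^] n"
  by (induction n) simp_all

definition u :: "rat set \<Rightarrow> _" where "u r = \<theta> (single_Z r)"

lemma p1: "p > 1" using p by (rule prime_gt_1_nat)

lemma u_closed [simp]: "r \<in> Gp p \<Longrightarrow> u r \<in> carrier D"
  by (simp add: u_def)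

lemma u_mult: "r \<in> Gp p \<Longrightarrow> s \<in> Gp p \<Longrightarrow> u (r \<otimes>\<^bsub>QmodZ\<^esub> s) = u r \<otimes> u s"
  using hom.hom_mult[OF single_Z_closed single_Z_closed, of r s] by (simp add: u_def single_mult)

lemma u_one: "u (mod1 0) = \<one>"
  using hom.hom_one by (simp add: u_def ZGp_one)

lemma u_torsion: "n > 0 \<Longrightarrow> coprime n p \<Longrightarrow> r \<in> torsion n \<Longrightarrow> u r [^] n = \<one>"
  unfolding u_def
  using torsion_pow[of n r p] hom_pow[of "single_Z r" n] torsion_subset_Gp[of n p] by auto

text \<open>
  If \<open>r \<noteq> 0\<close> has denominator \<open>n\<close>, the element \<open>\<Sum>\<^bsub>j<n\<^esub> e(jr)\<close> is in the kernel of \<open>\<delta>\<close>, so its image vanishes. If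
  \<open>u r = 1\<close>, this image is the integer \<open>n\<close>, which is prime to the characteristic.
\<close>

lemma u_eq_one:
  assumes r: "r \<in> Gp p" and eq: "u r = \<one>"
  shows "r = mod1 0"
proof (rule ccontr)
  assume ne: "r \<noteq> mod1 0"
  obtain n where n: "n > 0" "coprime n p" "r \<in> torsion n" using r by (auto simp: Gp_eq)
  define f where "f = (\<Oplus>\<^bsub>ZGp p\<^esub>j\<in>{..<n}. single_Z r [^]\<^bsub>ZGp p\<^esub> j)"
  have f: "f \<in> carrier (ZGp p)" unfolding f_def using r by (intro Z.A.finsum_closed) auto
  have "eval_Z f = (\<Sum>j<n. chi r ^ j)"
  proof -
    interpret ev: ring_hom_cring "ZGp p" "type_ring :: complex ring" eval_Z
      by (rule ring_hom_cringI[OF Z.A.cring_axioms cring_type_ring])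
         (auto intro!: ring_hom_memI simp: Z.eval_mult Z.eval_add Z.eval_one)
    have pow: "eval_Z (single_Z r [^]\<^bsub>ZGp p\<^esub> j) = chi r ^ j" for j
      using r by (induction j) (simp_all add: Z.eval_one Z.eval_mult eval_Z_single mult.commute)
    show ?thesis unfolding f_def using r by (subst ev.hom_finsum) (auto simp: pow o_def)
  qed
  also have "\<dots> = 0"
  proof -
    have "chi r \<noteq> chi (mod1 0)"
      using inj_onD[OF inj_chi, of r "mod1 0"] ne subsetD[OF Z.H_subset r] by auto
    then have "chi r \<noteq> 1" by (simp add: chi_mod1)
    then show ?thesis using sum_powers_root_of_unity[OF chi_torsion[OF n(1,3)]] by simp
  qed
  finally have "\<theta> f = \<zero>" using f kills delta_eq_0_iff by simp
  moreover have "\<theta> f = add_pow D n \<one>"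
  proof -
    have "\<theta> f = (\<Oplus>j\<in>{..<n}. \<one>)"
      unfolding f_def using r eq
      by (subst hom.hom_finsum) (auto simp: hom_pow u_def o_def intro!: finsum_cong')
    also have "\<dots> = add_pow D n \<one>" by (simp add: add.finprod_const)
    finally show ?thesis .
  qed
  ultimately show False using add_pow_coprime[OF char n(2) p1] by simp
qed

lemma u_inj: "inj_on u (Gp p)"
proof (rule inj_onI)
  fix r s assume r: "r \<in> Gp p" and s: "s \<in> Gp p" and eq: "u r = u s"
  define t where "t = inv\<^bsub>QmodZ_prime_to p\<^esub> s"
  have t: "t \<in> Gp p" "s \<otimes>\<^bsub>QmodZ\<^esub> t = mod1 0"
    using Z.G.inv_closed[OF s] Z.G.r_inv[OF s] by (simp_all add: t_def one_QmodZ)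
  have "u (r \<otimes>\<^bsub>QmodZ\<^esub> t) = u (s \<otimes>\<^bsub>QmodZ\<^esub> t)" using r s t(1) eq by (simp add: u_mult)
  then have "r \<otimes>\<^bsub>QmodZ\<^esub> t = mod1 0" using r t u_one by (intro u_eq_one) simp_all
  then show "r = s" using t Z.G.r_cancel[OF _ r s t(1)] by simp
qed

text \<open>
  The elements fixed by some power of Frobenius are closed under sums, and the images of the group elements are
  among them, because \<open>p\<close> has finite order modulo an integer prime to \<open>p\<close>.
\<close>

lemma frobenius_periodic:
  assumes "d \<in> carrier D"
  shows "\<exists>m>0. d [^] (p ^ m) = d"
proof -
  have iterate: "a [^] (p ^ (m * k)) = a" if "a \<in> carrier D" "a [^] (p ^ m) = a" for a m k
  proof (induction k)
    case 0
    show ?case using that by simp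
  next
    case (Suc k)
    have "a [^] (p ^ (m * Suc k)) = (a [^] (p ^ m)) [^] (p ^ (m * k))"
      using that(1) by (simp add: nat_pow_pow power_add)
    then show ?case using that(2) Suc by simp
  qed
  obtain f where "f \<in> carrier (ZGp p)" "d = \<theta> f" using assms surj by auto
  moreover have "\<exists>m>0. \<theta> f [^] (p ^ m) = \<theta> f" if "f \<in> carrier (ZGp p)" for f
    using that
  proof (induction f rule: ZGp_induct)
    case zero
    show ?case by (intro exI[of _ 1]) (use p1 in \<open>simp add: nat_pow_zero\<close>)
  next
    case (single r)
    obtain n where n: "n > 0" "coprime n p" "r \<in> torsion n" using single by (auto simp: Gp_eq)
    have "[p ^ totient n = 1] (mod n)" using n(2) by (intro euler_theorem) (simp add: coprime_commute)
    then have "n dvd p ^ totient n - 1" by (rule cong_to_1_nat)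
    then obtain k where "p ^ totient n - 1 = n * k" by (elim dvdE)
    moreover have "p ^ totient n > 0" using p1 by simp
    ultimately have k: "p ^ totient n = 1 + n * k" by linarith
    have "u r [^] (1 + n * k) = u r"
      using single u_torsion[OF n] by (simp add: nat_pow_pow[symmetric])
    then show ?case using n(1) unfolding k[symmetric] u_def by (intro exI[of _ "totient n"]) simp
  next
    case (minus f)
    then obtain m where m: "m > 0" "\<theta> f [^] (p ^ m) = \<theta> f" by blast
    have cl: "\<theta> f \<in> carrier D" using minus by simp
    have "\<zero> = (\<theta> f \<oplus> \<ominus> \<theta> f) [^] (p ^ m)" using p1 cl by (simp add: r_neg nat_pow_zero)
    also have "\<dots> = \<theta> f \<oplus> (\<ominus> \<theta> f) [^] (p ^ m)" using cl frobenius_char[OF p char] m by simp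
    finally have "(\<ominus> \<theta> f) [^] (p ^ m) = \<ominus> \<theta> f"
      using cl by (metis a_inv_closed minus_equality minus_minus nat_pow_closed a_comm)
    with m(1) minus show ?case by auto
  next
    case (add f g)
    then obtain m k where m: "m > 0" "\<theta> f [^] (p ^ m) = \<theta> f" and k: "k > 0" "\<theta> g [^] (p ^ k) = \<theta> g" by blast
    have cl: "\<theta> f \<in> carrier D" "\<theta> g \<in> carrier D" using add by simp_all
    have "(\<theta> f \<oplus> \<theta> g) [^] (p ^ (m * k)) = \<theta> f \<oplus> \<theta> g"
      using cl iterate[OF cl(1) m(2), of k] iterate[OF cl(2) k(2), of m]
      by (simp add: frobenius_char[OF p char] mult.commute)
    then show ?case using m k add by (intro exI[of _ "m * k"]) simp
  qed
  ultimately show ?thesis by blast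
qed

lemma nonzero_root_of_unity:
  assumes "d \<in> carrier D" "d \<noteq> \<zero>"
  shows "\<exists>n>0. coprime n p \<and> d [^] n = \<one>"
proof -
  obtain m where m: "m > 0" "d [^] (p ^ m) = d" using frobenius_periodic assms(1) by blast
  define n where "n = p ^ m - 1"
  have pm: "p ^ m > 1" using p1 m(1) by (rule one_less_power)
  then have Suc: "Suc n = p ^ m" by (simp add: n_def)
  have "n > 0" using pm by (simp add: n_def)
  moreover have "coprime n p"
  proof -
    have "coprime n (Suc n)" by simp
    then show ?thesis unfolding Suc using m(1) by simp
  qed
  moreover have "d [^] n = \<one>"
  proof -
    have "d [^] n \<otimes> d = \<one> \<otimes> d" using m(2) assms(1) unfolding Suc[symmetric] by simp
    then show ?thesis using assms m_rcancel[of d "d [^] n" \<one>] by simp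
  qed
  ultimately show ?thesis by blast
qed

lemma field_D: "field D"
proof (rule cring_fieldI2)
  fix d assume d: "d \<in> carrier D" "d \<noteq> \<zero>"
  then obtain n :: nat where "n > 0" "d [^] n = \<one>" using nonzero_root_of_unity by blast
  then have "d \<otimes> d [^] (n - 1) = \<one>" using d nat_pow_Suc2[of d "n - 1"] by simp
  then show "\<exists>b\<in>carrier D. d \<otimes> b = \<one>" using d by (intro bexI[of _ "d [^] (n - 1)"]) auto
qed (rule zero_not_one)

text \<open>
  The image of the \<open>n\<close> fractions with denominator \<open>n\<close> consists of \<open>n\<close> different roots of \<open>X\<^sup>n - 1\<close>, so it contains
  all of them.
\<close>

lemma u_surj:
  assumes "d \<in> carrier D" "d \<noteq> \<zero>"
  shows "\<exists>r\<in>Gp p. d = u r"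
proof -
  interpret F: field D by (rule field_D)
  obtain n where n: "n > 0" "coprime n p" "d [^] n = \<one>" using nonzero_root_of_unity assms by blast
  let ?M = "{x \<in> carrier D. x [^] n = \<one>}"
  have sub: "u ` torsion n \<subseteq> ?M" using torsion_subset_Gp[OF n(1,2)] u_torsion[OF n(1,2)] by auto
  have "card (u ` torsion n) = card (torsion n)"
    using torsion_subset_Gp[OF n(1,2)] u_inj by (intro card_image) (rule inj_on_subset)
  also have "\<dots> = n" using inj_frac1[OF n(1)] by (simp add: torsion_eq[OF n(1)] card_image)
  finally have "u ` torsion n = ?M"
    using F.card_roots_of_unity_le[OF n(1)] sub by (intro card_seteq) simp_all
  then have "d \<in> u ` torsion n" using assms n by simp
  then show ?thesis using torsion_subset_Gp[OF n(1,2)] by auto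
qed

lemma u_nonzero: "r \<in> Gp p \<Longrightarrow> u r \<noteq> \<zero>"
proof
  assume r: "r \<in> Gp p" "u r = \<zero>"
  obtain n where "n > 0" "coprime n p" "r \<in> torsion n" using r(1) by (auto simp: Gp_eq)
  then have "u r [^] n = \<one>" by (rule u_torsion)
  with r \<open>n > 0\<close> show False by (simp add: nat_pow_zero)
qed

end

section \<open>The permutation attached to a quotient domain\<close>

lemma root_nonzero: "r \<in> Gp p \<Longrightarrow> root r \<noteq> \<zero>\<^bsub>Qcyc\<^esub>"
proof
  assume r: "r \<in> Gp p" "root r = \<zero>\<^bsub>Qcyc\<^esub>"
  then have "chi r = 0" using emb_root[of r p] by simp
  then show False by (simp add: chi_def)
qed

lemma mu_closed: "x \<in> mu p \<Longrightarrow> x \<in> carrier Qcyc"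
  by (simp add: mu_def)

lemma mu_nonzero: "x \<in> mu p \<Longrightarrow> x \<noteq> \<zero>\<^bsub>Qcyc\<^esub>"
  using root_nonzero by (auto simp: mu_eq)

lemma mu_one: "\<one>\<^bsub>Qcyc\<^esub> \<in> mu p"
  unfolding mu_eq root_one[symmetric] by simp

lemma mu_mult: "x \<in> mu p \<Longrightarrow> y \<in> mu p \<Longrightarrow> x \<otimes>\<^bsub>Qcyc\<^esub> y \<in> mu p"
  by (auto simp: mu_eq root_mult)

lemma mu_Units: "x \<in> mu p \<Longrightarrow> x \<in> Units Qcyc"
  by (simp add: field.field_Units[OF field_Qcyc] mu_closed mu_nonzero)

lemma mu_inv: "x \<in> mu p \<Longrightarrow> inv\<^bsub>Qcyc\<^esub> x \<in> mu p"
proof -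
  assume "x \<in> mu p"
  then obtain r where r: "r \<in> Gp p" "x = root r" by (auto simp: mu_eq)
  define t where "t = inv\<^bsub>QmodZ_prime_to p\<^esub> r"
  have t: "t \<in> Gp p" "r \<otimes>\<^bsub>QmodZ\<^esub> t = mod1 0"
    using Z.G.inv_closed[OF r(1)] Z.G.r_inv[OF r(1)] by (simp_all add: t_def one_QmodZ)
  then have "x \<otimes>\<^bsub>Qcyc\<^esub> root t = \<one>\<^bsub>Qcyc\<^esub>" using r by (simp add: root_mult root_one)
  then have "inv\<^bsub>Qcyc\<^esub> x = root t"
    using r t Qcyc.m_comm[of x "root t"] by (intro Qcyc.inv_unique'[symmetric]) simp_all
  then show ?thesis using t by (auto simp: mu_eq)
qed

lemma mu0_closed: "x \<in> mu0 p \<Longrightarrow> x \<in> carrier Qcyc"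
  by (auto simp: mu0_def mu_closed)

lemma mu_mu0: "x \<in> mu p \<Longrightarrow> x \<in> mu0 p"
  by (simp add: mu0_def)

lemma zero_mu0: "\<zero>\<^bsub>Qcyc\<^esub> \<in> mu0 p"
  by (simp add: mu0_def)

lemma mu0_cases: "x \<in> mu0 p \<Longrightarrow> (x = \<zero>\<^bsub>Qcyc\<^esub> \<Longrightarrow> P) \<Longrightarrow> (x \<in> mu p \<Longrightarrow> P) \<Longrightarrow> P"
  by (auto simp: mu0_def)

lemma mu0_mult: "x \<in> mu p \<Longrightarrow> y \<in> mu0 p \<Longrightarrow> x \<otimes>\<^bsub>Qcyc\<^esub> y \<in> mu0 p"
  by (auto simp: mu0_def mu_mult mu_closed)

lemma mu_l_inv: "y \<in> mu p \<Longrightarrow> x \<in> carrier Qcyc \<Longrightarrow> inv\<^bsub>Qcyc\<^esub> y \<otimes>\<^bsub>Qcyc\<^esub> (y \<otimes>\<^bsub>Qcyc\<^esub> x) = x"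
  using Qcyc.m_assoc[of "inv\<^bsub>Qcyc\<^esub> y" y x] by (simp add: mu_closed mu_inv mu_Units)

lemma mu_r_inv: "y \<in> mu p \<Longrightarrow> x \<in> carrier Qcyc \<Longrightarrow> y \<otimes>\<^bsub>Qcyc\<^esub> (inv\<^bsub>Qcyc\<^esub> y \<otimes>\<^bsub>Qcyc\<^esub> x) = x"
  using Qcyc.m_assoc[of y "inv\<^bsub>Qcyc\<^esub> y" x] by (simp add: mu_closed mu_inv mu_Units)

text \<open>
  The exponent \<open>r\<close> of the root of unity \<open>\<delta>(e(r))\<close>.
\<close>

definition root_index :: "nat \<Rightarrow> (rat set \<Rightarrow> rat) set \<Rightarrow> rat set" where
  "root_index p x = (THE r. r \<in> Gp p \<and> root r = x)"

lemma root_index: "r \<in> Gp p \<Longrightarrow> root_index p (root r) = r"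
  unfolding root_index_def using root_inj[of p] by (intro the_equality) (auto dest: inj_onD)

definition mu0_lift :: "nat \<Rightarrow> (rat set \<Rightarrow> rat) set \<Rightarrow> rat set \<Rightarrow> int" where
  "mu0_lift p x = (if x = \<zero>\<^bsub>Qcyc\<^esub> then \<zero>\<^bsub>ZGp p\<^esub> else single_Z (root_index p x))"

context residue_model
begin

text \<open>
  The multiplicative bijection from \<open>{0} \<union> \<mu>\<close> to the domain that sends \<open>\<delta>(e(r))\<close> to \<open>\<theta>(e(r))\<close>.
\<close>

definition m :: "(rat set \<Rightarrow> rat) set \<Rightarrow> 'a" where
  "m x = (if x = \<zero>\<^bsub>Qcyc\<^esub> then \<zero> else u (root_index p x))"

lemma m_zero: "m \<zero>\<^bsub>Qcyc\<^esub> = \<zero>"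
  by (simp add: m_def)

lemma m_root: "r \<in> Gp p \<Longrightarrow> m (root r) = u r"
  by (simp add: m_def root_nonzero root_index)

lemma m_one: "m \<one>\<^bsub>Qcyc\<^esub> = \<one>"
  using m_root[of "mod1 0"] by (simp add: root_one u_one)

lemma m_closed: "x \<in> mu0 p \<Longrightarrow> m x \<in> carrier D"
  by (auto simp: mu0_def mu_eq m_zero m_root)

lemma m_bij: "bij_betw m (mu0 p) (carrier D)"
proof (rule bij_betw_imageI)
  show "inj_on m (mu0 p)"
  proof (rule inj_onI)
    fix x y assume xy: "x \<in> mu0 p" "y \<in> mu0 p" "m x = m y"
    show "x = y"
    proof (cases "x = \<zero>\<^bsub>Qcyc\<^esub> \<or> y = \<zero>\<^bsub>Qcyc\<^esub>")
      case True
      have "m z \<noteq> \<zero>" if "z \<in> mu p" for z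
        using that by (auto simp: mu_eq m_root u_nonzero)
      with True xy show ?thesis unfolding mu0_def by (metis insertE m_zero)
    next
      case False
      then obtain r s where "r \<in> Gp p" "s \<in> Gp p" "x = root r" "y = root s"
        using xy by (auto simp: mu0_def mu_eq)
      then show ?thesis using xy inj_onD[OF u_inj, of r s] by (simp add: m_root)
    qed
  qed
  show "m ` mu0 p = carrier D"
  proof
    show "m ` mu0 p \<subseteq> carrier D" using m_closed by auto
    show "carrier D \<subseteq> m ` mu0 p"
    proof
      fix d assume d: "d \<in> carrier D"
      show "d \<in> m ` mu0 p"
      proof (cases "d = \<zero>")
        case True
        then show ?thesis using m_zero zero_mu0 by (metis image_eqI)
      next
        case False
        then obtain r where "r \<in> Gp p" "d = u r" using d u_surj by blast
        then have "d = m (root r)" "root r \<in> mu0 p" by (auto simp: m_root mu0_def mu_eq)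
        then show ?thesis by blast
      qed
    qed
  qed
qed

lemma m_mult: "x \<in> mu p \<Longrightarrow> y \<in> mu0 p \<Longrightarrow> m (x \<otimes>\<^bsub>Qcyc\<^esub> y) = m x \<otimes> m y"
  by (auto simp: mu0_def mu_eq m_root m_zero u_mult root_mult)

lemma m_inv: "x \<in> mu p \<Longrightarrow> m x \<otimes> m (inv\<^bsub>Qcyc\<^esub> x) = \<one>"
  using m_mult[of x "inv\<^bsub>Qcyc\<^esub> x"] by (simp add: mu_mu0 mu_inv mu_Units m_one)

definition succ :: "(rat set \<Rightarrow> rat) set \<Rightarrow> (rat set \<Rightarrow> rat) set" where
  "succ = (\<lambda>x\<in>mu0 p. inv_into (mu0 p) m (m x \<oplus> \<one>))"

lemma succ:
  assumes "x \<in> mu0 p"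
  shows "succ x \<in> mu0 p" "m (succ x) = m x \<oplus> \<one>"
proof -
  have "m x \<oplus> \<one> \<in> m ` mu0 p" using m_bij m_closed[OF assms] by (simp add: bij_betw_def)
  then show "succ x \<in> mu0 p" "m (succ x) = m x \<oplus> \<one>"
    using assms by (simp_all add: succ_def inv_into_into f_inv_into_f)
qed

lemma m_eqI: "x \<in> mu0 p \<Longrightarrow> y \<in> mu0 p \<Longrightarrow> m x = m y \<Longrightarrow> x = y"
  using m_bij by (auto simp: bij_betw_def dest: inj_onD)

text \<open>
  The conjugate of \<open>succ\<close> by the multiplication by \<open>r\<close> is the transport of \<open>a \<mapsto> a + m r\<close>. So the conjugates of
  \<open>succ\<close> commute, and \<open>succ\<close> determines the addition of \<open>D\<close>.
\<close>

lemma succ_conj: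
  assumes r: "r \<in> mu p" and x: "x \<in> mu0 p"
  shows "m (r \<otimes>\<^bsub>Qcyc\<^esub> succ (inv\<^bsub>Qcyc\<^esub> r \<otimes>\<^bsub>Qcyc\<^esub> x)) = m x \<oplus> m r"
proof -
  have rx: "inv\<^bsub>Qcyc\<^esub> r \<otimes>\<^bsub>Qcyc\<^esub> x \<in> mu0 p" using r x by (simp add: mu0_mult mu_inv)
  have "m (r \<otimes>\<^bsub>Qcyc\<^esub> succ (inv\<^bsub>Qcyc\<^esub> r \<otimes>\<^bsub>Qcyc\<^esub> x)) = m r \<otimes> (m (inv\<^bsub>Qcyc\<^esub> r) \<otimes> m x \<oplus> \<one>)"
    using r x succ[OF rx] by (simp add: m_mult mu_inv)
  also have "\<dots> = (m r \<otimes> m (inv\<^bsub>Qcyc\<^esub> r)) \<otimes> m x \<oplus> m r"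
    using m_closed[OF mu_mu0[OF r]] m_closed[OF mu_mu0[OF mu_inv[OF r]]] m_closed[OF x]
    by (simp add: r_distr m_assoc)
  finally show ?thesis using r m_closed[OF x] by (simp add: m_inv)
qed

lemma succ_in_Sigma: "succ \<in> Sigma_set p"
proof -
  have cl: "m x \<in> carrier D" if "x \<in> mu0 p" for x using m_closed[OF that] .
  have bij: "bij_betw succ (mu0 p) (mu0 p)"
  proof (rule bij_betw_imageI)
    show "inj_on succ (mu0 p)"
    proof (rule inj_onI)
      fix x y assume xy: "x \<in> mu0 p" "y \<in> mu0 p" "succ x = succ y"
      then have "m x \<oplus> \<one> = m y \<oplus> \<one>" using succ by metis
      then show "x = y" using xy cl by (intro m_eqI) simp_all
    qed
    show "succ ` mu0 p = mu0 p"
    proof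
      show "succ ` mu0 p \<subseteq> mu0 p" using succ by auto
      show "mu0 p \<subseteq> succ ` mu0 p"
      proof
        fix y assume y: "y \<in> mu0 p"
        then have "m y \<ominus> \<one> \<in> m ` mu0 p" using m_bij cl by (simp add: bij_betw_def)
        then obtain x where x: "x \<in> mu0 p" "m x = m y \<ominus> \<one>" by auto
        then have "m (succ x) = m y" using succ(2)[OF x(1)] cl[OF y] by (simp add: a_minus_def a_assoc l_neg)
        then have "succ x = y" using x y succ by (intro m_eqI) auto
        then show "y \<in> succ ` mu0 p" using x by auto
      qed
    qed
  qed
  have comm: "succ (r \<otimes>\<^bsub>Qcyc\<^esub> succ (inv\<^bsub>Qcyc\<^esub> r \<otimes>\<^bsub>Qcyc\<^esub> x)) = r \<otimes>\<^bsub>Qcyc\<^esub> succ (inv\<^bsub>Qcyc\<^esub> r \<otimes>\<^bsub>Qcyc\<^esub> succ x)"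
    if r: "r \<in> mu p" and x: "x \<in> mu0 p" for r x
  proof -
    have 1: "r \<otimes>\<^bsub>Qcyc\<^esub> succ (inv\<^bsub>Qcyc\<^esub> r \<otimes>\<^bsub>Qcyc\<^esub> y) \<in> mu0 p" if "y \<in> mu0 p" for y
      using r that by (simp add: mu0_mult mu_inv succ)
    show ?thesis
      using 1[OF x] 1[OF succ(1)[OF x]] r x cl cl[OF mu_mu0[OF r]]
      by (intro m_eqI succ) (simp_all add: succ succ_conj a_ac)
  qed
  have "m (succ \<zero>\<^bsub>Qcyc\<^esub>) = m \<one>\<^bsub>Qcyc\<^esub>" by (simp add: succ zero_mu0 m_zero m_one)
  then have zero: "succ \<zero>\<^bsub>Qcyc\<^esub> = \<one>\<^bsub>Qcyc\<^esub>"
    by (intro m_eqI) (simp_all add: succ zero_mu0 mu_one mu_mu0)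
  have iter: "(succ ^^ k) x \<in> mu0 p \<and> m ((succ ^^ k) x) = m x \<oplus> add_pow D k \<one>" if x: "x \<in> mu0 p" for k x
  proof (induction k)
    case 0
    then show ?case using x cl by simp
  next
    case (Suc k)
    then show ?case using succ[of "(succ ^^ k) x"] cl[OF x] by (simp add: a_assoc)
  qed
  have "(succ ^^ p) x = x" if "x \<in> mu0 p" for x
    using iter[OF that, of p] that cl[OF that] by (intro m_eqI) (simp_all add: char)
  moreover have "succ \<in> extensional (mu0 p)" by (simp add: succ_def)
  ultimately show ?thesis
    unfolding Sigma_set_def using bij comm zero by simp
qed

lemma mu0_lift:
  assumes "x \<in> mu0 p"
  shows "mu0_lift p x \<in> carrier (ZGp p)" "\<theta> (mu0_lift p x) = m x"
  using assms by (auto simp: mu0_def mu_eq mu0_lift_def root_nonzero root_index m_def u_def)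

text \<open>
  The permutation can be read off from the kernel of \<open>\<theta>\<close>.
\<close>

lemma succ_eq_iff_kernel:
  assumes x: "x \<in> mu0 p" and y: "y \<in> mu0 p"
  shows "succ x = y \<longleftrightarrow> \<theta> (mu0_lift p x \<oplus>\<^bsub>ZGp p\<^esub> \<one>\<^bsub>ZGp p\<^esub> \<ominus>\<^bsub>ZGp p\<^esub> mu0_lift p y) = \<zero>"
proof -
  note cl = mu0_lift(1)[OF x] mu0_lift(1)[OF y]
  have "\<theta> (mu0_lift p x \<oplus>\<^bsub>ZGp p\<^esub> \<one>\<^bsub>ZGp p\<^esub> \<ominus>\<^bsub>ZGp p\<^esub> mu0_lift p y) = m x \<oplus> \<one> \<ominus> m y"
    using cl mu0_lift(2)[OF x] mu0_lift(2)[OF y] by (simp add: a_minus_def)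
  also have "\<dots> = \<zero> \<longleftrightarrow> m (succ x) = m y"
    using succ(2)[OF x] m_closed[OF x] m_closed[OF y] by simp
  also have "\<dots> \<longleftrightarrow> succ x = y" using m_eqI[OF succ(1)[OF x] y] by blast
  finally show ?thesis by blast
qed

lemma succ_outside: "x \<notin> mu0 p \<Longrightarrow> succ x = undefined"
  by (simp add: succ_def)

end

lemma kernel_eq_imp_succ_eq:
  assumes M: "residue_model p D \<theta>" and M': "residue_model p D' \<theta>'"
    and ker: "\<And>f. f \<in> carrier (ZGp p) \<Longrightarrow> \<theta> f = \<zero>\<^bsub>D\<^esub> \<longleftrightarrow> \<theta>' f = \<zero>\<^bsub>D'\<^esub>"
  shows "residue_model.succ p D \<theta> = residue_model.succ p D' \<theta>'"
proof
  fix x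
  show "residue_model.succ p D \<theta> x = residue_model.succ p D' \<theta>' x"
  proof (cases "x \<in> mu0 p")
    case False
    then show ?thesis using residue_model.succ_outside[OF M] residue_model.succ_outside[OF M'] by metis
  next
    case x: True
    let ?y = "residue_model.succ p D \<theta> x"
    have y: "?y \<in> mu0 p" by (rule residue_model.succ(1)[OF M x])
    have "mu0_lift p x \<oplus>\<^bsub>ZGp p\<^esub> \<one>\<^bsub>ZGp p\<^esub> \<ominus>\<^bsub>ZGp p\<^esub> mu0_lift p ?y \<in> carrier (ZGp p)"
      using residue_model.mu0_lift(1)[OF M x] residue_model.mu0_lift(1)[OF M y] by simp
    then show ?thesis
      using residue_model.succ_eq_iff_kernel[OF M x y] residue_model.succ_eq_iff_kernel[OF M' x y] ker by simp
  qed
qed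

text \<open>
  If the permutations agree, the bijection between the two domains that matches the images of the roots of unity
  is additive by \<open>succ_conj\<close>, and then compatible with \<open>\<theta>\<close> and \<open>\<theta>'\<close> on all of \<open>\<int>[G]\<close>.
\<close>

lemma succ_eq_imp_kernel_subset:
  assumes "residue_model p D \<theta>" "residue_model p D' \<theta>'"
    and eq: "residue_model.succ p D \<theta> = residue_model.succ p D' \<theta>'"
    and f: "f \<in> carrier (ZGp p)" "\<theta> f = \<zero>\<^bsub>D\<^esub>"
  shows "\<theta>' f = \<zero>\<^bsub>D'\<^esub>"
proof -
  interpret M: residue_model p D \<theta> by (rule assms(1))
  interpret M': residue_model p D' \<theta>' by (rule assms(2))
  define h where "h = (\<lambda>d. M'.m (inv_into (mu0 p) M.m d))"
  have h_m: "h (M.m x) = M'.m x" if "x \<in> mu0 p" for x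
    using that M.m_bij by (simp add: h_def bij_betw_def inv_into_f_f)
  have ex: "\<exists>x\<in>mu0 p. d = M.m x" if "d \<in> carrier D" for d
    using that M.m_bij by (auto simp: bij_betw_def)
  have h_hom: "h \<in> ring_hom D D'"
  proof (rule ring_hom_memI)
    fix a assume "a \<in> carrier D"
    then obtain x where x: "x \<in> mu0 p" "a = M.m x" using ex by blast
    then show "h a \<in> carrier D'" by (simp add: h_m M'.m_closed)
    fix b assume "b \<in> carrier D"
    then obtain y where y: "y \<in> mu0 p" "b = M.m y" using ex by blast
    show "h (a \<otimes>\<^bsub>D\<^esub> b) = h a \<otimes>\<^bsub>D'\<^esub> h b"
    proof (cases rule: mu0_cases[OF x(1)])
      case 1
      with x y show ?thesis
        using h_m[OF zero_mu0] by (simp add: M.m_zero M'.m_zero h_m M.m_closed M'.m_closed)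
    next
      case 2
      with x y show ?thesis by (simp add: h_m M.m_mult[symmetric] M'.m_mult[symmetric] mu0_mult)
    qed
    show "h (a \<oplus>\<^bsub>D\<^esub> b) = h a \<oplus>\<^bsub>D'\<^esub> h b"
    proof (cases rule: mu0_cases[OF y(1)])
      case 1
      with x y show ?thesis
        using h_m[OF zero_mu0] by (simp add: M.m_zero M'.m_zero h_m M.m_closed M'.m_closed)
    next
      case 2
      have cl: "y \<otimes>\<^bsub>Qcyc\<^esub> M.succ (inv\<^bsub>Qcyc\<^esub> y \<otimes>\<^bsub>Qcyc\<^esub> x) \<in> mu0 p"
        using 2 x by (simp add: mu0_mult mu_inv M.succ)
      have "h (a \<oplus>\<^bsub>D\<^esub> b) = M'.m (y \<otimes>\<^bsub>Qcyc\<^esub> M.succ (inv\<^bsub>Qcyc\<^esub> y \<otimes>\<^bsub>Qcyc\<^esub> x))"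
        unfolding x(2) y(2) M.succ_conj[OF 2 x(1), symmetric] by (rule h_m[OF cl])
      also have "\<dots> = M'.m x \<oplus>\<^bsub>D'\<^esub> M'.m y" unfolding eq by (rule M'.succ_conj[OF 2 x(1)])
      finally show ?thesis using x y by (simp add: h_m)
    qed
  next
    show "h \<one>\<^bsub>D\<^esub> = \<one>\<^bsub>D'\<^esub>" using h_m[OF mu_mu0[OF mu_one]] by (simp add: M.m_one M'.m_one)
  qed
  have h\<theta>: "h \<circ> \<theta> \<in> ring_hom (ZGp p) D'" by (rule ring_hom_trans[OF M.\<theta> h_hom])
  have singles: "(h \<circ> \<theta>) (single_Z r) = \<theta>' (single_Z r)" if r: "r \<in> Gp p" for r
  proof -
    have "root r \<in> mu0 p" using r by (auto simp: mu0_def mu_eq)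
    then have "h (M.m (root r)) = M'.m (root r)" by (rule h_m)
    then show ?thesis unfolding M.m_root[OF r] M'.m_root[OF r] M.u_def M'.u_def by (simp only: o_apply)
  qed
  have "(h \<circ> \<theta>) f = \<theta>' f"
    by (rule ZGp_hom_eqI[OF M'.ring_axioms h\<theta> M'.\<theta> singles f(1)])
  moreover have "h \<zero>\<^bsub>D\<^esub> = \<zero>\<^bsub>D'\<^esub>" using h_m[OF zero_mu0] by (simp add: M.m_zero M'.m_zero)
  ultimately show ?thesis using f(2) by simp
qed

section \<open>The field attached to an element of \<open>\<Sigma>\<^sub>p\<close>\<close>

text \<open>
  The addition is forced by \<open>x + y = y (x/y + 1)\<close> and \<open>x + 1 = s x\<close>.
\<close>

definition sigma_ring :: "nat \<Rightarrow> ((rat set \<Rightarrow> rat) set \<Rightarrow> (rat set \<Rightarrow> rat) set) \<Rightarrow> (rat set \<Rightarrow> rat) set ring" where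
  "sigma_ring p s = \<lparr>carrier = mu0 p, monoid.mult = monoid.mult Qcyc, one = \<one>\<^bsub>Qcyc\<^esub>, ring.zero = \<zero>\<^bsub>Qcyc\<^esub>,
     ring.add = (\<lambda>x y. if y = \<zero>\<^bsub>Qcyc\<^esub> then x else y \<otimes>\<^bsub>Qcyc\<^esub> s (inv\<^bsub>Qcyc\<^esub> y \<otimes>\<^bsub>Qcyc\<^esub> x))\<rparr>"

lemma sigma_ring_simps [simp]:
  "carrier (sigma_ring p s) = mu0 p" "x \<otimes>\<^bsub>sigma_ring p s\<^esub> y = x \<otimes>\<^bsub>Qcyc\<^esub> y"
  "\<one>\<^bsub>sigma_ring p s\<^esub> = \<one>\<^bsub>Qcyc\<^esub>" "\<zero>\<^bsub>sigma_ring p s\<^esub> = \<zero>\<^bsub>Qcyc\<^esub>"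
  by (simp_all add: sigma_ring_def)

lemma mu0_mult': "x \<in> mu0 p \<Longrightarrow> y \<in> mu0 p \<Longrightarrow> x \<otimes>\<^bsub>Qcyc\<^esub> y \<in> mu0 p"
  by (auto simp: mu0_def mu_mult mu_closed)

text \<open>
  Let \<open>T y\<close> be the conjugate of \<open>s\<close> by the multiplication by \<open>y\<close>, the translation by \<open>y\<close>. Translations commute by
  the third condition on \<open>s\<close>, and \<open>T y 0 = y\<close>. Hence \<open>x + y = T y (T x 0) = T x (T y 0) = y + x\<close>, and
  associativity is \<open>T z (T x y) = T x (T z y)\<close>.
\<close>

lemma domain_sigma_ring:
  assumes s: "s \<in> Sigma_set p"
  shows "domain (sigma_ring p s)"
proof -
  let ?S = "sigma_ring p s"
  have bij: "bij_betw s (mu0 p) (mu0 p)" and s0: "s \<zero>\<^bsub>Qcyc\<^esub> = \<one>\<^bsub>Qcyc\<^esub>"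
    and comm: "\<And>r x. r \<in> mu p \<Longrightarrow> x \<in> mu0 p \<Longrightarrow>
      s (r \<otimes>\<^bsub>Qcyc\<^esub> s (inv\<^bsub>Qcyc\<^esub> r \<otimes>\<^bsub>Qcyc\<^esub> x)) = r \<otimes>\<^bsub>Qcyc\<^esub> s (inv\<^bsub>Qcyc\<^esub> r \<otimes>\<^bsub>Qcyc\<^esub> s x)"
    using s by (auto simp: Sigma_set_def)
  have s_cl: "s x \<in> mu0 p" if "x \<in> mu0 p" for x using bij that by (auto simp: bij_betw_def)
  define T where "T = (\<lambda>y x. y \<otimes>\<^bsub>Qcyc\<^esub> s (inv\<^bsub>Qcyc\<^esub> y \<otimes>\<^bsub>Qcyc\<^esub> x))"
  have T_cl: "T y x \<in> mu0 p" if "y \<in> mu p" "x \<in> mu0 p" for x y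
    using that by (simp add: T_def mu0_mult mu_inv[of _ p] s_cl)
  have T_0: "T y \<zero>\<^bsub>Qcyc\<^esub> = y" if "y \<in> mu p" for y
    using that by (simp add: T_def s0 mu_closed[of _ p] mu_closed[OF mu_inv[of _ p]])
  have add: "x \<oplus>\<^bsub>?S\<^esub> y = (if y = \<zero>\<^bsub>Qcyc\<^esub> then x else T y x)" for x y
    by (simp add: sigma_ring_def T_def)
  have T_comm: "T y (T z x) = T z (T y x)" if y: "y \<in> mu p" and z: "z \<in> mu p" and x: "x \<in> mu0 p" for x y z
  proof -
    define r w where "r = inv\<^bsub>Qcyc\<^esub> y \<otimes>\<^bsub>Qcyc\<^esub> z" and "w = inv\<^bsub>Qcyc\<^esub> y \<otimes>\<^bsub>Qcyc\<^esub> x"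
    have c: "y \<in> carrier Qcyc" "z \<in> carrier Qcyc" "x \<in> carrier Qcyc" "inv\<^bsub>Qcyc\<^esub> y \<in> carrier Qcyc" "inv\<^bsub>Qcyc\<^esub> z \<in> carrier Qcyc"
      using y z x by (simp_all add: mu_closed[of _ p] mu0_closed[of _ p] mu_closed[OF mu_inv[of _ p]])
    have r: "r \<in> mu p" and w: "w \<in> mu0 p" using y z x by (simp_all add: r_def w_def mu_mult mu_inv[of _ p] mu0_mult)
    have inv_r: "inv\<^bsub>Qcyc\<^esub> r = inv\<^bsub>Qcyc\<^esub> z \<otimes>\<^bsub>Qcyc\<^esub> y"
    proof (rule Qcyc.inv_unique'[symmetric])
      show "r \<otimes>\<^bsub>Qcyc\<^esub> (inv\<^bsub>Qcyc\<^esub> z \<otimes>\<^bsub>Qcyc\<^esub> y) = \<one>\<^bsub>Qcyc\<^esub>"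
        using c y z by (simp add: r_def Qcyc.m_assoc mu_r_inv[of _ p] mu_Units[of _ p])
      then show "inv\<^bsub>Qcyc\<^esub> z \<otimes>\<^bsub>Qcyc\<^esub> y \<otimes>\<^bsub>Qcyc\<^esub> r = \<one>\<^bsub>Qcyc\<^esub>"
        using c r by (simp add: Qcyc.m_comm mu_closed[of _ p])
    qed (use c r in \<open>simp_all add: mu_closed[of _ p]\<close>)
    have yr: "y \<otimes>\<^bsub>Qcyc\<^esub> r = z" using y c by (simp add: r_def mu_r_inv[of _ p])
    have rw: "inv\<^bsub>Qcyc\<^esub> r \<otimes>\<^bsub>Qcyc\<^esub> w = inv\<^bsub>Qcyc\<^esub> z \<otimes>\<^bsub>Qcyc\<^esub> x"
      using c y by (simp add: inv_r w_def Qcyc.m_assoc mu_r_inv[of _ p])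
    have cl: "s (inv\<^bsub>Qcyc\<^esub> z \<otimes>\<^bsub>Qcyc\<^esub> x) \<in> carrier Qcyc" "s w \<in> carrier Qcyc"
      "s (inv\<^bsub>Qcyc\<^esub> z \<otimes>\<^bsub>Qcyc\<^esub> (y \<otimes>\<^bsub>Qcyc\<^esub> s w)) \<in> carrier Qcyc"
      using w y z x by (simp_all add: mu0_closed[of _ p] s_cl mu0_mult mu_inv[of _ p])
    have "T y (T z x) = y \<otimes>\<^bsub>Qcyc\<^esub> s (r \<otimes>\<^bsub>Qcyc\<^esub> s (inv\<^bsub>Qcyc\<^esub> r \<otimes>\<^bsub>Qcyc\<^esub> w))"
      using c cl by (simp add: T_def rw) (simp add: r_def Qcyc.m_assoc)
    also have "\<dots> = y \<otimes>\<^bsub>Qcyc\<^esub> (r \<otimes>\<^bsub>Qcyc\<^esub> s (inv\<^bsub>Qcyc\<^esub> z \<otimes>\<^bsub>Qcyc\<^esub> (y \<otimes>\<^bsub>Qcyc\<^esub> s w)))"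
      using c cl by (simp add: comm[OF r w]) (simp add: inv_r Qcyc.m_assoc)
    also have "\<dots> = (y \<otimes>\<^bsub>Qcyc\<^esub> r) \<otimes>\<^bsub>Qcyc\<^esub> s (inv\<^bsub>Qcyc\<^esub> z \<otimes>\<^bsub>Qcyc\<^esub> (y \<otimes>\<^bsub>Qcyc\<^esub> s w))"
      using c cl r by (simp add: Qcyc.m_assoc mu_closed[of _ p])
    also have "\<dots> = T z (T y x)" by (simp add: yr T_def w_def)
    finally show ?thesis .
  qed
  have add_cl: "x \<oplus>\<^bsub>?S\<^esub> y \<in> mu0 p" if "x \<in> mu0 p" "y \<in> mu0 p" for x y
    using that T_cl by (auto simp: add mu0_def)
  have add_0: "\<zero>\<^bsub>Qcyc\<^esub> \<oplus>\<^bsub>?S\<^esub> x = x" "x \<oplus>\<^bsub>?S\<^esub> \<zero>\<^bsub>Qcyc\<^esub> = x" if "x \<in> mu0 p" for x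
    using that T_0 by (auto simp: add mu0_def)
  have add_T: "x \<oplus>\<^bsub>?S\<^esub> y = T y x" if "y \<in> mu p" for x y
    using that mu_nonzero by (auto simp: add)
  have add_comm: "x \<oplus>\<^bsub>?S\<^esub> y = y \<oplus>\<^bsub>?S\<^esub> x" if x: "x \<in> mu0 p" and y: "y \<in> mu0 p" for x y
  proof (cases "x \<in> mu p \<and> y \<in> mu p")
    case True
    have "x \<oplus>\<^bsub>?S\<^esub> y = T y (T x \<zero>\<^bsub>Qcyc\<^esub>)" using True by (simp add: add_T T_0)
    also have "\<dots> = T x (T y \<zero>\<^bsub>Qcyc\<^esub>)" using True by (intro T_comm) (simp_all add: zero_mu0)
    finally show ?thesis using True by (simp add: add_T T_0)
  next
    case False
    then have "x = \<zero>\<^bsub>Qcyc\<^esub> \<or> y = \<zero>\<^bsub>Qcyc\<^esub>" using x y by (auto simp: mu0_def)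
    then show ?thesis using x y add_0 by auto
  qed
  have add_assoc: "(x \<oplus>\<^bsub>?S\<^esub> y) \<oplus>\<^bsub>?S\<^esub> z = x \<oplus>\<^bsub>?S\<^esub> (y \<oplus>\<^bsub>?S\<^esub> z)"
    if x: "x \<in> mu0 p" and y: "y \<in> mu0 p" and z: "z \<in> mu0 p" for x y z
  proof (cases "x \<in> mu p \<and> z \<in> mu p")
    case True
    have "(x \<oplus>\<^bsub>?S\<^esub> y) \<oplus>\<^bsub>?S\<^esub> z = T z (T x y)" using True add_comm[OF x y] by (simp add: add_T)
    also have "\<dots> = T x (T z y)" using True y by (intro T_comm) simp_all
    also have "\<dots> = (y \<oplus>\<^bsub>?S\<^esub> z) \<oplus>\<^bsub>?S\<^esub> x" using True by (simp add: add_T)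
    also have "\<dots> = x \<oplus>\<^bsub>?S\<^esub> (y \<oplus>\<^bsub>?S\<^esub> z)" using x y z by (intro add_comm add_cl)
    finally show ?thesis .
  next
    case False
    then have "x = \<zero>\<^bsub>Qcyc\<^esub> \<or> z = \<zero>\<^bsub>Qcyc\<^esub>" using x z by (auto simp: mu0_def)
    then show ?thesis using x y z add_0 add_cl by auto
  qed
  have distr: "(x \<oplus>\<^bsub>?S\<^esub> y) \<otimes>\<^bsub>Qcyc\<^esub> z = (x \<otimes>\<^bsub>Qcyc\<^esub> z) \<oplus>\<^bsub>?S\<^esub> (y \<otimes>\<^bsub>Qcyc\<^esub> z)"
    if x: "x \<in> mu0 p" and y: "y \<in> mu0 p" and z: "z \<in> mu0 p" for x y z
  proof (cases "y \<in> mu p \<and> z \<in> mu p")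
    case True
    have c: "x \<in> carrier Qcyc" "y \<in> carrier Qcyc" "z \<in> carrier Qcyc" "inv\<^bsub>Qcyc\<^esub> y \<in> carrier Qcyc"
      "s (inv\<^bsub>Qcyc\<^esub> y \<otimes>\<^bsub>Qcyc\<^esub> x) \<in> carrier Qcyc" "inv\<^bsub>Qcyc\<^esub> z \<in> carrier Qcyc"
      using True x by (simp_all add: mu_closed[of _ p] mu0_closed[of _ p] mu_closed[OF mu_inv[of _ p]] s_cl mu0_mult mu_inv)
    have "inv\<^bsub>Qcyc\<^esub> (y \<otimes>\<^bsub>Qcyc\<^esub> z) \<otimes>\<^bsub>Qcyc\<^esub> (x \<otimes>\<^bsub>Qcyc\<^esub> z) = inv\<^bsub>Qcyc\<^esub> y \<otimes>\<^bsub>Qcyc\<^esub> x"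
    proof -
      have "inv\<^bsub>Qcyc\<^esub> (y \<otimes>\<^bsub>Qcyc\<^esub> z) \<otimes>\<^bsub>Qcyc\<^esub> ((y \<otimes>\<^bsub>Qcyc\<^esub> z) \<otimes>\<^bsub>Qcyc\<^esub> (inv\<^bsub>Qcyc\<^esub> y \<otimes>\<^bsub>Qcyc\<^esub> x)) = inv\<^bsub>Qcyc\<^esub> y \<otimes>\<^bsub>Qcyc\<^esub> x"
        using True c by (intro mu_l_inv[of _ p]) (simp_all add: mu_mult)
      also have "(y \<otimes>\<^bsub>Qcyc\<^esub> z) \<otimes>\<^bsub>Qcyc\<^esub> (inv\<^bsub>Qcyc\<^esub> y \<otimes>\<^bsub>Qcyc\<^esub> x) = z \<otimes>\<^bsub>Qcyc\<^esub> (y \<otimes>\<^bsub>Qcyc\<^esub> (inv\<^bsub>Qcyc\<^esub> y \<otimes>\<^bsub>Qcyc\<^esub> x))"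
        using c by (simp add: Qcyc.m_ac)
      also have "\<dots> = x \<otimes>\<^bsub>Qcyc\<^esub> z" using True c mu_r_inv[of y p x] by (simp add: Qcyc.m_comm)
      finally show ?thesis .
    qed
    then show ?thesis using True c by (simp add: add_T mu_mult T_def Qcyc.m_ac)
  next
    case False
    then have "y = \<zero>\<^bsub>Qcyc\<^esub> \<or> z = \<zero>\<^bsub>Qcyc\<^esub>" using y z by (auto simp: mu0_def)
    then show ?thesis using x y z add_0 add_cl mu0_closed[of _ p] mu0_mult'[of x p z] zero_mu0 by auto
  qed
  have "cring ?S"
  proof (rule cringI)
    show "abelian_group ?S"
    proof (rule abelian_groupI)
      fix y assume "y \<in> carrier ?S"
      then have y: "y \<in> mu0 p" by simp
      have "\<exists>x\<in>mu0 p. x \<oplus>\<^bsub>?S\<^esub> y = \<zero>\<^bsub>Qcyc\<^esub>"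
      proof (cases "y \<in> mu p")
        case True
        obtain w where w: "w \<in> mu0 p" "s w = \<zero>\<^bsub>Qcyc\<^esub>"
          using bij zero_mu0[of p] by (auto simp: bij_betw_def) (metis imageE)
        have "(y \<otimes>\<^bsub>Qcyc\<^esub> w) \<oplus>\<^bsub>?S\<^esub> y = \<zero>\<^bsub>Qcyc\<^esub>"
          using True w mu0_closed[of w p] mu_closed[of y p] by (simp add: add_T T_def mu_l_inv[of _ p])
        then show ?thesis using True w mu0_mult by blast
      next
        case False
        then show ?thesis using y add_0[OF zero_mu0] zero_mu0 by (auto simp: mu0_def)
      qed
      then show "\<exists>x\<in>carrier ?S. x \<oplus>\<^bsub>?S\<^esub> y = \<zero>\<^bsub>?S\<^esub>" by simp
    qed (use add_cl add_comm add_assoc add_0 zero_mu0 in auto)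
    show "Group.comm_monoid ?S"
    proof (rule comm_monoidI)
      fix x y z assume "x \<in> carrier ?S" "y \<in> carrier ?S" "z \<in> carrier ?S"
      then have xyz: "x \<in> mu0 p" "y \<in> mu0 p" "z \<in> mu0 p" by simp_all
      note c = xyz[THEN mu0_closed]
      show "x \<otimes>\<^bsub>?S\<^esub> y \<in> carrier ?S" using mu0_mult' xyz by simp
      show "x \<otimes>\<^bsub>?S\<^esub> y \<otimes>\<^bsub>?S\<^esub> z = x \<otimes>\<^bsub>?S\<^esub> (y \<otimes>\<^bsub>?S\<^esub> z)" using c by (simp add: Qcyc.m_assoc)
      show "\<one>\<^bsub>?S\<^esub> \<otimes>\<^bsub>?S\<^esub> x = x" using c by simp
      show "x \<otimes>\<^bsub>?S\<^esub> y = y \<otimes>\<^bsub>?S\<^esub> x" using c Qcyc.m_comm by simp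
    next
      show "\<one>\<^bsub>?S\<^esub> \<in> carrier ?S" using mu_mu0[OF mu_one] by simp
    qed
    fix x y z assume "x \<in> carrier ?S" "y \<in> carrier ?S" "z \<in> carrier ?S"
    then show "(x \<oplus>\<^bsub>?S\<^esub> y) \<otimes>\<^bsub>?S\<^esub> z = x \<otimes>\<^bsub>?S\<^esub> z \<oplus>\<^bsub>?S\<^esub> y \<otimes>\<^bsub>?S\<^esub> z" using distr by simp
  qed
  then show ?thesis
  proof (rule domain.intro)
    show "domain_axioms ?S"
    proof (rule domain_axioms.intro)
      show "\<one>\<^bsub>?S\<^esub> \<noteq> \<zero>\<^bsub>?S\<^esub>" using mu_nonzero[OF mu_one] by simp
      fix a b assume ab: "a \<otimes>\<^bsub>?S\<^esub> b = \<zero>\<^bsub>?S\<^esub>" "a \<in> carrier ?S" "b \<in> carrier ?S"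
      then have "a \<in> carrier Qcyc" "b \<in> carrier Qcyc" using mu0_closed[of _ p] by auto
      then show "a = \<zero>\<^bsub>?S\<^esub> \<or> b = \<zero>\<^bsub>?S\<^esub>"
        using ab domain.integral[OF field.axioms(1)[OF field_Qcyc]] by simp
    qed
  qed
qed

text \<open>
  The characteristic is \<open>p\<close>, since \<open>p\<close> times \<open>1\<close> is the result of applying \<open>s\<close> to \<open>0\<close> exactly \<open>p\<close> times. In
  this ring the group elements are sent to themselves, so the bijection \<open>m\<close> is the identity and the permutation
  is \<open>s\<close>.
\<close>

lemma Sigma_from_model:
  assumes p: "Factorial_Ring.prime p" and s: "s \<in> Sigma_set p"
  shows "residue_model p (sigma_ring p s) (ga_lift (sigma_ring p s) root)"
    and "residue_model.succ p (sigma_ring p s) (ga_lift (sigma_ring p s) root) = s"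
proof -
  let ?S = "sigma_ring p s" and ?\<theta> = "ga_lift (sigma_ring p s) root"
  interpret S: domain ?S by (rule domain_sigma_ring[OF s])
  have s0: "s \<zero>\<^bsub>Qcyc\<^esub> = \<one>\<^bsub>Qcyc\<^esub>" and sp: "\<And>x. x \<in> mu0 p \<Longrightarrow> (s ^^ p) x = x"
    and bij: "bij_betw s (mu0 p) (mu0 p)" and ext: "s \<in> extensional (mu0 p)"
    using s by (auto simp: Sigma_set_def)
  have s_cl: "s x \<in> mu0 p" if "x \<in> mu0 p" for x using bij that by (auto simp: bij_betw_def)
  have add_one: "x \<oplus>\<^bsub>?S\<^esub> \<one>\<^bsub>Qcyc\<^esub> = s x" if "x \<in> mu0 p" for x
  proof -
    have "\<one>\<^bsub>Qcyc\<^esub> \<noteq> \<zero>\<^bsub>Qcyc\<^esub>" using mu_one mu_nonzero by blast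
    then show ?thesis using mu0_closed[OF that] mu0_closed[OF s_cl[OF that]] by (simp add: sigma_ring_def)
  qed
  have "add_pow ?S k \<one>\<^bsub>?S\<^esub> = (s ^^ k) \<zero>\<^bsub>Qcyc\<^esub> \<and> (s ^^ k) \<zero>\<^bsub>Qcyc\<^esub> \<in> mu0 p" for k :: nat
    by (induction k) (simp_all add: zero_mu0 add_one s_cl)
  then have char: "add_pow ?S p \<one>\<^bsub>?S\<^esub> = \<zero>\<^bsub>?S\<^esub>" using sp[OF zero_mu0] by simp
  have root_mu: "root r \<in> mu p" if "r \<in> Gp p" for r using that by (auto simp: mu_eq)
  have \<theta>: "?\<theta> \<in> ring_hom (ZGp p) ?S" and \<theta>_single: "\<And>r. r \<in> Gp p \<Longrightarrow> ?\<theta> (single_Z r) = root r"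
    using ga_lift[OF S.cring_axioms, of p root] mu_mu0[OF root_mu] by (auto simp: root_mult root_one)
  have p1: "p > 1" using p by (rule prime_gt_1_nat)
  have surj: "?\<theta> ` carrier (ZGp p) = carrier ?S"
  proof
    show "?\<theta> ` carrier (ZGp p) \<subseteq> carrier ?S" using \<theta> by (auto simp: ring_hom_def)
    show "carrier ?S \<subseteq> ?\<theta> ` carrier (ZGp p)"
    proof
      fix x assume "x \<in> carrier ?S"
      then have "x = \<zero>\<^bsub>Qcyc\<^esub> \<or> x \<in> mu p" by (auto simp: mu0_def)
      then show "x \<in> ?\<theta> ` carrier (ZGp p)"
      proof
        assume "x = \<zero>\<^bsub>Qcyc\<^esub>"
        then have "x = ?\<theta> \<zero>\<^bsub>ZGp p\<^esub>" using ring_hom_zero[OF \<theta> Z.A.ring_axioms S.ring_axioms] by simp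
        then show ?thesis by blast
      next
        assume "x \<in> mu p"
        then obtain r where r: "r \<in> Gp p" "x = root r" by (auto simp: mu_eq)
        then have "x = ?\<theta> (single_Z r)" using \<theta>_single by simp
        then show ?thesis using single_Z_closed[OF r(1)] by blast
      qed
    qed
  qed
  have kills: "?\<theta> f = \<zero>\<^bsub>?S\<^esub>" if "f \<in> carrier (ZGp p)" "delta f = \<zero>\<^bsub>Qcyc\<^esub>" for f
  proof (rule delta_kernel_killed[OF S.domain_axioms \<theta> _ _ that])
    show "inj_on (\<lambda>r. ?\<theta> (single_Z r)) (Gp p)" using root_inj[of p] \<theta>_single by (simp cong: inj_on_cong)
    fix n :: nat assume "coprime n p"
    then show "add_pow ?S n \<one>\<^bsub>?S\<^esub> \<noteq> \<zero>\<^bsub>?S\<^esub>" using S.add_pow_coprime[OF char _ p1] S.one_not_zero by blast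
  qed
  show model: "residue_model p ?S ?\<theta>"
    by (intro residue_model.intro residue_model_axioms.intro S.domain_axioms p \<theta> surj kills char)
  interpret M: residue_model p ?S ?\<theta> by (rule model)
  have m: "M.m x = x" if "x \<in> mu0 p" for x
    using that by (auto simp: mu0_def mu_eq M.m_zero M.m_root M.u_def \<theta>_single)
  show "M.succ = s"
  proof
    fix x
    show "M.succ x = s x"
    proof (cases "x \<in> mu0 p")
      case True
      then show ?thesis using M.succ[OF True] m[OF True] m[OF M.succ(1)[OF True]] add_one by simp
    next
      case False
      then show ?thesis using ext by (simp add: M.succ_def extensional_def)
    qed
  qed
qed

section \<open>The spectrum\<close>

definition descend :: "nat \<Rightarrow> ((rat set \<Rightarrow> int) \<Rightarrow> 'c) \<Rightarrow> (rat set \<Rightarrow> int) set \<Rightarrow> 'c" where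
  "descend p \<theta> = (\<lambda>a\<in>carrier (A_alg p). \<theta> (SOME f. f \<in> carrier (ZGp p) \<and> proj p f = a))"

lemma descend_proj:
  assumes "p > 1" "ring S" "\<theta> \<in> ring_hom (ZGp p) S"
    "\<And>f. f \<in> carrier (ZGp p) \<Longrightarrow> delta f = \<zero>\<^bsub>Qcyc\<^esub> \<Longrightarrow> \<theta> f = \<zero>\<^bsub>S\<^esub>"
    "add_pow S p \<one>\<^bsub>S\<^esub> = \<zero>\<^bsub>S\<^esub>" and f: "f \<in> carrier (ZGp p)"
  shows "descend p \<theta> (proj p f) = \<theta> f"
proof -
  define g where "g = (SOME g. g \<in> carrier (ZGp p) \<and> proj p g = proj p f)"
  have g: "g \<in> carrier (ZGp p) \<and> proj p g = proj p f"
    unfolding g_def by (rule someI[of _ f]) (use f in simp)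
  have "\<theta> g = \<theta> f" using g by (intro proj_eq_imp[OF assms(1-5)] f) auto
  moreover have "proj p f \<in> carrier (A_alg p)" using f carrier_A_alg[OF assms(1)] by simp
  ultimately show ?thesis by (simp add: descend_def g_def)
qed

lemma ring_hom_descend:
  assumes "p > 1" "ring S" "\<theta> \<in> ring_hom (ZGp p) S"
    "\<And>f. f \<in> carrier (ZGp p) \<Longrightarrow> delta f = \<zero>\<^bsub>Qcyc\<^esub> \<Longrightarrow> \<theta> f = \<zero>\<^bsub>S\<^esub>"
    "add_pow S p \<one>\<^bsub>S\<^esub> = \<zero>\<^bsub>S\<^esub>"
  shows "descend p \<theta> \<in> ring_hom (A_alg p) S"
proof -
  note d = descend_proj[OF assms]
  note hom = ring_hom_proj[OF assms(1)]
  show ?thesis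
  proof (rule ring_hom_memI)
    fix x assume "x \<in> carrier (A_alg p)"
    then obtain f where f: "f \<in> carrier (ZGp p)" "x = proj p f" using carrier_A_alg[OF assms(1)] by auto
    then show "descend p \<theta> x \<in> carrier S" using d ring_hom_closed[OF assms(3)] by simp
    fix y assume "y \<in> carrier (A_alg p)"
    then obtain g where g: "g \<in> carrier (ZGp p)" "y = proj p g" using carrier_A_alg[OF assms(1)] by auto
    show "descend p \<theta> (x \<otimes>\<^bsub>A_alg p\<^esub> y) = descend p \<theta> x \<otimes>\<^bsub>S\<^esub> descend p \<theta> y"
      using f g by (simp add: ring_hom_mult[OF hom, symmetric] d ring_hom_mult[OF assms(3)])
    show "descend p \<theta> (x \<oplus>\<^bsub>A_alg p\<^esub> y) = descend p \<theta> x \<oplus>\<^bsub>S\<^esub> descend p \<theta> y"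
      using f g by (simp add: ring_hom_add[OF hom, symmetric] d ring_hom_add[OF assms(3)])
  next
    show "descend p \<theta> \<one>\<^bsub>A_alg p\<^esub> = \<one>\<^bsub>S\<^esub>"
      using d[of "\<one>\<^bsub>ZGp p\<^esub>"] by (simp add: ring_hom_one[OF hom] ring_hom_one[OF assms(3)])
  qed
qed

lemma red_mod_single: "p > 1 \<Longrightarrow> red_mod p (single_Z r) = ga_single (residue_ring (int p)) r 1"
  by (auto simp: red_mod_def ga_single_def residue_ring_simps)

lemma hom_A_alg_model:
  assumes p: "Factorial_Ring.prime p" and D: "domain D" and h: "h \<in> ring_hom (A_alg p) D"
    and surj: "h ` carrier (A_alg p) = carrier D"
  shows "residue_model p D (\<lambda>f. h (proj p f))"
proof -
  have p1: "p > 1" using p by (rule prime_gt_1_nat)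
  interpret D: domain D by (rule D)
  interpret A: cring "A_alg p" by (rule cring_A_alg[OF p1])
  have hom: "(\<lambda>f. h (proj p f)) \<in> ring_hom (ZGp p) D"
    using ring_hom_trans[OF ring_hom_proj[OF p1] h] by (simp add: o_def)
  have h0: "h \<zero>\<^bsub>A_alg p\<^esub> = \<zero>\<^bsub>D\<^esub>" by (rule ring_hom_zero[OF h A.ring_axioms D.ring_axioms])
  show ?thesis
  proof (intro residue_model.intro residue_model_axioms.intro D p hom)
    show "(\<lambda>f. h (proj p f)) ` carrier (ZGp p) = carrier D"
      using surj carrier_A_alg[OF p1] by (simp add: image_image)
    fix f assume "f \<in> carrier (ZGp p)" "delta f = \<zero>\<^bsub>Qcyc\<^esub>"
    then show "h (proj p f) = \<zero>\<^bsub>D\<^esub>" using proj_kills[OF p1] h0 by simp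
  next
    have "add_pow D (int p) \<one>\<^bsub>D\<^esub> = h (add_pow (A_alg p) (int p) \<one>\<^bsub>A_alg p\<^esub>)"
      by (rule add_pow_one_hom[OF A.ring_axioms D.ring_axioms h, symmetric])
    also have "\<dots> = \<zero>\<^bsub>D\<^esub>" using A_alg_char[OF p1] h0 by (simp add: add_pow_int_ge)
    finally show "add_pow D p \<one>\<^bsub>D\<^esub> = \<zero>\<^bsub>D\<^esub>" by (simp add: add_pow_int_ge)
  qed
qed

abbreviation residue_hom :: "nat \<Rightarrow> (rat set \<Rightarrow> int) set set \<Rightarrow> (rat set \<Rightarrow> int) \<Rightarrow> (rat set \<Rightarrow> int) set set" where
  "residue_hom p P f \<equiv> P +>\<^bsub>A_alg p\<^esub> proj p f"

lemma prime_ideal_model: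
  assumes p: "Factorial_Ring.prime p" and P: "primeideal P (A_alg p)"
  shows "residue_model p (A_alg p Quot P) (residue_hom p P)"
    and "Spec_to_Sigma p P = residue_model.succ p (A_alg p Quot P) (residue_hom p P)"
    and "\<And>f. f \<in> carrier (ZGp p) \<Longrightarrow> residue_hom p P f = \<zero>\<^bsub>A_alg p Quot P\<^esub> \<longleftrightarrow> proj p f \<in> P"
proof -
  have p1: "p > 1" using p by (rule prime_gt_1_nat)
  interpret P: primeideal P "A_alg p" by (rule P)
  show model: "residue_model p (A_alg p Quot P) (residue_hom p P)"
  proof (rule hom_A_alg_model[OF p P.quotient_is_domain P.rcos_ring_hom])
    show "(+>\<^bsub>A_alg p\<^esub>) P ` carrier (A_alg p) = carrier (A_alg p Quot P)"
      by (auto simp: FactRing_def A_RCOSETS_def')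
  qed
  have zero: "\<zero>\<^bsub>A_alg p Quot P\<^esub> = P" by (simp add: FactRing_def)
  have "residue_model.m p (A_alg p Quot P) (residue_hom p P) = mu0_to_residue p P"
  proof
    fix x
    show "residue_model.m p (A_alg p Quot P) (residue_hom p P) x = mu0_to_residue p P x"
      unfolding residue_model.m_def[OF model] residue_model.u_def[OF model]
      unfolding mu0_to_residue_def root_index_def zero proj_def[OF p1] red_mod_single[OF p1] by (rule refl)
  qed
  then show "Spec_to_Sigma p P = residue_model.succ p (A_alg p Quot P) (residue_hom p P)"
    unfolding residue_model.succ_def[OF model] Spec_to_Sigma_def by simp
  fix f assume "f \<in> carrier (ZGp p)"
  then have "proj p f \<in> carrier (A_alg p)" using carrier_A_alg[OF p1] by simp
  then show "residue_hom p P f = \<zero>\<^bsub>A_alg p Quot P\<^esub> \<longleftrightarrow> proj p f \<in> P"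
    unfolding zero using P.a_rcos_const P.rcos_const_imp_mem by blast
qed

text \<open>
  The quotient by the kernel of a surjection and the image are residue models with the same kernel in \<open>\<int>[G]\<close>.
\<close>

lemma Spec_to_Sigma_kernel:
  assumes p: "Factorial_Ring.prime p" and D: "domain D" and h: "h \<in> ring_hom (A_alg p) D"
    and surj: "h ` carrier (A_alg p) = carrier D"
  shows "a_kernel (A_alg p) D h \<in> Spec (A_alg p)"
    and "Spec_to_Sigma p (a_kernel (A_alg p) D h) = residue_model.succ p D (\<lambda>f. h (proj p f))"
proof -
  have p1: "p > 1" using p by (rule prime_gt_1_nat)
  interpret D: domain D by (rule D)
  interpret A: cring "A_alg p" by (rule cring_A_alg[OF p1])
  interpret h: ring_hom_ring "A_alg p" D h by (rule ring_hom_ringI2[OF A.ring_axioms D.ring_axioms h])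
  have "primeideal {r \<in> carrier (A_alg p). h r \<in> {\<zero>\<^bsub>D\<^esub>}} (A_alg p)"
    by (rule h.primeideal_vimage[OF A.cring_axioms D.zeroprimeideal])
  moreover have "{r \<in> carrier (A_alg p). h r \<in> {\<zero>\<^bsub>D\<^esub>}} = a_kernel (A_alg p) D h"
    unfolding a_kernel_def' singleton_iff ..
  ultimately have P: "primeideal (a_kernel (A_alg p) D h) (A_alg p)" by (simp only:)
  then show "a_kernel (A_alg p) D h \<in> Spec (A_alg p)" by (simp add: Spec_def)
  show "Spec_to_Sigma p (a_kernel (A_alg p) D h) = residue_model.succ p D (\<lambda>f. h (proj p f))"
    unfolding prime_ideal_model(2)[OF p P]
  proof (rule kernel_eq_imp_succ_eq[OF prime_ideal_model(1)[OF p P] hom_A_alg_model[OF p D h surj]])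
    fix f assume f: "f \<in> carrier (ZGp p)"
    then have "proj p f \<in> carrier (A_alg p)" using carrier_A_alg[OF p1] by simp
    then show "residue_hom p (a_kernel (A_alg p) D h) f = \<zero>\<^bsub>A_alg p Quot a_kernel (A_alg p) D h\<^esub> \<longleftrightarrow> h (proj p f) = \<zero>\<^bsub>D\<^esub>"
      unfolding prime_ideal_model(3)[OF p P f] unfolding a_kernel_def' mem_Collect_eq by blast
  qed
qed

theorem bij_betw_Spec_to_Sigma:
  assumes p: "Factorial_Ring.prime p"
  shows "bij_betw (Spec_to_Sigma p) (Spec (A_alg p)) (Sigma_set p)"
proof -
  have p1: "p > 1" using p by (rule prime_gt_1_nat)
  have subset: "P \<subseteq> P'" if P: "primeideal P (A_alg p)" and P': "primeideal P' (A_alg p)"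
    and eq: "Spec_to_Sigma p P = Spec_to_Sigma p P'" for P P'
  proof
    fix a assume a: "a \<in> P"
    then have "a \<in> carrier (A_alg p)" by (rule ideal.Icarr[OF primeideal.axioms(1)[OF P]])
    then obtain f where f: "f \<in> carrier (ZGp p)" "a = proj p f" using carrier_A_alg[OF p1] by auto
    have "residue_hom p P f = \<zero>\<^bsub>A_alg p Quot P\<^esub>"
      using prime_ideal_model(3)[OF p P f(1)] a f(2) by simp
    then have "residue_hom p P' f = \<zero>\<^bsub>A_alg p Quot P'\<^esub>"
      using eq unfolding prime_ideal_model(2)[OF p P] prime_ideal_model(2)[OF p P']
      by (intro succ_eq_imp_kernel_subset[OF prime_ideal_model(1)[OF p P] prime_ideal_model(1)[OF p P'] _ f(1)])
    then show "a \<in> P'" using prime_ideal_model(3)[OF p P' f(1)] f(2) by simp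
  qed
  show ?thesis
  proof (rule bij_betw_imageI)
    show "inj_on (Spec_to_Sigma p) (Spec (A_alg p))"
    proof (rule inj_onI)
      fix P P' assume "P \<in> Spec (A_alg p)" "P' \<in> Spec (A_alg p)" "Spec_to_Sigma p P = Spec_to_Sigma p P'"
      then show "P = P'" using subset[of P P'] subset[of P' P] by (simp add: Spec_def)
    qed
    show "Spec_to_Sigma p ` Spec (A_alg p) = Sigma_set p"
    proof
      show "Spec_to_Sigma p ` Spec (A_alg p) \<subseteq> Sigma_set p"
        using residue_model.succ_in_Sigma[OF prime_ideal_model(1)[OF p]] prime_ideal_model(2)[OF p]
        by (auto simp: Spec_def)
      show "Sigma_set p \<subseteq> Spec_to_Sigma p ` Spec (A_alg p)"
      proof
        fix s assume s: "s \<in> Sigma_set p"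
        let ?S = "sigma_ring p s" and ?\<theta> = "ga_lift (sigma_ring p s) root"
        note M = Sigma_from_model(1)[OF p s]
        have D: "domain ?S" by (rule domain_sigma_ring[OF s])
        have R: "ring ?S" using D by (simp add: domain_def cring_def)
        note cond = p1 R residue_model.\<theta>[OF M] residue_model.kills[OF M] residue_model.char[OF M]
        have h: "descend p ?\<theta> \<in> ring_hom (A_alg p) ?S" by (rule ring_hom_descend[OF cond])
        have d: "descend p ?\<theta> (proj p f) = ?\<theta> f" if "f \<in> carrier (ZGp p)" for f
          by (rule descend_proj[OF cond that])
        have surj: "descend p ?\<theta> ` carrier (A_alg p) = carrier ?S"
          unfolding carrier_A_alg[OF p1] image_image
          using residue_model.surj[OF M] d by (simp cong: image_cong)
        have "Spec_to_Sigma p (a_kernel (A_alg p) ?S (descend p ?\<theta>)) =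
            residue_model.succ p ?S (\<lambda>f. descend p ?\<theta> (proj p f))"
          by (rule Spec_to_Sigma_kernel(2)[OF p D h surj])
        also have "\<dots> = residue_model.succ p ?S ?\<theta>"
          by (rule kernel_eq_imp_succ_eq[OF hom_A_alg_model[OF p D h surj] M]) (simp add: d)
        also have "\<dots> = s" by (rule Sigma_from_model(2)[OF p s])
        finally show "s \<in> Spec_to_Sigma p ` Spec (A_alg p)"
          using Spec_to_Sigma_kernel(1)[OF p D h surj] by (metis image_eqI)
      qed
    qed
  qed
qed

section \<open>Homomorphisms from the cyclotomic field\<close>

lemma Qcyc_prime_to_simps [simp]:
  "x \<otimes>\<^bsub>Qcyc_prime_to p\<^esub> y = x \<otimes>\<^bsub>Qcyc\<^esub> y" "x \<oplus>\<^bsub>Qcyc_prime_to p\<^esub> y = x \<oplus>\<^bsub>Qcyc\<^esub> y"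
  "\<one>\<^bsub>Qcyc_prime_to p\<^esub> = \<one>\<^bsub>Qcyc\<^esub>" "\<zero>\<^bsub>Qcyc_prime_to p\<^esub> = \<zero>\<^bsub>Qcyc\<^esub>"
  by (simp_all add: Qcyc_prime_to_def)

lemma mu_subset: "mu p \<subseteq> carrier Qcyc"
  using mu_closed by auto

lemma field_Qcyc_prime_to: "field (Qcyc_prime_to p)"
  unfolding Qcyc_prime_to_def by (rule field.generate_field_is_field[OF field_Qcyc mu_subset])

lemma Qcyc_prime_to_subset: "x \<in> carrier (Qcyc_prime_to p) \<Longrightarrow> x \<in> carrier Qcyc"
  using field.generate_field_incl[OF field_Qcyc mu_subset, of p] by (auto simp: Qcyc_prime_to_def)

lemma mu_Qcyc_prime_to: "x \<in> mu p \<Longrightarrow> x \<in> carrier (Qcyc_prime_to p)"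
  by (simp add: Qcyc_prime_to_def generate_field.incl)

lemma delta_uminus: "f \<in> carrier (ZGp p) \<Longrightarrow> delta (\<ominus>\<^bsub>ZGp p\<^esub> f) = \<ominus>\<^bsub>Qcyc\<^esub> delta f"
proof -
  assume f: "f \<in> carrier (ZGp p)"
  have 1: "\<ominus>\<^bsub>ZGp p\<^esub> f \<in> carrier (ZGp p)" using f by simp
  have "delta (\<ominus>\<^bsub>ZGp p\<^esub> f) \<oplus>\<^bsub>Qcyc\<^esub> delta f = \<zero>\<^bsub>Qcyc\<^esub>"
    using ring_hom_add[OF ring_hom_delta 1 f] f
      ring_hom_zero[OF ring_hom_delta[of p] Z.A.ring_axioms Qcyc.ring_axioms] by (simp add: Z.A.l_neg)
  then show ?thesis using delta_closed[OF f] delta_closed[OF 1] by (simp add: Qcyc.minus_equality)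
qed

lemma delta_Qcyc_prime_to: "f \<in> carrier (ZGp p) \<Longrightarrow> delta f \<in> carrier (Qcyc_prime_to p)"
proof (induction f rule: ZGp_induct)
  case zero
  have "delta \<zero>\<^bsub>ZGp p\<^esub> = \<zero>\<^bsub>Qcyc\<^esub>" by (rule ring_hom_zero[OF ring_hom_delta Z.A.ring_axioms Qcyc.ring_axioms])
  then show ?case using field.zero_in_generate[OF field_Qcyc] by (simp add: Qcyc_prime_to_def)
next
  case (single r)
  then show ?case by (intro mu_Qcyc_prime_to) (auto simp: mu_eq)
next
  case (minus f)
  then show ?case by (simp add: delta_uminus) (simp add: Qcyc_prime_to_def generate_field.a_inv)
next
  case (add f g)
  then show ?case by (simp add: ring_hom_add[OF ring_hom_delta]) (simp add: Qcyc_prime_to_def generate_field.eng_add)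
qed

lemma ring_hom_delta': "delta \<in> ring_hom (ZGp p) (Qcyc_prime_to p)"
  by (rule ring_hom_memI)
     (simp_all add: delta_Qcyc_prime_to ring_hom_add[OF ring_hom_delta] ring_hom_mult[OF ring_hom_delta] ring_hom_one[OF ring_hom_delta])

abbreviation const_Z :: "int \<Rightarrow> rat set \<Rightarrow> int" where
  "const_Z k \<equiv> ga_single type_ring (mod1 0) k"

lemma eval_const_Z [simp]: "eval_Z (const_Z k) = of_int k"
  by (simp add: Z.eval_single chi_mod1)

text \<open>
  The elements which become an element of \<open>\<delta>(\<int>[G])\<close> after multiplication by an integer are closed under inverses,
  by \<open>ev_inverse\<close>.
\<close>

lemma Qcyc_prime_to_fraction:
  assumes "x \<in> carrier (Qcyc_prime_to p)"
  shows "\<exists>m>0. \<exists>f\<in>carrier (ZGp p). of_nat m * emb x = eval_Z f"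
proof -
  have cl: "h \<in> carrier Qcyc" if "h \<in> generate_field Qcyc (mu p)" for h
    using field.generate_field_in_carrier[OF field_Qcyc mu_subset that] .
  have "x \<in> generate_field Qcyc (mu p)" using assms by (simp add: Qcyc_prime_to_def)
  then show ?thesis
  proof (induction x rule: generate_field.induct)
    case one
    show ?case by (intro exI[of _ 1] conjI bexI[of _ "\<one>\<^bsub>ZGp p\<^esub>"]) (simp_all add: Z.eval_one)
  next
    case (incl h)
    then obtain r where "r \<in> Gp p" "h = root r" by (auto simp: mu_eq)
    then show ?case by (intro exI[of _ 1] conjI bexI[of _ "single_Z r"]) (simp_all add: eval_Z_single)
  next
    case (a_inv h)
    then obtain m f where m: "m > 0" and f: "f \<in> carrier (ZGp p)" "of_nat m * emb h = eval_Z f" by blast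
    have "eval_Z (\<ominus>\<^bsub>ZGp p\<^esub> f) = - eval_Z f"
      using Z.eval_minus[of "\<zero>\<^bsub>ZGp p\<^esub>" p f] f by (simp add: Z.A.minus_eq Z.eval_zero)
    then have "of_nat m * emb (\<ominus>\<^bsub>Qcyc\<^esub> h) = eval_Z (\<ominus>\<^bsub>ZGp p\<^esub> f)" using cl[OF a_inv.hyps] f by simp
    then show ?case using m f(1) Z.A.a_inv_closed by blast
  next
    case (m_inv h)
    then obtain m f where m: "m > 0" and f: "f \<in> carrier (ZGp p)" "of_nat m * emb h = eval_Z f" by blast
    have "emb h \<noteq> 0" using emb_eq_0 cl[OF m_inv.hyps(1)] m_inv.hyps(2) by blast
    then have nz: "eval_Z f \<noteq> 0" using f m by (metis mult_eq_0_iff of_nat_eq_0_iff neq0_conv)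
    obtain n where n: "n > 0" "coprime n p" "{x. f x \<noteq> 0} \<subseteq> torsion n"
      using torsion_cover[of "{x. f x \<noteq> 0}" p] f(1) by (auto simp: ZGp_ga ga_type_carrier)
    obtain g k where g: "g \<in> carrier (ZGp p)" "k > 0" "eval_Z f * eval_Z g = of_nat k"
      using Z.ev_inverse[OF n(1) torsion_subset_Gp[OF n(1,2)] n(3) nz] by metis
    have "of_nat k * emb (inv\<^bsub>Qcyc\<^esub> h) = eval_Z (const_Z (int m) \<otimes>\<^bsub>ZGp p\<^esub> g)"
      using g f(2)[symmetric] \<open>emb h \<noteq> 0\<close> cl[OF m_inv.hyps(1)] m_inv.hyps(2)
      by (simp add: Z.eval_mult g(3)[symmetric] field_simps)
    then show ?case using g by (intro exI[of _ k] conjI bexI[of _ "const_Z (int m) \<otimes>\<^bsub>ZGp p\<^esub> g"]) simp_all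
  next
    case (eng_add h1 h2)
    then obtain m f n g where m: "m > 0" and f: "f \<in> carrier (ZGp p)" "of_nat m * emb h1 = eval_Z f"
      and n: "n > 0" and g: "g \<in> carrier (ZGp p)" "of_nat n * emb h2 = eval_Z g" by blast
    let ?h = "const_Z (int n) \<otimes>\<^bsub>ZGp p\<^esub> f \<oplus>\<^bsub>ZGp p\<^esub> const_Z (int m) \<otimes>\<^bsub>ZGp p\<^esub> g"
    have "of_nat (m * n) * emb (h1 \<oplus>\<^bsub>Qcyc\<^esub> h2) = eval_Z ?h"
      using f(1) g(1) cl[OF eng_add.hyps(1)] cl[OF eng_add.hyps(2)]
      by (simp add: Z.eval_mult Z.eval_add f(2)[symmetric] g(2)[symmetric] algebra_simps)
    then show ?case using m n f(1) g(1) by (intro exI[of _ "m * n"] conjI bexI[of _ ?h]) simp_all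
  next
    case (eng_mult h1 h2)
    then obtain m f n g where m: "m > 0" and f: "f \<in> carrier (ZGp p)" "of_nat m * emb h1 = eval_Z f"
      and n: "n > 0" and g: "g \<in> carrier (ZGp p)" "of_nat n * emb h2 = eval_Z g" by blast
    have "of_nat (m * n) * emb (h1 \<otimes>\<^bsub>Qcyc\<^esub> h2) = eval_Z (f \<otimes>\<^bsub>ZGp p\<^esub> g)"
      using f(1) g(1) cl[OF eng_mult.hyps(1)] cl[OF eng_mult.hyps(2)]
      by (simp add: Z.eval_mult f(2)[symmetric] g(2)[symmetric] algebra_simps)
    then show ?case using m n f(1) g(1) by (intro exI[of _ "m * n"] conjI bexI[of _ "f \<otimes>\<^bsub>ZGp p\<^esub> g"]) simp_all
  qed
qed

lemma hom_const_Z: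
  assumes "ring S" "\<theta> \<in> ring_hom (ZGp p) S"
  shows "\<theta> (const_Z k) = add_pow S k \<one>\<^bsub>S\<^esub>"
  using add_pow_one_hom[OF Z.A.ring_axioms assms, of k] by (simp only: single_Z_const)

context
  fixes p :: nat and C :: "('c, 'k) ring_scheme"
  assumes C: "field C" and char: "\<And>n::nat. n > 0 \<Longrightarrow> add_pow C n \<one>\<^bsub>C\<^esub> \<noteq> \<zero>\<^bsub>C\<^esub>"
begin

interpretation C: field C by (rule C)

lemma char_int: "n > 0 \<Longrightarrow> add_pow C (int n) \<one>\<^bsub>C\<^esub> \<noteq> \<zero>\<^bsub>C\<^esub>"
  using char by (simp add: add_pow_int_ge)

lemma Qcyc_prime_to_hom_eqI:
  assumes \<rho>: "\<rho> \<in> ring_Hom (Qcyc_prime_to p) C" and \<rho>': "\<rho>' \<in> ring_Hom (Qcyc_prime_to p) C"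
    and eq: "\<And>x. x \<in> mu p \<Longrightarrow> \<rho> x = \<rho>' x"
  shows "\<rho> = \<rho>'"
proof
  fix x
  show "\<rho> x = \<rho>' x"
  proof (cases "x \<in> carrier (Qcyc_prime_to p)")
    case False
    then show ?thesis using \<rho> \<rho>' by (auto simp: ring_Hom_def extensional_def)
  next
    case x: True
    have h: "\<rho> \<in> ring_hom (Qcyc_prime_to p) C" "\<rho>' \<in> ring_hom (Qcyc_prime_to p) C"
      using \<rho> \<rho>' by (simp_all add: ring_Hom_def)
    have eq_delta: "\<rho> (delta f) = \<rho>' (delta f)" if f: "f \<in> carrier (ZGp p)" for f
    proof -
      have "(\<rho> \<circ> delta) f = (\<rho>' \<circ> delta) f"
      proof (rule ZGp_hom_eqI[OF C.ring_axioms ring_hom_trans[OF ring_hom_delta' h(1)] ring_hom_trans[OF ring_hom_delta' h(2)] _ f])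
        fix r assume "r \<in> Gp p"
        then show "(\<rho> \<circ> delta) (single_Z r) = (\<rho>' \<circ> delta) (single_Z r)" using eq by (auto simp: mu_eq)
      qed
      then show ?thesis by simp
    qed
    obtain m f where m: "m > 0" and f: "f \<in> carrier (ZGp p)" "of_nat m * emb x = eval_Z f"
      using Qcyc_prime_to_fraction[OF x] by blast
    have mc: "delta (const_Z (int m)) \<in> carrier (Qcyc_prime_to p)" by (rule delta_Qcyc_prime_to) simp
    have xQ: "x \<in> carrier Qcyc" by (rule Qcyc_prime_to_subset[OF x])
    have cc: "const_Z (int m) \<in> carrier (ZGp p)" by simp
    have "delta (const_Z (int m)) \<otimes>\<^bsub>Qcyc\<^esub> x = delta f"
      using xQ f delta_closed[OF cc] emb_delta[OF cc]
        delta_closed[OF f(1)] emb_delta[OF f(1)]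
      by (intro Qcyc_eqI) simp_all
    then have "\<rho> (delta (const_Z (int m))) \<otimes>\<^bsub>C\<^esub> \<rho> x = \<rho>' (delta (const_Z (int m))) \<otimes>\<^bsub>C\<^esub> \<rho>' x"
      using eq_delta[OF f(1)] ring_hom_mult[OF h(1) mc x] ring_hom_mult[OF h(2) mc x] by simp
    moreover have "\<rho> (delta (const_Z (int m))) = add_pow C (int m) \<one>\<^bsub>C\<^esub>"
      using hom_const_Z[OF C.ring_axioms ring_hom_trans[OF ring_hom_delta' h(1)]] by simp
    moreover have "\<rho>' (delta (const_Z (int m))) = add_pow C (int m) \<one>\<^bsub>C\<^esub>"
      using hom_const_Z[OF C.ring_axioms ring_hom_trans[OF ring_hom_delta' h(2)]] by simp
    ultimately show ?thesis
      using char_int[OF m] ring_hom_closed[OF h(1) x] ring_hom_closed[OF h(2) x] by (simp add: C.m_lcancel)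
  qed
qed

text \<open>
  The value of \<open>\<rho>\<close> at \<open>\<delta>(f)/m\<close> has to be \<open>V(f)/m\<close>. The relation \<open>rel\<close> is the graph of \<open>\<rho>\<close>.
\<close>

lemma Qcyc_prime_to_hom_exists:
  assumes V: "V \<in> ring_hom (ZGp p) C"
    and kills: "\<And>f. f \<in> carrier (ZGp p) \<Longrightarrow> delta f = \<zero>\<^bsub>Qcyc\<^esub> \<Longrightarrow> V f = \<zero>\<^bsub>C\<^esub>"
  shows "\<exists>\<rho>\<in>ring_Hom (Qcyc_prime_to p) C. \<forall>f\<in>carrier (ZGp p). \<rho> (delta f) = V f"
proof -
  define N where "N = (\<lambda>m::nat. add_pow C (int m) \<one>\<^bsub>C\<^esub>)"
  have N: "N m \<in> carrier C" "V (const_Z (int m)) = N m" for m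
    using hom_const_Z[OF C.ring_axioms V] by (simp_all add: N_def)
  have N_nz: "m > 0 \<Longrightarrow> N m \<noteq> \<zero>\<^bsub>C\<^esub>" for m using char_int by (simp add: N_def)
  have V_cl: "V f \<in> carrier C" if "f \<in> carrier (ZGp p)" for f by (rule ring_hom_closed[OF V that])
  have V_mult: "V (f \<otimes>\<^bsub>ZGp p\<^esub> g) = V f \<otimes>\<^bsub>C\<^esub> V g" and V_add: "V (f \<oplus>\<^bsub>ZGp p\<^esub> g) = V f \<oplus>\<^bsub>C\<^esub> V g"
    if "f \<in> carrier (ZGp p)" "g \<in> carrier (ZGp p)" for f g
    using ring_hom_mult[OF V that] ring_hom_add[OF V that] by simp_all
  have V_eq: "V f = V g" if f: "f \<in> carrier (ZGp p)" and g: "g \<in> carrier (ZGp p)" and eq: "eval_Z f = eval_Z g" for f g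
  proof -
    have d: "f \<ominus>\<^bsub>ZGp p\<^esub> g \<in> carrier (ZGp p)" using f g by simp
    have "eval_Z (f \<ominus>\<^bsub>ZGp p\<^esub> g) = 0" using f g eq by (simp add: Z.eval_minus)
    then have "V (f \<ominus>\<^bsub>ZGp p\<^esub> g) = \<zero>\<^bsub>C\<^esub>" using kills d delta_eq_0_iff by simp
    moreover have "f = (f \<ominus>\<^bsub>ZGp p\<^esub> g) \<oplus>\<^bsub>ZGp p\<^esub> g"
      using f g by (simp add: a_minus_def Z.A.a_assoc Z.A.l_neg)
    ultimately show ?thesis using V_add[OF d g] V_cl[OF g] by simp
  qed
  define rel where "rel = (\<lambda>x y. y \<in> carrier C \<and> (\<exists>m>0. \<exists>f\<in>carrier (ZGp p). of_nat m * emb x = eval_Z f \<and> N m \<otimes>\<^bsub>C\<^esub> y = V f))"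
  have rel_unique: "y = y'" if rel: "rel x y" "rel x y'" for x y y'
  proof -
    obtain m f where m: "m > 0" "f \<in> carrier (ZGp p)" "of_nat m * emb x = eval_Z f" "N m \<otimes>\<^bsub>C\<^esub> y = V f" "y \<in> carrier C"
      using rel(1) by (auto simp: rel_def)
    obtain n g where n: "n > 0" "g \<in> carrier (ZGp p)" "of_nat n * emb x = eval_Z g" "N n \<otimes>\<^bsub>C\<^esub> y' = V g" "y' \<in> carrier C"
      using rel(2) by (auto simp: rel_def)
    have "V (const_Z (int n) \<otimes>\<^bsub>ZGp p\<^esub> f) = V (const_Z (int m) \<otimes>\<^bsub>ZGp p\<^esub> g)"
      using m n by (intro V_eq) (simp_all add: Z.eval_mult m(3)[symmetric] n(3)[symmetric])
    then have "N n \<otimes>\<^bsub>C\<^esub> (N m \<otimes>\<^bsub>C\<^esub> y) = N m \<otimes>\<^bsub>C\<^esub> (N n \<otimes>\<^bsub>C\<^esub> y')"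
      using m n by (simp add: V_mult N)
    then have "(N n \<otimes>\<^bsub>C\<^esub> N m) \<otimes>\<^bsub>C\<^esub> y = (N n \<otimes>\<^bsub>C\<^esub> N m) \<otimes>\<^bsub>C\<^esub> y'"
      using m(5) n(5) N(1) by (simp add: C.m_ac)
    moreover have "N n \<otimes>\<^bsub>C\<^esub> N m \<noteq> \<zero>\<^bsub>C\<^esub>" using N_nz m(1) n(1) N(1) C.integral by blast
    ultimately show ?thesis using m(5) n(5) N(1) C.m_lcancel by simp
  qed
  define \<rho> where "\<rho> = (\<lambda>x\<in>carrier (Qcyc_prime_to p). THE y. rel x y)"
  have \<rho>_eq: "\<rho> x = y" if "x \<in> carrier (Qcyc_prime_to p)" "rel x y" for x y
    using that rel_unique[of x] by (auto simp: \<rho>_def intro!: the_equality)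
  have rel_exists: "\<exists>y. rel x y" if x: "x \<in> carrier (Qcyc_prime_to p)" for x
  proof -
    obtain m f where m: "m > 0" "f \<in> carrier (ZGp p)" "of_nat m * emb x = eval_Z f"
      using Qcyc_prime_to_fraction[OF x] by blast
    have U: "N m \<in> Units C" using N_nz[OF m(1)] N(1) by (simp add: C.field_Units)
    then have "N m \<otimes>\<^bsub>C\<^esub> (inv\<^bsub>C\<^esub> N m \<otimes>\<^bsub>C\<^esub> V f) = V f"
      using V_cl[OF m(2)] N(1) by (simp add: C.m_assoc[symmetric])
    then have "rel x (inv\<^bsub>C\<^esub> N m \<otimes>\<^bsub>C\<^esub> V f)" using m V_cl U unfolding rel_def by auto
    then show ?thesis by blast
  qed
  have \<rho>_rel: "rel x (\<rho> x)" if "x \<in> carrier (Qcyc_prime_to p)" for x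
    using rel_exists[OF that] \<rho>_eq[OF that] by blast
  have K: "x \<otimes>\<^bsub>Qcyc\<^esub> y \<in> carrier (Qcyc_prime_to p)" "x \<oplus>\<^bsub>Qcyc\<^esub> y \<in> carrier (Qcyc_prime_to p)"
    if "x \<in> carrier (Qcyc_prime_to p)" "y \<in> carrier (Qcyc_prime_to p)" for x y
    using that by (simp_all add: Qcyc_prime_to_def generate_field.eng_add generate_field.eng_mult)
  have hom: "\<rho> \<in> ring_hom (Qcyc_prime_to p) C"
  proof (rule ring_hom_memI)
    fix x assume x: "x \<in> carrier (Qcyc_prime_to p)"
    show "\<rho> x \<in> carrier C" using \<rho>_rel[OF x] by (simp add: rel_def)
    fix y assume y: "y \<in> carrier (Qcyc_prime_to p)"
    note xy = Qcyc_prime_to_subset[OF x] Qcyc_prime_to_subset[OF y]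
    obtain m f where m: "m > 0" "f \<in> carrier (ZGp p)" "of_nat m * emb x = eval_Z f" "N m \<otimes>\<^bsub>C\<^esub> \<rho> x = V f" "\<rho> x \<in> carrier C"
      using \<rho>_rel[OF x] by (auto simp: rel_def)
    obtain n g where n: "n > 0" "g \<in> carrier (ZGp p)" "of_nat n * emb y = eval_Z g" "N n \<otimes>\<^bsub>C\<^esub> \<rho> y = V g" "\<rho> y \<in> carrier C"
      using \<rho>_rel[OF y] by (auto simp: rel_def)
    have Nmn: "N (m * n) = N m \<otimes>\<^bsub>C\<^esub> N n"
    proof -
      have "const_Z (int (m * n)) = const_Z (int m) \<otimes>\<^bsub>ZGp p\<^esub> const_Z (int n)"
        by (simp add: single_mult mod1_mult)
      then have "V (const_Z (int (m * n))) = V (const_Z (int m)) \<otimes>\<^bsub>C\<^esub> V (const_Z (int n))"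
        using V_mult[of "const_Z (int m)" "const_Z (int n)"] by simp
      then show ?thesis unfolding N(2) .
    qed
    have "rel (x \<otimes>\<^bsub>Qcyc\<^esub> y) (\<rho> x \<otimes>\<^bsub>C\<^esub> \<rho> y)"
      unfolding rel_def
    proof (intro conjI exI[of _ "m * n"] bexI[of _ "f \<otimes>\<^bsub>ZGp p\<^esub> g"])
      show "of_nat (m * n) * emb (x \<otimes>\<^bsub>Qcyc\<^esub> y) = eval_Z (f \<otimes>\<^bsub>ZGp p\<^esub> g)"
        using m n xy by (simp add: Z.eval_mult m(3)[symmetric] n(3)[symmetric])
      show "N (m * n) \<otimes>\<^bsub>C\<^esub> (\<rho> x \<otimes>\<^bsub>C\<^esub> \<rho> y) = V (f \<otimes>\<^bsub>ZGp p\<^esub> g)"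
        using m(2,5) n(2,5) N(1) by (simp add: V_mult Nmn m(4)[symmetric] n(4)[symmetric] C.m_ac)
    qed (use m n in auto)
    then show "\<rho> (x \<otimes>\<^bsub>Qcyc_prime_to p\<^esub> y) = \<rho> x \<otimes>\<^bsub>C\<^esub> \<rho> y" using K(1)[OF x y] \<rho>_eq by simp
    let ?h = "const_Z (int n) \<otimes>\<^bsub>ZGp p\<^esub> f \<oplus>\<^bsub>ZGp p\<^esub> const_Z (int m) \<otimes>\<^bsub>ZGp p\<^esub> g"
    have "rel (x \<oplus>\<^bsub>Qcyc\<^esub> y) (\<rho> x \<oplus>\<^bsub>C\<^esub> \<rho> y)"
      unfolding rel_def
    proof (intro conjI exI[of _ "m * n"] bexI[of _ ?h])
      show "of_nat (m * n) * emb (x \<oplus>\<^bsub>Qcyc\<^esub> y) = eval_Z ?h"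
        using m(2) n(2) xy by (simp add: Z.eval_mult Z.eval_add m(3)[symmetric] n(3)[symmetric] algebra_simps)
      show "N (m * n) \<otimes>\<^bsub>C\<^esub> (\<rho> x \<oplus>\<^bsub>C\<^esub> \<rho> y) = V ?h"
        using m(2,5) n(2,5) N(1) by (simp add: V_add V_mult N(2) Nmn m(4)[symmetric] n(4)[symmetric] C.r_distr C.m_ac)
    qed (use m n in auto)
    then show "\<rho> (x \<oplus>\<^bsub>Qcyc_prime_to p\<^esub> y) = \<rho> x \<oplus>\<^bsub>C\<^esub> \<rho> y" using K(2)[OF x y] \<rho>_eq by simp
  next
    have "rel \<one>\<^bsub>Qcyc\<^esub> \<one>\<^bsub>C\<^esub>" unfolding rel_def
      using ring_hom_one[OF V]
      by (intro conjI exI[of _ 1] bexI[of _ "\<one>\<^bsub>ZGp p\<^esub>"]) (simp_all add: Z.eval_one N_def)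
    then show "\<rho> \<one>\<^bsub>Qcyc_prime_to p\<^esub> = \<one>\<^bsub>C\<^esub>"
      using \<rho>_eq mu_Qcyc_prime_to[OF mu_one] by simp
  qed
  have "\<rho> (delta f) = V f" if f: "f \<in> carrier (ZGp p)" for f
  proof (rule \<rho>_eq)
    show "delta f \<in> carrier (Qcyc_prime_to p)" by (rule delta_Qcyc_prime_to[OF f])
    show "rel (delta f) (V f)" unfolding rel_def using f V_cl[OF f] emb_delta[OF f]
      by (intro conjI exI[of _ 1] bexI[of _ f]) (simp_all add: N_def add_pow_int_ge)
  qed
  moreover have "\<rho> \<in> ring_Hom (Qcyc_prime_to p) C" using hom by (simp add: ring_Hom_def \<rho>_def)
  ultimately show ?thesis by blast
qed

end

section \<open>Fields that are algebraic over a finite prime field\<close>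

text \<open>
  The prime field is finite, so an algebraic element generates a finite ring and has a finite order \<open>p\<^sup>k n\<close> with \<open>n\<close>
  prime to \<open>p\<close>. As \<open>(x\<^sup>n - 1)\<close> raised to the power \<open>p\<^sup>k\<close> vanishes, \<open>n\<close> is already a period.
\<close>

lemma (in field) root_of_unity_if_algebraic:
  assumes p: "Factorial_Ring.prime (p::nat)" and char: "add_pow R p \<one> = \<zero>"
    and alg: "(algebraic over (generate_field R {})) x"
    and x: "x \<in> carrier R" "x \<noteq> \<zero>"
  shows "\<exists>n>0. coprime n p \<and> x [^] n = \<one>"
proof -
  let ?k = "generate_field R {}"
  have p1: "p > 1" using p by (rule prime_gt_1_nat)
  define c where "c = (\<lambda>n::nat. add_pow R n \<one>)"
  have c: "c n \<in> carrier R" for n by (simp add: c_def)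
  have c_add: "c m \<oplus> c n = c (m + n)" for m n by (simp add: c_def add.nat_pow_mult)
  have c_mult: "c m \<otimes> c n = c (m * n)" for m n
    by (simp add: c_def add_pow_ldistr add.nat_pow_pow mult.commute)
  have c_p: "c (p * n) = \<zero>" for n using c_mult[of p n] char c[of n] by (simp add: c_def)
  have c_mod: "c (n mod p) = c n" for n
    using c_add[of "p * (n div p)" "n mod p"] c_p[of "n div p"] c[of "n mod p"] by simp
  have "h \<in> range c" if "h \<in> ?k" for h
    using that
  proof (induction h rule: generate_field.induct)
    case one
    show ?case by (intro range_eqI[of _ _ 1]) (simp add: c_def)
  next
    case (a_inv h)
    then obtain n where n: "h = c n" by auto
    have "c (p * n - n) \<oplus> c n = \<zero>" using p1 by (simp add: c_add c_p)
    then have "\<ominus> h = c (p * n - n)" using c n by (simp add: minus_equality)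
    then show ?case by simp
  next
    case (m_inv h)
    then obtain n where n: "h = c n" by auto
    have "\<not> p dvd n" using m_inv.hyps(2) c_p by (auto simp: n)
    then have "coprime n p" using p by (metis prime_imp_coprime coprime_commute)
    then obtain m where "[n * m = Suc 0] (mod p)" using cong_solve_coprime_nat by blast
    then have "c (n * m) = c (Suc 0)" by (metis c_mod cong_def)
    then have "h \<otimes> c m = \<one>" by (simp add: n c_mult) (simp add: c_def)
    then have "inv h = c m" using c n by (simp add: comm_inv_char)
    then show ?case by simp
  next
    case (eng_add h1 h2)
    then show ?case using c_add by auto
  next
    case (eng_mult h1 h2)
    then show ?case using c_mult by auto
  qed auto
  then have "?k \<subseteq> c ` {..<p}" using c_mod p1 by (auto simp: image_iff) (metis lessThan_iff mod_less_divisor prime_gt_0_nat[OF p])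
  then have fin_k: "finite ?k" by (rule finite_subset) simp
  have k: "subfield ?k R" by (rule generate_field_is_subfield) simp
  let ?E = "simple_extension ?k x"
  have sub: "subring ?E R" by (rule simple_extension_is_subring[OF subfieldE(1)[OF k] x(1)])
  have "finite_dimension ?k ?E" using finite_dimension_simple_extension[OF k x(1)] alg by simp
  then obtain n where "dimension n ?k ?E" by (auto simp: finite_dimension_def)
  then obtain Us where Us: "set Us \<subseteq> carrier R" "Span ?k Us = ?E" using exists_base[OF k] by metis
  have "?E \<subseteq> (\<lambda>Ks. combine Ks Us) ` {Ks. set Ks \<subseteq> ?k \<and> length Ks = length Us}"
    using Span_eq_combine_set_length_version[OF k Us(1)] Us(2) by auto
  then have fin: "finite ?E"
    by (rule finite_subset) (intro finite_imageI finite_lists_length_eq fin_k)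
  have "x \<in> ?E" by (rule simple_extension_mem[OF subfieldE(1)[OF k] x(1)])
  then have "x [^] (i::nat) \<in> ?E" for i
    by (induction i) (use subringE(3,6)[OF sub] in auto)
  then have "range (\<lambda>i::nat. x [^] i) \<subseteq> ?E" by auto
  then have "finite (range (\<lambda>i::nat. x [^] i))" using fin by (rule finite_subset)
  then have "\<not> inj (\<lambda>i::nat. x [^] i)" using finite_imageD by auto
  then obtain i j :: nat where ij: "i < j" "x [^] i = x [^] j"
    unfolding inj_def by (metis linorder_neqE_nat)
  have nz: "x [^] i \<noteq> \<zero>" for i :: nat
    using x by (induction i) (auto dest: integral)
  have "x [^] i \<otimes> x [^] (j - i) = x [^] i \<otimes> \<one>" using ij(1) x ij(2)[symmetric] by (simp add: nat_pow_mult)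
  then have N: "x [^] (j - i) = \<one>" using nz[of i] x(1) by (metis m_lcancel nat_pow_closed one_closed)
  obtain k n where kn: "j - i = p ^ k * n" "\<not> p dvd n"
    using ij(1) p1 by (metis multiplicity_decompose' zero_less_diff neq0_conv not_prime_unit p)
  define y where "y = x [^] n"
  have y: "y \<in> carrier R" "y [^] (p ^ k) = \<one>" using N x kn(1) by (simp_all add: y_def nat_pow_pow mult.commute)
  have "\<one> \<oplus> (y \<ominus> \<one>) = y" using y by (simp add: a_minus_def a_lcomm r_neg)
  then have "\<one> = \<one> \<oplus> (y \<ominus> \<one>) [^] (p ^ k)"
    using frobenius_char[OF p char, of \<one> "y \<ominus> \<one>" k] y by simp
  then have z: "(y \<ominus> \<one>) [^] (p ^ k) = \<zero>"
    using y by (metis add.l_cancel_one' nat_pow_closed minus_closed one_closed)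
  have "a = \<zero>" if "a \<in> carrier R" "a [^] (i::nat) = \<zero>" for a i
    using that by (induction i) (auto dest: integral)
  then have "y \<ominus> \<one> = \<zero>" using z y by blast
  then have "x [^] n = \<one>" using y by (simp add: y_def)
  moreover have "n > 0" using kn(2) by (auto intro: Nat.gr0I)
  moreover have "coprime n p" using kn(2) p by (metis prime_imp_coprime coprime_commute)
  ultimately show ?thesis by blast
qed

section \<open>Non-archimedean valued fields\<close>

context nonarch_valued_field
begin

lemma absv_le_max_minus:
  assumes "x \<in> carrier C" "y \<in> carrier C"
  shows "absv (x \<ominus> y) \<le> max (absv x) (absv y)"
  using absv_ultra[of x "\<ominus> y"] absv_uminus[of y] assms by (simp add: a_minus_def)

lemma absv_zero: "absv \<zero> = 0"
  by (simp add: absv_eq_0_iff)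

lemma absv_pow: "x \<in> carrier C \<Longrightarrow> absv (x [^] (n::nat)) = absv x ^ n"
  by (induction n) (simp_all add: absv_one absv_mult)

lemma absv_minus_commute: "x \<in> carrier C \<Longrightarrow> y \<in> carrier C \<Longrightarrow> absv (x \<ominus> y) = absv (y \<ominus> x)"
proof -
  assume "x \<in> carrier C" "y \<in> carrier C"
  then have "y \<ominus> x = \<ominus> (x \<ominus> y)" by (simp add: a_minus_def minus_add a_comm)
  then show ?thesis using \<open>x \<in> _\<close> \<open>y \<in> _\<close> by (simp add: absv_uminus)
qed

lemma minus_trans: "x \<in> carrier C \<Longrightarrow> y \<in> carrier C \<Longrightarrow> z \<in> carrier C \<Longrightarrow> x \<ominus> z = (x \<ominus> y) \<oplus> (y \<ominus> z)"
  by (simp add: a_minus_def a_assoc r_neg1)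

lemma absv_triangle:
  assumes "x \<in> carrier C" "y \<in> carrier C" "z \<in> carrier C"
  shows "absv (x \<ominus> z) \<le> max (absv (x \<ominus> y)) (absv (y \<ominus> z))"
  using absv_ultra[of "x \<ominus> y" "y \<ominus> z"] minus_trans[OF assms] assms by simp

lemma absv_pos: "x \<in> carrier C \<Longrightarrow> x \<noteq> \<zero> \<Longrightarrow> absv x > 0"
  using absv_nonneg absv_eq_0_iff by (metis less_eq_real_def)

lemma absv_inv: "x \<in> carrier C \<Longrightarrow> x \<noteq> \<zero> \<Longrightarrow> absv (inv x) = inverse (absv x)"
proof -
  assume x: "x \<in> carrier C" "x \<noteq> \<zero>"
  then have U: "x \<in> Units C" by (simp add: field_Units)
  then have "absv (x \<otimes> inv x) = 1" by (simp add: absv_one)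
  then have "absv x * absv (inv x) = 1" using absv_mult[of x "inv x"] x(1) U by simp
  then show ?thesis by (simp add: inverse_unique)
qed

lemma absv_finsum_le:
  assumes "finite I" "\<And>i. i \<in> I \<Longrightarrow> f i \<in> carrier C" "\<And>i. i \<in> I \<Longrightarrow> absv (f i) \<le> e" "e \<ge> 0"
  shows "absv (finsum C f I) \<le> e"
  using assms(1-3)
proof (induction I rule: finite_induct)
  case empty
  then show ?case using assms(4) by (simp add: absv_zero)
next
  case (insert i I)
  then have "finsum C f I \<in> carrier C" by (intro finsum_closed) auto
  then show ?case using insert absv_ultra[of "f i" "finsum C f I"] by (simp add: Pi_def) (smt (verit))
qed

lemma mem_closure: "x \<in> closure T \<longleftrightarrow> x \<in> carrier C \<and> (\<forall>e>0. \<exists>y\<in>T \<inter> carrier C. absv (x \<ominus> y) < e)"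
proof -
  have "closure T = {x \<in> carrier C. \<forall>r>0. \<exists>y\<in>T. y \<in> absv.mball x r}"
    by (rule absv.metric_closure_of)
  then show ?thesis
    by (auto simp: absv.in_mball absv_dist_def)
qed

lemma subset_closure: "T \<subseteq> carrier C \<Longrightarrow> T \<subseteq> closure T"
  by (rule closure_of_subset) simp

lemma subfield_closure:
  assumes K: "subfield K C"
  shows "subfield (closure K) C"
proof (rule subfieldI')
  have KC: "K \<subseteq> carrier C" by (rule subfieldE(3)[OF K])
  note sub = subfieldE(1)[OF K]
  show "subring (closure K) C"
  proof (rule subringI)
    show "closure K \<subseteq> carrier C" by (auto simp: mem_closure)
    show "\<one> \<in> closure K" using subset_closure[OF KC] subringE(3)[OF sub] by auto
    fix x y assume x: "x \<in> closure K"
    then have xC: "x \<in> carrier C" by (simp add: mem_closure)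
    show "\<ominus> x \<in> closure K"
      unfolding mem_closure
    proof (intro conjI allI impI)
      fix e :: real assume "e > 0"
      then obtain a where a: "a \<in> K" "absv (x \<ominus> a) < e" using x by (auto simp: mem_closure)
      then have "absv (\<ominus> x \<ominus> \<ominus> a) < e"
        using xC KC absv_minus_commute[of x a] by (simp add: a_minus_def subset_iff a_comm)
      then show "\<exists>y\<in>K \<inter> carrier C. absv (\<ominus> x \<ominus> y) < e" using a KC subringE(5)[OF sub] by blast
    qed (use xC in simp)
    assume y: "y \<in> closure K"
    then have yC: "y \<in> carrier C" by (simp add: mem_closure)
    show "x \<oplus> y \<in> closure K"
      unfolding mem_closure
    proof (intro conjI allI impI)
      fix e :: real assume "e > 0"
      then obtain a b where a: "a \<in> K" "absv (x \<ominus> a) < e" and b: "b \<in> K" "absv (y \<ominus> b) < e"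
        using x y unfolding mem_closure by blast
      have ab: "a \<in> carrier C" "b \<in> carrier C" using a b KC by auto
      have "(x \<oplus> y) \<ominus> (a \<oplus> b) = (x \<ominus> a) \<oplus> (y \<ominus> b)"
        using xC yC ab by (simp add: a_minus_def minus_add a_ac)
      then have "absv ((x \<oplus> y) \<ominus> (a \<oplus> b)) < e"
        using absv_ultra[of "x \<ominus> a" "y \<ominus> b"] a b xC yC ab by simp
      then show "\<exists>z\<in>K \<inter> carrier C. absv (x \<oplus> y \<ominus> z) < e" using a b ab subringE(7)[OF sub] by blast
    qed (use xC yC in simp)
    show "x \<otimes> y \<in> closure K"
      unfolding mem_closure
    proof (intro conjI allI impI)
      fix e :: real assume e: "e > 0"
      define M where "M = absv x + absv y + 1"
      have M: "M \<ge> 1" "absv x \<le> M" "absv y \<le> M" using absv_nonneg[OF xC] absv_nonneg[OF yC] by (simp_all add: M_def)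
      define d where "d = min 1 (e / M)"
      have d: "d > 0" "d \<le> 1" "d * M \<le> e" using e M by (auto simp: d_def min_def field_simps)
      obtain a b where a: "a \<in> K" "absv (x \<ominus> a) < d" and b: "b \<in> K" "absv (y \<ominus> b) < d"
        using x y d(1) unfolding mem_closure by blast
      have ab: "a \<in> carrier C" "b \<in> carrier C" using a b KC by auto
      have bM: "absv b \<le> M"
      proof -
        have "b = y \<ominus> (y \<ominus> b)" using yC ab by (simp add: a_minus_def minus_add r_neg2)
        then have "absv b \<le> max (absv y) (absv (y \<ominus> b))" using absv_le_max_minus[of y "y \<ominus> b"] yC ab by simp
        then show ?thesis using M b d by simp
      qed
      have "x \<otimes> y \<ominus> a \<otimes> b = x \<otimes> (y \<ominus> b) \<oplus> (x \<ominus> a) \<otimes> b"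
        using xC yC ab by (simp add: a_minus_def r_distr l_distr r_minus l_minus a_assoc r_neg1)
      then have "absv (x \<otimes> y \<ominus> a \<otimes> b) \<le> max (absv x * absv (y \<ominus> b)) (absv (x \<ominus> a) * absv b)"
        using absv_ultra[of "x \<otimes> (y \<ominus> b)" "(x \<ominus> a) \<otimes> b"] xC yC ab by (simp add: absv_mult)
      also have "\<dots> < e"
      proof -
        have "absv x * absv (y \<ominus> b) \<le> M * absv (y \<ominus> b)" using M absv_nonneg[of "y \<ominus> b"] yC ab by (intro mult_right_mono) auto
        also have "\<dots> < M * d" using b M by (intro mult_strict_left_mono) auto
        finally have 1: "absv x * absv (y \<ominus> b) < e" using d by (simp add: mult.commute)
        have "absv (x \<ominus> a) * absv b \<le> absv (x \<ominus> a) * M" using bM absv_nonneg[of "x \<ominus> a"] xC ab by (intro mult_left_mono) auto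
        also have "\<dots> < d * M" using a M by (intro mult_strict_right_mono) auto
        finally show ?thesis using 1 d by simp
      qed
      finally show "\<exists>z\<in>K \<inter> carrier C. absv (x \<otimes> y \<ominus> z) < e" using a b ab subringE(6)[OF sub] by blast
    qed (use xC yC in simp)
  qed
  fix x assume "x \<in> closure K - {\<zero>}"
  then have x: "x \<in> closure K" "x \<noteq> \<zero>" and xC: "x \<in> carrier C" by (auto simp: mem_closure)
  have ax: "absv x > 0" using absv_pos xC x by simp
  have xU: "x \<in> Units C" using xC x by (simp add: field_Units)
  show "inv x \<in> closure K"
    unfolding mem_closure
  proof (intro conjI allI impI)
    fix e :: real assume e: "e > 0"
    define d where "d = min (absv x) (e * absv x * absv x)"
    have d: "d > 0" using ax e by (simp add: d_def)
    obtain a where a: "a \<in> K" "absv (x \<ominus> a) < d" using x(1) d unfolding mem_closure by blast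
    have aC: "a \<in> carrier C" using a KC by auto
    have a_ge: "absv a \<ge> absv x"
    proof -
      have "x = (x \<ominus> a) \<oplus> a" using xC aC by (simp add: a_minus_def a_assoc l_neg)
      then have "absv x \<le> max (absv (x \<ominus> a)) (absv a)" using absv_ultra[of "x \<ominus> a" a] xC aC by simp
      then show ?thesis using a(2) by (auto simp: d_def max_def split: if_splits)
    qed
    then have a0: "a \<noteq> \<zero>" using ax by (auto simp: absv_zero)
    have aU: "a \<in> Units C" using aC a0 by (simp add: field_Units)
    have "inv x \<ominus> inv a = inv x \<otimes> inv a \<otimes> (a \<ominus> x)"
    proof -
      have "inv x \<otimes> inv a \<otimes> a = inv x" using xC aC xU aU by (simp add: m_assoc)
      moreover have "inv x \<otimes> inv a \<otimes> x = inv a"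
        using xC aC xU aU m_comm[of "inv x" "inv a"] by (simp add: m_assoc)
      ultimately show ?thesis using xC aC xU aU by (simp add: a_minus_def r_distr r_minus)
    qed
    then have "absv (inv x \<ominus> inv a) = absv (x \<ominus> a) / (absv x * absv a)"
      using xC aC x(2) a0 xU aU absv_minus_commute[OF xC aC] by (simp add: absv_mult absv_inv field_simps)
    also have "\<dots> \<le> absv (x \<ominus> a) / (absv x * absv x)"
      using ax a_ge absv_nonneg[of "x \<ominus> a"] xC aC by (intro divide_left_mono mult_left_mono) auto
    also have "\<dots> < e" using a(2) ax by (simp add: d_def pos_divide_less_eq mult.assoc)
    finally show "\<exists>z\<in>K \<inter> carrier C. absv (inv x \<ominus> z) < e"
      using aU subfield_m_inv(1)[OF K, of a] a a0 by (intro bexI[of _ "inv a"]) auto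
  qed (use xU in simp)
qed

lemma closure_limit:
  assumes "b \<in> carrier C" "\<And>e. e > 0 \<Longrightarrow> \<exists>x\<in>closure T. absv (b \<ominus> x) < e"
  shows "b \<in> closure T"
  unfolding mem_closure
proof (intro conjI allI impI assms(1))
  fix e :: real assume "e > 0"
  then obtain x where x: "x \<in> closure T" "absv (b \<ominus> x) < e" using assms(2) by blast
  then obtain y where y: "y \<in> T \<inter> carrier C" "absv (x \<ominus> y) < e" using \<open>e > 0\<close> unfolding mem_closure by blast
  have "absv (b \<ominus> y) \<le> max (absv (b \<ominus> x)) (absv (x \<ominus> y))"
    using assms(1) x y by (intro absv_triangle) (auto simp: mem_closure)
  then show "\<exists>y\<in>T \<inter> carrier C. absv (b \<ominus> y) < e" using x y by (intro bexI[of _ y]) auto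
qed

lemma complete_geometric:
  assumes complete: "absv.mcomplete" and r: "0 < r" "r < 1"
    and P: "\<And>k. P k \<in> carrier C" and step: "\<And>k. absv (P (Suc k) \<ominus> P k) \<le> r ^ k"
  shows "\<exists>b\<in>carrier C. \<forall>k. absv (b \<ominus> P k) \<le> r ^ k"
proof -
  have far: "absv (P (k + l) \<ominus> P k) \<le> r ^ k" for k l :: nat
  proof (induction l)
    case 0
    then show ?case using P r by (simp add: a_minus_def r_neg absv_zero)
  next
    case (Suc l)
    have "absv (P (k + Suc l) \<ominus> P k) \<le> max (absv (P (Suc (k + l)) \<ominus> P (k + l))) (absv (P (k + l) \<ominus> P k))"
      using P by (simp add: absv_triangle)
    moreover have "r ^ (k + l) \<le> r ^ k" using r by (intro power_decreasing) auto
    ultimately show ?case using Suc step[of "k + l"] by simp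
  qed
  have small: "\<exists>N. r ^ N < e" if "e > 0" for e :: real using real_arch_pow_inv[OF that r(2)] by blast
  have "absv.MCauchy P"
    unfolding absv.MCauchy_def
  proof (intro conjI allI impI)
    show "range P \<subseteq> carrier C" using P by auto
    fix e :: real assume "e > 0"
    then obtain N where N: "r ^ N < e" using small by blast
    show "\<exists>N. \<forall>n n'. N \<le> n \<longrightarrow> N \<le> n' \<longrightarrow> absv_dist (P n) (P n') < e"
    proof (intro exI[of _ N] allI impI)
      fix n n' assume nn: "N \<le> n" "N \<le> n'"
      have "absv (P n \<ominus> P n') \<le> max (absv (P n \<ominus> P N)) (absv (P N \<ominus> P n'))" using P by (intro absv_triangle)
      also have "absv (P N \<ominus> P n') = absv (P n' \<ominus> P N)" using P by (intro absv_minus_commute)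
      finally show "absv_dist (P n) (P n') < e"
        using far[of N "n - N"] far[of N "n' - N"] nn N P by (simp add: absv_dist_def)
    qed
  qed
  then obtain b where b: "limitin absv.mtopology P b sequentially"
    using complete unfolding absv.mcomplete_def by blast
  then have bC: "b \<in> carrier C" by (simp add: absv.limit_metric_sequentially)
  have "absv (b \<ominus> P k) \<le> r ^ k" for k
  proof -
    have "r ^ k > 0" using r by simp
    then obtain N where N: "\<And>n. n \<ge> N \<Longrightarrow> absv_dist (P n) b < r ^ k"
      using b unfolding absv.limit_metric_sequentially by blast
    define n where "n = max N k"
    have "absv (b \<ominus> P k) \<le> max (absv (b \<ominus> P n)) (absv (P n \<ominus> P k))" using P bC by (intro absv_triangle)
    moreover have "absv (b \<ominus> P n) < r ^ k"
      using N[of n] P bC absv_minus_commute[of b "P n"] by (simp add: n_def absv_dist_def)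
    moreover have "absv (P n \<ominus> P k) \<le> r ^ k" using far[of k "n - k"] by (simp add: n_def)
    ultimately show ?thesis by simp
  qed
  with bC show ?thesis by blast
qed

end

section \<open>Primitive roots of unity\<close>

lemma (in monoid) nat_pow_exp_mult: "x \<in> carrier G \<Longrightarrow> x [^] (m * n :: nat) = (x [^] m) [^] n"
  by (simp add: nat_pow_pow)

lemma (in field) exists_root_of_power_minus:
  assumes alg: "algebraically_closed R" and c: "c \<in> carrier R" and n: "n > 0"
  shows "\<exists>x\<in>carrier R. x [^] (n::nat) = c"
proof -
  interpret alg: algebraically_closed R by (rule alg)
  define P where "P = \<one> # replicate (n - 1) \<zero> @ [\<ominus> c]"
  have P: "P \<in> carrier (poly_ring R)" unfolding P_def by (rule power_minus_carrier[OF c])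
  have "size (roots P) = length P - 1" using alg.roots_over_carrier[OF P] by (simp add: splitted_def)
  also have "length P - 1 = n" using n by (simp add: P_def)
  finally have "roots P \<noteq> {#}" using n by auto
  then obtain x where "x \<in># roots P" by auto
  then have "is_root P x" using roots_mem_iff_is_root[OF P] by simp
  then have "x \<in> carrier R" "x [^] Suc (n - 1) \<ominus> c = \<zero>"
    using eval_power_minus[of x c "n - 1"] c by (auto simp: is_root_def P_def)
  then show ?thesis using n c by (intro bexI[of _ x]) simp_all
qed

text \<open>
  A root of \<open>1 + X + \<dots> + X\<^sup>l\<^sup>-\<^sup>1\<close> is an \<open>l\<close>-th root of unity, and it is not \<open>1\<close> because \<open>l\<close> is not zero in the field.
\<close>

lemma (in field) exists_root_of_unity_prime:
  assumes alg: "algebraically_closed R" and l: "l > 1" and nz: "add_pow R l \<one> \<noteq> \<zero>"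
  shows "\<exists>x\<in>carrier R. x [^] (l::nat) = \<one> \<and> x \<noteq> \<one>"
proof -
  interpret alg: algebraically_closed R by (rule alg)
  define P where "P = replicate l \<one>"
  have P: "P \<in> carrier (poly_ring R)"
    unfolding P_def using l by (auto simp: univ_poly_carrier[symmetric] polynomial_def)
  have "size (roots P) = length P - 1" using alg.roots_over_carrier[OF P] by (simp add: splitted_def)
  also have "length P - 1 = l - 1" by (simp add: P_def)
  finally have "roots P \<noteq> {#}" using l by auto
  then obtain x where "x \<in># roots P" by auto
  then have x: "x \<in> carrier R" "eval (replicate l \<one>) x = \<zero>"
    using roots_mem_iff_is_root[OF P] by (auto simp: is_root_def P_def)
  have geom: "eval (replicate k \<one>) x \<otimes> (x \<ominus> \<one>) = x [^] k \<ominus> \<one>" for k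
  proof (induction k)
    case 0
    show ?case using x(1) by (simp add: a_minus_def r_neg)
  next
    case (Suc k)
    have cl: "eval (replicate k \<one>) x \<in> carrier R" by (rule eval_in_carrier) (use x(1) in auto)
    have "eval (replicate (Suc k) \<one>) x \<otimes> (x \<ominus> \<one>) = x [^] k \<otimes> (x \<ominus> \<one>) \<oplus> (x [^] k \<ominus> \<one>)"
      using x(1) cl Suc by (simp add: l_distr)
    then show ?case using x(1) by (simp add: a_minus_def r_distr r_minus a_assoc r_neg1)
  qed
  have "x [^] l \<ominus> \<one> = \<zero>" using geom[of l] x by simp
  then have "x [^] l = \<one>" using x(1) by simp
  moreover have "x \<noteq> \<one>"
  proof
    assume "x = \<one>"
    moreover have "eval (replicate k \<one>) \<one> = add_pow R k \<one>" for k
      by (induction k) (simp_all add: a_comm)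
    ultimately show False using x(2) nz by simp
  qed
  ultimately show ?thesis using x(1) by blast
qed

definition primitive_root :: "('c, 'k) ring_scheme \<Rightarrow> nat \<Rightarrow> 'c \<Rightarrow> bool" where
  "primitive_root R n x \<longleftrightarrow> x \<in> carrier R \<and> x [^]\<^bsub>R\<^esub> n = \<one>\<^bsub>R\<^esub> \<and> (\<forall>d. x [^]\<^bsub>R\<^esub> d = \<one>\<^bsub>R\<^esub> \<longrightarrow> n dvd d)"

text \<open>
  Let \<open>l\<close> be a prime divisor of \<open>n = l m\<close> and \<open>y\<close> a primitive root of order \<open>m\<close>. If \<open>l\<close> divides \<open>m\<close>, an \<open>l\<close>-th root of
  \<open>y\<close> is primitive of order \<open>n\<close>; otherwise the product of \<open>y\<close> with a primitive root of order \<open>l\<close> is.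
\<close>

lemma (in field) exists_primitive_root:
  assumes alg: "algebraically_closed R" and "n > 0" and nz: "\<And>l. Factorial_Ring.prime (l::nat) \<Longrightarrow> l dvd n \<Longrightarrow> add_pow R l \<one> \<noteq> \<zero>"
  shows "\<exists>x. primitive_root R n x"
  using assms(2) nz
proof (induction n rule: less_induct)
  case (less n)
  show ?case
  proof (cases "n = 1")
    case True
    then show ?thesis by (intro exI[of _ \<one>]) (simp add: primitive_root_def)
  next
    case False
    then obtain l where l: "Factorial_Ring.prime l" "l dvd n" using prime_factor_nat by blast
    then obtain m where m: "n = l * m" by (elim dvdE)
    have l1: "l > 1" using l(1) by (rule prime_gt_1_nat)
    have m0: "m > 0" "m < n" using less.prems(1) l1 m by auto
    obtain y where y: "y \<in> carrier R" "y [^] m = \<one>" "\<And>d. y [^] d = \<one> \<Longrightarrow> m dvd d"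
      using less.IH[OF m0(2,1)] less.prems(2) m by (auto simp: primitive_root_def)
    have pow_eq: "x [^] (d mod n) = x [^] d" if "x \<in> carrier R" "x [^] n = \<one>" for x d
    proof -
      have "x [^] d = x [^] (n * (d div n)) \<otimes> x [^] (d mod n)" using that(1) by (simp add: nat_pow_mult)
      also have "x [^] (n * (d div n)) = \<one>" using that by (simp add: nat_pow_exp_mult)
      finally show ?thesis using that(1) by simp
    qed
    show ?thesis
    proof (cases "l dvd m")
      case True
      obtain x where x: "x \<in> carrier R" "x [^] l = y"
        using exists_root_of_power_minus[OF alg y(1), of l] l1 by auto
      have xn: "x [^] n = \<one>" using x y(2) by (simp add: m nat_pow_exp_mult)
      have "n dvd d" if d: "x [^] d = \<one>" for d
      proof -
        have "y [^] d = (x [^] d) [^] l" using x(1) unfolding x(2)[symmetric] by (simp add: nat_pow_pow mult.commute)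
        then have "m dvd d" using d y(3) by simp
        then have "l dvd d" using True by (rule dvd_trans[rotated])
        then obtain k where k: "d = l * k" by (elim dvdE)
        then have "y [^] k = \<one>" using d x by (simp add: nat_pow_exp_mult)
        then show ?thesis using y(3) k m by simp
      qed
      with x xn show ?thesis by (auto simp: primitive_root_def)
    next
      case False
      then have cop: "coprime l m" using l(1) by (simp add: prime_imp_coprime)
      obtain z where z: "z \<in> carrier R" "z [^] l = \<one>" "z \<noteq> \<one>"
        using exists_root_of_unity_prime[OF alg l1 less.prems(2)[OF l]] by blast
      have z_dvd: "l dvd d" if d: "z [^] d = \<one>" for d
      proof (rule ccontr)
        assume "\<not> l dvd d"
        then have "coprime d l" using l(1) by (metis prime_imp_coprime coprime_commute)
        then obtain e where "[d * e = Suc 0] (mod l)" using cong_solve_coprime_nat by blast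
        then have "d * e mod l = 1" using l1 by (simp add: cong_def)
        moreover define k where "k = d * e div l"
        ultimately have de: "d * e = l * k + 1" using mult_div_mod_eq[of l "d * e"] by simp
        have "z [^] (d * e) = \<one>" using d z(1) by (simp add: nat_pow_exp_mult)
        moreover have "z [^] (d * e) = z"
          unfolding de using z(1,2) by (simp add: nat_pow_mult[symmetric] nat_pow_exp_mult)
        ultimately show False using z(3) by simp
      qed
      have xn: "(y \<otimes> z) [^] n = \<one>"
      proof -
        have "y [^] n = (y [^] m) [^] l" "z [^] n = (z [^] l) [^] m"
          unfolding m using nat_pow_exp_mult[OF y(1), of m l] nat_pow_exp_mult[OF z(1), of l m] by (simp_all only: mult.commute)
        then show ?thesis using y(1,2) z(1,2) by (simp add: nat_pow_distrib)
      qed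
      have "n dvd d" if d: "(y \<otimes> z) [^] d = \<one>" for d
      proof -
        have yz: "y [^] d \<otimes> z [^] d = \<one>" using d y z by (simp add: nat_pow_distrib)
        have "z [^] (d * m) = \<one>"
        proof -
          have "(y [^] d \<otimes> z [^] d) [^] m = (y [^] m) [^] d \<otimes> z [^] (d * m)"
            using y(1) z(1) nat_pow_pow[OF y(1), of d m] nat_pow_pow[OF y(1), of m d] nat_pow_pow[OF z(1), of d m]
            by (simp add: nat_pow_distrib mult.commute)
          then show ?thesis using yz y(2) z(1) by simp
        qed
        then have "l dvd d * m" by (rule z_dvd)
        then have "l dvd d" using cop by (simp add: coprime_dvd_mult_left_iff)
        have "y [^] (d * l) = \<one>"
        proof -
          have "(y [^] d \<otimes> z [^] d) [^] l = y [^] (d * l) \<otimes> (z [^] l) [^] d"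
            using y(1) z(1) nat_pow_pow[OF z(1), of d l] nat_pow_pow[OF z(1), of l d] nat_pow_pow[OF y(1), of d l]
            by (simp add: nat_pow_distrib mult.commute)
          then show ?thesis using yz y(1) z(2) by simp
        qed
        then have "m dvd d * l" by (rule y(3))
        then have "m dvd d" using cop by (simp add: coprime_dvd_mult_left_iff coprime_commute)
        obtain k where k: "d = l * k" using \<open>l dvd d\<close> by (elim dvdE)
        with \<open>m dvd d\<close> have "m dvd k" using cop by (metis coprime_commute coprime_dvd_mult_right_iff)
        then show ?thesis unfolding m k by simp
      qed
      with y z xn show ?thesis by (intro exI[of _ "y \<otimes> z"]) (auto simp: primitive_root_def)
    qed
  qed
qed

section \<open>The p-adic integers\<close>

context padic_complex_field
begin

abbreviation of_Z :: "int \<Rightarrow> 'a" where "of_Z k \<equiv> add_pow C k \<one>"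

lemma of_Z_closed [simp]: "of_Z k \<in> carrier C" by simp

lemma of_Z_add: "of_Z (j + k) = of_Z j \<oplus> of_Z k"
  by (simp add: add.int_pow_mult)

lemma of_Z_mult: "of_Z (j * k) = of_Z j \<otimes> of_Z k"
  by (simp add: add_pow_ldistr_int add.int_pow_pow mult.commute)

lemma of_Z_minus: "of_Z (- k) = \<ominus> of_Z k"
  by (simp add: add.int_pow_neg)

lemma of_Z_diff: "of_Z (j - k) = of_Z j \<ominus> of_Z k"
  using of_Z_add[of j "- k"] by (simp add: of_Z_minus a_minus_def)

lemma of_Z_0: "of_Z 0 = \<zero>" by (simp add: add_pow_int_ge)
lemma of_Z_1: "of_Z 1 = \<one>" by (simp add: add_pow_int_ge)

end

locale padic_prime_field = padic_complex_field +
  assumes prime: "Factorial_Ring.prime p"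
begin

lemma p1: "p > 1" using prime by (rule prime_gt_1_nat)

lemma absv_of_Z_pos: "k \<noteq> 0 \<Longrightarrow> absv (of_Z k) > 0"
  using absv_of_int[of k] p1 by simp

lemma of_Z_nonzero: "k \<noteq> 0 \<Longrightarrow> of_Z k \<noteq> \<zero>"
  using absv_of_Z_pos[of k] absv_zero by auto

lemma absv_of_Z_le: "absv (of_Z k) \<le> 1"
proof (cases "k = 0")
  case True
  then show ?thesis by (simp add: of_Z_0 absv_zero)
next
  case False
  have "real p ^ multiplicity (int p) k \<ge> 1" using p1 by (intro one_le_power) simp
  then show ?thesis using absv_of_int[OF False] p1 by (simp add: divide_le_eq_1)
qed

lemma multiplicity_p: "multiplicity (int p) (int p) = 1"
  by (rule multiplicity_self) (use p1 in auto)

lemma absv_of_Z_dvd: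
  assumes "int p dvd k"
  shows "absv (of_Z k) \<le> 1 / p"
proof -
  obtain j where "k = int p * j" using assms by (elim dvdE)
  moreover have "absv (of_Z (int p)) = 1 / p"
    using absv_of_int[of "int p"] p1 by (simp add: multiplicity_p)
  ultimately have "absv (of_Z k) = 1 / p * absv (of_Z j)" by (simp add: of_Z_mult absv_mult)
  also have "\<dots> \<le> 1 / p * 1" using absv_of_Z_le[of j] by (intro mult_left_mono) auto
  finally show ?thesis by simp
qed

lemma absv_of_Z_unit:
  assumes "\<not> int p dvd k"
  shows "absv (of_Z k) = 1"
proof -
  have "k \<noteq> 0" using assms by auto
  moreover have "multiplicity (int p) k = 0" using assms by (rule not_dvd_imp_multiplicity_0)
  ultimately show ?thesis using absv_of_int[of k] by simp
qed

abbreviation Q0 :: "'a set" where "Q0 \<equiv> generate_field C {}"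

lemma subfield_Q0: "subfield Q0 C"
  by (rule generate_field_is_subfield) simp

lemma subfield_Qp: "subfield Qp C"
  unfolding Qp_def by (rule subfield_closure[OF subfield_Q0])

lemma Qp_carrier: "a \<in> Qp \<Longrightarrow> a \<in> carrier C"
  using subfieldE(3)[OF subfield_Qp] by auto

lemma of_Z_in:
  assumes "subring S C"
  shows "of_Z k \<in> S"
proof -
  have nat: "add_pow C (n::nat) \<one> \<in> S" for n
    by (induction n) (use subringE(2,3,7)[OF assms] in auto)
  show ?thesis
    by (cases k rule: int_cases2) (use nat subringE(5)[OF assms] in \<open>auto simp: add_pow_int_ge of_Z_minus\<close>)
qed

lemma of_Z_Qp: "of_Z k \<in> Qp"
  by (rule of_Z_in[OF subfieldE(1)[OF subfield_Qp]])

lemma Q0_fraction: "h \<in> Q0 \<Longrightarrow> \<exists>b c. c \<noteq> 0 \<and> of_Z c \<otimes> h = of_Z b"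
proof (induction h rule: generate_field.induct)
  case one
  show ?case by (intro exI[of _ 1]) (simp add: of_Z_1)
next
  case (a_inv h)
  then obtain b c where "c \<noteq> 0" "of_Z c \<otimes> h = of_Z b" by blast
  moreover have "h \<in> carrier C" using a_inv.hyps subfieldE(3)[OF subfield_Q0] by auto
  ultimately show ?case by (intro exI[of _ "- b"] exI[of _ c]) (simp add: r_minus of_Z_minus)
next
  case (m_inv h)
  then obtain b c where bc: "c \<noteq> 0" "of_Z c \<otimes> h = of_Z b" by blast
  have h: "h \<in> carrier C" using m_inv.hyps subfieldE(3)[OF subfield_Q0] by auto
  then have U: "h \<in> Units C" using m_inv.hyps(2) by (simp add: field_Units)
  have "b \<noteq> 0"
  proof
    assume "b = 0"
    then have "of_Z c \<otimes> h = \<zero>" using bc by (simp add: of_Z_0)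
    then show False using of_Z_nonzero[OF bc(1)] m_inv.hyps(2) h integral by auto
  qed
  moreover have "of_Z b \<otimes> inv h = of_Z c"
    using h U by (simp add: bc(2)[symmetric] m_assoc)
  ultimately show ?case by blast
next
  case (eng_add h1 h2)
  then obtain b c b' c' where bc: "c \<noteq> 0" "of_Z c \<otimes> h1 = of_Z b" "c' \<noteq> 0" "of_Z c' \<otimes> h2 = of_Z b'" by blast
  have h: "h1 \<in> carrier C" "h2 \<in> carrier C" using eng_add.hyps subfieldE(3)[OF subfield_Q0] by auto
  have "of_Z (c * c') \<otimes> (h1 \<oplus> h2) = of_Z c' \<otimes> (of_Z c \<otimes> h1) \<oplus> of_Z c \<otimes> (of_Z c' \<otimes> h2)"
    using h by (simp add: of_Z_mult r_distr l_distr m_ac)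
  also have "\<dots> = of_Z (c' * b + c * b')" by (simp add: bc of_Z_mult of_Z_add)
  finally show ?case using bc by (intro exI[of _ "c' * b + c * b'"] exI[of _ "c * c'"]) simp
next
  case (eng_mult h1 h2)
  then obtain b c b' c' where bc: "c \<noteq> 0" "of_Z c \<otimes> h1 = of_Z b" "c' \<noteq> 0" "of_Z c' \<otimes> h2 = of_Z b'" by blast
  have h: "h1 \<in> carrier C" "h2 \<in> carrier C" using eng_mult.hyps subfieldE(3)[OF subfield_Q0] by auto
  have "of_Z (c * c') \<otimes> (h1 \<otimes> h2) = (of_Z c \<otimes> h1) \<otimes> (of_Z c' \<otimes> h2)"
    using h by (simp add: of_Z_mult m_ac)
  also have "\<dots> = of_Z (b * b')" by (simp add: bc of_Z_mult)
  finally show ?case using bc by (intro exI[of _ "b * b'"] exI[of _ "c * c'"]) simp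
qed auto

text \<open>
  A fraction \<open>b/c\<close> in lowest terms of absolute value at most \<open>1\<close> has a denominator prime to \<open>p\<close>, so it is congruent
  modulo \<open>p\<close> to an integer.
\<close>

lemma Q0_approx:
  assumes h: "h \<in> Q0" "absv h \<le> 1"
  shows "\<exists>k::nat. absv (h \<ominus> of_Z (int k)) \<le> 1 / p"
proof -
  have hC: "h \<in> carrier C" using h subfieldE(3)[OF subfield_Q0] by auto
  obtain b0 c0 where bc0: "c0 \<noteq> 0" "of_Z c0 \<otimes> h = of_Z b0" using Q0_fraction[OF h(1)] by blast
  define g where "g = gcd b0 c0"
  have g: "g \<noteq> 0" using bc0 by (simp add: g_def)
  obtain b c where bc: "b0 = g * b" "c0 = g * c" "coprime b c"
    using bc0(1) unfolding g_def by (metis gcd_coprime_exists gcd_eq_0_iff mult.commute)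
  have "of_Z g \<otimes> (of_Z c \<otimes> h) = of_Z g \<otimes> of_Z b"
    using bc0(2) hC by (simp add: bc of_Z_mult m_assoc)
  then have ch: "of_Z c \<otimes> h = of_Z b" using of_Z_nonzero[OF g] hC by (simp add: m_lcancel)
  have pc: "\<not> int p dvd c"
  proof
    assume pc: "int p dvd c"
    have "\<not> int p dvd b"
      using pc bc(3) prime by (metis coprime_common_divisor not_prime_unit prime_int_iff prime_nat_int_transfer)
    then have "1 = absv (of_Z c) * absv h"
      using ch hC absv_of_Z_unit[of b] by (simp flip: absv_mult)
    also have "\<dots> \<le> absv (of_Z c) * 1" using h(2) absv_nonneg by (intro mult_left_mono) auto
    also have "\<dots> \<le> 1 / p" using absv_of_Z_dvd[OF pc] by simp
    also have "\<dots> < 1" using p1 by simp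
    finally show False by simp
  qed
  then have "coprime c (int p)" using prime by (metis coprime_commute prime_imp_coprime prime_int_iff prime_nat_int_transfer)
  then obtain c' where c': "[c * c' = 1] (mod int p)" using cong_solve_coprime_int by blast
  define k where "k = nat ((b * c') mod int p)"
  have k: "int k = (b * c') mod int p" using p1 by (simp add: k_def)
  have "[c * int k = b] (mod int p)"
  proof -
    have "[c * int k = c * (b * c')] (mod int p)" unfolding k by (intro cong_mult) (auto simp: cong_def)
    also have "c * (b * c') = b * (c * c')" by simp
    also have "[b * (c * c') = b * 1] (mod int p)" using c' by (intro cong_mult) auto
    finally show ?thesis by simp
  qed
  then have dvd: "int p dvd b - c * int k" by (metis cong_iff_dvd_diff cong_sym)
  have "of_Z c \<otimes> (h \<ominus> of_Z (int k)) = of_Z (b - c * int k)"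
    using hC ch by (simp add: a_minus_def r_distr r_minus of_Z_diff of_Z_mult)
  then have "absv (of_Z c) * absv (h \<ominus> of_Z (int k)) = absv (of_Z (b - c * int k))"
    using hC by (metis absv_mult of_Z_closed minus_closed)
  then have "absv (h \<ominus> of_Z (int k)) \<le> 1 / p"
    using absv_of_Z_unit[OF pc] absv_of_Z_dvd[OF dvd] by simp
  then show ?thesis by blast
qed

definition varpi :: 'a where "varpi = of_Z (int p)"

lemma varpi: "varpi \<in> carrier C" "varpi \<noteq> \<zero>" "absv varpi = 1 / p" "varpi \<in> Qp"
  using absv_of_int[of "int p"] p1 of_Z_nonzero of_Z_Qp by (simp_all add: varpi_def multiplicity_p)

lemma absv_varpi_pow: "absv (varpi [^] (k::nat)) = (1 / p) ^ k"
  using varpi by (simp add: absv_pow)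

definition Zp :: "'a set" where "Zp = {a \<in> Qp. absv a \<le> 1}"

lemma Zp_carrier: "a \<in> Zp \<Longrightarrow> a \<in> carrier C"
  by (simp add: Zp_def Qp_carrier)

lemma subring_Zp: "subring Zp C"
proof (rule subringI)
  note sub = subfieldE(1)[OF subfield_Qp]
  show "Zp \<subseteq> carrier C" using Zp_carrier by auto
  show "\<one> \<in> Zp" using subringE(3)[OF sub] by (simp add: Zp_def absv_one)
  fix a b assume a: "a \<in> Zp"
  then show "\<ominus> a \<in> Zp" using subringE(5)[OF sub] by (simp add: Zp_def absv_uminus Qp_carrier)
  assume b: "b \<in> Zp"
  show "a \<otimes> b \<in> Zp"
    using a b subringE(6)[OF sub] absv_nonneg[OF Zp_carrier[OF a]] absv_nonneg[OF Zp_carrier[OF b]]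
    by (simp add: Zp_def absv_mult Qp_carrier mult_le_one)
  show "a \<oplus> b \<in> Zp"
    using a b subringE(7)[OF sub] absv_ultra[OF Zp_carrier[OF a] Zp_carrier[OF b]] by (auto simp: Zp_def)
qed

lemma varpi_Zp: "varpi \<in> Zp"
  using varpi p1 by (simp add: Zp_def)

lemma Zp_residue:
  assumes a: "a \<in> Zp"
  shows "\<exists>k::nat. \<exists>b\<in>Zp. a = of_Z (int k) \<oplus> varpi \<otimes> b"
proof -
  have aC: "a \<in> carrier C" by (rule Zp_carrier[OF a])
  have pp: "1 / real p > 0" using p1 by simp
  obtain h where h: "h \<in> Q0" "absv (a \<ominus> h) < 1 / p"
    using a pp unfolding Zp_def Qp_def mem_closure by blast
  have hC: "h \<in> carrier C" using h subfieldE(3)[OF subfield_Q0] by auto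
  have "absv h \<le> 1"
  proof -
    have "h = a \<ominus> (a \<ominus> h)" using aC hC by (simp add: a_minus_def minus_add r_neg2)
    then have "absv h \<le> max (absv a) (absv (a \<ominus> h))" using absv_le_max_minus[of a "a \<ominus> h"] aC hC by simp
    moreover have "1 / real p \<le> 1" using p1 by simp
    ultimately show ?thesis using h(2) a by (auto simp: Zp_def max_def split: if_splits)
  qed
  then obtain k :: nat where k: "absv (h \<ominus> of_Z (int k)) \<le> 1 / p" using Q0_approx h by blast
  have ak: "absv (a \<ominus> of_Z (int k)) \<le> 1 / p"
    using absv_triangle[OF aC hC of_Z_closed, of "int k"] h(2) k by simp
  define b where "b = inv varpi \<otimes> (a \<ominus> of_Z (int k))"
  have U: "varpi \<in> Units C" using varpi by (simp add: field_Units)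
  have "inv varpi \<in> Qp" using subfield_m_inv(1)[OF subfield_Qp, of varpi] varpi by simp
  moreover have "a \<ominus> of_Z (int k) \<in> Qp"
    using a of_Z_Qp subringE(5,7)[OF subfieldE(1)[OF subfield_Qp]] by (simp add: Zp_def a_minus_def)
  ultimately have "b \<in> Qp" unfolding b_def using subringE(6)[OF subfieldE(1)[OF subfield_Qp]] by simp
  moreover have "absv b = p * absv (a \<ominus> of_Z (int k))"
    using aC U varpi by (simp add: b_def absv_mult absv_inv)
  then have "absv b \<le> 1" using ak p1 by (simp add: field_simps)
  ultimately have "b \<in> Zp" by (simp add: Zp_def)
  moreover have "varpi \<otimes> b = a \<ominus> of_Z (int k)"
    using aC U varpi by (simp add: b_def m_assoc[symmetric])
  then have "a = of_Z (int k) \<oplus> varpi \<otimes> b" using aC by (simp add: a_minus_def a_lcomm r_neg)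
  ultimately show ?thesis by blast
qed

lemma Zp_limit:
  assumes P: "\<And>k. P k \<in> Zp" and step: "\<And>k. absv (P (Suc k) \<ominus> P k) \<le> (1 / p) ^ k"
  shows "\<exists>b\<in>Zp. \<forall>k. absv (b \<ominus> P k) \<le> (1 / p) ^ k"
proof -
  have r: "0 < 1 / real p" "1 / real p < 1" using p1 by simp_all
  obtain b where b: "b \<in> carrier C" "\<And>k. absv (b \<ominus> P k) \<le> (1 / p) ^ k"
    using complete_geometric[OF complete r Zp_carrier[OF P] step] by blast
  have "b \<in> Qp"
    unfolding Qp_def
  proof (rule closure_limit[OF b(1)])
    fix e :: real assume "e > 0"
    then obtain k where "(1 / real p) ^ k < e" using real_arch_pow_inv r(2) by blast
    then show "\<exists>x\<in>closure Q0. absv (b \<ominus> x) < e"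
      using P[of k] b(2)[of k] by (intro bexI[of _ "P k"]) (auto simp: Zp_def Qp_def)
  qed
  moreover have "absv b \<le> 1"
  proof -
    have "b = (b \<ominus> P 0) \<oplus> P 0" using b(1) Zp_carrier[OF P[of 0]] by (simp add: a_minus_def a_assoc l_neg)
    then have "absv b \<le> max (absv (b \<ominus> P 0)) (absv (P 0))"
      using absv_ultra[of "b \<ominus> P 0" "P 0"] b(1) Zp_carrier[OF P[of 0]] by simp
    then show ?thesis using b(2)[of 0] P[of 0] by (auto simp: Zp_def max_def split: if_splits)
  qed
  ultimately have "b \<in> Zp" by (simp add: Zp_def)
  then show ?thesis using b(2) by blast
qed

end

section \<open>Integers generated by a root of unity\<close>

locale padic_root_of_unity = padic_prime_field +
  fixes n :: nat and z :: 'a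
  assumes n: "n > 0" "coprime n p" and z: "z \<in> carrier C" "z [^] n = \<one>"
begin

lemma z_pow_mod: "z [^] (i mod n) = z [^] i"
proof -
  have "z [^] i = z [^] (n * (i div n)) \<otimes> z [^] (i mod n)" using z(1) by (simp add: nat_pow_mult)
  also have "z [^] (n * (i div n)) = \<one>" using z by (simp add: nat_pow_exp_mult)
  finally show ?thesis using z(1) by simp
qed

lemma absv_z: "absv (z [^] (i::nat)) = 1"
proof -
  have "absv z ^ n = 1" using absv_pow[OF z(1), of n] z(2) by (simp add: absv_one)
  then have "absv z ^ n = 1 ^ n" by (simp only: power_one)
  then have "absv z = 1" using n(1) absv_nonneg[OF z(1)] power_eq_imp_eq_base[of "absv z" n 1] by simp
  then show ?thesis using absv_pow[OF z(1)] by simp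
qed

definition comb :: "(nat \<Rightarrow> 'a) \<Rightarrow> 'a" where
  "comb a = (\<Oplus>i\<in>{..<n}. a i \<otimes> z [^] i)"

text \<open>
  The ring \<open>\<int>\<^sub>p[z]\<close>. Its elements are treated as combinations with \<open>n\<close> coefficients: these are not unique, but
  limits can be taken coefficientwise.
\<close>

definition S :: "'a set" where "S = {comb a | a. \<forall>i. a i \<in> Zp}"

lemma comb_closed: "(\<And>i. a i \<in> carrier C) \<Longrightarrow> comb a \<in> carrier C"
  unfolding comb_def using z by (intro finsum_closed) auto

lemma S_carrier: "s \<in> S \<Longrightarrow> s \<in> carrier C"
  unfolding S_def using comb_closed Zp_carrier by blast

lemma comb_S: "(\<And>i. a i \<in> Zp) \<Longrightarrow> comb a \<in> S"
  unfolding S_def by blast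

lemma comb_add: "(\<And>i. a i \<in> carrier C) \<Longrightarrow> (\<And>i. b i \<in> carrier C) \<Longrightarrow> comb a \<oplus> comb b = comb (\<lambda>i. a i \<oplus> b i)"
  unfolding comb_def using z by (subst finsum_addf[symmetric]) (auto simp: l_distr intro!: finsum_cong')

lemma comb_scale: "c \<in> carrier C \<Longrightarrow> (\<And>i. a i \<in> carrier C) \<Longrightarrow> c \<otimes> comb a = comb (\<lambda>i. c \<otimes> a i)"
  unfolding comb_def using z by (subst finsum_rdistr) (auto simp: m_assoc intro!: finsum_cong')

lemma absv_comb_le:
  assumes "\<And>i. a i \<in> carrier C" "\<And>i. absv (a i) \<le> e" "e \<ge> 0"
  shows "absv (comb a) \<le> e"
  unfolding comb_def using assms z absv_z by (intro absv_finsum_le) (auto simp: absv_mult)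

lemma absv_S: "s \<in> S \<Longrightarrow> absv s \<le> 1"
  unfolding S_def using absv_comb_le[of _ 1] Zp_carrier by (auto simp: Zp_def)

lemma S_add: "s \<in> S \<Longrightarrow> t \<in> S \<Longrightarrow> s \<oplus> t \<in> S"
proof -
  assume "s \<in> S" "t \<in> S"
  then obtain a b where ab: "s = comb a" "t = comb b" "\<And>i. a i \<in> Zp" "\<And>i. b i \<in> Zp" unfolding S_def by blast
  then have "s \<oplus> t = comb (\<lambda>i. a i \<oplus> b i)" by (simp add: comb_add Zp_carrier)
  then show ?thesis using ab subringE(7)[OF subring_Zp] by (simp add: comb_S)
qed

lemma S_scale: "c \<in> Zp \<Longrightarrow> s \<in> S \<Longrightarrow> c \<otimes> s \<in> S"
proof -
  assume c: "c \<in> Zp" and "s \<in> S"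
  then obtain a where a: "s = comb a" "\<And>i. a i \<in> Zp" unfolding S_def by blast
  then have "c \<otimes> s = comb (\<lambda>i. c \<otimes> a i)" using c by (simp add: comb_scale Zp_carrier)
  then show ?thesis using a c subringE(6)[OF subring_Zp] by (simp add: comb_S)
qed

lemma Zp_0: "\<zero> \<in> Zp" and Zp_1: "\<one> \<in> Zp"
  using subringE(2,3)[OF subring_Zp] .

lemma S_0: "\<zero> \<in> S"
proof -
  have "comb (\<lambda>i. \<zero>) = \<zero>" unfolding comb_def using z by (simp add: finsum_zero)
  then show ?thesis using comb_S[of "\<lambda>i. \<zero>"] Zp_0 by simp
qed

lemma S_z: "z [^] (i::nat) \<in> S"
proof -
  define j where "j = i mod n"
  have j: "j \<in> {..<n}" using n by (simp add: j_def)
  have "comb (\<lambda>k. if j = k then \<one> else \<zero>) = (\<Oplus>k\<in>{..<n}. if j = k then z [^] k else \<zero>)"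
    unfolding comb_def using z by (intro finsum_cong') auto
  also have "\<dots> = z [^] j" using z j by (intro finsum_singleton) auto
  also have "\<dots> = z [^] i" unfolding j_def by (rule z_pow_mod)
  finally have "z [^] i = comb (\<lambda>k. if j = k then \<one> else \<zero>)" by simp
  then show ?thesis using comb_S[of "\<lambda>k. if j = k then \<one> else \<zero>"] Zp_0 Zp_1 by simp
qed

lemma S_finsum: "finite I \<Longrightarrow> (\<And>i. i \<in> I \<Longrightarrow> f i \<in> S) \<Longrightarrow> finsum C f I \<in> S"
proof (induction I rule: finite_induct)
  case empty
  show ?case by (simp add: S_0)
next
  case (insert i I)
  then show ?case using S_carrier by (subst finsum_insert) (auto intro: S_add)
qed

lemma S_mult:
  assumes s: "s \<in> S" and t: "t \<in> S"
  shows "s \<otimes> t \<in> S"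
proof -
  obtain a b where a: "s = comb a" "\<And>i. a i \<in> Zp" and b: "t = comb b" "\<And>i. b i \<in> Zp" using s t unfolding S_def by blast
  have zt: "z [^] i \<otimes> t \<in> S" for i :: nat
  proof -
    have "z [^] i \<otimes> t = (\<Oplus>j\<in>{..<n}. b j \<otimes> z [^] (i + j))"
      unfolding b(1) comb_def using z b(2)[THEN Zp_carrier]
      by (subst finsum_rdistr) (auto intro!: finsum_cong' simp: nat_pow_mult[symmetric] m_ac)
    also have "\<dots> \<in> S" using b(2) S_z by (intro S_finsum) (auto intro: S_scale)
    finally show ?thesis .
  qed
  have "s \<otimes> t = (\<Oplus>i\<in>{..<n}. a i \<otimes> (z [^] i \<otimes> t))"
    unfolding a(1) comb_def using z a(2)[THEN Zp_carrier] S_carrier[OF t]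
    by (subst finsum_ldistr) (auto intro!: finsum_cong' simp: m_assoc)
  also have "\<dots> \<in> S" using a(2) zt by (intro S_finsum) (auto intro: S_scale)
  finally show ?thesis .
qed

lemma S_1: "\<one> \<in> S"
  using S_z[of 0] by simp

lemma subring_S: "subring S C"
proof (rule subringI)
  show "S \<subseteq> carrier C" using S_carrier by auto
  fix s assume s: "s \<in> S"
  have "\<ominus> \<one> \<otimes> s \<in> S" using s Zp_1 subringE(5)[OF subring_Zp] by (intro S_scale) auto
  then show "\<ominus> s \<in> S" using S_carrier[OF s] by (simp add: l_minus)
qed (auto intro: S_1 S_add S_mult)

lemma Zp_S: "a \<in> Zp \<Longrightarrow> a \<in> S"
  using S_scale[OF _ S_1, of a] Zp_carrier by simp

lemma S_pow: "s \<in> S \<Longrightarrow> s [^] (k::nat) \<in> S"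
  by (induction k) (auto intro: S_1 S_mult)

lemma varpi_pow_S: "varpi [^] (k::nat) \<in> S"
  by (rule S_pow[OF Zp_S[OF varpi_Zp]])

definition cong_S :: "nat \<Rightarrow> 'a \<Rightarrow> 'a \<Rightarrow> bool" where
  "cong_S k a b \<longleftrightarrow> (\<exists>u\<in>S. a = b \<oplus> varpi [^] k \<otimes> u)"

lemma cong_S_refl: "a \<in> S \<Longrightarrow> cong_S k a a"
  unfolding cong_S_def using S_carrier varpi by (intro bexI[of _ \<zero>] S_0) simp

lemma cong_S_trans: "cong_S k a b \<Longrightarrow> cong_S k b c \<Longrightarrow> c \<in> S \<Longrightarrow> cong_S k a c"
proof -
  assume "cong_S k a b" "cong_S k b c" and c: "c \<in> S"
  then obtain u v where u: "u \<in> S" "a = b \<oplus> varpi [^] k \<otimes> u" and v: "v \<in> S" "b = c \<oplus> varpi [^] k \<otimes> v"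
    unfolding cong_S_def by blast
  then have "a = c \<oplus> varpi [^] k \<otimes> (v \<oplus> u)"
    using S_carrier c varpi(1) by (simp add: r_distr a_assoc)
  then show ?thesis unfolding cong_S_def using u v S_add by blast
qed

lemma cong_S_sym: "cong_S k a b \<Longrightarrow> b \<in> S \<Longrightarrow> cong_S k b a"
proof -
  assume "cong_S k a b" and b: "b \<in> S"
  then obtain u where u: "u \<in> S" "a = b \<oplus> varpi [^] k \<otimes> u" unfolding cong_S_def by blast
  then have "b = a \<oplus> varpi [^] k \<otimes> (\<ominus> u)"
    using S_carrier b varpi(1) by (simp add: r_minus a_assoc r_neg)
  then show ?thesis unfolding cong_S_def using u subringE(5)[OF subring_S] by blast
qed

lemma cong_S_add: "cong_S k a b \<Longrightarrow> cong_S k c d \<Longrightarrow> b \<in> S \<Longrightarrow> d \<in> S \<Longrightarrow> cong_S k (a \<oplus> c) (b \<oplus> d)"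
proof -
  assume "cong_S k a b" "cong_S k c d" and bd: "b \<in> S" "d \<in> S"
  then obtain u v where u: "u \<in> S" "a = b \<oplus> varpi [^] k \<otimes> u" and v: "v \<in> S" "c = d \<oplus> varpi [^] k \<otimes> v"
    unfolding cong_S_def by blast
  then have "a \<oplus> c = (b \<oplus> d) \<oplus> varpi [^] k \<otimes> (u \<oplus> v)"
    using S_carrier bd varpi(1) by (simp add: r_distr a_ac)
  then show ?thesis unfolding cong_S_def using u v S_add by blast
qed

lemma cong_S_mult: "cong_S k a b \<Longrightarrow> cong_S k c d \<Longrightarrow> a \<in> S \<Longrightarrow> b \<in> S \<Longrightarrow> c \<in> S \<Longrightarrow> d \<in> S \<Longrightarrow> cong_S k (a \<otimes> c) (b \<otimes> d)"
proof -
  assume "cong_S k a b" "cong_S k c d" and abcd: "a \<in> S" "b \<in> S" "c \<in> S" "d \<in> S"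
  then obtain u v where u: "u \<in> S" "a = b \<oplus> varpi [^] k \<otimes> u" and v: "v \<in> S" "c = d \<oplus> varpi [^] k \<otimes> v"
    unfolding cong_S_def by blast
  have "a \<otimes> c = b \<otimes> c \<oplus> varpi [^] k \<otimes> (u \<otimes> c)"
  proof -
    have "b \<in> carrier C" "c \<in> carrier C" "u \<in> carrier C" "varpi [^] k \<in> carrier C" using S_carrier abcd u varpi(1) by auto
    then show ?thesis unfolding u(2) by (simp add: l_distr m_assoc)
  qed
  also have "b \<otimes> c = b \<otimes> d \<oplus> varpi [^] k \<otimes> (b \<otimes> v)"
    unfolding v(2) using S_carrier abcd v varpi(1) by (simp add: r_distr m_lcomm)
  finally have "a \<otimes> c = b \<otimes> d \<oplus> varpi [^] k \<otimes> (b \<otimes> v \<oplus> u \<otimes> c)"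
    using S_carrier abcd u(1) v(1) varpi(1) by (simp add: r_distr a_assoc)
  then show ?thesis unfolding cong_S_def using u v abcd S_add S_mult by blast
qed

lemma add_pow_p: "x \<in> carrier C \<Longrightarrow> add_pow C p x = varpi \<otimes> x"
  using add_pow_ldistr[of \<one> x p] by (simp add: varpi_def add_pow_int_ge)

lemma cong_S_frobenius:
  assumes "a \<in> S" "b \<in> S"
  shows "cong_S 1 ((a \<oplus> b) [^] p) (a [^] p \<oplus> b [^] p)"
proof -
  obtain t where t: "t \<in> S" "(a \<oplus> b) [^] p = a [^] p \<oplus> b [^] p \<oplus> add_pow C p (a \<otimes> b \<otimes> t)"
    using frobenius_add_subring[OF subring_S prime assms] by blast
  then show ?thesis
    unfolding cong_S_def using assms varpi(1) S_carrier
    by (intro bexI[of _ "a \<otimes> b \<otimes> t"] S_mult) (simp_all add: add_pow_p)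
qed

text \<open>
  Raising to the power \<open>p\<close> improves congruences, by the shape of the correction term in \<open>frobenius_add_subring\<close>.
\<close>

lemma cong_S_pow_p:
  assumes a: "a \<in> S" and b: "b \<in> S" and k: "k \<ge> 1" and cong: "cong_S k a b"
  shows "cong_S (Suc k) (a [^] p) (b [^] p)"
proof -
  obtain u where u: "u \<in> S" "a = b \<oplus> varpi [^] k \<otimes> u" using cong unfolding cong_S_def by blast
  define w where "w = varpi [^] k \<otimes> u"
  have w: "w \<in> S" unfolding w_def using varpi_pow_S u by (intro S_mult)
  obtain t where t: "t \<in> S" "a [^] p = b [^] p \<oplus> w [^] p \<oplus> add_pow C p (b \<otimes> w \<otimes> t)"
    using frobenius_add_subring[OF subring_S prime b w] u(2) unfolding w_def by auto
  have c: "b \<in> carrier C" "u \<in> carrier C" "t \<in> carrier C" "w \<in> carrier C" using S_carrier b u t w by auto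
  have "k * p \<ge> k * 2" using p1 by (intro mult_le_mono2) simp
  then have kp: "k * p = Suc k + (k * p - Suc k)" using k by linarith
  have "w [^] p = varpi [^] (k * p) \<otimes> u [^] p"
    unfolding w_def using c varpi(1) by (simp add: nat_pow_distrib nat_pow_pow)
  also have "\<dots> = varpi [^] Suc k \<otimes> (varpi [^] (k * p - Suc k) \<otimes> u [^] p)"
  proof -
    have "varpi [^] (k * p) = varpi [^] Suc k \<otimes> varpi [^] (k * p - Suc k)"
      by (subst kp) (rule nat_pow_mult[OF varpi(1), symmetric])
    then show ?thesis using c varpi(1) by (simp add: m_assoc del: nat_pow_Suc)
  qed
  finally have 1: "w [^] p = varpi [^] Suc k \<otimes> (varpi [^] (k * p - Suc k) \<otimes> u [^] p)" .
  have 2: "add_pow C p (b \<otimes> w \<otimes> t) = varpi [^] Suc k \<otimes> (b \<otimes> u \<otimes> t)"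
    using c varpi(1) by (simp add: add_pow_p w_def m_ac)
  have "a [^] p = b [^] p \<oplus> varpi [^] Suc k \<otimes> (varpi [^] (k * p - Suc k) \<otimes> u [^] p \<oplus> b \<otimes> u \<otimes> t)"
    unfolding t(2) 1 2 using c varpi(1) by (simp add: r_distr a_assoc del: nat_pow_Suc)
  then show ?thesis unfolding cong_S_def
    using b u t by (intro bexI[of _ "varpi [^] (k * p - Suc k) \<otimes> u [^] p \<oplus> b \<otimes> u \<otimes> t"] S_add S_mult S_pow varpi_pow_S)
qed

lemma cong_S_weaken: "cong_S (k + l) a b \<Longrightarrow> cong_S k a b"
proof -
  assume "cong_S (k + l) a b"
  then obtain u where u: "u \<in> S" "a = b \<oplus> varpi [^] (k + l) \<otimes> u" unfolding cong_S_def by blast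
  then have "a = b \<oplus> varpi [^] k \<otimes> (varpi [^] l \<otimes> u)"
    using S_carrier varpi(1) by (simp add: nat_pow_mult[symmetric] m_assoc)
  then show ?thesis unfolding cong_S_def using u S_mult varpi_pow_S by blast
qed

lemma cong_S_pow_p_iter:
  assumes a: "a \<in> S" and b: "b \<in> S" and k: "k \<ge> 1" and cong: "cong_S k a b"
  shows "cong_S (k + t) (a [^] (p ^ t)) (b [^] (p ^ t))"
proof (induction t)
  case 0
  show ?case using cong a b S_carrier by simp
next
  case (Suc t)
  have "x [^] (p ^ Suc t) = (x [^] (p ^ t)) [^] p" if "x \<in> carrier C" for x
    using that by (simp add: nat_pow_pow mult.commute)
  then show ?case using cong_S_pow_p[OF S_pow[OF a] S_pow[OF b] _ Suc] k S_carrier[OF a] S_carrier[OF b] by simp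
qed

lemma cong_S_frobenius_iter:
  assumes a: "a \<in> S" and b: "b \<in> S"
  shows "cong_S 1 ((a \<oplus> b) [^] (p ^ t)) (a [^] (p ^ t) \<oplus> b [^] (p ^ t))"
proof (induction t)
  case 0
  show ?case using a b S_carrier by (simp add: cong_S_refl S_add del: One_nat_def)
next
  case (Suc t)
  have pw: "x [^] (p ^ Suc t) = (x [^] (p ^ t)) [^] p" if "x \<in> S" for x
    using S_carrier[OF that] by (simp add: nat_pow_pow mult.commute)
  note ab = S_add[OF a b]
  have "cong_S (1 + 1) (((a \<oplus> b) [^] (p ^ t)) [^] p) ((a [^] (p ^ t) \<oplus> b [^] (p ^ t)) [^] p)"
    using cong_S_pow_p[OF S_pow[OF ab] S_add[OF S_pow[OF a] S_pow[OF b]] _ Suc] by simp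
  then have "cong_S 1 (((a \<oplus> b) [^] (p ^ t)) [^] p) ((a [^] (p ^ t) \<oplus> b [^] (p ^ t)) [^] p)"
    by (rule cong_S_weaken)
  moreover have "cong_S 1 ((a [^] (p ^ t) \<oplus> b [^] (p ^ t)) [^] p) ((a [^] (p ^ t)) [^] p \<oplus> (b [^] (p ^ t)) [^] p)"
    by (rule cong_S_frobenius[OF S_pow[OF a] S_pow[OF b]])
  ultimately show ?case
    unfolding pw[OF a] pw[OF b] pw[OF ab]
    by (rule cong_S_trans) (intro S_add S_pow a b)
qed

text \<open>
  As \<open>q\<close> is a power of \<open>p\<close> congruent to \<open>1\<close> modulo \<open>n\<close>, the \<open>q\<close>-th power map is a power of Frobenius that fixes \<open>z\<close>.
\<close>

definition q :: nat where "q = p ^ totient n"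

lemma z_q: "z [^] q = z"
proof -
  have "[p ^ totient n = 1] (mod n)" using n(2) by (intro euler_theorem) (simp add: coprime_commute)
  then have "n dvd p ^ totient n - 1" by (rule cong_to_1_nat)
  then obtain k where "p ^ totient n - 1 = n * k" by (elim dvdE)
  moreover have "p ^ totient n > 0" using p1 by simp
  ultimately have k: "q = n * k + 1" unfolding q_def by linarith
  have "z [^] q = z [^] (n * k) \<otimes> z" unfolding k using z(1) by (simp add: nat_pow_mult[symmetric])
  also have "z [^] (n * k) = \<one>" using z by (simp add: nat_pow_exp_mult)
  finally show ?thesis using z(1) by simp
qed

lemma q1: "q > 1"
  unfolding q_def using p1 n(1) by (intro one_less_power) simp_all

text \<open>
  The elements fixed by the \<open>q\<close>-th power map modulo \<open>p\<close>. They form a subring that contains \<open>\<int>\<^sub>p\<close> and \<open>z\<close>, hence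
  everything.
\<close>

definition T where "T = {s \<in> S. cong_S 1 (s [^] q) s}"

lemma T_add: "s \<in> T \<Longrightarrow> t \<in> T \<Longrightarrow> s \<oplus> t \<in> T"
proof -
  assume "s \<in> T" "t \<in> T"
  then have st: "s \<in> S" "t \<in> S" "cong_S 1 (s [^] q) s" "cong_S 1 (t [^] q) t" by (auto simp: T_def)
  have "cong_S 1 ((s \<oplus> t) [^] q) (s [^] q \<oplus> t [^] q)"
    unfolding q_def by (rule cong_S_frobenius_iter[OF st(1,2)])
  moreover have "cong_S 1 (s [^] q \<oplus> t [^] q) (s \<oplus> t)" using st by (intro cong_S_add)
  ultimately have "cong_S 1 ((s \<oplus> t) [^] q) (s \<oplus> t)" by (rule cong_S_trans) (rule S_add[OF st(1,2)])
  then show ?thesis using st S_add by (simp add: T_def)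
qed

lemma T_mult: "s \<in> T \<Longrightarrow> t \<in> T \<Longrightarrow> s \<otimes> t \<in> T"
proof -
  assume "s \<in> T" "t \<in> T"
  then have st: "s \<in> S" "t \<in> S" "cong_S 1 (s [^] q) s" "cong_S 1 (t [^] q) t" by (auto simp: T_def)
  have "cong_S 1 (s [^] q \<otimes> t [^] q) (s \<otimes> t)" using st by (intro cong_S_mult S_pow)
  then show ?thesis using st S_mult S_carrier by (simp add: T_def nat_pow_distrib del: One_nat_def)
qed

lemma T_cong: "s \<in> T \<Longrightarrow> t \<in> S \<Longrightarrow> cong_S 1 t s \<Longrightarrow> t \<in> T"
proof -
  assume "s \<in> T" and t: "t \<in> S" and ts: "cong_S 1 t s"
  then have s: "s \<in> S" "cong_S 1 (s [^] q) s" by (auto simp: T_def)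
  have "cong_S (1 + totient n) (t [^] q) (s [^] q)" unfolding q_def by (rule cong_S_pow_p_iter[OF t s(1) _ ts]) simp
  then have "cong_S 1 (t [^] q) (s [^] q)" by (rule cong_S_weaken)
  then have "cong_S 1 (t [^] q) s" by (rule cong_S_trans) (rule s)+
  then have "cong_S 1 (t [^] q) t" by (rule cong_S_trans) (rule cong_S_sym[OF ts s(1)], rule t)
  then show ?thesis using t by (simp add: T_def)
qed

lemma T_of_nat: "of_Z (int k) \<in> T"
proof (induction k)
  case 0
  have "\<zero> [^] q = \<zero>" using q1 by (intro nat_pow_zero) simp
  then have "cong_S 1 (\<zero> [^] q) \<zero>" using cong_S_refl[OF S_0] by simp
  then show ?case using S_0 by (simp add: of_Z_0 T_def)
next
  case (Suc k)
  have "\<one> \<in> T" using S_1 cong_S_refl[OF S_1] by (simp add: T_def)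
  then have "of_Z (int k) \<oplus> \<one> \<in> T" using Suc by (intro T_add)
  moreover have "of_Z (int (Suc k)) = of_Z (int k) \<oplus> \<one>" using of_Z_add[of "int k" 1] by (simp only: of_Z_1 of_nat_Suc add.commute)
  ultimately show ?case by (simp only:)
qed

lemma Zp_T: "a \<in> Zp \<Longrightarrow> a \<in> T"
proof -
  assume a: "a \<in> Zp"
  then obtain k b where b: "b \<in> Zp" "a = of_Z (int k) \<oplus> varpi \<otimes> b" using Zp_residue by blast
  then have "cong_S 1 a (of_Z (int k))" unfolding cong_S_def using varpi(1) by (intro bexI[of _ b] Zp_S) simp_all
  then show ?thesis by (rule T_cong[OF T_of_nat Zp_S[OF a]])
qed

lemma z_T: "z [^] (i::nat) \<in> T"
proof (induction i)
  case 0
  show ?case using Zp_T[OF Zp_1] by simp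
next
  case (Suc i)
  have "z \<in> T" using S_z[of 1] z cong_S_refl[OF S_z[of 1], of 1] by (simp add: T_def z_q)
  with Suc show ?case by (simp add: T_mult)
qed

lemma S_T: "s \<in> S \<Longrightarrow> s \<in> T"
proof -
  assume "s \<in> S"
  then obtain a where a: "s = comb a" "\<And>i. a i \<in> Zp" unfolding S_def by blast
  have T_C: "t \<in> T \<Longrightarrow> t \<in> carrier C" for t using S_carrier by (simp add: T_def)
  have "finsum C (\<lambda>i. a i \<otimes> z [^] i) I \<in> T" if "finite I" for I
    using that
  proof (induction I rule: finite_induct)
    case empty
    show ?case using Zp_T[OF Zp_0] by simp
  next
    case (insert i I)
    then show ?case using a(2) z_T Zp_carrier[OF a(2)] z(1) by (subst finsum_insert) (auto intro: T_add T_mult Zp_T)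
  qed
  then show ?thesis using a(1) by (simp add: comb_def)
qed

text \<open>
  The powers \<open>s\<^sub>k\<close> of \<open>s\<close> with exponent \<open>q\<^sup>k\<close> satisfy \<open>s\<^sub>k\<^sub>+\<^sub>1 \<equiv> s\<^sub>k\<close> modulo \<open>p\<^sup>k\<^sup>+\<^sup>1\<close>, and they tend to zero because \<open>s\<close>
  is small. Summing the differences gives \<open>0 = s + p w\<close>, where \<open>w\<close> is the sum of a series in \<open>\<int>\<^sub>p[z]\<close> that
  converges coefficientwise.
\<close>

theorem S_small_divisible:
  assumes s: "s \<in> S" and small: "absv s < 1"
  shows "\<exists>v\<in>S. s = varpi \<otimes> v"
proof -
  have sC: "s \<in> carrier C" by (rule S_carrier[OF s])
  define sk where "sk = (\<lambda>k::nat. s [^] (q ^ k))"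
  have sk: "sk k \<in> S" for k unfolding sk_def by (rule S_pow[OF s])
  have sk_Suc: "sk (Suc k) = (sk k) [^] q" for k
    unfolding sk_def using sC by (simp add: nat_pow_pow mult.commute)
  have cong: "cong_S (Suc k) (sk (Suc k)) (sk k)" for k
  proof (induction k)
    case 0
    show ?case using S_T[OF s] sC by (simp add: sk_def T_def)
  next
    case (Suc k)
    have "cong_S (Suc k + totient n) (sk (Suc k) [^] (p ^ totient n)) (sk k [^] (p ^ totient n))"
      using Suc by (intro cong_S_pow_p_iter sk) simp_all
    then have "cong_S (Suc k + totient n) (sk (Suc (Suc k))) (sk (Suc k))"
      unfolding sk_Suc[of "Suc k"] sk_Suc[of k] q_def by simp
    moreover have "Suc k + totient n = Suc (Suc k) + (totient n - 1)" using n(1) by simp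
    ultimately show ?case using cong_S_weaken by metis
  qed
  have "\<forall>k. \<exists>a. (\<forall>i. a i \<in> Zp) \<and> sk (Suc k) = sk k \<oplus> varpi [^] Suc k \<otimes> comb a"
    using cong unfolding cong_S_def S_def by blast
  then obtain a where a: "\<And>k i. a k i \<in> Zp" "\<And>k. sk (Suc k) = sk k \<oplus> varpi [^] Suc k \<otimes> comb (a k)"
    by metis
  have aC: "a k i \<in> carrier C" for k i by (rule Zp_carrier[OF a(1)])
  have vp: "varpi [^] (k::nat) \<in> Zp" for k
    by (induction k) (use Zp_1 varpi_Zp subringE(6)[OF subring_Zp] in auto)
  \<comment> \<open>The coefficients of \<open>(s\<^sub>k - s)/p\<close>.\<close>
  define P where "P = (\<lambda>i k. \<Oplus>j\<in>{..<k}. varpi [^] j \<otimes> a j i)"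
  have P_Suc: "P i (Suc k) = P i k \<oplus> varpi [^] k \<otimes> a k i" for i k
    unfolding P_def lessThan_Suc using aC varpi(1) by (subst finsum_insert) (auto intro: a_comm finsum_closed)
  have P_Zp: "P i k \<in> Zp" for i k
  proof (induction k)
    case 0
    show ?case by (simp add: P_def Zp_0)
  next
    case (Suc k)
    then show ?case unfolding P_Suc using vp a(1) subringE(6,7)[OF subring_Zp] by blast
  qed
  have PC: "P i k \<in> carrier C" for i k by (rule Zp_carrier[OF P_Zp])
  have step: "absv (P i (Suc k) \<ominus> P i k) \<le> (1 / p) ^ k" for i k
  proof -
    have "P i (Suc k) \<ominus> P i k = varpi [^] k \<otimes> a k i"
      unfolding P_Suc using PC aC varpi(1) by (simp add: a_minus_def a_comm[of "P i k"] a_assoc r_neg)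
    then have "absv (P i (Suc k) \<ominus> P i k) = (1 / p) ^ k * absv (a k i)"
      using aC varpi(1) by (simp add: absv_mult absv_varpi_pow)
    also have "\<dots> \<le> (1 / p) ^ k * 1" using a(1)[of k i] by (intro mult_left_mono) (simp_all add: Zp_def)
    finally show ?thesis by simp
  qed
  have "\<forall>i. \<exists>b\<in>Zp. \<forall>k. absv (b \<ominus> P i k) \<le> (1 / p) ^ k"
  proof
    fix i
    show "\<exists>b\<in>Zp. \<forall>k. absv (b \<ominus> P i k) \<le> (1 / p) ^ k" by (rule Zp_limit) (rule P_Zp, rule step)
  qed
  then obtain b where b: "\<And>i. b i \<in> Zp" "\<And>i k. absv (b i \<ominus> P i k) \<le> (1 / p) ^ k" by metis
  have bC: "b i \<in> carrier C" for i by (rule Zp_carrier[OF b(1)])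
  define w where "w = comb b"
  have w: "w \<in> S" unfolding w_def by (rule comb_S[OF b(1)])
  have wC: "w \<in> carrier C" by (rule S_carrier[OF w])
  have combP: "comb (\<lambda>i. P i k) \<in> carrier C" for k by (rule comb_closed[OF PC])
  have sk_eq: "sk k = s \<oplus> varpi \<otimes> comb (\<lambda>i. P i k)" for k
  proof (induction k)
    case 0
    have "comb (\<lambda>i. P i 0) = \<zero>" unfolding comb_def P_def using z by (simp add: finsum_zero)
    then show ?case using sC varpi(1) by (simp add: sk_def)
  next
    case (Suc k)
    have "comb (\<lambda>i. P i (Suc k)) = comb (\<lambda>i. P i k) \<oplus> varpi [^] k \<otimes> comb (a k)"
      unfolding P_Suc using PC aC varpi(1) by (simp add: comb_scale comb_add)
    then show ?case
      unfolding a(2) Suc using sC combP[of k] comb_closed[of "a k", OF aC] varpi(1)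
      by (simp add: r_distr a_assoc m_ac)
  qed
  have small_bound: "absv (s \<oplus> varpi \<otimes> w) \<le> max (absv s ^ k) ((1 / p) ^ k)" for k
  proof -
    have wP: "w \<ominus> comb (\<lambda>i. P i k) = comb (\<lambda>i. b i \<ominus> P i k)"
    proof -
      have "comb (\<lambda>i. b i \<ominus> P i k) \<oplus> comb (\<lambda>i. P i k) = comb b"
        using bC PC by (subst comb_add) (simp_all add: a_minus_def a_assoc l_neg)
      moreover have "comb (\<lambda>i. b i \<ominus> P i k) \<in> carrier C" using bC PC by (intro comb_closed) simp
      ultimately show ?thesis unfolding w_def using combP[of k] by (simp add: a_minus_def a_assoc r_neg flip: \<open>comb (\<lambda>i. b i \<ominus> P i k) \<oplus> comb (\<lambda>i. P i k) = comb b\<close>)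
    qed
    then have "absv (w \<ominus> comb (\<lambda>i. P i k)) \<le> (1 / p) ^ k"
      using bC PC b(2) by (auto intro!: absv_comb_le)
    then have "absv varpi * absv (w \<ominus> comb (\<lambda>i. P i k)) \<le> 1 * (1 / p) ^ k"
      using varpi(3) p1 absv_nonneg[of "w \<ominus> comb (\<lambda>i. P i k)"] wC combP by (intro mult_mono) auto
    then have 1: "absv (varpi \<otimes> (w \<ominus> comb (\<lambda>i. P i k))) \<le> (1 / p) ^ k"
      using varpi(1) wC combP by (simp add: absv_mult)
    \<comment> \<open>Both summands on the right hand side tend to zero.\<close>
    have "s \<oplus> varpi \<otimes> w = sk k \<oplus> varpi \<otimes> (w \<ominus> comb (\<lambda>i. P i k))"
      unfolding sk_eq using sC varpi(1) wC combP[of k]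
      by (simp add: a_minus_def r_distr r_minus a_assoc a_lcomm[of "varpi \<otimes> comb (\<lambda>i. P i k)"] r_neg)
    then have "absv (s \<oplus> varpi \<otimes> w) \<le> max (absv (sk k)) (absv (varpi \<otimes> (w \<ominus> comb (\<lambda>i. P i k))))"
      using absv_ultra[of "sk k" "varpi \<otimes> (w \<ominus> comb (\<lambda>i. P i k))"] S_carrier[OF sk] varpi(1) wC combP by simp
    moreover have "absv (sk k) \<le> absv s ^ k"
    proof -
      have "k \<le> q ^ k" using power_gt_expt[of q k] q1 by simp
      then show ?thesis unfolding sk_def using small absv_nonneg[OF sC] by (simp add: absv_pow[OF sC] power_decreasing)
    qed
    ultimately show ?thesis using 1 by auto
  qed
  have "absv (s \<oplus> varpi \<otimes> w) = 0"
  proof (rule ccontr)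
    assume "absv (s \<oplus> varpi \<otimes> w) \<noteq> 0"
    then have pos: "absv (s \<oplus> varpi \<otimes> w) > 0" using absv_nonneg[of "s \<oplus> varpi \<otimes> w"] sC wC varpi(1) by simp
    define r where "r = max (absv s) (1 / p)"
    have r: "0 < r" "r < 1" using small p1 by (auto simp: r_def less_max_iff_disj)
    obtain k where "r ^ k < absv (s \<oplus> varpi \<otimes> w)" using real_arch_pow_inv[OF pos r(2)] by blast
    moreover have "absv s ^ k \<le> r ^ k" "(1 / p) ^ k \<le> r ^ k"
      using absv_nonneg[OF sC] by (auto intro!: power_mono simp: r_def)
    ultimately show False using small_bound[of k] by simp
  qed
  then have "s \<oplus> varpi \<otimes> w = \<zero>" using absv_eq_0_iff sC wC varpi(1) by simp
  then have "s = \<ominus> (varpi \<otimes> w)" using sC wC varpi(1) by (intro sum_zero_eq_neg) simp_all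
  then have "s = varpi \<otimes> (\<ominus> w)" using wC varpi(1) by (simp add: r_minus)
  then show ?thesis using subringE(5)[OF subring_S w] by blast
qed

end

section \<open>Roots of unity of order prime to p are unramified\<close>

lemma (in ring) finsum_in_subring:
  assumes "subring K R" "finite I" "\<And>i. i \<in> I \<Longrightarrow> f i \<in> K"
  shows "finsum R f I \<in> K"
  using assms(2,3)
proof (induction I rule: finite_induct)
  case empty
  show ?case using subringE(2)[OF assms(1)] by simp
next
  case (insert i I)
  then have "f \<in> I \<rightarrow> carrier R" "f i \<in> carrier R" using subringE(1)[OF assms(1)] by auto
  then show ?case using insert subringE(7)[OF assms(1)] by simp
qed

context padic_root_of_unity
begin

text \<open>
  Dividing by \<open>p\<close> as long as the absolute value is less than \<open>1\<close> terminates, since the absolute value of \<open>s\<close> is positive.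
\<close>

lemma S_factor:
  assumes s: "s \<in> S" "s \<noteq> \<zero>"
  shows "\<exists>j. \<exists>v\<in>S. absv v = 1 \<and> s = varpi [^] (j::nat) \<otimes> v"
proof (rule ccontr)
  assume none: "\<not> ?thesis"
  have ex: "\<exists>v\<in>S. s = varpi [^] (k::nat) \<otimes> v" for k
  proof (induction k)
    case 0
    show ?case using s S_carrier by (intro bexI[of _ s]) simp_all
  next
    case (Suc k)
    then obtain v where v: "v \<in> S" "s = varpi [^] k \<otimes> v" by blast
    then have "absv v < 1" using none absv_S[OF v(1)] by force
    then obtain v' where "v' \<in> S" "v = varpi \<otimes> v'" using S_small_divisible[OF v(1)] by blast
    then show ?case using v S_carrier varpi(1) by (intro bexI[of _ v']) (simp_all add: m_assoc)
  qed
  have pos: "absv s > 0" using absv_nonneg[of s] absv_eq_0_iff[of s] s S_carrier[OF s(1)] by force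
  obtain k where k: "(1 / real p) ^ k < absv s" using real_arch_pow_inv[OF pos, of "1 / real p"] p1 by auto
  obtain v where v: "v \<in> S" "s = varpi [^] k \<otimes> v" using ex by blast
  have "absv s = (1 / real p) ^ k * absv v" using v S_carrier varpi(1) by (simp add: absv_mult absv_varpi_pow)
  also have "\<dots> \<le> (1 / real p) ^ k * 1" using absv_S[OF v(1)] by (intro mult_left_mono) simp_all
  finally show False using k by simp
qed

lemma varpi_pow_Qp: "varpi [^] (k::nat) \<in> Qp"
  using varpi(4) subringE(3,6)[OF subfieldE(1)[OF subfield_Qp]] by (induction k) auto

lemma Qp_scale_Zp:
  assumes a: "a \<in> Qp"
  shows "\<exists>l. varpi [^] (l::nat) \<otimes> a \<in> Zp"
proof -
  have aC: "a \<in> carrier C" by (rule Qp_carrier[OF a])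
  obtain l where l: "absv a < real p ^ l" using real_arch_pow[of "real p" "absv a"] p1 by auto
  have "absv (varpi [^] l \<otimes> a) = absv a / real p ^ l"
    using aC varpi(1) by (simp add: absv_mult absv_varpi_pow power_divide)
  also have "\<dots> \<le> 1" using l p1 by (simp add: divide_le_eq_1)
  finally have "varpi [^] l \<otimes> a \<in> Zp"
    using varpi_pow_Qp[of l] a subringE(6)[OF subfieldE(1)[OF subfield_Qp]] by (simp add: Zp_def)
  then show ?thesis by blast
qed

definition K :: "'a set" where "K = simple_extension Qp z"

lemma Qp_incl_carrier: "Qp \<subseteq> carrier C"
  by (rule subfieldE(3)[OF subfield_Qp])

lemma algebraic_z: "(algebraic over Qp) z"
proof (rule algebraicI)
  note sub = subfieldE(1)[OF subfield_Qp]
  show "\<one> # replicate (n - 1) \<zero> @ [\<ominus> \<one>] \<in> carrier (Qp[X]\<^bsub>C\<^esub>)"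
    unfolding univ_poly_carrier[symmetric] polynomial_def
    using subringE(2,3)[OF sub] subringE(5)[OF sub subringE(3)[OF sub]] by auto
  have "eval (\<one> # replicate (n - 1) \<zero> @ [\<ominus> \<one>]) z = z [^] Suc (n - 1) \<ominus> \<one>"
    by (rule eval_power_minus[OF z(1) one_closed])
  also have "Suc (n - 1) = n" using n by simp
  also have "z [^] n \<ominus> \<one> = \<zero>" using z by (simp add: a_minus_def r_neg)
  finally show "eval (\<one> # replicate (n - 1) \<zero> @ [\<ominus> \<one>]) z = \<zero>" .
qed simp

lemma subfield_K: "subfield K C"
  unfolding K_def using simple_extension_is_subfield[OF subfield_Qp z(1)] algebraic_z by simp

lemma Qp_K: "Qp \<subseteq> K"
  unfolding K_def by (rule simple_extension_incl[OF Qp_incl_carrier z(1)])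

lemma z_K: "z \<in> K"
  unfolding K_def by (rule simple_extension_mem[OF subfieldE(1)[OF subfield_Qp] z(1)])

lemma S_K: "s \<in> S \<Longrightarrow> s \<in> K"
proof -
  assume "s \<in> S"
  then obtain a where a: "s = comb a" "\<And>i. a i \<in> Zp" unfolding S_def by blast
  note sub = subfieldE(1)[OF subfield_K]
  have "z [^] i \<in> K" for i :: nat using z_K subringE(3,6)[OF sub] by (induction i) auto
  moreover have "a i \<in> K" for i using a(2)[of i] Qp_K by (auto simp: Zp_def)
  ultimately show ?thesis unfolding a(1) comb_def using subringE(6)[OF sub] by (intro finsum_in_subring[OF sub]) auto
qed

lemma K_scale_S: "x \<in> K \<Longrightarrow> \<exists>k. varpi [^] (k::nat) \<otimes> x \<in> S"
  unfolding K_def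
proof (induction x rule: simple_extension.induct)
  case zero
  show ?case using S_0 varpi(1) by (intro exI[of _ 0]) simp
next
  case (lin k1 k2)
  then obtain k where k: "varpi [^] (k::nat) \<otimes> k1 \<in> S" by blast
  obtain l where l: "varpi [^] (l::nat) \<otimes> k2 \<in> Zp" using Qp_scale_Zp[OF lin(2)] by blast
  have c: "k1 \<in> carrier C" "k2 \<in> carrier C"
    using lin simple_extension_in_carrier[OF Qp_incl_carrier z(1)] Qp_carrier by auto
  have "varpi [^] (k + l) \<otimes> (k1 \<otimes> z \<oplus> k2)
      = varpi [^] l \<otimes> ((varpi [^] k \<otimes> k1) \<otimes> z) \<oplus> varpi [^] k \<otimes> (varpi [^] l \<otimes> k2)"
    using c z(1) varpi(1) by (simp add: nat_pow_mult[symmetric] r_distr m_ac)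
  moreover have "z \<in> S" using S_z[of 1] z(1) by simp
  ultimately have "varpi [^] (k + l) \<otimes> (k1 \<otimes> z \<oplus> k2) \<in> S"
    using S_add[OF S_mult[OF varpi_pow_S S_mult[OF k]] S_mult[OF varpi_pow_S Zp_S[OF l]]] by simp
  then show ?case by blast
qed

text \<open>
  Up to a power of \<open>p\<close>, a nonzero element of \<open>K\<close> is in \<open>\<int>\<^sub>p[z]\<close>, and by \<open>S_factor\<close> its absolute value is a power of
  the one of \<open>p\<close>. So the value group of \<open>K\<close> is the one of \<open>\<rat>\<^sub>p\<close>.
\<close>

lemma unramified_K: "unramified K"
  unfolding unramified_def
proof (intro conjI subfield_K Qp_K equalityI)
  show "finite_dimension Qp K"
    unfolding K_def using finite_dimension_simple_extension[OF subfield_Qp z(1)] algebraic_z by simp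
  show "absv ` (Qp - {\<zero>}) \<subseteq> absv ` (K - {\<zero>})" using Qp_K by blast
  show "absv ` (K - {\<zero>}) \<subseteq> absv ` (Qp - {\<zero>})"
  proof
    fix e assume "e \<in> absv ` (K - {\<zero>})"
    then obtain x where x: "x \<in> K" "x \<noteq> \<zero>" "e = absv x" by blast
    have xC: "x \<in> carrier C" using x(1) subfieldE(3)[OF subfield_K] by auto
    obtain k where k: "varpi [^] (k::nat) \<otimes> x \<in> S" using K_scale_S[OF x(1)] by blast
    have vk: "varpi [^] (i::nat) \<in> carrier C" "varpi [^] i \<in> Qp" "varpi [^] i \<noteq> \<zero>" for i
    proof -
      show "varpi [^] i \<in> carrier C" using varpi(1) by simp
      show "varpi [^] i \<in> Qp" by (rule varpi_pow_Qp)
      show "varpi [^] i \<noteq> \<zero>" using varpi(1,2) by (induction i) (auto simp: integral_iff)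
    qed
    have "varpi [^] k \<otimes> x \<noteq> \<zero>" using vk xC x(2) by (simp add: integral_iff)
    then obtain j v where v: "v \<in> S" "absv v = 1" "varpi [^] k \<otimes> x = varpi [^] (j::nat) \<otimes> v" using S_factor[OF k] by blast
    have U: "varpi [^] k \<in> Units C" using vk by (simp add: field_Units)
    define y where "y = inv (varpi [^] k) \<otimes> varpi [^] j"
    have invQ: "inv (varpi [^] k) \<in> Qp - {\<zero>}" using subfield_m_inv(1)[OF subfield_Qp, of "varpi [^] k"] vk by simp
    have "x = inv (varpi [^] k) \<otimes> (varpi [^] k \<otimes> x)" using U xC vk by (simp add: m_assoc[symmetric])
    also have "\<dots> = y \<otimes> v" unfolding y_def v(3) using U vk S_carrier[OF v(1)] by (simp add: m_assoc)
    finally have "absv x = absv y" using U vk S_carrier[OF v(1)] v(2) by (simp add: y_def absv_mult)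
    moreover have "y \<in> Qp"
      unfolding y_def using invQ vk(2)[of j] subringE(6)[OF subfieldE(1)[OF subfield_Qp]] by simp
    moreover have "y \<noteq> \<zero>" unfolding y_def using invQ vk Qp_carrier by (simp add: integral_iff)
    ultimately show "e \<in> absv ` (Qp - {\<zero>})" using x(3) by blast
  qed
qed

theorem S_unr_integers: "S \<subseteq> carrier unr_integers"
proof
  fix s assume s: "s \<in> S"
  have "Qp_unr \<subseteq> carrier C" unfolding Qp_unr_def unramified_def using subfieldE(3) by blast
  moreover have "s \<in> Qp_unr" unfolding Qp_unr_def using S_K[OF s] unramified_K by blast
  ultimately have "s \<in> closure Qp_unr" using subset_closure by blast
  then show "s \<in> carrier unr_integers" using absv_S[OF s] by (simp add: unr_integers_def)
qed

end

section \<open>The residue homomorphism on roots of unity\<close>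

lemma (in ring) geometric_sum:
  assumes "x \<in> carrier R"
  shows "(\<Oplus>i\<in>{..<n}. x [^] i) \<otimes> (x \<ominus> \<one>) = x [^] (n::nat) \<ominus> \<one>"
proof (induction n)
  case 0
  show ?case using assms by (simp add: a_minus_def r_neg)
next
  case (Suc n)
  have "(\<Oplus>i\<in>{..<Suc n}. x [^] i) \<otimes> (x \<ominus> \<one>) = (x [^] n \<oplus> (\<Oplus>i\<in>{..<n}. x [^] i)) \<otimes> (x \<ominus> \<one>)"
    unfolding lessThan_Suc using assms by (subst finsum_insert) auto
  also have "\<dots> = x [^] n \<otimes> (x \<ominus> \<one>) \<oplus> (x [^] n \<ominus> \<one>)"
    using assms Suc by (subst l_distr) auto
  also have "\<dots> = x [^] Suc n \<ominus> \<one>"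
    using assms by (simp add: a_minus_def r_distr r_minus a_assoc r_neg1)
  finally show ?case .
qed

lemma primitive_root_powers_inj:
  assumes R: "field R" and z: "primitive_root R n z" and n: "n > 0"
  shows "inj_on (\<lambda>i::nat. z [^]\<^bsub>R\<^esub> i) {..<n}"
proof -
  interpret R: field R by (rule R)
  have zR: "z \<in> carrier R" and zn: "z [^]\<^bsub>R\<^esub> n = \<one>\<^bsub>R\<^esub>" and order: "\<And>d. z [^]\<^bsub>R\<^esub> d = \<one>\<^bsub>R\<^esub> \<Longrightarrow> n dvd d"
    using z by (auto simp: primitive_root_def)
  have z0: "z \<noteq> \<zero>\<^bsub>R\<^esub>" using zn n R.nat_pow_zero[of n] by auto
  have pow0: "z [^]\<^bsub>R\<^esub> (i::nat) \<noteq> \<zero>\<^bsub>R\<^esub>" for i using zR z0 by (induction i) (auto simp: R.integral_iff)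
  have less: False if "i < j" "j < n" "z [^]\<^bsub>R\<^esub> i = z [^]\<^bsub>R\<^esub> j" for i j :: nat
  proof -
    have "z [^]\<^bsub>R\<^esub> i \<otimes>\<^bsub>R\<^esub> z [^]\<^bsub>R\<^esub> (j - i) = z [^]\<^bsub>R\<^esub> i \<otimes>\<^bsub>R\<^esub> \<one>\<^bsub>R\<^esub>"
      using that zR R.nat_pow_mult[OF zR, of i "j - i"] by simp
    then have "z [^]\<^bsub>R\<^esub> (j - i) = \<one>\<^bsub>R\<^esub>" using zR pow0[of i] R.m_lcancel by blast
    then have "n dvd j - i" by (rule order)
    with that show False by (auto dest: dvd_imp_le)
  qed
  show ?thesis by (rule inj_onI) (metis less lessThan_iff linorder_neqE_nat)
qed

locale padic_residue = padic_prime_field C absv p for C :: "'c ring" (structure) and absv and p +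
  fixes F :: "'f ring" and eps :: "'c \<Rightarrow> 'f"
  assumes F: "alg_closure_of_Fp p F" and eps: "eps \<in> ring_hom unr_integers F"
begin

abbreviation W :: "'c ring" where "W \<equiv> unr_integers"

lemma W_simps [simp]: "x \<otimes>\<^bsub>W\<^esub> y = x \<otimes> y" "x \<oplus>\<^bsub>W\<^esub> y = x \<oplus> y" "\<one>\<^bsub>W\<^esub> = \<one>"
  by (simp_all add: unr_integers_def)

lemma W_carrier: "x \<in> carrier W \<Longrightarrow> x \<in> carrier C"
  by (auto simp: unr_integers_def mem_closure)

lemma field_F: "field F"
  using F by (simp add: alg_closure_of_Fp_def algebraic_closure_def)

lemma char_F: "add_pow F p \<one>\<^bsub>F\<^esub> = \<zero>\<^bsub>F\<^esub>"
  using F by (simp add: alg_closure_of_Fp_def)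

lemma F_root_of_unity: "x \<in> carrier F \<Longrightarrow> x \<noteq> \<zero>\<^bsub>F\<^esub> \<Longrightarrow> \<exists>n>0. coprime n p \<and> x [^]\<^bsub>F\<^esub> n = \<one>\<^bsub>F\<^esub>"
  using field.root_of_unity_if_algebraic[OF field_F prime char_F] F
  by (simp add: alg_closure_of_Fp_def algebraic_closure_def algebraic_closure_axioms_def)

definition mu_C :: "'c set" where
  "mu_C = {z \<in> carrier C. \<exists>n::nat. n > 0 \<and> coprime n p \<and> z [^] n = \<one>}"

lemma mu_C_I: "z \<in> carrier C \<Longrightarrow> n > 0 \<Longrightarrow> coprime n p \<Longrightarrow> z [^] (n::nat) = \<one> \<Longrightarrow> z \<in> mu_C"
  by (auto simp: mu_C_def)

lemma mu_C_carrier: "z \<in> mu_C \<Longrightarrow> z \<in> carrier C"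
  by (simp add: mu_C_def)

lemma padic_root_of_unity: "n > 0 \<Longrightarrow> coprime n p \<Longrightarrow> z \<in> carrier C \<Longrightarrow> z [^] n = \<one> \<Longrightarrow> padic_root_of_unity C absv p n z"
  by (intro padic_root_of_unity.intro padic_root_of_unity_axioms.intro padic_prime_field_axioms)

lemma mu_C_W: "z \<in> mu_C \<Longrightarrow> z \<in> carrier W"
proof -
  assume "z \<in> mu_C"
  then obtain n where n: "n > 0" "coprime n p" "z \<in> carrier C" "z [^] (n::nat) = \<one>" by (auto simp: mu_C_def)
  interpret R: padic_root_of_unity C absv p n z by (rule padic_root_of_unity[OF n])
  show ?thesis using R.S_unr_integers R.S_z[of 1] n(3) by auto
qed

lemma mu_C_one: "\<one> \<in> mu_C"
  by (rule mu_C_I[of _ 1]) simp_all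

lemma mu_C_mult: "z \<in> mu_C \<Longrightarrow> w \<in> mu_C \<Longrightarrow> z \<otimes> w \<in> mu_C"
proof -
  assume "z \<in> mu_C" "w \<in> mu_C"
  then obtain m n :: nat where m: "m > 0" "coprime m p" "z \<in> carrier C" "z [^] m = \<one>"
    and n: "n > 0" "coprime n p" "w \<in> carrier C" "w [^] n = \<one>" by (auto simp: mu_C_def)
  have "(z \<otimes> w) [^] (m * n) = z [^] (m * n) \<otimes> w [^] (n * m)"
    using m n by (simp add: nat_pow_distrib mult.commute)
  also have "\<dots> = \<one>" using m n by (simp add: nat_pow_exp_mult)
  finally show ?thesis using m n by (intro mu_C_I[of _ "m * n"]) simp_all
qed

lemma mu_C_pow: "z \<in> mu_C \<Longrightarrow> z [^] (k::nat) \<in> mu_C"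
  by (induction k) (auto intro: mu_C_one mu_C_mult)

lemma eps_mult: "z \<in> mu_C \<Longrightarrow> w \<in> mu_C \<Longrightarrow> eps (z \<otimes> w) = eps z \<otimes>\<^bsub>F\<^esub> eps w"
  using ring_hom_mult[OF eps mu_C_W mu_C_W] by simp

lemma eps_one: "eps \<one> = \<one>\<^bsub>F\<^esub>"
  using ring_hom_one[OF eps] by simp

lemma eps_closed: "z \<in> mu_C \<Longrightarrow> eps z \<in> carrier F"
  by (rule ring_hom_closed[OF eps mu_C_W])

lemma eps_pow: "z \<in> mu_C \<Longrightarrow> eps (z [^] (k::nat)) = eps z [^]\<^bsub>F\<^esub> k"
proof (induction k)
  case (Suc k)
  then show ?case using eps_mult[OF mu_C_pow[OF Suc.prems], of z k] by simp
qed (simp add: eps_one)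

lemma eps_nonzero: "z \<in> mu_C \<Longrightarrow> eps z \<noteq> \<zero>\<^bsub>F\<^esub>"
proof
  interpret F: field F by (rule field_F)
  assume z: "z \<in> mu_C" "eps z = \<zero>\<^bsub>F\<^esub>"
  then obtain n where n: "n > 0" "z [^] (n::nat) = \<one>" by (auto simp: mu_C_def)
  have "\<one>\<^bsub>F\<^esub> = eps z [^]\<^bsub>F\<^esub> n" using eps_pow[OF z(1), of n] n(2) eps_one by simp
  also have "\<dots> = \<zero>\<^bsub>F\<^esub>" unfolding z(2) using n(1) by (intro F.nat_pow_zero) simp
  finally show False by simp
qed

text \<open>
  If \<open>z \<noteq> 1\<close> is an \<open>n\<close>-th root of unity, then \<open>1 + z + \<dots> + z\<^sup>n\<^sup>-\<^sup>1 = 0\<close>. If \<open>\<epsilon>(z) = 1\<close>, the image of this sum is the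
  integer \<open>n\<close>, which is not zero in characteristic \<open>p\<close>. The sum is formed in \<open>\<int>\<^sub>p[z]\<close>, a ring on which \<open>\<epsilon>\<close> is a
  homomorphism.
\<close>

lemma eps_eq_one:
  assumes z: "z \<in> mu_C" and eq: "eps z = \<one>\<^bsub>F\<^esub>"
  shows "z = \<one>"
proof (rule ccontr)
  assume ne: "z \<noteq> \<one>"
  obtain n where n: "n > 0" "coprime n p" "z \<in> carrier C" "z [^] (n::nat) = \<one>" using z by (auto simp: mu_C_def)
  interpret R: padic_root_of_unity C absv p n z by (rule padic_root_of_unity[OF n])
  interpret F: field F by (rule field_F)
  have epsS: "eps \<in> ring_hom (C\<lparr>carrier := R.S\<rparr>) F"
    using R.S_unr_integers ring_hom_closed[OF eps] ring_hom_mult[OF eps] ring_hom_add[OF eps] eps_one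
    by (intro ring_hom_memI) (auto simp: subset_iff)
  have eps0: "eps \<zero> = \<zero>\<^bsub>F\<^esub>"
    using ring_hom_zero[OF epsS subring_is_ring[OF R.subring_S] F.ring_axioms] by simp
  have "eps (\<Oplus>i\<in>{..<k}. z [^] i) = add_pow F k \<one>\<^bsub>F\<^esub>" for k :: nat
  proof (induction k)
    case 0
    show ?case by (simp add: eps0)
  next
    case (Suc k)
    have S: "(\<Oplus>i\<in>{..<k}. z [^] i) \<in> R.S" by (rule finsum_in_subring[OF R.subring_S]) (simp_all add: R.S_z)
    have "eps (\<Oplus>i\<in>{..<Suc k}. z [^] i) = eps (z [^] k \<oplus> (\<Oplus>i\<in>{..<k}. z [^] i))"
      unfolding lessThan_Suc using n by (subst finsum_insert) auto
    also have "\<dots> = eps (z [^] k) \<oplus>\<^bsub>F\<^esub> eps (\<Oplus>i\<in>{..<k}. z [^] i)"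
      using ring_hom_add[OF epsS, of "z [^] k" "\<Oplus>i\<in>{..<k}. z [^] i"] S R.S_z by simp
    also have "eps (z [^] k) = \<one>\<^bsub>F\<^esub>" by (simp add: eps_pow[OF z] eq)
    finally show ?case using Suc by (simp add: F.a_comm)
  qed
  moreover have "(\<Oplus>i\<in>{..<n}. z [^] i) = \<zero>"
  proof -
    have "(\<Oplus>i\<in>{..<n}. z [^] i) \<otimes> (z \<ominus> \<one>) = \<zero>"
      using geometric_sum[OF n(3), of n] n(4) by (simp add: a_minus_def r_neg)
    moreover have "z \<ominus> \<one> \<noteq> \<zero>" using ne n(3) by simp
    moreover have "(\<Oplus>i\<in>{..<n}. z [^] i) \<in> carrier C" using n(3) by (intro finsum_closed) auto
    ultimately show ?thesis using n(3) by (simp add: integral_iff)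
  qed
  ultimately have "add_pow F n \<one>\<^bsub>F\<^esub> = \<zero>\<^bsub>F\<^esub>" using eps0 by metis
  then show False using F.add_pow_coprime[OF char_F n(2) p1] by simp
qed

lemma eps_inj: "inj_on eps mu_C"
proof (rule inj_onI)
  fix z w assume z: "z \<in> mu_C" and w: "w \<in> mu_C" and eq: "eps z = eps w"
  obtain n where n: "n > 0" "w [^] (n::nat) = \<one>" using w by (auto simp: mu_C_def)
  have c: "z \<in> carrier C" "w \<in> carrier C" using z w mu_C_carrier by auto
  have w1: "w \<otimes> w [^] (n - 1) = \<one>" using n c nat_pow_Suc2[of w "n - 1"] by simp
  have "eps (z \<otimes> w [^] (n - 1)) = eps (w \<otimes> w [^] (n - 1))"
    using eps_mult[OF z mu_C_pow[OF w]] eps_mult[OF w mu_C_pow[OF w]] eq by simp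
  also have "\<dots> = \<one>\<^bsub>F\<^esub>" unfolding w1 by (rule eps_one)
  finally have "z \<otimes> w [^] (n - 1) = \<one>" using z w by (intro eps_eq_one mu_C_mult mu_C_pow)
  then have "z \<otimes> w [^] (n - 1) \<otimes> w = w" using c by simp
  moreover have "w [^] (n - 1) \<otimes> w = \<one>" using w1 c by (simp add: m_comm)
  ultimately show "z = w" using c by (simp add: m_assoc)
qed

lemma exists_primitive_root_C:
  assumes n: "n > 0" "coprime n p"
  shows "\<exists>z. primitive_root C n z"
proof -
  let ?L = "C\<lparr>carrier := Qp_alg\<rparr>"
  interpret L: algebraic_closure ?L Qp by (rule alg_closure_Qp)
  have pow: "x [^]\<^bsub>?L\<^esub> (k::nat) = x [^] k" for x k by (induction k) (simp_all add: nat_pow_def)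
  have add_pow: "add_pow ?L (k::nat) x = add_pow C k x" for x k
    by (simp add: add_pow_def nat_pow_def)
  have "\<exists>z. primitive_root ?L n z"
  proof (rule L.exists_primitive_root[OF _ n(1)])
    show "algebraically_closed ?L" by (rule L.algebraically_closed_axioms)
    fix l :: nat assume "Factorial_Ring.prime l" "l dvd n"
    then have "l > 0" by (simp add: prime_gt_0_nat)
    then have "of_Z (int l) \<noteq> \<zero>" by (intro of_Z_nonzero) simp
    then show "add_pow ?L l \<one>\<^bsub>?L\<^esub> \<noteq> \<zero>\<^bsub>?L\<^esub>" by (simp add: add_pow add_pow_int_ge)
  qed
  then obtain z where "z \<in> Qp_alg" "z [^] n = \<one>" "\<And>d::nat. z [^] d = \<one> \<Longrightarrow> n dvd d"
    unfolding primitive_root_def pow by auto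
  then show ?thesis unfolding primitive_root_def Qp_alg_def by blast
qed

text \<open>
  A nonzero \<open>x\<close> in the residue field is an \<open>n\<close>-th root of unity with \<open>n\<close> prime to \<open>p\<close>. The powers of a primitive
  \<open>n\<close>-th root of unity \<open>z\<close> have \<open>n\<close> different images among the \<open>n\<close>-th roots of unity, so \<open>x\<close> is one of them.
\<close>

theorem eps_bij: "bij_betw eps mu_C (carrier F - {\<zero>\<^bsub>F\<^esub>})"
proof (rule bij_betw_imageI[OF eps_inj])
  interpret F: field F by (rule field_F)
  show "eps ` mu_C = carrier F - {\<zero>\<^bsub>F\<^esub>}"
  proof
    show "eps ` mu_C \<subseteq> carrier F - {\<zero>\<^bsub>F\<^esub>}" using eps_closed eps_nonzero by auto
    show "carrier F - {\<zero>\<^bsub>F\<^esub>} \<subseteq> eps ` mu_C"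
    proof
      fix x assume "x \<in> carrier F - {\<zero>\<^bsub>F\<^esub>}"
      then have x: "x \<in> carrier F" "x \<noteq> \<zero>\<^bsub>F\<^esub>" by auto
      obtain n where n: "n > 0" "coprime n p" "x [^]\<^bsub>F\<^esub> (n::nat) = \<one>\<^bsub>F\<^esub>" using F_root_of_unity[OF x] by blast
      obtain z where z: "primitive_root C n z" using exists_primitive_root_C[OF n(1,2)] by blast
      then have zC: "z \<in> carrier C" "z [^] n = \<one>" by (auto simp: primitive_root_def)
      have z_mu: "z \<in> mu_C" by (rule mu_C_I[OF zC(1) n(1,2) zC(2)])
      let ?M = "{y \<in> carrier F. y [^]\<^bsub>F\<^esub> n = \<one>\<^bsub>F\<^esub>}" and ?P = "(\<lambda>i::nat. z [^] i) ` {..<n}"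
      have P: "?P \<subseteq> mu_C" using mu_C_pow[OF z_mu] by auto
      have "(z [^] i) [^] n = \<one>" for i :: nat
        using zC nat_pow_pow[of z i n] nat_pow_exp_mult[of z n i] by (simp add: mult.commute)
      then have sub: "eps ` ?P \<subseteq> ?M"
        using eps_pow[OF mu_C_pow[OF z_mu], of _ n] eps_closed[OF mu_C_pow[OF z_mu]] eps_one by auto
      have "card (eps ` ?P) = card ?P" by (rule card_image) (rule inj_on_subset[OF eps_inj P])
      also have "\<dots> = n" using primitive_root_powers_inj[OF field_axioms z n(1)] by (simp add: card_image)
      finally have "eps ` ?P = ?M"
        using F.card_roots_of_unity_le[OF n(1)] sub by (intro card_seteq) simp_all
      moreover have "x \<in> ?M" using x n by simp
      ultimately show "x \<in> eps ` mu_C" using P by blast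
    qed
  qed
qed

end

section \<open>Reduction of homomorphisms\<close>

lemma ring_hom_nat_pow:
  assumes "ring R" "ring S" "h \<in> ring_hom R S" "x \<in> carrier R"
  shows "h (x [^]\<^bsub>R\<^esub> (k::nat)) = h x [^]\<^bsub>S\<^esub> k"
proof -
  interpret R: ring R by (rule assms(1))
  interpret S: ring S by (rule assms(2))
  show ?thesis
    by (induction k) (use assms(3,4) in \<open>simp_all add: ring_hom_one ring_hom_mult\<close>)
qed

lemma single_Z_frac1_pow:
  assumes "M > 0" "coprime M p"
  shows "single_Z (frac1 M j) = single_Z (frac1 M 1) [^]\<^bsub>ZGp p\<^esub> j"
proof (induction j)
  case 0
  show ?case by (simp add: ZGp_one)
next
  case (Suc j)
  have G: "frac1 M i \<in> Gp p" for i using torsion_subset_Gp[OF assms] frac1_in_torsion by blast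
  have "single_Z (frac1 M (Suc j)) = single_Z (frac1 M j \<otimes>\<^bsub>QmodZ\<^esub> frac1 M 1)"
    using frac1_mult[OF assms(1), of j 1] by simp
  also have "\<dots> = single_Z (frac1 M j) \<otimes>\<^bsub>ZGp p\<^esub> single_Z (frac1 M 1)"
    using single_mult[OF G[of j] G[of 1], of 1 1] by (simp only: mult_1)
  finally show ?case using Suc by simp
qed

context padic_residue
begin

lemma char_C: "n > 0 \<Longrightarrow> add_pow C (n::nat) \<one> \<noteq> \<zero>"
  using of_Z_nonzero[of "int n"] by (simp add: add_pow_int_ge)

lemma hom_root_mu_C:
  assumes V: "V \<in> ring_hom (ZGp p) C" and r: "r \<in> Gp p"
  shows "V (single_Z r) \<in> mu_C"
proof -
  obtain n where n: "n > 0" "coprime n p" "r \<in> torsion n" using r by (auto simp: Gp_eq)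
  have "V (single_Z r) [^] n = V (single_Z r [^]\<^bsub>ZGp p\<^esub> n)"
    by (rule ring_hom_nat_pow[OF Z.A.ring_axioms ring_axioms V single_Z_closed[OF r], symmetric])
  also have "\<dots> = \<one>" using torsion_pow[OF n(1,3,2)] ring_hom_one[OF V] by simp
  finally show ?thesis using n ring_hom_closed[OF V single_Z_closed[OF r]] by (intro mu_C_I[of _ n])
qed

text \<open>
  The image of an element supported on fractions with denominator \<open>M\<close> lies in \<open>\<int>\<^sub>p[\<zeta>\<^sub>M]\<close>. The statement is proved for all
  multiples \<open>M\<close> of some \<open>N\<close>, so that two summands can be compared over a common denominator.
\<close>

lemma hom_W:
  assumes V: "V \<in> ring_hom (ZGp p) C" and f: "f \<in> carrier (ZGp p)"
  shows "V f \<in> carrier W"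
proof -
  define \<zeta> where "\<zeta> = (\<lambda>M. V (single_Z (frac1 M 1)))"
  define B where "B = (\<lambda>M. padic_root_of_unity.S C absv M (\<zeta> M))"
  have G: "frac1 M j \<in> Gp p" if "M > 0" "coprime M p" for M j
    using torsion_subset_Gp[OF that] frac1_in_torsion by blast
  have pow: "V (single_Z (frac1 M j)) = \<zeta> M [^] j" if M: "M > 0" "coprime M p" for M j
    unfolding single_Z_frac1_pow[OF M, of j] \<zeta>_def
    by (rule ring_hom_nat_pow[OF Z.A.ring_axioms ring_axioms V single_Z_closed[OF G[OF M]]])
  have loc: "padic_root_of_unity C absv p M (\<zeta> M)" if M: "M > 0" "coprime M p" for M
  proof (rule padic_root_of_unity[OF M])
    show "\<zeta> M \<in> carrier C" unfolding \<zeta>_def by (rule ring_hom_closed[OF V single_Z_closed[OF G[OF M]]])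
    have "\<zeta> M [^] M = V (single_Z (frac1 M M))" by (rule pow[OF M, symmetric])
    also have "frac1 M M = frac1 M 0" using frac1_mod[OF M(1), of M] by simp
    also have "V (single_Z (frac1 M 0)) = \<one>" using pow[OF M, of 0] by simp
    finally show "\<zeta> M [^] M = \<one>" .
  qed
  have sub: "subring (B M) C" if "M > 0" "coprime M p" for M
    unfolding B_def by (rule padic_root_of_unity.subring_S[OF loc[OF that]])
  have "\<exists>N>0. coprime N p \<and> (\<forall>M>0. coprime M p \<longrightarrow> N dvd M \<longrightarrow> V f \<in> B M)"
    using f
  proof (induction f rule: ZGp_induct)
    case zero
    show ?case
      using ring_hom_zero[OF V Z.A.ring_axioms ring_axioms] subringE(2)[OF sub] by (intro exI[of _ 1]) simp
  next
    case (single r)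
    then obtain N where N: "N > 0" "coprime N p" "r \<in> torsion N" by (auto simp: Gp_eq)
    have "V (single_Z r) \<in> B M" if M: "M > 0" "coprime M p" "N dvd M" for M
    proof -
      have "r \<in> torsion M" using torsion_mono[OF M(3,1)] N(3) by blast
      then obtain j where "r = frac1 M j" by (auto simp: torsion_def)
      then show ?thesis using padic_root_of_unity.S_z[OF loc[OF M(1,2)]] by (simp add: pow[OF M(1,2)] B_def)
    qed
    then show ?case using N by blast
  next
    case (minus f)
    then obtain N where N: "N > 0" "coprime N p" "\<And>M. M > 0 \<Longrightarrow> coprime M p \<Longrightarrow> N dvd M \<Longrightarrow> V f \<in> B M" by blast
    interpret V: ring_hom_ring "ZGp p" C V by (rule ring_hom_ringI2[OF Z.A.ring_axioms ring_axioms V])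
    have "V (\<ominus>\<^bsub>ZGp p\<^esub> f) = \<ominus> V f" using minus.hyps by (rule V.hom_a_inv)
    then show ?case using N subringE(5)[OF sub] by (intro exI[of _ N]) simp
  next
    case (add f g)
    then obtain N N' where N: "N > 0" "coprime N p" "\<And>M. M > 0 \<Longrightarrow> coprime M p \<Longrightarrow> N dvd M \<Longrightarrow> V f \<in> B M"
      and N': "N' > 0" "coprime N' p" "\<And>M. M > 0 \<Longrightarrow> coprime M p \<Longrightarrow> N' dvd M \<Longrightarrow> V g \<in> B M" by blast
    have eq: "V (f \<oplus>\<^bsub>ZGp p\<^esub> g) = V f \<oplus> V g" using add.hyps by (intro ring_hom_add[OF V])
    show ?case
    proof (intro exI[of _ "N * N'"] conjI allI impI)
      show "N * N' > 0" "coprime (N * N') p" using N(1,2) N'(1,2) by simp_all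
      fix M assume M: "M > 0" "coprime M p" "N * N' dvd M"
      show "V (f \<oplus>\<^bsub>ZGp p\<^esub> g) \<in> B M"
        unfolding eq using N(3)[OF M(1,2) dvd_mult_left[OF M(3)]] N'(3)[OF M(1,2) dvd_mult_right[OF M(3)]]
        by (rule subringE(7)[OF sub[OF M(1,2)]])
    qed
  qed
  then obtain N where N: "N > 0" "coprime N p" and "\<forall>M>0. coprime M p \<longrightarrow> N dvd M \<longrightarrow> V f \<in> B M" by auto
  then have "V f \<in> B N" using dvd_refl by simp
  then show ?thesis using padic_root_of_unity.S_unr_integers[OF loc[OF N(1,2)]] unfolding B_def by (rule subsetD[rotated])
qed

lemma reduction_hom:
  assumes V: "V \<in> ring_hom (ZGp p) C"
  shows "(\<lambda>f. eps (V f)) \<in> ring_hom (ZGp p) F"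
proof (rule ring_hom_memI)
  fix f g assume f: "f \<in> carrier (ZGp p)"
  then show "eps (V f) \<in> carrier F" by (intro ring_hom_closed[OF eps] hom_W[OF V])
  assume g: "g \<in> carrier (ZGp p)"
  show "eps (V (f \<otimes>\<^bsub>ZGp p\<^esub> g)) = eps (V f) \<otimes>\<^bsub>F\<^esub> eps (V g)"
    using ring_hom_mult[OF eps hom_W[OF V f] hom_W[OF V g]] by (simp add: ring_hom_mult[OF V f g])
  show "eps (V (f \<oplus>\<^bsub>ZGp p\<^esub> g)) = eps (V f) \<oplus>\<^bsub>F\<^esub> eps (V g)"
    using ring_hom_add[OF eps hom_W[OF V f] hom_W[OF V g]] by (simp add: ring_hom_add[OF V f g])
next
  show "eps (V \<one>\<^bsub>ZGp p\<^esub>) = \<one>\<^bsub>F\<^esub>" by (simp add: ring_hom_one[OF V] eps_one)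
qed

lemma eps_zero: "eps \<zero> = \<zero>\<^bsub>F\<^esub>"
proof -
  interpret F: field F by (rule field_F)
  interpret R: padic_root_of_unity C absv p 1 \<one> by (rule padic_root_of_unity) simp_all
  have z: "\<zero> \<in> carrier W" using R.S_0 R.S_unr_integers by auto
  have "eps \<zero> \<oplus>\<^bsub>F\<^esub> eps \<zero> = eps \<zero>" using ring_hom_add[OF eps z z] by simp
  then show ?thesis using ring_hom_closed[OF eps z] by simp
qed

text \<open>
  The homomorphism is surjective: its image is a quotient domain, on which the group elements are
  distinguished by \<open>u_inj\<close>, so by counting it contains all roots of unity of order prime to \<open>p\<close>, and hence every
  nonzero element.
\<close>

lemma F_model:
  assumes \<theta>: "\<theta> \<in> ring_hom (ZGp p) F"
    and kills: "\<And>f. f \<in> carrier (ZGp p) \<Longrightarrow> delta f = \<zero>\<^bsub>Qcyc\<^esub> \<Longrightarrow> \<theta> f = \<zero>\<^bsub>F\<^esub>"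
  shows "residue_model p F \<theta>"
proof -
  interpret F: field F by (rule field_F)
  interpret h: ring_hom_ring "ZGp p" F \<theta> by (rule ring_hom_ringI2[OF Z.A.ring_axioms F.ring_axioms \<theta>])
  \<comment> \<open>The image is a model by construction; it is shown below to be all of \<open>F\<close>.\<close>
  let ?D = "F\<lparr>carrier := \<theta> ` carrier (ZGp p)\<rparr>"
  have sub: "subring (\<theta> ` carrier (ZGp p)) F" by (rule h.img_is_subring[OF Z.A.carrier_is_subring])
  have add_pow: "add_pow ?D (k::nat) x = add_pow F k x" for x k by (simp add: add_pow_def nat_pow_def)
  have "residue_model p ?D \<theta>"
  proof (intro residue_model.intro residue_model_axioms.intro F.subring_is_domain[OF sub] prime)
    show "\<theta> \<in> ring_hom (ZGp p) ?D" using \<theta> by (auto simp: ring_hom_def)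
    show "\<theta> f = \<zero>\<^bsub>?D\<^esub>" if "f \<in> carrier (ZGp p)" "delta f = \<zero>\<^bsub>Qcyc\<^esub>" for f using kills[OF that] by simp
    show "add_pow ?D p \<one>\<^bsub>?D\<^esub> = \<zero>\<^bsub>?D\<^esub>" using char_F by (simp add: add_pow)
  qed simp
  then have inj: "inj_on (\<lambda>r. \<theta> (single_Z r)) (Gp p)"
    using residue_model.u_inj[of p ?D \<theta>] residue_model.u_def[of p ?D \<theta>] by (simp add: inj_on_def)
  have surj: "x \<in> \<theta> ` carrier (ZGp p)" if x: "x \<in> carrier F" for x
  proof (cases "x = \<zero>\<^bsub>F\<^esub>")
    case True
    then show ?thesis using subringE(2)[OF sub] by simp
  next
    case False
    obtain n where n: "n > 0" "coprime n p" "x [^]\<^bsub>F\<^esub> (n::nat) = \<one>\<^bsub>F\<^esub>" using F_root_of_unity[OF x False] by blast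
    let ?M = "{y \<in> carrier F. y [^]\<^bsub>F\<^esub> n = \<one>\<^bsub>F\<^esub>}" and ?P = "(\<lambda>r. \<theta> (single_Z r)) ` torsion n"
    note G = torsion_subset_Gp[OF n(1,2)]
    have "\<theta> (single_Z r) [^]\<^bsub>F\<^esub> n = \<one>\<^bsub>F\<^esub>" if "r \<in> torsion n" for r
    proof -
      have "single_Z r \<in> carrier (ZGp p)" using that G by (intro single_Z_closed) blast
      then show ?thesis
        using ring_hom_nat_pow[OF Z.A.ring_axioms F.ring_axioms \<theta>, of "single_Z r" n] torsion_pow[OF n(1) that n(2)]
          ring_hom_one[OF \<theta>] by simp
    qed
    moreover have "\<theta> (single_Z r) \<in> carrier F" if "r \<in> torsion n" for r
      using that G by (intro ring_hom_closed[OF \<theta>] single_Z_closed) blast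
    ultimately have P: "?P \<subseteq> ?M" by auto
    have "card ?P = card (torsion n)" by (rule card_image) (rule inj_on_subset[OF inj G])
    also have "\<dots> = n" using inj_frac1[OF n(1)] by (simp add: torsion_eq[OF n(1)] card_image)
    finally have "?P = ?M" using F.card_roots_of_unity_le[OF n(1)] P by (intro card_seteq) simp_all
    then obtain r where "r \<in> torsion n" "x = \<theta> (single_Z r)" using x n(3) by blast
    then show ?thesis using single_Z_closed G by blast
  qed
  show ?thesis
  proof (intro residue_model.intro residue_model_axioms.intro F.domain_axioms prime \<theta> kills char_F)
    show "\<theta> ` carrier (ZGp p) = carrier F" using surj ring_hom_closed[OF \<theta>] by blast
  qed
qed

context
  fixes \<rho> assumes \<rho>: "\<rho> \<in> ring_Hom (Qcyc_prime_to p) C"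
begin

lemma Hom_delta: "(\<lambda>f. \<rho> (delta f)) \<in> ring_hom (ZGp p) C"
  using ring_hom_trans[OF ring_hom_delta', of \<rho> p C] \<rho> by (simp add: ring_Hom_def o_def)

lemma Hom_delta_model: "residue_model p F (\<lambda>f. eps (\<rho> (delta f)))"
proof (rule F_model[OF reduction_hom[OF Hom_delta]])
  fix f assume "delta f = \<zero>\<^bsub>Qcyc\<^esub>"
  moreover have "\<rho> \<zero>\<^bsub>Qcyc_prime_to p\<^esub> = \<zero>"
    using \<rho> field_Qcyc_prime_to[of p] ring_axioms
    by (intro ring_hom_zero) (simp_all add: ring_Hom_def field_def domain_def cring_def)
  ultimately show "eps (\<rho> (delta f)) = \<zero>\<^bsub>F\<^esub>" by (simp add: eps_zero)
qed

lemma res_proj: "f \<in> carrier (ZGp p) \<Longrightarrow> res p eps \<rho> (proj p f) = eps (\<rho> (delta f))"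
  and res_Hom: "res p eps \<rho> \<in> ring_Hom (A_alg p) F"
proof -
  interpret F: field F by (rule field_F)
  let ?\<theta> = "\<lambda>f. eps (\<rho> (delta f))"
  note M = Hom_delta_model
  note cond = p1 F.ring_axioms residue_model.\<theta>[OF M] residue_model.kills[OF M] char_F
  have proj: "res p eps \<rho> (proj p f) = ?\<theta> f" if f: "f \<in> carrier (ZGp p)" for f
  proof -
    have "proj p f \<in> carrier (A_alg p)" using f carrier_A_alg[OF p1] by simp
    moreover have "(THE y. \<exists>g\<in>carrier (ZGp p). proj p f = J_mod p +>\<^bsub>FpGp p\<^esub> red_mod p g \<and> y = ?\<theta> g) = ?\<theta> f"
    proof (rule the_equality)
      show "\<exists>g\<in>carrier (ZGp p). proj p f = J_mod p +>\<^bsub>FpGp p\<^esub> red_mod p g \<and> ?\<theta> f = ?\<theta> g"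
        using f by (intro bexI[of _ f]) (simp_all add: proj_def[OF p1])
      fix y assume "\<exists>g\<in>carrier (ZGp p). proj p f = J_mod p +>\<^bsub>FpGp p\<^esub> red_mod p g \<and> y = ?\<theta> g"
      then obtain g where g: "g \<in> carrier (ZGp p)" "proj p f = proj p g" "y = ?\<theta> g" by (auto simp: proj_def[OF p1])
      then show "y = ?\<theta> f" using proj_eq_imp[OF cond f g(1,2)] by simp
    qed
    ultimately show ?thesis by (simp add: res_def)
  qed
  then show "f \<in> carrier (ZGp p) \<Longrightarrow> res p eps \<rho> (proj p f) = ?\<theta> f" .
  have eq: "res p eps \<rho> = descend p ?\<theta>"
  proof
    fix a show "res p eps \<rho> a = descend p ?\<theta> a"
    proof (cases "a \<in> carrier (A_alg p)")
      case True
      then obtain f where "f \<in> carrier (ZGp p)" "a = proj p f" using carrier_A_alg[OF p1] by auto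
      then show ?thesis using proj descend_proj[OF cond] by simp
    qed (simp add: res_def descend_def)
  qed
  show "res p eps \<rho> \<in> ring_Hom (A_alg p) F"
    using ring_hom_descend[OF cond] unfolding ring_Hom_def eq[symmetric] by (auto simp: res_def)
qed

end

text \<open>
  On nonzero elements, this is the Teichmueller lift; see \<open>teichmueller_eq\<close>.
\<close>

definition lift :: "'f \<Rightarrow> 'c" where "lift = inv_into mu_C eps"

lemma lift:
  assumes "x \<in> carrier F" "x \<noteq> \<zero>\<^bsub>F\<^esub>"
  shows "lift x \<in> mu_C" "eps (lift x) = x"
proof -
  have "x \<in> eps ` mu_C" using assms eps_bij by (simp add: bij_betw_def)
  then show "lift x \<in> mu_C" "eps (lift x) = x"
    unfolding lift_def by (rule inv_into_into, rule f_inv_into_f)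
qed

lemma lift_eps: "z \<in> mu_C \<Longrightarrow> lift (eps z) = z"
  unfolding lift_def by (rule inv_into_f_f[OF eps_inj])

lemma lift_mult:
  assumes x: "x \<in> carrier F" "x \<noteq> \<zero>\<^bsub>F\<^esub>" and y: "y \<in> carrier F" "y \<noteq> \<zero>\<^bsub>F\<^esub>"
  shows "lift (x \<otimes>\<^bsub>F\<^esub> y) = lift x \<otimes> lift y"
  using lift_eps[OF mu_C_mult[OF lift(1)[OF x] lift(1)[OF y]]]
  by (simp add: eps_mult[OF lift(1)[OF x] lift(1)[OF y]] lift(2)[OF x] lift(2)[OF y])

lemma lift_one: "lift \<one>\<^bsub>F\<^esub> = \<one>"
  using lift_eps[OF mu_C_one] by (simp add: eps_one)

text \<open>
  The lift of an injective character of \<open>G\<close> is an injective character with values in characteristic zero, so it kills the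
  kernel of \<open>\<delta>\<close> and extends to the cyclotomic field.
\<close>

lemma Hom_of_character:
  assumes w: "\<And>r. r \<in> Gp p \<Longrightarrow> w r \<in> carrier F" "\<And>r. r \<in> Gp p \<Longrightarrow> w r \<noteq> \<zero>\<^bsub>F\<^esub>"
    and mult: "\<And>r s. r \<in> Gp p \<Longrightarrow> s \<in> Gp p \<Longrightarrow> w (r \<otimes>\<^bsub>QmodZ\<^esub> s) = w r \<otimes>\<^bsub>F\<^esub> w s"
    and one: "w (mod1 0) = \<one>\<^bsub>F\<^esub>" and inj: "inj_on w (Gp p)"
  shows "\<exists>\<rho>\<in>ring_Hom (Qcyc_prime_to p) C. \<forall>r\<in>Gp p. \<rho> (root r) = lift (w r)"
proof -
  let ?V = "ga_lift C (\<lambda>r. lift (w r))"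
  have V: "?V \<in> ring_hom (ZGp p) C" "\<And>r. r \<in> Gp p \<Longrightarrow> ?V (single_Z r) = lift (w r)"
    by (rule ga_lift[OF cring_axioms]; simp add: mu_C_carrier lift w mult one lift_mult lift_one)+
  have kills: "?V f = \<zero>" if "f \<in> carrier (ZGp p)" "delta f = \<zero>\<^bsub>Qcyc\<^esub>" for f
  proof (rule delta_kernel_killed[OF domain_axioms V(1) _ _ that])
    show "inj_on (\<lambda>r. ?V (single_Z r)) (Gp p)"
    proof (rule inj_onI)
      fix r s assume rs: "r \<in> Gp p" "s \<in> Gp p" "?V (single_Z r) = ?V (single_Z s)"
      then have "eps (lift (w r)) = eps (lift (w s))" by (simp add: V(2))
      then show "r = s" using rs(1,2) inj by (simp add: lift w inj_on_def)
    qed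
  qed (use char_C in blast)
  obtain \<rho> where "\<rho> \<in> ring_Hom (Qcyc_prime_to p) C" "\<forall>f\<in>carrier (ZGp p). \<rho> (delta f) = ?V f"
    using Qcyc_prime_to_hom_exists[OF field_axioms char_C V(1) kills] by blast
  then show ?thesis using V(2) single_Z_closed by (intro bexI[of _ \<rho>]) auto
qed

text \<open>
  A homomorphism \<open>\<rho>\<close> is determined by its values at roots of unity, and these by their images under \<open>\<epsilon>\<close>. Conversely, a
  homomorphism on \<open>\<A>\<close> is the reduction of the \<open>\<rho>\<close> obtained by lifting its restriction to the group elements.
\<close>

theorem bij_betw_res: "bij_betw (res p eps) (ring_Hom (Qcyc_prime_to p) C) (ring_Hom (A_alg p) F)"
proof (rule bij_betw_imageI)
  interpret F: field F by (rule field_F)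
  show "inj_on (res p eps) (ring_Hom (Qcyc_prime_to p) C)"
  proof (rule inj_onI)
    fix \<rho> \<rho>' assume \<rho>: "\<rho> \<in> ring_Hom (Qcyc_prime_to p) C" and \<rho>': "\<rho>' \<in> ring_Hom (Qcyc_prime_to p) C"
      and eq: "res p eps \<rho> = res p eps \<rho>'"
    show "\<rho> = \<rho>'"
    proof (rule Qcyc_prime_to_hom_eqI[OF field_axioms char_C \<rho> \<rho>'])
      fix x assume "x \<in> mu p"
      then obtain r where r: "r \<in> Gp p" "x = root r" by (auto simp: mu_eq)
      have "eps (\<rho> (root r)) = eps (\<rho>' (root r))"
        using res_proj[OF \<rho> single_Z_closed[OF r(1)]] res_proj[OF \<rho>' single_Z_closed[OF r(1)]] eq by simp
      then show "\<rho> x = \<rho>' x"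
        using inj_onD[OF eps_inj] hom_root_mu_C[OF Hom_delta[OF \<rho>] r(1)] hom_root_mu_C[OF Hom_delta[OF \<rho>'] r(1)] r(2)
        by simp
    qed
  qed
  show "res p eps ` ring_Hom (Qcyc_prime_to p) C = ring_Hom (A_alg p) F"
  proof
    show "res p eps ` ring_Hom (Qcyc_prime_to p) C \<subseteq> ring_Hom (A_alg p) F" using res_Hom by blast
    show "ring_Hom (A_alg p) F \<subseteq> res p eps ` ring_Hom (Qcyc_prime_to p) C"
    proof
      fix \<phi> assume \<phi>: "\<phi> \<in> ring_Hom (A_alg p) F"
      then have \<phi>h: "\<phi> \<in> ring_hom (A_alg p) F" by (simp add: ring_Hom_def)
      let ?\<theta> = "\<lambda>f. \<phi> (proj p f)"
      interpret A: cring "A_alg p" by (rule cring_A_alg[OF p1])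
      have hom: "?\<theta> \<in> ring_hom (ZGp p) F" using ring_hom_trans[OF ring_hom_proj[OF p1] \<phi>h] by (simp add: o_def)
      have M: "residue_model p F ?\<theta>"
        by (rule F_model[OF hom])
           (simp add: proj_kills[OF p1] ring_hom_zero[OF \<phi>h A.ring_axioms F.ring_axioms])
      note uM = residue_model.u_closed[OF M] residue_model.u_nonzero[OF M] residue_model.u_mult[OF M]
        residue_model.u_one[OF M] residue_model.u_inj[OF M]
      obtain \<rho> where \<rho>: "\<rho> \<in> ring_Hom (Qcyc_prime_to p) C" "\<And>r. r \<in> Gp p \<Longrightarrow> \<rho> (root r) = lift (\<phi> (proj p (single_Z r)))"
        using Hom_of_character[OF uM] unfolding residue_model.u_def[OF M] by blast
      have eq: "eps (\<rho> (delta f)) = ?\<theta> f" if "f \<in> carrier (ZGp p)" for f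
      proof (rule ZGp_hom_eqI[OF F.ring_axioms reduction_hom[OF Hom_delta[OF \<rho>(1)]] hom _ that])
        fix r assume r: "r \<in> Gp p"
        then show "eps (\<rho> (root r)) = ?\<theta> (single_Z r)"
          using uM(1,2)[OF r] unfolding residue_model.u_def[OF M] by (simp add: \<rho>(2) lift)
      qed
      have "res p eps \<rho> = \<phi>"
      proof
        fix a show "res p eps \<rho> a = \<phi> a"
        proof (cases "a \<in> carrier (A_alg p)")
          case True
          then obtain f where "f \<in> carrier (ZGp p)" "a = proj p f" using carrier_A_alg[OF p1] by auto
          then show ?thesis using res_proj[OF \<rho>(1)] eq by simp
        next
          case False
          then show ?thesis using \<phi> by (simp add: res_def ring_Hom_def extensional_def)
        qed
      qed
      then show "\<phi> \<in> res p eps ` ring_Hom (Qcyc_prime_to p) C" using \<rho>(1) by blast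
    qed
  qed
qed

lemma Units_F: "Units F = carrier F - {\<zero>\<^bsub>F\<^esub>}"
  by (rule field.field_Units[OF field_F])

text \<open>
  A multiplicative section of \<open>\<epsilon>\<close> has values of finite order prime to \<open>p\<close>, where \<open>\<epsilon>\<close> is injective.
\<close>

lemma teichmueller_eq: "x \<in> Units F \<Longrightarrow> teichmueller W F eps x = lift x"
proof -
  interpret F: field F by (rule field_F)
  let ?lift = "\<lambda>x\<in>Units F. lift x"
  have "teichmueller W F eps = ?lift"
    unfolding teichmueller_def
  proof (rule the_equality, intro conjI)
    have "lift x \<in> Units W" if x: "x \<in> Units F" for x
    proof -
      have x': "x \<in> carrier F" "x \<noteq> \<zero>\<^bsub>F\<^esub>" "inv\<^bsub>F\<^esub> x \<in> carrier F" "inv\<^bsub>F\<^esub> x \<noteq> \<zero>\<^bsub>F\<^esub>"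
        using x F.Units_inv_Units[OF x] by (auto simp: Units_F)
      have "lift x \<otimes> lift (inv\<^bsub>F\<^esub> x) = \<one>" "lift (inv\<^bsub>F\<^esub> x) \<otimes> lift x = \<one>"
        using lift_mult[of x "inv\<^bsub>F\<^esub> x"] lift_mult[of "inv\<^bsub>F\<^esub> x" x] x x' by (simp_all add: lift_one)
      then show ?thesis
        unfolding Units_def using mu_C_W[OF lift(1)] x' by (auto intro!: bexI[of _ "lift (inv\<^bsub>F\<^esub> x)"])
    qed
    then have "?lift \<in> hom (units_of F) (units_of W)"
      by (intro homI) (auto simp: units_of_def Units_F lift_mult F.integral_iff)
    then show "?lift \<in> hom (units_of F) (units_of W) \<inter> extensional (Units F)" by simp
    show "\<forall>x\<in>Units F. eps (?lift x) = x" by (simp add: lift Units_F)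
  next
    fix \<tau> assume "\<tau> \<in> hom (units_of F) (units_of W) \<inter> extensional (Units F) \<and> (\<forall>x\<in>Units F. eps (\<tau> x) = x)"
    then have hom: "\<tau> \<in> hom (units_of F) (units_of W)" and ext: "\<tau> \<in> extensional (Units F)"
      and section_eq: "\<And>x. x \<in> Units F \<Longrightarrow> eps (\<tau> x) = x" by auto
    have mult: "\<tau> (x \<otimes>\<^bsub>F\<^esub> y) = \<tau> x \<otimes> \<tau> y" if "x \<in> Units F" "y \<in> Units F" for x y
      using hom_mult[OF hom, of x y] that by (simp add: units_of_def)
    have cl: "\<tau> x \<in> Units W" if "x \<in> Units F" for x
      using hom_in_carrier[OF hom, of x] that by (simp add: units_of_def)
    have clC: "\<tau> x \<in> carrier C" if "x \<in> Units F" for x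
      using cl[OF that] W_carrier by (auto simp: Units_def)
    have one: "\<tau> \<one>\<^bsub>F\<^esub> = \<one>"
    proof -
      have "\<tau> \<one>\<^bsub>F\<^esub> \<otimes> \<tau> \<one>\<^bsub>F\<^esub> = \<tau> \<one>\<^bsub>F\<^esub>" using mult[of "\<one>\<^bsub>F\<^esub>" "\<one>\<^bsub>F\<^esub>"] by simp
      moreover obtain y where "y \<in> carrier C" "y \<otimes> \<tau> \<one>\<^bsub>F\<^esub> = \<one>"
        using cl[OF F.Units_one_closed] W_carrier by (auto simp: Units_def)
      ultimately show ?thesis using clC[OF F.Units_one_closed] by (metis m_assoc l_one)
    qed
    have mem: "\<tau> x \<in> mu_C" if x: "x \<in> Units F" for x
    proof -
      obtain n where n: "n > 0" "coprime n p" "x [^]\<^bsub>F\<^esub> (n::nat) = \<one>\<^bsub>F\<^esub>" using F_root_of_unity[of x] x by (auto simp: Units_F)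
      have "\<tau> (x [^]\<^bsub>F\<^esub> k) = \<tau> x [^] k" for k :: nat
        using x by (induction k) (simp_all add: one mult F.Units_pow_closed)
      then have "\<tau> x [^] n = \<one>" using n(3) one by metis
      then show ?thesis using n clC[OF x] by (intro mu_C_I)
    qed
    show "\<tau> = ?lift"
    proof
      fix x show "\<tau> x = ?lift x"
      proof (cases "x \<in> Units F")
        case True
        then show ?thesis using lift_eps[OF mem[OF True]] section_eq[OF True] by simp
      qed (use ext in \<open>simp add: extensional_def\<close>)
    qed
  qed
  then show "x \<in> Units F \<Longrightarrow> teichmueller W F eps x = lift x" by simp
qed

context
  fixes \<sigma> assumes \<sigma>: "\<sigma> \<in> X_set F"
begin

lemma sigma_mult: "x \<in> Units F \<Longrightarrow> y \<in> Units F \<Longrightarrow> \<sigma> (x \<otimes>\<^bsub>F\<^esub> y) = \<sigma> x \<otimes>\<^bsub>Qcyc\<^esub> \<sigma> y"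
  using \<sigma> hom_mult[of \<sigma> "units_of F" "units_of Qcyc" x y] by (simp add: X_set_def units_of_def)

lemma sigma_Units: "x \<in> Units F \<Longrightarrow> \<sigma> x \<in> Units Qcyc"
  using \<sigma> hom_in_carrier[of \<sigma> "units_of F" "units_of Qcyc" x] by (simp add: X_set_def units_of_def)

lemma sigma_inj: "inj_on \<sigma> (Units F)"
  using \<sigma> by (simp add: X_set_def)

lemma sigma_one: "\<sigma> \<one>\<^bsub>F\<^esub> = \<one>\<^bsub>Qcyc\<^esub>"
proof -
  interpret F: field F by (rule field_F)
  interpret Q: field Qcyc by (rule field_Qcyc)
  note s = sigma_Units[OF F.Units_one_closed]
  have "\<sigma> \<one>\<^bsub>F\<^esub> \<otimes>\<^bsub>Qcyc\<^esub> \<sigma> \<one>\<^bsub>F\<^esub> = \<sigma> \<one>\<^bsub>F\<^esub> \<otimes>\<^bsub>Qcyc\<^esub> \<one>\<^bsub>Qcyc\<^esub>"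
    using sigma_mult[of "\<one>\<^bsub>F\<^esub>" "\<one>\<^bsub>F\<^esub>"] Qcyc.Units_closed[OF s] by simp
  then show ?thesis using s Qcyc.Units_closed[OF s] Qcyc.Units_l_cancel[OF s, of "\<sigma> \<one>\<^bsub>F\<^esub>" "\<one>\<^bsub>Qcyc\<^esub>"] by simp
qed

lemma sigma_pow: "x \<in> Units F \<Longrightarrow> \<sigma> (x [^]\<^bsub>F\<^esub> (k::nat)) = \<sigma> x [^]\<^bsub>Qcyc\<^esub> k"
proof (induction k)
  interpret F: field F by (rule field_F)
  case (Suc k)
  then show ?case by (simp add: sigma_mult F.Units_pow_closed)
qed (simp add: sigma_one)

text \<open>
  Both sides contain \<open>n\<close> roots of \<open>X\<^sup>n - 1\<close> for every \<open>n\<close> prime to \<open>p\<close>.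
\<close>

lemma sigma_bij: "bij_betw \<sigma> (Units F) (mu p)"
proof (rule bij_betw_imageI[OF sigma_inj])
  interpret F: field F by (rule field_F)
  interpret Q: field Qcyc by (rule field_Qcyc)
  show "\<sigma> ` Units F = mu p"
  proof
    show "\<sigma> ` Units F \<subseteq> mu p"
    proof (rule image_subsetI)
      fix x assume x: "x \<in> Units F"
      then obtain n where n: "n > 0" "coprime n p" "x [^]\<^bsub>F\<^esub> (n::nat) = \<one>\<^bsub>F\<^esub>" using F_root_of_unity[of x] by (auto simp: Units_F)
      have "\<sigma> x [^]\<^bsub>Qcyc\<^esub> n = \<one>\<^bsub>Qcyc\<^esub>" using sigma_pow[OF x, of n] n(3) sigma_one by simp
      then show "\<sigma> x \<in> mu p" using n sigma_Units[OF x] by (auto simp: mu_def)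
    qed
    show "mu p \<subseteq> \<sigma> ` Units F"
    proof
      fix y assume "y \<in> mu p"
      then obtain n where n: "n > 0" "coprime n p" and y: "y \<in> carrier Qcyc" "y [^]\<^bsub>Qcyc\<^esub> (n::nat) = \<one>\<^bsub>Qcyc\<^esub>"
        by (auto simp: mu_def)
      obtain z where z: "primitive_root C n z" using exists_primitive_root_C[OF n] by blast
      then have zC: "z \<in> carrier C" "z [^] n = \<one>" by (auto simp: primitive_root_def)
      have z_mu: "z [^] i \<in> mu_C" for i :: nat by (rule mu_C_pow[OF mu_C_I[OF zC(1) n zC(2)]])
      have zn: "(z [^] i) [^] n = \<one>" for i :: nat
        using zC nat_pow_pow[of z i n] nat_pow_exp_mult[of z n i] by (simp add: mult.commute)
      let ?P = "(\<lambda>i::nat. \<sigma> (eps (z [^] i))) ` {..<n}" and ?M = "{y \<in> carrier Qcyc. y [^]\<^bsub>Qcyc\<^esub> n = \<one>\<^bsub>Qcyc\<^esub>}"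
      have U: "eps (z [^] i) \<in> Units F" for i :: nat using eps_closed[OF z_mu] eps_nonzero[OF z_mu] by (simp add: Units_F)
      have "inj_on (\<lambda>i::nat. \<sigma> (eps (z [^] i))) {..<n}"
      proof (rule inj_onI)
        fix i j assume ij: "i \<in> {..<n}" "j \<in> {..<n}" "\<sigma> (eps (z [^] i)) = \<sigma> (eps (z [^] j))"
        then have "z [^] i = z [^] j" using inj_onD[OF sigma_inj _ U U] inj_onD[OF eps_inj _ z_mu z_mu] by blast
        then show "i = j" using primitive_root_powers_inj[OF field_axioms z n(1)] ij by (auto dest: inj_onD)
      qed
      then have "card ?P = n" by (simp add: card_image)
      moreover have "?P \<subseteq> ?M"
      proof (rule image_subsetI)
        fix i :: nat
        have "\<sigma> (eps (z [^] i)) [^]\<^bsub>Qcyc\<^esub> n = \<sigma> (eps ((z [^] i) [^] n))"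
          by (simp only: sigma_pow[OF U] eps_pow[OF z_mu])
        then show "\<sigma> (eps (z [^] i)) \<in> ?M" using Qcyc.Units_closed[OF sigma_Units[OF U]] by (simp add: zn eps_one sigma_one)
      qed
      ultimately have "?P = ?M" using Q.card_roots_of_unity_le[OF n(1)] by (intro card_seteq) simp_all
      then have "y \<in> ?P" using y by simp
      then show "y \<in> \<sigma> ` Units F" using U by blast
    qed
  qed
qed

definition sigma_inv where "sigma_inv = inv_into (Units F) \<sigma>"

lemma sigma_inv:
  assumes "y \<in> mu p"
  shows "sigma_inv y \<in> Units F" "\<sigma> (sigma_inv y) = y"
proof -
  have "y \<in> \<sigma> ` Units F" using assms sigma_bij by (simp add: bij_betw_def)
  then show "sigma_inv y \<in> Units F" "\<sigma> (sigma_inv y) = y"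
    unfolding sigma_inv_def by (rule inv_into_into, rule f_inv_into_f)
qed

lemma sigma_inv_sigma: "x \<in> Units F \<Longrightarrow> sigma_inv (\<sigma> x) = x"
  unfolding sigma_inv_def by (rule inv_into_f_f[OF sigma_inj])

lemma X_to_Hom:
  shows "X_to_Hom p C W F eps \<sigma> \<in> ring_Hom (Qcyc_prime_to p) C"
    and "r \<in> Gp p \<Longrightarrow> X_to_Hom p C W F eps \<sigma> (root r) = lift (sigma_inv (root r))"
proof -
  interpret F: field F by (rule field_F)
  define w where "w = (\<lambda>r. sigma_inv (root r))"
  have mu: "r \<in> Gp p \<Longrightarrow> root r \<in> mu p" for r by (simp add: mu_eq)
  have w: "w r \<in> Units F" "\<sigma> (w r) = root r" if "r \<in> Gp p" for r
    using sigma_inv[OF mu[OF that]] by (simp_all add: w_def)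
  have mult: "w (r \<otimes>\<^bsub>QmodZ\<^esub> s) = w r \<otimes>\<^bsub>F\<^esub> w s" if rs: "r \<in> Gp p" "s \<in> Gp p" for r s
  proof -
    have "\<sigma> (w r \<otimes>\<^bsub>F\<^esub> w s) = root (r \<otimes>\<^bsub>QmodZ\<^esub> s)"
      using sigma_mult[OF w(1) w(1), OF rs] w(2) rs root_mult[OF rs] by simp
    then show ?thesis using sigma_inv_sigma[of "w r \<otimes>\<^bsub>F\<^esub> w s"] w(1)[OF rs(1)] w(1)[OF rs(2)] by (simp add: w_def)
  qed
  have one: "w (mod1 0) = \<one>\<^bsub>F\<^esub>"
    using sigma_inv_sigma[of "\<one>\<^bsub>F\<^esub>"] by (simp add: w_def root_one sigma_one)
  have inj: "inj_on w (Gp p)"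
  proof (rule inj_onI)
    fix r s assume rs: "r \<in> Gp p" "s \<in> Gp p" "w r = w s"
    then have "root r = root s" using w(2)[of r] w(2)[of s] by simp
    then show "r = s" using rs(1,2) by (rule inj_onD[OF root_inj])
  qed
  have wF: "w r \<in> carrier F" "w r \<noteq> \<zero>\<^bsub>F\<^esub>" if "r \<in> Gp p" for r using w(1)[OF that] by (simp_all add: Units_F)
  obtain \<rho> where \<rho>: "\<rho> \<in> ring_Hom (Qcyc_prime_to p) C" "\<forall>r\<in>Gp p. \<rho> (root r) = lift (w r)"
    using Hom_of_character[OF wF mult one inj] by blast
  have T: "teichmueller W F eps (inv_into (Units F) \<sigma> x) = lift (sigma_inv x)" if "x \<in> mu p" for x
    using teichmueller_eq[OF sigma_inv(1)[OF that]] by (simp add: sigma_inv_def)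
  have "X_to_Hom p C W F eps \<sigma> = \<rho>"
    unfolding X_to_Hom_def
  proof (rule the_equality, intro conjI ballI)
    show "\<rho> \<in> ring_Hom (Qcyc_prime_to p) C" by (rule \<rho>(1))
    fix x assume x: "x \<in> mu p"
    then obtain r where "r \<in> Gp p" "x = root r" by (auto simp: mu_eq)
    then show "\<rho> x = teichmueller W F eps (inv_into (Units F) \<sigma> x)" using \<rho>(2) T[OF x] by (simp add: w_def)
  next
    fix \<rho>' assume \<rho>': "\<rho>' \<in> ring_Hom (Qcyc_prime_to p) C \<and> (\<forall>x\<in>mu p. \<rho>' x = teichmueller W F eps (inv_into (Units F) \<sigma> x))"
    show "\<rho>' = \<rho>"
    proof (rule Qcyc_prime_to_hom_eqI[OF field_axioms char_C])
      show "\<rho>' \<in> ring_Hom (Qcyc_prime_to p) C" using \<rho>' by blast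
      show "\<rho> \<in> ring_Hom (Qcyc_prime_to p) C" by (rule \<rho>(1))
      fix x assume x: "x \<in> mu p"
      then obtain r where "r \<in> Gp p" "x = root r" by (auto simp: mu_eq)
      then show "\<rho>' x = \<rho> x" using \<rho>(2) \<rho>' T[OF x] x by (simp add: w_def)
    qed
  qed
  then show "X_to_Hom p C W F eps \<sigma> \<in> ring_Hom (Qcyc_prime_to p) C"
    and "r \<in> Gp p \<Longrightarrow> X_to_Hom p C W F eps \<sigma> (root r) = lift (sigma_inv (root r))"
    using \<rho> by (simp_all add: w_def)
qed

text \<open>
  The homomorphism on \<open>\<A>\<close> attached to \<open>\<sigma>\<close> sends the class of \<open>e(r)\<close> to the preimage under \<open>\<sigma>\<close> of the root of unity
  \<open>\<delta>(e(r))\<close>. So the bijection \<open>m\<close> for this homomorphism is inverse to the extension of \<open>\<sigma>\<close> by zero.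
\<close>

theorem Spec_to_Sigma_X:
  "Spec_to_Sigma p (a_kernel (A_alg p) F (res p eps (X_to_Hom p C W F eps \<sigma>))) = X_to_Sigma p F \<sigma>"
proof -
  interpret F: field F by (rule field_F)
  define \<rho> where "\<rho> = X_to_Hom p C W F eps \<sigma>"
  have \<rho>: "\<rho> \<in> ring_Hom (Qcyc_prime_to p) C" "\<And>r. r \<in> Gp p \<Longrightarrow> \<rho> (root r) = lift (sigma_inv (root r))"
    unfolding \<rho>_def by (rule X_to_Hom(1), rule X_to_Hom(2))
  let ?h = "res p eps \<rho>"
  let ?\<theta> = "\<lambda>f. ?h (proj p f)"
  have h: "?h \<in> ring_hom (A_alg p) F" using res_Hom[OF \<rho>(1)] by (simp add: ring_Hom_def)
  note M0 = Hom_delta_model[OF \<rho>(1)]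
  have surj: "?h ` carrier (A_alg p) = carrier F"
    unfolding carrier_A_alg[OF p1] image_image
    using residue_model.surj[OF M0] res_proj[OF \<rho>(1)] by (simp cong: image_cong)
  interpret M: residue_model p F ?\<theta> by (rule hom_A_alg_model[OF prime F.domain_axioms h surj])
  have \<theta>: "?\<theta> (single_Z r) = sigma_inv (root r)" if r: "r \<in> Gp p" for r
    using res_proj[OF \<rho>(1) single_Z_closed[OF r]] \<rho>(2)[OF r] lift(2)[of "sigma_inv (root r)"] sigma_inv(1)[of "root r"] r
    by (simp add: mu_eq Units_F)
  let ?s = "extend_zero F \<sigma>"
  have s_m: "?s (M.m x) = x" if "x \<in> mu0 p" for x
    using that
  proof (rule mu0_cases)
    assume "x = \<zero>\<^bsub>Qcyc\<^esub>"
    then show ?thesis by (simp add: M.m_zero extend_zero_def)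
  next
    assume x: "x \<in> mu p"
    then obtain r where r: "r \<in> Gp p" "x = root r" by (auto simp: mu_eq)
    have "M.m x = sigma_inv x" using M.m_root[OF r(1)] \<theta>[OF r(1)] by (simp add: M.u_def r(2))
    then show ?thesis using sigma_inv[OF x] by (simp add: extend_zero_def Units_F)
  qed
  have inv: "inv_into (carrier F) ?s x = M.m x" if x: "x \<in> mu0 p" for x
  proof -
    have "inj_on ?s (carrier F)"
    proof (rule inj_onI)
      fix a b assume ab: "a \<in> carrier F" "b \<in> carrier F" "?s a = ?s b"
      obtain x y where xy: "x \<in> mu0 p" "a = M.m x" "y \<in> mu0 p" "b = M.m y"
        using ab M.m_bij unfolding bij_betw_def by blast
      then show "a = b" using ab(3) by (simp add: s_m)
    qed
    then have "inv_into (carrier F) ?s (?s (M.m x)) = M.m x" using M.m_closed[OF x] by (rule inv_into_f_f)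
    then show ?thesis by (simp add: s_m[OF x])
  qed
  have "Spec_to_Sigma p (a_kernel (A_alg p) F ?h) = M.succ"
    by (rule Spec_to_Sigma_kernel(2)[OF prime F.domain_axioms h surj])
  also have "\<dots> = X_to_Sigma p F \<sigma>"
  proof
    fix x show "M.succ x = X_to_Sigma p F \<sigma> x"
    proof (cases "x \<in> mu0 p")
      case True
      have "?s (M.m (M.succ x)) = M.succ x" by (rule s_m[OF M.succ(1)[OF True]])
      then show ?thesis using True by (simp add: X_to_Sigma_def inv M.succ(2))
    qed (simp add: X_to_Sigma_def M.succ_outside)
  qed
  finally show ?thesis unfolding \<rho>_def .
qed

end

end

theorem proposition8p16:
  fixes p :: nat and C :: "'c ring" and absv :: "'c \<Rightarrow> real" and F :: "'f ring" and eps :: "'c \<Rightarrow> 'f"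
  defines "W \<equiv> nonarch_valued_field.unr_integers C absv"
  assumes "Factorial_Ring.prime p"
    and "padic_complex_field C absv p"
    and "alg_closure_of_Fp p F"
    and "eps \<in> ring_hom W F" and "eps ` carrier W = carrier F"
  shows "bij_betw (res p eps) (ring_Hom (Qcyc_prime_to p) C) (ring_Hom (A_alg p) F) \<and>
    bij_betw (Spec_to_Sigma p) (Spec (A_alg p)) (Sigma_set p) \<and>
    (\<forall>\<sigma> \<in> X_set F.
      Spec_to_Sigma p (a_kernel (A_alg p) F (res p eps (X_to_Hom p C W F eps \<sigma>))) = X_to_Sigma p F \<sigma>)"
proof -
  interpret padic_residue C absv p F eps
    using assms(2-5) unfolding W_def
    by (intro padic_residue.intro padic_residue_axioms.intro padic_prime_field.intro padic_prime_field_axioms.intro)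
  show ?thesis
    using bij_betw_res bij_betw_Spec_to_Sigma[OF assms(2)] Spec_to_Sigma_X unfolding W_def by blast
qed

end
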